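(* Let $\Omega\subset\mathbb{R}^3$ be a domain, let $p$ satisfy $p\in C[0,\infty)$, $p(0)=0$ and $p(\rho)\ge 0$ for all $\rho\ge 0$, and suppose there is a constant $C>0$ such that $p(\rho)\le C\sqrt{\rho}$ for $0\le\rho<1$. Let $G$ satisfy either $G\in D_0^{1,q}(\Omega)$ for some $6/5\le q<\infty$, or $G\in W^{1,\infty}(\Omega)$. Let $(\rho,\mathbf{u})$ be a weak solution in $\Omega$ of the steady barotropic Navier--Stokes system with no-slip boundary condition, with pressure $p$ and force potential $G$. If $\rho\in L^1\cap L^\infty(\Omega)$, then $\mathbf{u}=0$ a.e. in $\Omega$.
   Context: The system is $\operatorname{div}(\rho\mathbf{u})=0$, $\operatorname{div}(\rho\mathbf{u}\otimes\mathbf{u})+\nabla p(\rho)-\operatorname{div}\mathbb{S}(\nabla\mathbf{u})=\rho\nabla G$ in $\Omega$, $\mathbf{u}|_{\partial\Omega}=0$, where $\mathbb{S}(\nabla\mathbf{u})=\mu\left(\nabla\mathbf{u}+\nabla^t\mathbf{u}-\frac23\operatorname{div}\mathbf{u}\,\mathbb{I}\right)+\eta\operatorname{div}\mathbf{u}\,\mathbb{I}$ with constants $\mu>0$, $\eta\ge0$. Function space: for $1\le q<\infty$, $D_0^{1,q}(\Omega)$ is the completion of $C_c^\infty(\Omega)$ in the norm $\left(\int_\Omega|\nabla v|^q\,dx\right)^{1/q}$; $D_0^{1,q}(\Omega;\mathbb{R}^3)$ is the vector-valued version. (It is identified with a closed subspace of $\{v\in L^1_{\rm loc}(\Omega):\nabla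 v\in L^q(\Omega)\}$ modulo constants.) For matrices, $F:G=\sum_{i,j}F_{ij}G_{ij}$. Weak solution: $(\rho,\mathbf{u})$ is a weak solution if (1) $\rho,\mathbf{u}$ are measurable in $\Omega$ and $\rho\ge0$ a.e. in $\Omega$; (2) $\rho\mathbf{u}\in L^1_{\rm loc}(\overline\Omega;\mathbb{R}^3)$ and $\int_\Omega\rho\mathbf{u}\cdot\nabla\phi\,dx=0$ for all $\phi\in C_c^\infty(\mathbb{R}^3)$; (3) $\rho,\ \rho|\mathbf{u}|^2,\ p(\rho),\ \rho\nabla G$ are in $L^1_{\rm loc}(\Omega)$, $\mathbf{u}\in D_0^{1,2}(\Omega;\mathbb{R}^3)$, and $$\int_\Omega[\rho\mathbf{u}\otimes\mathbf{u}:\nabla\boldsymbol{\varphi}+p(\rho)\operatorname{div}\boldsymbol{\varphi}]\,dx=\int_\Omega\mathbb{S}(\nabla\mathbf{u}):\nabla\boldsymbol{\varphi}\,dx-\int_\Omega\rho\nabla G\cdot\boldsymbol{\varphi}\,dx$$ for all $\boldsymbol{\varphi}\in C_c^1(\Omega;\mathbb{R}^3)$. *)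

theory Defs
  imports "HOL-Analysis.Analysis"
begin

subsection \<open>Test functions\<close>

(* C^k on the whole space: in finite dimension, f is C^(k+1) iff f is (Frechet) differentiable
   everywhere and all its directional derivatives are C^k. *)
primrec Ck :: "nat \<Rightarrow> ('a::euclidean_space \<Rightarrow> 'b::real_normed_vector) \<Rightarrow> bool" where
  "Ck 0 f \<longleftrightarrow> continuous_on UNIV f"
| "Ck (Suc k) f \<longleftrightarrow> (\<forall>x. f differentiable at x) \<and>
     (\<forall>v. Ck k (\<lambda>x. frechet_derivative f (at x) v))"

definition supp :: "('a::euclidean_space \<Rightarrow> 'b::real_normed_vector) \<Rightarrow> 'a set" where
  "supp f = closure (support_on UNIV f)"

(* Compactly supported functions on an open set are represented by their extension by zero
   to the whole space. *)
definition Cck :: "nat \<Rightarrow> 'a set \<Rightarrow> ('a::euclidean_space \<Rightarrow> 'b::real_normed_vector) set" where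
  "Cck k \<Omega> = {f. Ck k f \<and> compact (supp f) \<and> supp f \<subseteq> \<Omega>}"

definition Ccinf :: "'a set \<Rightarrow> ('a::euclidean_space \<Rightarrow> 'b::real_normed_vector) set" where
  "Ccinf \<Omega> = (\<Inter>k. Cck k \<Omega>)"

definition grad :: "(real^'n \<Rightarrow> real) \<Rightarrow> real^'n \<Rightarrow> real^'n" where
  "grad f x = (\<chi> j. frechet_derivative f (at x) (axis j 1))"

subsection \<open>Lebesgue and Sobolev spaces\<close>

(* Membership is a property of functions on the whole space that only depends on their
   restriction to \<Omega> up to null sets. *)

definition Lq :: "real \<Rightarrow> (real^'n) set \<Rightarrow> (real^'n \<Rightarrow> 'b::euclidean_space) set" where
  "Lq q \<Omega> = {f. f \<in> borel_measurable (lebesgue_on \<Omega>) \<and>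
     integrable (lebesgue_on \<Omega>) (\<lambda>x. norm (f x) powr q)}"

definition Linf :: "(real^'n) set \<Rightarrow> (real^'n \<Rightarrow> 'b::euclidean_space) set" where
  "Linf \<Omega> = {f. f \<in> borel_measurable (lebesgue_on \<Omega>) \<and>
     (\<exists>M. AE x in lebesgue_on \<Omega>. norm (f x) \<le> M)}"

definition L1loc :: "(real^'n) set \<Rightarrow> (real^'n \<Rightarrow> 'b::euclidean_space) set" where
  "L1loc \<Omega> = {f. \<forall>K. compact K \<longrightarrow> K \<subseteq> \<Omega> \<longrightarrow> integrable (lebesgue_on K) f}"

(* Functions are only given on \<Omega>, so integrability up to the boundary is over K \<inter> \<Omega>
   rather than over K. *)
definition L1loc_closure :: "(real^'n) set \<Rightarrow> (real^'n \<Rightarrow> 'b::euclidean_space) set" where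
  "L1loc_closure \<Omega> = {f. \<forall>K. compact K \<longrightarrow> K \<subseteq> closure \<Omega> \<longrightarrow> integrable (lebesgue_on (K \<inter> \<Omega>)) f}"

definition has_weak_grad :: "(real^'n) set \<Rightarrow> (real^'n \<Rightarrow> real) \<Rightarrow> (real^'n \<Rightarrow> real^'n) \<Rightarrow> bool" where
  "has_weak_grad \<Omega> v g \<longleftrightarrow> v \<in> L1loc \<Omega> \<and> g \<in> L1loc \<Omega> \<and>
     (\<forall>\<phi>\<in>Ccinf \<Omega>. (LINT x|lebesgue_on \<Omega>. v x *\<^sub>R grad \<phi> x) = - (LINT x|lebesgue_on \<Omega>. \<phi> x *\<^sub>R g x))"

(* The weak gradient is unique up to null sets in \<Omega>; this picks one representative.
   It is only meaningful if a weak gradient exists. *)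
definition weak_grad :: "(real^'n) set \<Rightarrow> (real^'n \<Rightarrow> real) \<Rightarrow> real^'n \<Rightarrow> real^'n" where
  "weak_grad \<Omega> v = (SOME g. has_weak_grad \<Omega> v g)"

(* Same index convention as the library's jacobian: entry (i,j) is the j-th derivative of u_i. *)
definition weak_jacobian :: "(real^'n) set \<Rightarrow> (real^'n \<Rightarrow> real^'m) \<Rightarrow> real^'n \<Rightarrow> real^'n^'m" where
  "weak_jacobian \<Omega> u x = (\<chi> i. weak_grad \<Omega> (\<lambda>y. u y $ i) x)"

definition W1inf :: "(real^'n) set \<Rightarrow> (real^'n \<Rightarrow> real) set" where
  "W1inf \<Omega> = {v. v \<in> Linf \<Omega> \<and> (\<exists>g. has_weak_grad \<Omega> v g) \<and> weak_grad \<Omega> v \<in> Linf \<Omega>}"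

(* D_0^{1,q}: the completion of C_c^\<infinity>(\<Omega>) in the norm of the gradient in L^q, realised by functions:
   v belongs to it iff test functions converge to v in L^1_loc and their gradients converge to
   that of v in L^q.

   On a connected open set every Cauchy sequence of test functions has such a limit, possibly after
   replacing the sequence by an equivalent one.  The limit is unique, except that constants have to
   be factored out when they are themselves null limits (as for \<Omega> = R^3, q \<ge> 3).  In dimension 3
   this does not happen for q < 3: by the Sobolev inequality the approximating sequence converges
   in L^{3q/(3-q)}, so in particular for q = 2 the elements are genuine functions, without
   a free additive constant. *)
definition D0 :: "real \<Rightarrow> (real^'n) set \<Rightarrow> (real^'n \<Rightarrow> real) set" where
  "D0 q \<Omega> = {v. (\<exists>g. has_weak_grad \<Omega> v g) \<and> weak_grad \<Omega> v \<in> Lq q \<Omega> \<and>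
     (\<exists>\<phi>. (\<forall>n::nat. \<phi> n \<in> Ccinf \<Omega>) \<and>
        (\<lambda>n. LINT x|lebesgue_on \<Omega>. norm (grad (\<phi> n) x - weak_grad \<Omega> v x) powr q) \<longlonglongrightarrow> 0 \<and>
        (\<forall>K. compact K \<longrightarrow> K \<subseteq> \<Omega> \<longrightarrow>
           (\<lambda>n. LINT x|lebesgue_on K. \<bar>\<phi> n x - v x\<bar>) \<longlonglongrightarrow> 0))}"

definition D0_vec :: "real \<Rightarrow> (real^'n) set \<Rightarrow> (real^'n \<Rightarrow> real^'m) set" where
  "D0_vec q \<Omega> = {u. \<forall>i. (\<lambda>x. u x $ i) \<in> D0 q \<Omega>}"

subsection \<open>Weak solutions of the steady barotropic Navier--Stokes system\<close>

(* The argument A is the velocity gradient, so that trace A is the divergence. *)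
definition stress :: "real \<Rightarrow> real \<Rightarrow> real^3^3 \<Rightarrow> real^3^3" where
  "stress \<mu> \<eta> A = \<mu> *\<^sub>R (A + transpose A - (2/3 * trace A) *\<^sub>R mat 1) + (\<eta> * trace A) *\<^sub>R mat 1"

definition outer :: "real^'n \<Rightarrow> real^'m \<Rightarrow> real^'m^'n" where
  "outer a b = (\<chi> i j. a $ i * b $ j)"

(* The inner product of matrices is F:G = \<Sum>i j. F_ij G_ij.  The divergence of \<phi> is the trace of
   its Jacobian. *)
definition weak_solution ::
  "(real^3) set \<Rightarrow> real \<Rightarrow> real \<Rightarrow> (real \<Rightarrow> real) \<Rightarrow> (real^3 \<Rightarrow> real) \<Rightarrow>
   (real^3 \<Rightarrow> real) \<Rightarrow> (real^3 \<Rightarrow> real^3) \<Rightarrow> bool" where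
  "weak_solution \<Omega> \<mu> \<eta> p G \<rho> u \<longleftrightarrow>
     \<rho> \<in> borel_measurable (lebesgue_on \<Omega>) \<and> u \<in> borel_measurable (lebesgue_on \<Omega>) \<and>
     (AE x in lebesgue_on \<Omega>. 0 \<le> \<rho> x) \<and>
     (\<lambda>x. \<rho> x *\<^sub>R u x) \<in> L1loc_closure \<Omega> \<and>
     (\<forall>\<phi>\<in>Ccinf UNIV. (LINT x|lebesgue_on \<Omega>. (\<rho> x *\<^sub>R u x) \<bullet> grad \<phi> x) = 0) \<and>
     \<rho> \<in> L1loc \<Omega> \<and>
     (\<lambda>x. \<rho> x * (norm (u x))\<^sup>2) \<in> L1loc \<Omega> \<and>
     (\<lambda>x. p (\<rho> x)) \<in> L1loc \<Omega> \<and>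
     (\<lambda>x. \<rho> x *\<^sub>R weak_grad \<Omega> G x) \<in> L1loc \<Omega> \<and>
     u \<in> D0_vec 2 \<Omega> \<and>
     (\<forall>\<phi>\<in>Cck 1 \<Omega>.
        (LINT x|lebesgue_on \<Omega>. (\<rho> x *\<^sub>R outer (u x) (u x)) \<bullet> jacobian \<phi> (at x)
            + p (\<rho> x) * trace (jacobian \<phi> (at x)))
        = (LINT x|lebesgue_on \<Omega>. stress \<mu> \<eta> (weak_jacobian \<Omega> u x) \<bullet> jacobian \<phi> (at x))
          - (LINT x|lebesgue_on \<Omega>. (\<rho> x *\<^sub>R weak_grad \<Omega> G x) \<bullet> \<phi> x))"

end

theory Submission
  imports Defs
begin

text \<open>
  Extended by zero, the density r and the velocity w satisfy div (r w) = 0 on the whole space, and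
  w is approximated by test functions in L^6 (Sobolev) together with its gradient A in L^2.  Since
  r lies in L^1 and L^infinity, the momentum equation may then be tested with w itself.  The
  convective term drops out because |w|^2/2 can be used in the continuity equation, and the force
  term because the potential can.  The pressure term drops out by renormalization in the manner of
  DiPerna and Lions: mollifying r and integrating by parts, one finds that the integral of r^m div w
  equals m times itself, hence vanishes for m >= 2; by the Weierstrass theorem so does that of
  r^2 f(r) div w for every continuous f, and p(s) is the pointwise limit of
  s^2 p(s) / (s^2 + 1/n), dominated by p(r) in L^2.  What remains is that the integral of S(A) : A
  is zero, which bounds that of |A|^2, because the integrals of A : A^T and of (tr A)^2 agree.
\<close>

subsection \<open>Functions of class C^k and test functions\<close>

text \<open>The growth condition enters once: p(s) <= C sqrt s near 0 gives p(r)^2 <= const r, so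
  p(r) is in L^2 although r is only integrable, and div w is known to lie in L^2 and nothing better.
  The exponent m = 1 is lost because there the identity X = m X is empty; hence the factor s^2 in
  the approximation of the pressure. The delicate point is the order of limits in the commutator
  argument. The continuity equation holds for w, while integration by parts needs a test field, and
  replacing one by the other costs a factor 1/d at the mollification scale d. The test field must
  therefore reach its limit before d does. This works because the commutator is controlled by the
  L^2 norm of the velocity gradient, uniformly in d. The exponent 6/5 for the potential is dual to
  the Sobolev exponent 6. No bump function is built explicitly: if all approximating test fields
  vanish, then so does w, and otherwise the normalized square of one of their components serves as
  mollifier.\<close>

lemma Ck_SucI:
  assumes "\<And>x. (f has_derivative f' x) (at x)" "\<And>v. Ck k (\<lambda>x. f' x v)"
  shows "Ck (Suc k) f"
proof -
  have "frechet_derivative f (at x) = f' x" for x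
    using frechet_derivative_at[OF assms(1)] by simp
  then show ?thesis using assms by (auto simp: differentiable_def)
qed

lemma Ck_Suc_has_derivative:
  "Ck (Suc k) f \<Longrightarrow> (f has_derivative frechet_derivative f (at x)) (at x)"
  by (simp add: frechet_derivative_works)

lemma Ck_imp_continuous: "Ck k f \<Longrightarrow> continuous_on UNIV f"
  by (cases k) (auto simp: continuous_on_eq_continuous_at differentiable_imp_continuous_within)

lemma Ck_SucD: "Ck (Suc k) f \<Longrightarrow> Ck k f"
proof (induction k arbitrary: f)
  case 0
  show ?case using Ck_imp_continuous[OF 0] by simp
next
  case (Suc k)
  from Suc.prems have d: "\<forall>x. f differentiable at x"
    and "\<And>v. Ck (Suc k) (\<lambda>x. frechet_derivative f (at x) v)"
    unfolding Ck.simps(2)[of "Suc k" f] by blast+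
  with Suc.IH have "\<And>v. Ck k (\<lambda>x. frechet_derivative f (at x) v)" by blast
  with d show ?case unfolding Ck.simps(2)[of k f] by blast
qed

lemma Ck_const [simp]: "Ck k (\<lambda>x. c)"
proof (induction k arbitrary: c)
  case (Suc k)
  show ?case by (rule Ck_SucI[of _ "\<lambda>x v. 0"]) (auto intro: Suc)
qed simp

lemma Ck_add: "Ck k f \<Longrightarrow> Ck k g \<Longrightarrow> Ck k (\<lambda>x. f x + g x)"
proof (induction k arbitrary: f g)
  case 0
  then show ?case by (auto intro: continuous_intros)
next
  case (Suc k)
  note d = Suc.prems[THEN Ck_Suc_has_derivative]
  show ?case
    by (rule Ck_SucI[OF has_derivative_add[OF d]]) (use Suc in auto)
qed

lemma Ck_sum: "finite I \<Longrightarrow> (\<And>i. i \<in> I \<Longrightarrow> Ck k (f i)) \<Longrightarrow> Ck k (\<lambda>x. \<Sum>i\<in>I. f i x)"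
  by (induction I rule: finite_induct) (auto intro: Ck_add)

lemma Ck_linear:
  assumes "bounded_linear L" shows "Ck k f \<Longrightarrow> Ck k (\<lambda>x. L (f x))"
proof (induction k arbitrary: f)
  case 0
  then show ?case
    using bounded_linear.continuous_on[OF assms] by simp
next
  case (Suc k)
  show ?case
    by (rule Ck_SucI[OF bounded_linear.has_derivative[OF assms Ck_Suc_has_derivative[OF Suc.prems]]])
      (use Suc in auto)
qed

lemma Ck_mult:
  fixes f g :: "'a::euclidean_space \<Rightarrow> real"
  shows "Ck k f \<Longrightarrow> Ck k g \<Longrightarrow> Ck k (\<lambda>x. f x * g x)"
proof (induction k arbitrary: f g)
  case 0
  then show ?case by (auto intro: continuous_intros)
next
  case (Suc k)
  note d = Suc.prems[THEN Ck_Suc_has_derivative]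
  have "Ck k (\<lambda>x. f x * frechet_derivative g (at x) v + frechet_derivative f (at x) v * g x)" for v
    by (intro Ck_add Suc.IH Ck_SucD[OF Suc.prems(1)] Ck_SucD[OF Suc.prems(2)]) (use Suc.prems in auto)
  then show ?case
    by (intro Ck_SucI[OF has_derivative_mult[OF d]])
qed

lemma Ck_power:
  fixes f :: "'a::euclidean_space \<Rightarrow> real"
  shows "Ck k f \<Longrightarrow> Ck k (\<lambda>x. f x ^ m)"
  by (induction m) (auto intro: Ck_mult)

text \<open>The derivative of 1/f is -(1/f) f' (1/f), in which 1/f itself recurs, so the induction
  closes. The lemma serves the rational cutoff \<open>sat\<close>.\<close>

lemma Ck_inverse:
  fixes f :: "'a::euclidean_space \<Rightarrow> real"
  assumes nz: "\<And>x. f x \<noteq> 0"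
  shows "Ck k f \<Longrightarrow> Ck k (\<lambda>x. inverse (f x))"
proof (induction k)
  case 0
  then show ?case using nz by (auto intro: continuous_intros)
next
  case (Suc k)
  note d = Deriv.has_derivative_inverse[OF nz Ck_Suc_has_derivative[OF Suc.prems]]
  have "Ck k (\<lambda>x. - (inverse (f x) * frechet_derivative f (at x) v * inverse (f x)))" for v
    by (intro Ck_linear[OF bounded_linear_minus[OF bounded_linear_ident]] Ck_mult
        Suc.IH Ck_SucD[OF Suc.prems(1)]) (use Suc.prems in auto)
  then show ?case by (intro Ck_SucI[OF d]) auto
qed

lemma Ck_affine: "Ck k f \<Longrightarrow> Ck k (\<lambda>x. f (a + c *\<^sub>R x))"
proof (induction k arbitrary: f)
  case 0
  then show ?case
    by (auto intro!: continuous_on_compose2[of UNIV f UNIV "\<lambda>x. a + c *\<^sub>R x"] continuous_intros)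
next
  case (Suc k)
  have 1: "((\<lambda>x. a + c *\<^sub>R x) has_derivative (\<lambda>v. c *\<^sub>R v)) (at x)" for x
    by (auto intro!: derivative_eq_intros)
  have 2: "((\<lambda>x. f (a + c *\<^sub>R x)) has_derivative
      (\<lambda>v. frechet_derivative f (at (a + c *\<^sub>R x)) (c *\<^sub>R v))) (at x)" for x
    using has_derivative_compose[OF 1 Ck_Suc_has_derivative[OF Suc.prems]] by simp
  show ?case
    by (rule Ck_SucI[OF 2]) (use Suc in auto)
qed

lemma Ck_vec:
  fixes f :: "'a::euclidean_space \<Rightarrow> real^'n"
  assumes "\<And>i. Ck k (\<lambda>x. f x $ i)" shows "Ck k f"
proof -
  have "Ck k (\<lambda>x. \<Sum>i\<in>UNIV. (f x $ i) *\<^sub>R axis i (1::real))"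
    by (intro Ck_sum Ck_linear[OF bounded_linear_scaleR_left] assms) auto
  moreover have "(\<lambda>x. \<Sum>i\<in>UNIV. (f x $ i) *\<^sub>R axis i (1::real)) = f"
    by (auto simp: basis_expansion scalar_mult_eq_scaleR[symmetric])
  ultimately show ?thesis by simp
qed

section \<open>Supports and closure properties of test functions\<close>

lemma supp_subset: "closed S \<Longrightarrow> (\<And>x. x \<notin> S \<Longrightarrow> f x = 0) \<Longrightarrow> supp f \<subseteq> S"
  unfolding supp_def by (rule closure_minimal) (auto simp: support_on_def)

lemma not_in_supp: "x \<notin> supp f \<Longrightarrow> f x = 0"
  using closure_subset[of "support_on UNIV f"] by (auto simp: supp_def support_on_def)

lemma closed_supp [simp]: "closed (supp f)"
  by (simp add: supp_def)

lemma Ccinf_iff: "f \<in> Ccinf S \<longleftrightarrow> (\<forall>k. Ck k f) \<and> compact (supp f) \<and> supp f \<subseteq> S"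
  by (auto simp: Ccinf_def Cck_def)

lemma Ccinf_mono: "f \<in> Ccinf S \<Longrightarrow> S \<subseteq> T \<Longrightarrow> f \<in> Ccinf T"
  by (auto simp: Ccinf_iff)

lemma compact_suppI: "compact K \<Longrightarrow> (\<And>x. x \<notin> K \<Longrightarrow> f x = 0) \<Longrightarrow> compact (supp f)"
  by (metis closed_supp compact_Int_closed compact_imp_closed inf.absorb_iff2 supp_subset)

lemma Ccinf_mult:
  fixes f g :: "'a::euclidean_space \<Rightarrow> real"
  assumes "f \<in> Ccinf S" "\<And>k. Ck k g" shows "(\<lambda>x. f x * g x) \<in> Ccinf S"
proof -
  have "supp (\<lambda>x. f x * g x) \<subseteq> supp f" by (rule supp_subset) (auto simp: not_in_supp)
  moreover have "compact (supp (\<lambda>x. f x * g x))"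
    by (rule compact_suppI[of "supp f"]) (use assms in \<open>auto simp: Ccinf_iff not_in_supp\<close>)
  ultimately show ?thesis using assms by (auto simp: Ccinf_iff intro: Ck_mult)
qed

lemma Ccinf_add:
  assumes "f \<in> Ccinf S" "g \<in> Ccinf S" shows "(\<lambda>x. f x + g x) \<in> Ccinf S"
proof -
  have "supp (\<lambda>x. f x + g x) \<subseteq> supp f \<union> supp g"
    by (rule supp_subset) (auto simp: not_in_supp)
  moreover have "compact (supp (\<lambda>x. f x + g x))"
    by (rule compact_suppI[of "supp f \<union> supp g"]) (use assms in \<open>auto simp: Ccinf_iff not_in_supp\<close>)
  ultimately show ?thesis using assms by (auto simp: Ccinf_iff intro: Ck_add)
qed

lemma Ccinf_zero: "(\<lambda>x. 0) \<in> Ccinf S"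
  using supp_subset[of "{}" "\<lambda>x. 0"] by (auto simp: Ccinf_iff)

lemma Ccinf_sum:
  "finite I \<Longrightarrow> (\<And>i. i \<in> I \<Longrightarrow> f i \<in> Ccinf S) \<Longrightarrow> (\<lambda>x. \<Sum>i\<in>I. f i x) \<in> Ccinf S"
  by (induction I rule: finite_induct) (auto intro: Ccinf_add Ccinf_zero)

lemma Ccinf_cmult:
  fixes f :: "'a::euclidean_space \<Rightarrow> real"
  shows "f \<in> Ccinf S \<Longrightarrow> (\<lambda>x. c * f x) \<in> Ccinf S"
  using Ccinf_mult[of f S "\<lambda>x. c"] by (simp add: mult.commute)

text \<open>Translates (\<open>c = 1\<close>), dilations and reflections of test functions are all
  of this form; with \<open>c \<noteq> 0\<close> the support is an affine image of the old
  one.\<close>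

lemma Ccinf_affine:
  assumes f: "f \<in> Ccinf UNIV" and c: "c \<noteq> 0"
  shows "(\<lambda>x. f (a + c *\<^sub>R x)) \<in> Ccinf UNIV"
proof -
  let ?K = "(\<lambda>y. (1/c) *\<^sub>R (y - a)) ` supp f"
  have "compact (supp (\<lambda>x. f (a + c *\<^sub>R x)))"
  proof (rule compact_suppI[of ?K])
    show "compact ?K"
      using f by (intro compact_continuous_image continuous_intros) (auto simp: Ccinf_iff)
    show "f (a + c *\<^sub>R x) = 0" if "x \<notin> ?K" for x
    proof (rule not_in_supp, rule notI)
      assume "a + c *\<^sub>R x \<in> supp f"
      then have "(1/c) *\<^sub>R (a + c *\<^sub>R x - a) \<in> ?K" by blast
      then show False using that c by simp
    qed
  qed
  then show ?thesis using f by (auto simp: Ccinf_iff intro: Ck_affine)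
qed

section \<open>Gradients of test functions\<close>

lemma grad_inner_works:
  assumes "f differentiable at x"
  shows "(f has_derivative (\<lambda>v. grad f x \<bullet> v)) (at x)"
proof -
  have lin: "linear (frechet_derivative f (at x))"
    using assms linear_frechet_derivative by blast
  have "frechet_derivative f (at x) v = grad f x \<bullet> v" for v
  proof -
    have "frechet_derivative f (at x) v = frechet_derivative f (at x) (\<Sum>i\<in>UNIV. (v $ i) *\<^sub>R axis i 1)"
      using basis_expansion[of v] by (simp add: scalar_mult_eq_scaleR)
    also have "\<dots> = (\<Sum>i\<in>UNIV. (v $ i) * frechet_derivative f (at x) (axis i 1))"
      using lin by (simp add: linear_sum linear_scale)
    finally show ?thesis by (simp add: inner_vec_def grad_def mult.commute)
  qed
  then show ?thesis
    using assms frechet_derivative_works[of f "at x"] by presburger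
qed

lemma grad_eqI: "(f has_derivative (\<lambda>v. g \<bullet> v)) (at x) \<Longrightarrow> grad f x = g"
  by (simp add: vec_eq_iff grad_def frechet_derivative_at[symmetric] inner_axis)

lemma Ccinf_differentiable: "f \<in> Ccinf S \<Longrightarrow> f differentiable at x"
  by (metis Ccinf_iff Ck.simps(2))

lemma Ccinf_continuous: "f \<in> Ccinf S \<Longrightarrow> continuous_on UNIV f"
  by (metis Ccinf_iff Ck.simps(1))

lemma Ccinf_has_derivative: "f \<in> Ccinf S \<Longrightarrow> (f has_derivative (\<lambda>v. grad f x \<bullet> v)) (at x)"
  by (simp add: grad_inner_works Ccinf_differentiable)

lemma Ccinf_compact: "f \<in> Ccinf S \<Longrightarrow> compact (supp f)"
  by (simp add: Ccinf_iff)

lemma grad_mult: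
  assumes "f differentiable at x" "g differentiable at x"
  shows "grad (\<lambda>x. f x * g x) x = f x *\<^sub>R grad g x + g x *\<^sub>R grad f x"
  by (rule grad_eqI, rule has_derivative_eq_rhs[OF has_derivative_mult])
    (use assms in \<open>auto intro!: grad_inner_works simp: inner_add_left\<close>)

lemma grad_affine:
  assumes "f differentiable at (a + c *\<^sub>R x)"
  shows "grad (\<lambda>x. f (a + c *\<^sub>R x)) x = c *\<^sub>R grad f (a + c *\<^sub>R x)"
proof (rule grad_eqI)
  have 1: "((\<lambda>x. a + c *\<^sub>R x) has_derivative (\<lambda>v. c *\<^sub>R v)) (at x)"
    by (auto intro!: derivative_eq_intros)
  show "((\<lambda>x. f (a + c *\<^sub>R x)) has_derivative (\<lambda>v. (c *\<^sub>R grad f (a + c *\<^sub>R x)) \<bullet> v)) (at x)"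
    using has_derivative_compose[OF 1 grad_inner_works[OF assms]] by simp
qed

text \<open>\<open>supp\<close> is closed, so f vanishes on a whole neighbourhood of such a
  point.\<close>

lemma grad_not_in_supp: 
  assumes "x \<notin> supp f" shows "grad f x = 0"
proof -
  have "(f has_derivative (\<lambda>v. 0)) (at x)"
    by (rule has_derivative_transform_within_open[of "\<lambda>x. 0" _ _ _ "- supp f"])
      (use assms in \<open>auto simp: not_in_supp\<close>)
  then show ?thesis by (intro grad_eqI) simp
qed

lemma Ck_grad: "Ck (Suc k) f \<Longrightarrow> Ck k (\<lambda>x. grad f x $ j)"
  by (simp add: grad_def)

lemma continuous_on_grad: "Ck (Suc k) f \<Longrightarrow> continuous_on UNIV (grad f)"
  by (auto intro!: Ck_imp_continuous[of k] Ck_vec Ck_grad simp del: Ck.simps)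

lemma Ccinf_continuous_grad: "f \<in> Ccinf S \<Longrightarrow> continuous_on UNIV (grad f)"
  by (meson Ccinf_iff continuous_on_grad)

lemma continuous_compact_support_bounded:
  fixes g :: "'a::euclidean_space \<Rightarrow> 'b::euclidean_space"
  assumes "continuous_on UNIV g" "compact K" "\<And>x. x \<notin> K \<Longrightarrow> g x = 0"
  obtains B where "B > 0" "\<And>x. norm (g x) \<le> B"
proof -
  have "bounded (g ` K)"
    using assms by (intro compact_imp_bounded compact_continuous_image) (auto intro: continuous_on_subset)
  then obtain B where "B > 0" "\<forall>x\<in>K. norm (g x) \<le> B" by (auto simp: bounded_pos)
  then have "norm (g x) \<le> B" for x
    using assms(3)[of x] by (cases "x \<in> K") auto
  with \<open>B > 0\<close> show ?thesis using that by blast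
qed

lemma continuous_compact_support_integrable:
  fixes g :: "'a::euclidean_space \<Rightarrow> 'b::euclidean_space"
  assumes "continuous_on UNIV g" "compact K" "\<And>x. x \<notin> K \<Longrightarrow> g x = 0"
  shows "integrable lborel g"
proof -
  have "integrable lborel (\<lambda>x. indicator K x *\<^sub>R g x)"
    by (rule borel_integrable_compact) (use assms in \<open>auto intro: continuous_on_subset\<close>)
  moreover have "(\<lambda>x. indicator K x *\<^sub>R g x) = g"
    using assms(3) by (auto simp: indicator_def)
  ultimately show ?thesis by simp
qed

lemma Ccinf_bounded:
  fixes f :: "'a::euclidean_space \<Rightarrow> 'b::euclidean_space"
  assumes "f \<in> Ccinf S" obtains B where "B > 0" "\<And>x. norm (f x) \<le> B"
  using continuous_compact_support_bounded[OF Ccinf_continuous[OF assms] Ccinf_compact[OF assms] not_in_supp[where f = f]]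
  by blast

lemma Ccinf_grad_bounded:
  assumes "f \<in> Ccinf S" obtains B where "B > 0" "\<And>x. norm (grad f x) \<le> B"
  using continuous_compact_support_bounded[OF Ccinf_continuous_grad[OF assms] Ccinf_compact[OF assms] grad_not_in_supp[where f = f]]
  by blast

lemma Ccinf_diff_bound:
  fixes f :: "real^'n \<Rightarrow> real"
  assumes f: "f \<in> Ccinf S" and B: "\<And>x. norm (grad f x) \<le> B"
  shows "\<bar>f x - f y\<bar> \<le> B * norm (x - y)"
proof -
  have "onorm (\<lambda>v. grad f z \<bullet> v) \<le> B" for z
  proof (rule onorm_bound)
    show "0 \<le> B" using B norm_ge_zero order_trans by blast
    show "norm (grad f z \<bullet> v) \<le> B * norm v" for v
      by (rule order_trans[OF Cauchy_Schwarz_ineq2[of "grad f z" v, folded real_norm_def]])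
        (use B[of z] in \<open>auto intro: mult_right_mono\<close>)
  qed
  then show ?thesis
    using differentiable_bound[of UNIV f "\<lambda>z v. grad f z \<bullet> v" B x y] Ccinf_has_derivative[OF f] by auto
qed

subsection \<open>Integration by parts and continuity of translations\<close>

lemma Ccinf_integrable:
  fixes f :: "'a::euclidean_space \<Rightarrow> 'b::euclidean_space"
  assumes "f \<in> Ccinf S" shows "integrable lborel f"
  using continuous_compact_support_integrable[OF Ccinf_continuous[OF assms] Ccinf_compact[OF assms] not_in_supp[where f = f]]
  by blast

lemma Ccinf_grad_integrable: "f \<in> Ccinf S \<Longrightarrow> integrable lborel (grad f)"
  using continuous_compact_support_integrable[OF Ccinf_continuous_grad Ccinf_compact grad_not_in_supp[where f = f]]
  by blast

lemma Ccinf_measurable [measurable_dest]: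
  fixes f :: "'a::euclidean_space \<Rightarrow> 'b::euclidean_space"
  shows "f \<in> Ccinf S \<Longrightarrow> f \<in> borel_measurable borel"
  by (intro borel_measurable_continuous_onI Ccinf_continuous)

lemma Ccinf_grad_measurable: "f \<in> Ccinf S \<Longrightarrow> grad f \<in> borel_measurable borel"
  by (intro borel_measurable_continuous_onI Ccinf_continuous_grad)

section \<open>Continuity of translations in L^1\<close>

lemma lborel_integrable_translate:
  fixes f :: "'a::euclidean_space \<Rightarrow> 'b::{banach, second_countable_topology}"
  assumes "integrable lborel f" shows "integrable lborel (\<lambda>x. f (x + a))"
proof -
  have "integrable (distr lborel borel ((+) a)) f" using assms by (simp add: lborel_distr_plus)
  then show ?thesis
    by (subst (asm) integrable_distr_eq) (use assms in \<open>auto simp: add.commute\<close>)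
qed

lemma lborel_integral_translate:
  fixes f :: "'a::euclidean_space \<Rightarrow> 'b::{banach, second_countable_topology}"
  assumes [measurable]: "f \<in> borel_measurable borel"
  shows "(LBINT x. f (x + a)) = integral\<^sup>L lborel f"
proof -
  have "integral\<^sup>L lborel f = integral\<^sup>L (distr lborel borel ((+) a)) f" by (simp add: lborel_distr_plus)
  also have "\<dots> = (LBINT x. f (x + a))"
    by (subst integral_distr) (auto simp: add.commute)
  finally show ?thesis by simp
qed

lemma lborel_integral_affine:
  fixes f :: "'a::euclidean_space \<Rightarrow> 'b::{banach, second_countable_topology}"
  assumes [measurable]: "f \<in> borel_measurable borel" and c: "c \<noteq> 0"
  shows "integral\<^sup>L lborel f = \<bar>c\<bar> ^ DIM('a) *\<^sub>R (LBINT x. f (a + c *\<^sub>R x))"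
  by (subst lborel_affine[OF c, of a])
    (simp add: integral_density integral_distr)

text \<open>The null sequence may depend on e. Both the density argument for translations and the
  trade-off estimates for the velocities end in this form.\<close>

lemma LIMSEQ_le_eps:
  fixes f :: "nat \<Rightarrow> real"
  assumes "\<And>e. e > 0 \<Longrightarrow> \<exists>g. g \<longlonglongrightarrow> 0 \<and> (\<forall>n. \<bar>f n\<bar> \<le> g n + e)"
  shows "f \<longlonglongrightarrow> 0"
proof (rule LIMSEQ_I)
  fix r :: real assume "r > 0"
  then obtain g where g: "g \<longlonglongrightarrow> 0" "\<And>n. \<bar>f n\<bar> \<le> g n + r/2" using assms[of "r/2"] by auto
  from g(1) \<open>r > 0\<close> have "\<forall>\<^sub>F n in sequentially. g n < r/2" by (intro order_tendstoD) auto
  then obtain N where "\<And>n. n \<ge> N \<Longrightarrow> g n < r/2" by (auto simp: eventually_sequentially)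
  then have "\<And>n. n \<ge> N \<Longrightarrow> norm (f n - 0) < r" using g(2) by (smt (verit) field_sum_of_halves real_norm_def)
  then show "\<exists>no. \<forall>n\<ge>no. norm (f n - 0) < r" by blast
qed

text \<open>A translation does not change the L^1 distance of f and g, so the three-epsilon estimate
  is uniform in the shift: functions whose translates along h converge form a closed set.\<close>

lemma L1_translation_closed:
  fixes f :: "'a::euclidean_space \<Rightarrow> 'b::{banach, second_countable_topology}"
  assumes f: "integrable lborel f"
    and ap: "\<And>e. e > 0 \<Longrightarrow> \<exists>g. integrable lborel g \<and>
      (\<lambda>n. LBINT y. norm (g (y + h n) - g y)) \<longlonglongrightarrow> 0 \<and> (LBINT y. norm (f y - g y)) \<le> e"
  shows "(\<lambda>n. LBINT y. norm (f (y + h n) - f y)) \<longlonglongrightarrow> 0"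
proof (rule LIMSEQ_le_eps)
  fix e :: real assume "e > 0"
  then obtain g where g: "integrable lborel g"
    and lim: "(\<lambda>n. LBINT y. norm (g (y + h n) - g y)) \<longlonglongrightarrow> 0"
    and le: "(LBINT y. norm (f y - g y)) \<le> e/2" using ap[of "e/2"] by auto
  have [measurable]: "f \<in> borel_measurable borel" "g \<in> borel_measurable borel"
    using f g by (auto dest: borel_measurable_integrable)
  note tr = lborel_integrable_translate[OF f] lborel_integrable_translate[OF g]
  have "\<bar>LBINT y. norm (f (y + h n) - f y)\<bar> \<le> (LBINT y. norm (g (y + h n) - g y)) + e" for n
  proof -
    have i: "integrable lborel (\<lambda>y. norm (f y - g y))" using f g by auto
    have "(LBINT y. norm (f (y + h n) - f y)) \<le>
      (LBINT y. (norm (g (y + h n) - g y) + norm (f (y + h n) - g (y + h n))) + norm (f y - g y))"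
    proof (rule integral_mono)
      show "norm (f (y + h n) - f y) \<le>
        norm (g (y + h n) - g y) + norm (f (y + h n) - g (y + h n)) + norm (f y - g y)" for y
        using norm_triangle_ineq[of "g (y + h n) - g y + (f (y + h n) - g (y + h n))" "g y - f y"]
          norm_triangle_ineq[of "g (y + h n) - g y" "f (y + h n) - g (y + h n)"]
        by (simp add: norm_minus_commute algebra_simps)
    qed (use f g tr in auto)
    also have "\<dots> = (LBINT y. norm (g (y + h n) - g y))
        + (LBINT y. norm (f (y + h n) - g (y + h n))) + (LBINT y. norm (f y - g y))"
      using f g tr by (subst Bochner_Integration.integral_add Bochner_Integration.integral_add | force)+
    also have "(LBINT y. norm (f (y + h n) - g (y + h n))) = (LBINT y. norm (f y - g y))"
      using lborel_integral_translate[of "\<lambda>y. norm (f y - g y)" "h n"] by simp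
    finally show ?thesis using le by (simp add: abs_of_nonneg integral_nonneg_AE)
  qed
  with lim show "\<exists>g. g \<longlonglongrightarrow> 0 \<and> (\<forall>n. \<bar>LBINT y. norm (f (y + h n) - f y)\<bar> \<le> g n + e)" by blast
qed

text \<open>The points lost by the shift are controlled pointwise, because U is open, and are
  dominated by U. Openness says nothing about the points gained, but they form a set of the same
  measure, since the shift preserves volume.\<close>

lemma L1_translation_open:
  fixes U :: "'a::euclidean_space set"
  assumes U: "open U" "emeasure lborel U < \<infinity>" and h: "h \<longlonglongrightarrow> 0"
  shows "(\<lambda>n. LBINT y. \<bar>indicator U (y + h n) - indicat_real U y\<bar>) \<longlonglongrightarrow> 0"
proof -
  have [measurable]: "U \<in> sets borel" using U by simp
  let ?I = "indicat_real U"
  have int: "integrable lborel ?I" using U by (intro integrable_real_indicator) auto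
  note tr = lborel_integrable_translate[OF int]
  have lim: "(\<lambda>n. LBINT y. max 0 (?I y - ?I (y + h n))) \<longlonglongrightarrow> (\<integral>y. 0 \<partial>(lborel :: 'a measure))"
  proof (rule integral_dominated_convergence[where w = ?I])
    have "(\<lambda>n. max 0 (?I y - ?I (y + h n))) \<longlonglongrightarrow> 0" for y
    proof (cases "y \<in> U")
      case True
      have "(\<lambda>n. y + h n) \<longlonglongrightarrow> y + 0" by (intro tendsto_intros h)
      then have "\<forall>\<^sub>F n in sequentially. y + h n \<in> U"
        using topological_tendstoD[OF _ U(1)] True by simp
      then have "\<forall>\<^sub>F n in sequentially. max 0 (?I y - ?I (y + h n)) = 0"
        by eventually_elim (simp add: True)
      then show ?thesis by (rule tendsto_eventually)
    qed (simp add: indicator_def)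
    then show "AE y in lborel. (\<lambda>n. max 0 (?I y - ?I (y + h n))) \<longlonglongrightarrow> 0" by simp
  qed (use int in \<open>auto simp: indicator_def\<close>)
  have eq: "(LBINT y. \<bar>?I (y + h n) - ?I y\<bar>) = 2 * (LBINT y. max 0 (?I y - ?I (y + h n)))" for n
  proof -
    have i: "integrable lborel (\<lambda>y. max 0 (?I y - ?I (y + h n)))"
      using int tr by (intro integrable_max) auto
    \<comment> \<open>|b - a| = 2 max(0, a - b) + (b - a), and the last difference integrates to
      zero.\<close>
    have "(LBINT y. \<bar>?I (y + h n) - ?I y\<bar>) =
      (LBINT y. 2 * max 0 (?I y - ?I (y + h n)) + (?I (y + h n) - ?I y))"
      by (rule Bochner_Integration.integral_cong) (auto simp: max_def)
    also have "\<dots> = 2 * (LBINT y. max 0 (?I y - ?I (y + h n))) + ((LBINT y. ?I (y + h n)) - (LBINT y. ?I y))"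
      using i int tr[of "h n"] by simp
    also have "(LBINT y. ?I (y + h n)) = (LBINT y. ?I y)"
      by (rule lborel_integral_translate) simp
    finally show ?thesis by simp
  qed
  show ?thesis unfolding eq using tendsto_mult_right_zero[OF lim[simplified]] by simp
qed

text \<open>Induction over integrable functions. Outer regularity reduces an indicator to that of an
  open set; this step and the limit step both rest on closedness in L^1.\<close>

lemma L1_translation_continuous:
  fixes f :: "'a::euclidean_space \<Rightarrow> 'b::{banach, second_countable_topology}"
  assumes f: "integrable lborel f" and h: "h \<longlonglongrightarrow> 0"
  shows "(\<lambda>n. LBINT y. norm (f (y + h n) - f y)) \<longlonglongrightarrow> 0"
  using f
proof (induction rule: integrable_induct)
  case (base A c)
  then have [measurable]: "A \<in> sets borel" by simp
  have iA: "integrable lborel (indicat_real A)" using base by (intro integrable_real_indicator) auto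
  have "(\<lambda>n. LBINT y. norm (indicat_real A (y + h n) - indicat_real A y)) \<longlonglongrightarrow> 0"
  proof (rule L1_translation_closed[OF iA])
    fix e :: real assume e: "e > 0"
    obtain U where U: "open U" "A \<subseteq> U" "emeasure lborel (U - A) < e"
      using outer_regular_lborel[OF \<open>A \<in> sets borel\<close> e] by blast
    have [measurable]: "U \<in> sets borel" using U by simp
    have "emeasure lborel U \<le> emeasure lborel A + emeasure lborel (U - A)"
      using U by (metis Un_Diff_cancel Un_absorb1 \<open>A \<in> sets borel\<close> \<open>U \<in> sets borel\<close> emeasure_subadditive sets.Diff sets_lborel)
    also have "\<dots> < \<infinity>" using base U(3) less_trans[OF U(3) ennreal_less_top] by simp
    finally have fin: "emeasure lborel U < \<infinity>" .
    have "(LBINT y. norm (indicat_real A y - indicator U y)) = (LBINT y. indicator (U - A) y)"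
      using U(2) by (intro Bochner_Integration.integral_cong) (auto simp: indicator_def)
    also have "\<dots> = measure lborel (U - A)" by simp
    also have "\<dots> \<le> e" using U(3) e by (simp add: enn2real_leI measure_def)
    finally show "\<exists>g. integrable lborel g \<and> (\<lambda>n. LBINT y. norm (g (y + h n) - g y)) \<longlonglongrightarrow> 0 \<and>
        (LBINT y. norm (indicat_real A y - g y)) \<le> e"
      using L1_translation_open[OF U(1) fin h] fin
      by (intro exI[of _ "indicat_real U"]) (auto intro: integrable_real_indicator)
  qed
  then have "(\<lambda>n. (LBINT y. \<bar>indicat_real A (y + h n) - indicat_real A y\<bar>) * norm c) \<longlonglongrightarrow> 0"
    using tendsto_mult_left_zero by fastforce
  moreover have "(LBINT y. \<bar>indicat_real A (y + k) - indicat_real A y\<bar>) * norm c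
    = (LBINT y. norm (indicat_real A (y + k) *\<^sub>R c - indicat_real A y *\<^sub>R c))" for k
    by (subst integral_mult_left_zero[symmetric]) (simp add: scaleR_left_diff_distrib[symmetric])
  ultimately show ?case by simp
next
  case (add f g)
  note tr = lborel_integrable_translate[OF add.hyps(1)] lborel_integrable_translate[OF add.hyps(2)]
  show ?case
  proof (rule tendsto_sandwich[OF _ _ tendsto_const])
    show "(\<lambda>n. (LBINT y. norm (f (y + h n) - f y)) + (LBINT y. norm (g (y + h n) - g y))) \<longlonglongrightarrow> 0"
      using tendsto_add[OF add.IH] by simp
    have "(LBINT y. norm (f (y + h n) + g (y + h n) - (f y + g y)))
      \<le> (LBINT y. norm (f (y + h n) - f y) + norm (g (y + h n) - g y))" for n
      by (rule integral_mono)
        (use add.hyps tr in \<open>auto intro: order_trans[OF _ norm_triangle_ineq] simp: add_diff_add\<close>)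
    also have "\<dots> n = (LBINT y. norm (f (y + h n) - f y)) + (LBINT y. norm (g (y + h n) - g y))" for n
      using add.hyps tr by (intro Bochner_Integration.integral_add) auto
    finally show "\<forall>\<^sub>F n in sequentially. (LBINT y. norm (f (y + h n) + g (y + h n) - (f y + g y)))
      \<le> (LBINT y. norm (f (y + h n) - f y)) + (LBINT y. norm (g (y + h n) - g y))" by simp
  qed simp
next
  case (lim f s)
  show ?case
  proof (rule L1_translation_closed[OF lim.hyps(4)])
    have [measurable]: "f \<in> borel_measurable borel" "\<And>i. s i \<in> borel_measurable borel"
      using lim by (auto dest: borel_measurable_integrable)
    have "(\<lambda>i. LBINT y. norm (f y - s i y)) \<longlonglongrightarrow> (\<integral>y. 0 \<partial>(lborel :: 'a measure))"
    proof (rule integral_dominated_convergence[where w = "\<lambda>y. 3 * norm (f y)"])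
      have "(\<lambda>i. norm (f y - s i y)) \<longlonglongrightarrow> 0" for y
        using lim.hyps(2)[of y] tendsto_norm_zero[OF LIM_zero[of "\<lambda>i. s i y" "f y"]]
        by (simp add: norm_minus_commute)
      then show "AE y in lborel. (\<lambda>i. norm (f y - s i y)) \<longlonglongrightarrow> 0" by simp
      have "norm (f y - s i y) \<le> 3 * norm (f y)" for i y
        using norm_triangle_ineq4[of "f y" "s i y"] lim.hyps(3)[of y i] by simp
      then show "AE y in lborel. norm (norm (f y - s i y)) \<le> 3 * norm (f y)" for i by simp
    qed (use lim in auto)
    then have l: "(\<lambda>i. LBINT y. norm (f y - s i y)) \<longlonglongrightarrow> 0" by simp
    fix e :: real assume "e > 0"
    then have "\<forall>\<^sub>F i in sequentially. (LBINT y. norm (f y - s i y)) < e"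
      using order_tendstoD(2)[OF l] by simp
    then obtain i where "(LBINT y. norm (f y - s i y)) < e"
      unfolding eventually_sequentially by blast
    then show "\<exists>g. integrable lborel g \<and> (\<lambda>n. LBINT y. norm (g (y + h n) - g y)) \<longlonglongrightarrow> 0 \<and>
        (LBINT y. norm (f y - g y)) \<le> e"
      using lim.hyps(1) lim.IH by (intro exI[of _ "s i"]) auto
  qed
qed

section \<open>Products of square-integrable functions\<close>

lemma integrable_mult_L2:
  fixes f g :: "'a \<Rightarrow> real"
  assumes [measurable]: "f \<in> borel_measurable M" "g \<in> borel_measurable M"
    and f: "integrable M (\<lambda>x. (f x)\<^sup>2)" and g: "integrable M (\<lambda>x. (g x)\<^sup>2)"
  shows "integrable M (\<lambda>x. f x * g x)"
proof (rule Bochner_Integration.integrable_bound[OF Bochner_Integration.integrable_add[OF f g]])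
  have "\<bar>f x * g x\<bar> \<le> (f x)\<^sup>2 + (g x)\<^sup>2" for x
  proof -
    have "2 * \<bar>f x * g x\<bar> \<le> (f x)\<^sup>2 + (g x)\<^sup>2"
      using sum_squares_bound[of "\<bar>f x\<bar>" "\<bar>g x\<bar>"] by (simp add: abs_mult)
    then show ?thesis by linarith
  qed
  then show "AE x in M. norm (f x * g x) \<le> norm ((f x)\<^sup>2 + (g x)\<^sup>2)" by simp
qed simp

lemma Cauchy_Schwarz_integral:
  fixes f g :: "'a \<Rightarrow> real"
  assumes [measurable]: "f \<in> borel_measurable M" "g \<in> borel_measurable M"
    and f: "integrable M (\<lambda>x. (f x)\<^sup>2)" and g: "integrable M (\<lambda>x. (g x)\<^sup>2)"
  shows "(\<integral>x. \<bar>f x * g x\<bar> \<partial>M) \<le> sqrt (\<integral>x. (f x)\<^sup>2 \<partial>M) * sqrt (\<integral>x. (g x)\<^sup>2 \<partial>M)"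
proof -
  have fg: "integrable M (\<lambda>x. \<bar>f x * g x\<bar>)" using integrable_mult_L2[OF assms] by simp
  have "ennreal ((\<integral>x. \<bar>f x * g x\<bar> \<partial>M)\<^sup>2) = (\<integral>\<^sup>+x. ennreal \<bar>f x\<bar> * ennreal \<bar>g x\<bar> \<partial>M)\<^sup>2"
    using nn_integral_eq_integral[OF fg] by (simp add: ennreal_mult abs_mult ennreal_power)
  also have "\<dots> \<le> (\<integral>\<^sup>+x. ennreal \<bar>f x\<bar> ^ 2 \<partial>M) * (\<integral>\<^sup>+x. ennreal \<bar>g x\<bar> ^ 2 \<partial>M)"
    by (rule Cauchy_Schwarz_nn_integral) auto
  also have "\<dots> = ennreal ((\<integral>x. (f x)\<^sup>2 \<partial>M) * (\<integral>x. (g x)\<^sup>2 \<partial>M))"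
    using nn_integral_eq_integral[OF f] nn_integral_eq_integral[OF g] by (simp add: ennreal_power ennreal_mult)
  finally have "(\<integral>x. \<bar>f x * g x\<bar> \<partial>M)\<^sup>2 \<le> (\<integral>x. (f x)\<^sup>2 \<partial>M) * (\<integral>x. (g x)\<^sup>2 \<partial>M)"
    by (simp add: ennreal_le_iff)
  then show ?thesis
    by (metis real_le_rsqrt real_sqrt_mult)
qed

lemma tendsto_Cauchy_Schwarz:
  fixes f g :: "nat \<Rightarrow> 'a \<Rightarrow> real"
  assumes [measurable]: "\<And>n. f n \<in> borel_measurable M" "\<And>n. g n \<in> borel_measurable M"
    and f: "\<And>n. integrable M (\<lambda>x. (f n x)\<^sup>2)" and g: "\<And>n. integrable M (\<lambda>x. (g n x)\<^sup>2)"
    and lim: "(\<lambda>n. \<integral>x. (f n x)\<^sup>2 \<partial>M) \<longlonglongrightarrow> 0" and B: "\<And>n. (\<integral>x. (g n x)\<^sup>2 \<partial>M) \<le> B"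
  shows "(\<lambda>n. \<integral>x. \<bar>f n x * g n x\<bar> \<partial>M) \<longlonglongrightarrow> 0"
proof (rule tendsto_sandwich[OF _ _ tendsto_const])
  show "(\<lambda>n. sqrt (\<integral>x. (f n x)\<^sup>2 \<partial>M) * sqrt B) \<longlonglongrightarrow> 0"
    using tendsto_mult_left_zero[OF tendsto_real_sqrt[OF lim, simplified]] by simp
  have "(\<integral>x. \<bar>f n x * g n x\<bar> \<partial>M) \<le> sqrt (\<integral>x. (f n x)\<^sup>2 \<partial>M) * sqrt B" for n
    by (rule order_trans[OF Cauchy_Schwarz_integral[OF assms(1,2) f g]])
      (auto intro!: mult_left_mono B)
  then show "\<forall>\<^sub>F n in sequentially. (\<integral>x. \<bar>f n x * g n x\<bar> \<partial>M) \<le> sqrt (\<integral>x. (f n x)\<^sup>2 \<partial>M) * sqrt B"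
    by simp
qed simp

section \<open>Difference quotients and integration by parts\<close>

lemma difference_quotient_tendsto:
  fixes f :: "'a::euclidean_space \<Rightarrow> real"
  assumes f: "(f has_derivative f') (at x)" and h: "h \<longlonglongrightarrow> 0" "\<And>n. h n \<noteq> 0"
  shows "(\<lambda>n. (f (x + h n *\<^sub>R e) - f x) / h n) \<longlonglongrightarrow> f' e"
proof -
  have 1: "((\<lambda>t. x + t *\<^sub>R e) has_derivative (\<lambda>t. t *\<^sub>R e)) (at 0)"
    by (auto intro!: derivative_eq_intros)
  have "((\<lambda>t. f (x + t *\<^sub>R e)) has_derivative (\<lambda>t. f' (t *\<^sub>R e))) (at 0)"
    using has_derivative_compose[OF 1, of f f'] f by simp
  moreover have "(\<lambda>t. f' (t *\<^sub>R e)) = (*) (f' e)"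
    using linear_scale[OF has_derivative_linear[OF f]] by (auto simp: mult.commute)
  ultimately have "((\<lambda>t. f (x + t *\<^sub>R e)) has_real_derivative f' e) (at 0)"
    by (simp add: has_field_derivative_def)
  then have "(\<lambda>t. (f (x + t *\<^sub>R e) - f x) / t) \<midarrow>0\<rightarrow> f' e"
    by (simp add: DERIV_def)
  moreover have "filterlim h (at 0) sequentially"
    using h by (auto simp: filterlim_at)
  ultimately show ?thesis by (rule filterlim_compose)
qed

text \<open>Only the difference quotients of P along one direction and one null sequence enter, so that
  P may be a mollified function whose smoothness is never established.\<close>

lemma integration_by_parts:
  fixes f P DP :: "real^'n \<Rightarrow> real"
  assumes f: "f \<in> Ccinf S" and P [measurable]: "P \<in> borel_measurable borel"
    and C: "\<And>y. \<bar>P y\<bar> \<le> C" and L: "\<And>n y. \<bar>(P (y + h n *\<^sub>R e) - P y) / h n\<bar> \<le> L"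
    and h: "h \<longlonglongrightarrow> 0" "\<And>n. h n \<noteq> 0" "\<And>n. \<bar>h n\<bar> \<le> 1"
    and lim: "\<And>y. (\<lambda>n. (P (y + h n *\<^sub>R e) - P y) / h n) \<longlonglongrightarrow> DP y"
  shows "(LBINT y. P y * (grad f y \<bullet> e)) = - (LBINT y. DP y * f y)"
proof -
  have DP [measurable]: "DP \<in> borel_measurable borel"
    by (rule borel_measurable_LIMSEQ_real[OF lim]) auto
  have [measurable]: "f \<in> borel_measurable borel" "grad f \<in> borel_measurable borel"
    by (intro borel_measurable_continuous_onI Ccinf_continuous[OF f] Ccinf_continuous_grad[OF f])+
  obtain R where R: "\<And>x. x \<in> supp f \<Longrightarrow> norm x \<le> R"
    using compact_imp_bounded[OF Ccinf_compact[OF f]] by (auto simp: bounded_iff)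
  obtain B where B: "\<And>x. norm (grad f x) \<le> B" using Ccinf_grad_bounded[OF f] by blast
  obtain B0 where B0: "\<And>x. \<bar>f x\<bar> \<le> B0" using Ccinf_bounded[OF f] by (metis real_norm_def)
  have C0: "0 \<le> C" using C[of 0] by linarith
  have L0: "0 \<le> L" using L[of 0 0] by linarith
  have BB: "0 \<le> B" using order_trans[OF norm_ge_zero B] .
  have BB0: "0 \<le> B0" using order_trans[OF abs_ge_zero B0] .
  \<comment> \<open>Since |h n| <= 1, for y outside this larger ball both y and its shift lie
    outside the ball of radius R that contains the support.\<close>
  define K where "K = cball (0::real^'n) (R + norm e)"
  define w where "w y = (C * (B * norm e) + L * B0) * indicat_real K y" for y
  have iw: "integrable lborel w"
    unfolding w_def K_def by (intro integrable_mult_right integrable_real_indicator) (use emeasure_lborel_cball_finite[of "0::real^'n" "R + norm e"] in auto)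
  define F where "F y = P y * f y" for y
  have F0: "F y = 0" if "norm y > R" for y using R[of y] that not_in_supp[of y f] by (force simp: F_def)
  have iF: "integrable lborel F"
  proof (rule Bochner_Integration.integrable_bound)
    show "integrable lborel (\<lambda>y. C * f y)"
      by (intro integrable_mult_right Ccinf_integrable[OF f])
    show "AE x in lborel. norm (F x) \<le> norm (C * f x)"
      using C C0 by (auto simp: F_def abs_mult intro!: mult_right_mono AE_I2)
  qed (simp add: F_def[abs_def])
  \<comment> \<open>Discrete product rule.\<close>
  have eq: "(F (y + h n *\<^sub>R e) - F y) / h n =
      P (y + h n *\<^sub>R e) * ((f (y + h n *\<^sub>R e) - f y) / h n) + (P (y + h n *\<^sub>R e) - P y) / h n * f y" for y n
    by (simp add: F_def h(2) field_simps)
  have fq: "\<bar>(f (y + h n *\<^sub>R e) - f y) / h n\<bar> \<le> B * norm e" for y n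
    using Ccinf_diff_bound[OF f B, of "y + h n *\<^sub>R e" y] h(2)[of n]
    by (simp add: divide_simps mult_ac)
  have bd: "\<bar>(F (y + h n *\<^sub>R e) - F y) / h n\<bar> \<le> w y" for y n
  proof (cases "y \<in> K")
    case True
    have "\<bar>P (y + h n *\<^sub>R e) * ((f (y + h n *\<^sub>R e) - f y) / h n)\<bar> \<le> C * (B * norm e)"
      unfolding abs_mult by (intro mult_mono C fq C0) auto
    moreover have "\<bar>(P (y + h n *\<^sub>R e) - P y) / h n * f y\<bar> \<le> L * B0"
      unfolding abs_mult by (intro mult_mono L B0 L0) auto
    moreover have "w y = C * (B * norm e) + L * B0" using True by (simp add: w_def)
    ultimately show ?thesis unfolding eq by (intro order_trans[OF abs_triangle_ineq]) linarith
  next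
    case False
    then have y: "norm y > R + norm e" by (simp add: K_def)
    have "norm (h n *\<^sub>R e) \<le> norm e" using h(3)[of n] by (simp add: mult_left_le_one_le)
    then have "norm (y + h n *\<^sub>R e) > R" using y norm_triangle_ineq4[of "y + h n *\<^sub>R e" "h n *\<^sub>R e"] by simp
    moreover have "norm y > R" using y norm_ge_zero[of e] by linarith
    ultimately show ?thesis using False by (simp add: F0 w_def)
  qed
  have limF: "(\<lambda>n. (F (y + h n *\<^sub>R e) - F y) / h n) \<longlonglongrightarrow> P y * (grad f y \<bullet> e) + DP y * f y" for y
  proof -
    \<comment> \<open>Continuity of P along the sequence is recovered from the convergence of its
      difference quotients.\<close>
    have "(\<lambda>n. P y + h n * ((P (y + h n *\<^sub>R e) - P y) / h n)) \<longlonglongrightarrow> P y + 0 * DP y"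
      by (intro tendsto_intros lim h)
    then have "(\<lambda>n. P (y + h n *\<^sub>R e)) \<longlonglongrightarrow> P y" using h(2) by simp
    then show ?thesis unfolding eq
      by (intro tendsto_intros lim difference_quotient_tendsto[OF Ccinf_has_derivative[OF f]] h)
  qed
  have "(\<lambda>n. LBINT y. (F (y + h n *\<^sub>R e) - F y) / h n) \<longlonglongrightarrow>
      (LBINT y. P y * (grad f y \<bullet> e) + DP y * f y)"
    by (rule integral_dominated_convergence[OF _ _ iw]) (use limF bd in \<open>auto simp: F_def\<close>)
  \<comment> \<open>By translation invariance F and its shift have the same integral.\<close>
  moreover have "(LBINT y. (F (y + h n *\<^sub>R e) - F y) / h n) = 0" for n
    using iF lborel_integrable_translate[OF iF] lborel_integral_translate[of F "h n *\<^sub>R e"]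
      borel_measurable_integrable[OF iF]
    by simp
  ultimately have "(LBINT y. P y * (grad f y \<bullet> e) + DP y * f y) = 0"
    by (simp only: LIMSEQ_const_iff)
  moreover have "integrable lborel (\<lambda>y. P y * (grad f y \<bullet> e))"
  proof (rule Bochner_Integration.integrable_bound)
    show "integrable lborel (\<lambda>y. C * norm e * norm (grad f y))"
      by (intro integrable_mult_right integrable_norm Ccinf_grad_integrable[OF f])
    have "\<bar>P y * (grad f y \<bullet> e)\<bar> \<le> C * (norm (grad f y) * norm e)" for y
      unfolding abs_mult by (intro mult_mono C C0 Cauchy_Schwarz_ineq2) auto
    then show "AE y in lborel. norm (P y * (grad f y \<bullet> e)) \<le> norm (C * norm e * norm (grad f y))"
      using C0 by (auto simp: mult_ac)
  qed simp
  moreover have "integrable lborel (\<lambda>y. DP y * f y)"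
  proof (rule Bochner_Integration.integrable_bound)
    show "integrable lborel (\<lambda>y. L * f y)"
      by (intro integrable_mult_right Ccinf_integrable[OF f])
    have "\<bar>DP y\<bar> \<le> L" for y
      by (rule LIMSEQ_le_const2[OF tendsto_rabs[OF lim]]) (use L in auto)
    then show "AE x in lborel. norm (DP x * f x) \<le> norm (L * f x)"
      using L0 by (auto simp: abs_mult intro!: mult_right_mono AE_I2)
  qed simp
  ultimately show ?thesis by simp
qed

lemma null_sequence_exists:
  obtains h :: "nat \<Rightarrow> real" where "h \<longlonglongrightarrow> 0" "\<And>n. h n > 0" "\<And>n. h n \<le> 1"
  using LIMSEQ_inverse_real_of_nat
  by (rule that) (auto simp: divide_simps)

lemma Ccinf_quotient_bound:
  assumes f: "f \<in> Ccinf S" and B: "\<And>x. norm (grad f x) \<le> B" and h: "h \<noteq> 0"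
  shows "\<bar>(f (y + h *\<^sub>R e) - f y) / h\<bar> \<le> B * norm e"
  using Ccinf_diff_bound[OF f B, of "y + h *\<^sub>R e" y] h by (simp add: divide_simps mult_ac)

lemma integration_by_parts_Ccinf:
  fixes f g :: "real^'n \<Rightarrow> real"
  assumes f: "f \<in> Ccinf S" and g: "g \<in> Ccinf T"
  shows "(LBINT y. g y * (grad f y \<bullet> e)) = - (LBINT y. (grad g y \<bullet> e) * f y)"
proof -
  obtain h :: "nat \<Rightarrow> real" where h: "h \<longlonglongrightarrow> 0" "\<And>n. h n > 0" "\<And>n. h n \<le> 1"
    using null_sequence_exists by blast
  have h0: "h n \<noteq> 0" "\<bar>h n\<bar> \<le> 1" for n using h(2,3)[of n] by auto
  obtain B where B: "\<And>x. norm (grad g x) \<le> B" using Ccinf_grad_bounded[OF g] by blast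
  obtain C where C: "\<And>x. \<bar>g x\<bar> \<le> C" using Ccinf_bounded[OF g] by (metis real_norm_def)
  show ?thesis
    by (rule integration_by_parts[OF f _ C Ccinf_quotient_bound[OF g B h0(1)] h(1) h0
        difference_quotient_tendsto[OF Ccinf_has_derivative[OF g] h(1) h0(1)]])
      (intro borel_measurable_continuous_onI Ccinf_continuous[OF g])
qed

text \<open>Integration by parts against the constant 1.\<close>

lemma integral_grad_zero:
  fixes f :: "real^'n \<Rightarrow> real"
  assumes f: "f \<in> Ccinf S"
  shows "(LBINT y. grad f y \<bullet> e) = 0"
  using integration_by_parts[OF f, of "\<lambda>_. 1" 1 "\<lambda>n. inverse (real (Suc n))" e 0 "\<lambda>_. 0"]
    LIMSEQ_inverse_real_of_nat by (auto simp: divide_simps)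

text \<open>Exchanging the directions in the double integral of d_i f and d_j g with difference quotients
  in place of one of the derivatives avoids the symmetry of second derivatives.\<close>

lemma integral_grad_grad_swap:
  fixes f g :: "real^'n \<Rightarrow> real"
  assumes f: "f \<in> Ccinf S" and g: "g \<in> Ccinf T"
  shows "(LBINT y. (grad f y \<bullet> d) * (grad g y \<bullet> e)) = (LBINT y. (grad f y \<bullet> e) * (grad g y \<bullet> d))"
proof -
  obtain h :: "nat \<Rightarrow> real" where h: "h \<longlonglongrightarrow> 0" "\<And>n. h n > 0" "\<And>n. h n \<le> 1"
    using null_sequence_exists by blast
  have h0: "h n \<noteq> 0" "- h n \<noteq> 0" "\<bar>h n\<bar> \<le> 1" for n using h(2,3)[of n] by auto
  have mh: "(\<lambda>n. - h n) \<longlonglongrightarrow> 0" using tendsto_minus[OF h(1)] by simp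
  obtain Bg where Bg: "\<And>x. norm (grad g x) \<le> Bg" using Ccinf_grad_bounded[OF g] by blast
  obtain Bf where Bf: "\<And>x. norm (grad f x) \<le> Bf" using Ccinf_grad_bounded[OF f] by blast
  have [measurable]: "f \<in> borel_measurable borel" "grad f \<in> borel_measurable borel"
     "g \<in> borel_measurable borel" "grad g \<in> borel_measurable borel"
    by (intro borel_measurable_continuous_onI Ccinf_continuous[OF f] Ccinf_continuous_grad[OF f]
       Ccinf_continuous[OF g] Ccinf_continuous_grad[OF g])+
  have igf: "integrable lborel (\<lambda>y. norm (grad f y))"
    by (intro integrable_norm Ccinf_grad_integrable[OF f])
  have igg: "integrable lborel (\<lambda>y. norm (grad g y))"
    by (intro integrable_norm Ccinf_grad_integrable[OF g])
  have in_le: "\<bar>u \<bullet> v\<bar> \<le> norm u * norm v" for u v :: "real^'n" by (rule Cauchy_Schwarz_ineq2)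
  have "(\<lambda>n. LBINT y. (grad f y \<bullet> d) * ((g (y + h n *\<^sub>R e) - g y) / h n))
      \<longlonglongrightarrow> (LBINT y. (grad f y \<bullet> d) * (grad g y \<bullet> e))"
  proof (rule integral_dominated_convergence)
    show "integrable lborel (\<lambda>y. norm d * (Bg * norm e) * norm (grad f y))" using igf by simp
    show "AE y in lborel. norm ((grad f y \<bullet> d) * ((g (y + h n *\<^sub>R e) - g y) / h n))
        \<le> norm d * (Bg * norm e) * norm (grad f y)" for n
    proof (rule AE_I2)
      fix y show "norm ((grad f y \<bullet> d) * ((g (y + h n *\<^sub>R e) - g y) / h n))
        \<le> norm d * (Bg * norm e) * norm (grad f y)"
        using mult_mono[OF in_le[of "grad f y" d] Ccinf_quotient_bound[OF g Bg h0(1)[of n], of y e]]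
        by (simp add: abs_mult mult_ac)
    qed
    show "AE y in lborel. (\<lambda>n. (grad f y \<bullet> d) * ((g (y + h n *\<^sub>R e) - g y) / h n))
        \<longlonglongrightarrow> (grad f y \<bullet> d) * (grad g y \<bullet> e)"
      by (intro AE_I2 tendsto_intros difference_quotient_tendsto[OF Ccinf_has_derivative[OF g]] h h0)
  qed simp_all
  moreover have "(\<lambda>n. LBINT y. ((f (y + (- h n) *\<^sub>R e) - f y) / (- h n)) * (grad g y \<bullet> d))
      \<longlonglongrightarrow> (LBINT y. (grad f y \<bullet> e) * (grad g y \<bullet> d))"
  proof (rule integral_dominated_convergence)
    show "integrable lborel (\<lambda>y. norm d * (Bf * norm e) * norm (grad g y))" using igg by simp
    show "AE y in lborel. norm (((f (y + (- h n) *\<^sub>R e) - f y) / (- h n)) * (grad g y \<bullet> d))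
        \<le> norm d * (Bf * norm e) * norm (grad g y)" for n
    proof (rule AE_I2)
      fix y show "norm (((f (y + (- h n) *\<^sub>R e) - f y) / (- h n)) * (grad g y \<bullet> d))
        \<le> norm d * (Bf * norm e) * norm (grad g y)"
        using mult_mono[OF Ccinf_quotient_bound[OF f Bf h0(2)[of n], of y e] in_le[of "grad g y" d]]
          order_trans[OF norm_ge_zero Bf]
        by (simp add: abs_mult mult_ac)
    qed
    show "AE y in lborel. (\<lambda>n. ((f (y + (- h n) *\<^sub>R e) - f y) / (- h n)) * (grad g y \<bullet> d))
        \<longlonglongrightarrow> (grad f y \<bullet> e) * (grad g y \<bullet> d)"
      by (intro AE_I2 tendsto_intros difference_quotient_tendsto[OF Ccinf_has_derivative[OF f]] mh h0)
  qed simp_all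
  \<comment> \<open>Moving the derivative d from f to g gives a minus sign, and moving the
    difference from g to f by translation turns it into a backward one with step -h; the two signs
    cancel.\<close>
  moreover have "(LBINT y. (grad f y \<bullet> d) * ((g (y + h n *\<^sub>R e) - g y) / h n))
    = (LBINT y. ((f (y + (- h n) *\<^sub>R e) - f y) / (- h n)) * (grad g y \<bullet> d))" for n
  proof -
    define gh where "gh y = g (h n *\<^sub>R e + 1 *\<^sub>R y)" for y
    have gh: "gh \<in> Ccinf UNIV" unfolding gh_def
      by (rule Ccinf_affine) (auto intro: Ccinf_mono[OF g])
    have dgh: "grad gh y = grad g (y + h n *\<^sub>R e)" for y
      unfolding gh_def using grad_affine[OF Ccinf_differentiable[OF g], of "h n *\<^sub>R e" 1 y]
      by (simp add: add.commute)
    have cg: "integrable lborel (\<lambda>y. g y * (grad f y \<bullet> d))" if "g \<in> Ccinf T" for g T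
      by (rule continuous_compact_support_integrable[of _ "supp g"])
        (use that Ccinf_continuous Ccinf_continuous_grad[OF f] Ccinf_compact not_in_supp in
          \<open>auto intro!: continuous_intros dest: not_in_supp\<close>)
    have cf: "integrable lborel (\<lambda>y. f (y + a) * (grad g (y + b) \<bullet> d))" for a b
    proof -
      have "integrable lborel (\<lambda>y. f y * (grad g (y + (b - a)) \<bullet> d))"
        by (rule continuous_compact_support_integrable[of _ "supp f"])
          (use f Ccinf_continuous Ccinf_compact not_in_supp in
          \<open>auto intro!: continuous_intros continuous_on_compose2[OF Ccinf_continuous_grad[OF g]] dest: not_in_supp\<close>)
      from lborel_integrable_translate[OF this, of a] show ?thesis by (simp add: algebra_simps)
    qed
    have "(LBINT y. (grad f y \<bullet> d) * ((g (y + h n *\<^sub>R e) - g y) / h n))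
      = (LBINT y. (gh y * (grad f y \<bullet> d) - g y * (grad f y \<bullet> d)) / h n)"
      by (rule Bochner_Integration.integral_cong) (auto simp: gh_def algebra_simps)
    also have "\<dots> = ((LBINT y. gh y * (grad f y \<bullet> d)) - (LBINT y. g y * (grad f y \<bullet> d))) / h n"
      using cg[OF gh] cg[OF g] by simp
    also have "\<dots> = ((LBINT y. f y * (grad g y \<bullet> d)) - (LBINT y. f y * (grad g (y + h n *\<^sub>R e) \<bullet> d))) / h n"
      unfolding integration_by_parts_Ccinf[OF f gh] integration_by_parts_Ccinf[OF f g] dgh by (simp add: mult.commute)
    also have "(LBINT y. f y * (grad g (y + h n *\<^sub>R e) \<bullet> d)) = (LBINT y. f (y + (- h n) *\<^sub>R e) * (grad g y \<bullet> d))"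
      using lborel_integral_translate[of "\<lambda>y. f (y + (- h n) *\<^sub>R e) * (grad g y \<bullet> d)" "h n *\<^sub>R e"]
      by simp
    also have "((LBINT y. f y * (grad g y \<bullet> d)) - (LBINT y. f (y + (- h n) *\<^sub>R e) * (grad g y \<bullet> d))) / h n
      = (LBINT y. (f y * (grad g y \<bullet> d) - f (y + (- h n) *\<^sub>R e) * (grad g y \<bullet> d)) / h n)"
      using cf[of 0 0] cf[of "(- h n) *\<^sub>R e" 0] by simp
    also have "\<dots> = (LBINT y. ((f (y + (- h n) *\<^sub>R e) - f y) / (- h n)) * (grad g y \<bullet> d))"
      by (rule Bochner_Integration.integral_cong) (use h0(1)[of n] in \<open>auto simp: field_simps\<close>)
    finally show ?thesis .
  qed
  ultimately show ?thesis using LIMSEQ_unique by fastforce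
qed

text \<open>The segment from y to y + z is cut into \<open>Suc n\<close> equal steps. Cauchy-Schwarz
  for the sum and translation invariance bound the left side by the integral of one squared
  difference quotient with increment z/(n+1), which tends to the squared directional derivative. No
  integration along segments is involved.\<close>

lemma L2_difference_bound:
  fixes v :: "real^'n \<Rightarrow> real"
  assumes v: "v \<in> Ccinf S"
  shows "(LBINT y. (v (y + z) - v y)\<^sup>2) \<le> (LBINT y. (grad v y \<bullet> z)\<^sup>2)"
proof -
  have [measurable]: "v \<in> borel_measurable borel" "grad v \<in> borel_measurable borel"
    by (intro borel_measurable_continuous_onI Ccinf_continuous[OF v] Ccinf_continuous_grad[OF v])+
  obtain R where R: "\<And>x. x \<in> supp v \<Longrightarrow> norm x \<le> R"
    using compact_imp_bounded[OF Ccinf_compact[OF v]] by (auto simp: bounded_iff)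
  obtain B where B: "\<And>x. norm (grad v x) \<le> B" using Ccinf_grad_bounded[OF v] by blast
  have v0: "v y = 0" if "norm y > R" for y using R[of y] that not_in_supp[of y v] by force
  define h where "h n = inverse (real (Suc n))" for n
  have h: "h \<longlonglongrightarrow> 0" "h n > 0" "h n \<le> 1" for n
    using LIMSEQ_inverse_real_of_nat unfolding h_def by (auto simp: divide_simps)
  define q where "q n y = (v (y + h n *\<^sub>R z) - v y) / h n" for n y
  have qw: "(q n y)\<^sup>2 \<le> (B * norm z)\<^sup>2 * indicator (cball 0 (R + norm z)) y" for n y
  proof (cases "norm y > R + norm z")
    case True
    have "norm (h n *\<^sub>R z) \<le> norm z" using h(2,3)[of n] by (simp add: mult_left_le_one_le)
    then have "norm (y + h n *\<^sub>R z) > R" using True norm_triangle_ineq4[of "y + h n *\<^sub>R z" "h n *\<^sub>R z"] by simp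
    moreover have "norm y > R" using True norm_ge_zero[of z] by linarith
    ultimately show ?thesis by (simp add: q_def v0)
  next
    case False
    have "\<bar>q n y\<bar> \<le> B * norm z"
      unfolding q_def by (rule Ccinf_quotient_bound[OF v B]) (use h(2)[of n] in simp)
    then have "(q n y)\<^sup>2 \<le> (B * norm z)\<^sup>2" by (metis abs_ge_zero power2_abs power_mono)
    with False show ?thesis by simp
  qed
  have iw: "integrable lborel (\<lambda>y. (B * norm z)\<^sup>2 * indicat_real (cball 0 (R + norm z)) (y :: real^'n))"
    by (intro integrable_mult_right integrable_real_indicator)
       (use emeasure_lborel_cball_finite[of "0::real^'n" "R + norm z"] in auto)
  have iq: "integrable lborel (\<lambda>y. (q n y)\<^sup>2)" for n
    by (rule Bochner_Integration.integrable_bound[OF iw]) (use qw in \<open>auto simp: q_def[abs_def]\<close>)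
  have lim: "(\<lambda>n. LBINT y. (q n y)\<^sup>2) \<longlonglongrightarrow> (LBINT y. (grad v y \<bullet> z)\<^sup>2)"
  proof (rule integral_dominated_convergence[OF _ _ iw])
    show "AE y in lborel. (\<lambda>n. (q n y)\<^sup>2) \<longlonglongrightarrow> (grad v y \<bullet> z)\<^sup>2"
      unfolding q_def
      by (intro AE_I2 tendsto_intros difference_quotient_tendsto[OF Ccinf_has_derivative[OF v]] h)
        (use h(2) in \<open>auto simp: less_imp_neq[symmetric]\<close>)
  qed (use qw in \<open>auto simp: q_def[abs_def]\<close>)
  have "(LBINT y. (v (y + z) - v y)\<^sup>2) \<le> (LBINT y. (q n y)\<^sup>2)" for n
  proof -
    let ?q = "\<lambda>k y. q n (y + (real k * h n) *\<^sub>R z)"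
    \<comment> \<open>The steps cover the segment exactly, so the telescoping sum ends at y + z and
      the factor \<open>Suc n\<close> from Cauchy-Schwarz is absorbed.\<close>
    have hn: "real (Suc n) * h n = 1" by (simp add: h_def)
    have tel: "v (y + z) - v y = h n * (\<Sum>k<Suc n. ?q k y)" for y
    proof -
      have "h n * ?q k y = v (y + (real (Suc k) * h n) *\<^sub>R z) - v (y + (real k * h n) *\<^sub>R z)" for k
        using h(2)[of n] by (simp add: q_def scaleR_left_distrib distrib_right add_ac)
      then have "h n * (\<Sum>k<Suc n. ?q k y) =
          (\<Sum>k<Suc n. v (y + (real (Suc k) * h n) *\<^sub>R z) - v (y + (real k * h n) *\<^sub>R z))"
        unfolding sum_distrib_left by (intro sum.cong) auto
      also have "\<dots> = v (y + (real (Suc n) * h n) *\<^sub>R z) - v (y + (real 0 * h n) *\<^sub>R z)"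
        by (rule sum_lessThan_telescope)
      finally show ?thesis unfolding hn by simp
    qed
    have sq: "(v (y + z) - v y)\<^sup>2 \<le> h n * (\<Sum>k<Suc n. (?q k y)\<^sup>2)" for y
    proof -
      have "(v (y + z) - v y)\<^sup>2 \<le> (h n)\<^sup>2 * ((\<Sum>k<Suc n. (?q k y)\<^sup>2) * real (Suc n))"
        unfolding tel power_mult_distrib
        using sum_squared_le_sum_of_squares[of "\<lambda>k. ?q k y" "{..<Suc n}"]
        by (intro mult_left_mono) (auto simp del: sum.lessThan_Suc)
      also have "\<dots> = (real (Suc n) * h n) * (h n * (\<Sum>k<Suc n. (?q k y)\<^sup>2))"
        by (simp add: power2_eq_square mult_ac del: sum.lessThan_Suc)
      finally show ?thesis unfolding hn by simp
    qed
    note it = lborel_integrable_translate[OF iq]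
    have "(LBINT y. (v (y + z) - v y)\<^sup>2) \<le> (LBINT y. h n * (\<Sum>k<Suc n. (?q k y)\<^sup>2))"
    proof (rule integral_mono)
      show i: "integrable lborel (\<lambda>y. h n * (\<Sum>k<Suc n. (?q k y)\<^sup>2))"
        using it by (intro integrable_mult_right Bochner_Integration.integrable_sum) auto
      show "integrable lborel (\<lambda>y. (v (y + z) - v y)\<^sup>2)"
      proof (rule Bochner_Integration.integrable_bound[OF i])
        show "AE y in lborel. norm ((v (y + z) - v y)\<^sup>2) \<le> norm (h n * (\<Sum>k<Suc n. (?q k y)\<^sup>2))"
          unfolding real_norm_def abs_power2 by (intro AE_I2 order_trans[OF sq abs_ge_self])
      qed simp
    qed (rule sq)
    also have "\<dots> = h n * (\<Sum>k<Suc n. LBINT y. (?q k y)\<^sup>2)"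
      using it by (subst integral_mult_right_zero, subst Bochner_Integration.integral_sum) auto
    also have "\<dots> = h n * (\<Sum>k<Suc n. LBINT y. (q n y)\<^sup>2)"
      by (intro arg_cong[where f = "(*) (h n)"] sum.cong refl
          lborel_integral_translate[of "\<lambda>y. (q n y)\<^sup>2"]) (simp add: q_def[abs_def])
    also have "\<dots> = (LBINT y. (q n y)\<^sup>2)"
      unfolding sum_constant card_lessThan using hn by (metis mult.assoc mult.commute mult_1)
    finally show ?thesis .
  qed
  then show ?thesis by (intro LIMSEQ_le_const[OF lim]) auto
qed

subsection \<open>The Sobolev inequality in dimension three\<close>

text \<open>Coordinates as nested pairs, so that integrals over \<open>real^3\<close> can be
  evaluated iteratively as integrals over a product measure.\<close>

definition vec3 :: "real \<times> real \<times> real \<Rightarrow> real^3" where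
  "vec3 p = fst p *\<^sub>R axis 1 1 + fst (snd p) *\<^sub>R axis 2 1 + snd (snd p) *\<^sub>R axis 3 1"

lemma vec3_nth [simp]:
  "vec3 p $ 1 = fst p" "vec3 p $ 2 = fst (snd p)" "vec3 p $ 3 = snd (snd p)"
  by (simp_all add: vec3_def axis_def)

lemma vec3_measurable [measurable]: "vec3 \<in> borel_measurable borel"
  unfolding vec3_def[abs_def] by (intro borel_measurable_continuous_onI continuous_intros)

text \<open>Lebesgue measure is determined by its values on boxes, and the preimage of a box under
  \<open>vec3\<close> is the box with the same sides.\<close>

lemma distr_vec3: "distr lborel borel vec3 = (lborel :: (real^3) measure)"
proof (rule lborel_eqI[symmetric])
  fix l u :: "real^3" assume le: "\<And>b. b \<in> Basis \<Longrightarrow> l \<bullet> b \<le> u \<bullet> b"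
  have le: "l $ i \<le> u $ i" for i using le[of "axis i 1"] by (simp add: inner_axis)
  have B: "(\<Prod>b\<in>(Basis::(real^3) set). (u - l) \<bullet> b) = (\<Prod>i\<in>UNIV. u $ i - l $ i)"
  proof -
    have 1: "(Basis::(real^3) set) = (\<lambda>i. axis i 1) ` UNIV" by (auto simp: Basis_vec_def)
    have 2: "inj (\<lambda>i. axis i 1 :: real^3)" by (auto simp: inj_on_def axis_eq_axis)
    show ?thesis unfolding 1 by (subst prod.reindex[OF 2]) (simp add: inner_axis)
  qed
  have "vec3 -` box l u = box (l $ 1, l $ 2, l $ 3) (u $ 1, u $ 2, u $ 3)"
    by (auto simp: mem_box_cart forall_3) (auto simp: mem_box Basis_prod_def)
  then have "emeasure (distr lborel borel vec3) (box l u)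
      = emeasure lborel (box (l $ 1, l $ 2, l $ 3) (u $ 1, u $ 2, u $ 3))"
    by (subst emeasure_distr) auto
  also have "\<dots> = ennreal (\<Prod>b\<in>Basis. ((u $ 1, u $ 2, u $ 3) - (l $ 1, l $ 2, l $ 3)) \<bullet> b)"
    using le by (intro emeasure_lborel_box) (auto simp: Basis_prod_def)
  also have "(\<Prod>b\<in>Basis. ((u $ 1, u $ 2, u $ 3) - (l $ 1, l $ 2, l $ 3)) \<bullet> b)
      = (u $ 1 - l $ 1) * ((u $ 2 - l $ 2) * (u $ 3 - l $ 3))"
  proof -
    have B3: "(Basis :: (real \<times> real \<times> real) set) = {(1, 0, 0), (0, 1, 0), (0, 0, 1)}"
      by (auto simp: Basis_prod_def zero_prod_def)
    show ?thesis unfolding B3 by simp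
  qed
  also have "\<dots> = (\<Prod>i\<in>UNIV. u $ i - l $ i)" unfolding UNIV_3 by simp
  finally show "emeasure (distr lborel borel vec3) (box l u) = (\<Prod>b\<in>Basis. (u - l) \<bullet> b)" by (simp add: B)
qed simp

lemma nn_integral_vec3:
  fixes f :: "real^3 \<Rightarrow> ennreal"
  assumes [measurable]: "f \<in> borel_measurable borel"
  shows "(\<integral>\<^sup>+x. f x \<partial>lborel) = (\<integral>\<^sup>+x. \<integral>\<^sup>+y. \<integral>\<^sup>+z. f (vec3 (x, y, z)) \<partial>lborel \<partial>lborel \<partial>lborel)"
proof -
  have "(\<integral>\<^sup>+x. f x \<partial>lborel) = (\<integral>\<^sup>+p. f (vec3 p) \<partial>lborel)"
    unfolding distr_vec3[symmetric] by (subst nn_integral_distr) auto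
  also have "\<dots> = (\<integral>\<^sup>+p. f (vec3 p) \<partial>(lborel \<Otimes>\<^sub>M (lborel :: (real \<times> real) measure)))"
    by (simp add: lborel_prod)
  also have "\<dots> = (\<integral>\<^sup>+x. \<integral>\<^sup>+q. f (vec3 (x, q)) \<partial>lborel \<partial>lborel)"
    by (subst lborel.nn_integral_fst[symmetric]) (auto simp: lborel_prod borel_prod)
  also have "\<dots> = (\<integral>\<^sup>+x. \<integral>\<^sup>+q. f (vec3 (x, q)) \<partial>(lborel \<Otimes>\<^sub>M lborel) \<partial>lborel)"
    by (simp add: lborel_prod)
  also have "\<dots> = (\<integral>\<^sup>+x. \<integral>\<^sup>+y. \<integral>\<^sup>+z. f (vec3 (x, y, z)) \<partial>lborel \<partial>lborel \<partial>lborel)"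
    by (intro nn_integral_cong, subst lborel.nn_integral_fst[symmetric]) (auto simp: lborel_prod borel_prod)
  finally show ?thesis .
qed

text \<open>Square root with \<open>top\<close> sent to \<open>top\<close>, so that Cauchy-Schwarz
  for nonnegative integrals can be iterated without finiteness assumptions.\<close>

definition esqrt :: "ennreal \<Rightarrow> ennreal" where
  "esqrt x = (if x = top then top else ennreal (sqrt (enn2real x)))"

lemma esqrt_measurable [measurable]: "esqrt \<in> borel_measurable borel"
  unfolding esqrt_def[abs_def] by measurable

lemma esqrt_power2: "esqrt x ^ 2 = x"
  by (cases x) (auto simp: esqrt_def ennreal_power)

lemma ennreal_power2_le_imp_le:
  fixes x y :: ennreal
  assumes "x ^ 2 \<le> y ^ 2" shows "x \<le> y"
  using assms by (cases x; cases y) (auto simp: ennreal_power top_unique)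

text \<open>The factor a does not involve x, so for fixed x Cauchy-Schwarz over (y, z) splits off
  its full square integral. What remains is a function of (x, z) times a function of (x, y), which
  factorizes; a second Cauchy-Schwarz then acts in x.\<close>

lemma Loomis_Whitney:
  fixes a b c :: "real \<times> real \<Rightarrow> ennreal"
  assumes [measurable]: "a \<in> borel_measurable borel" "b \<in> borel_measurable borel" "c \<in> borel_measurable borel"
  shows "(\<integral>\<^sup>+x. \<integral>\<^sup>+y. \<integral>\<^sup>+z. a (y, z) * b (x, z) * c (x, y) \<partial>lborel \<partial>lborel \<partial>lborel)\<^sup>2
    \<le> (\<integral>\<^sup>+y. \<integral>\<^sup>+z. (a (y, z))\<^sup>2 \<partial>lborel \<partial>lborel) * (\<integral>\<^sup>+x. \<integral>\<^sup>+z. (b (x, z))\<^sup>2 \<partial>lborel \<partial>lborel)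
      * (\<integral>\<^sup>+x. \<integral>\<^sup>+y. (c (x, y))\<^sup>2 \<partial>lborel \<partial>lborel)"
    (is "?L\<^sup>2 \<le> ?A * ?B * ?C")
proof -
  have [measurable]: "a \<in> borel_measurable (borel \<Otimes>\<^sub>M borel)" "b \<in> borel_measurable (borel \<Otimes>\<^sub>M borel)"
      "c \<in> borel_measurable (borel \<Otimes>\<^sub>M borel)"
    by (simp_all add: borel_prod)
  let ?b = "\<lambda>x. \<integral>\<^sup>+z. (b (x, z))\<^sup>2 \<partial>lborel" and ?c = "\<lambda>x. \<integral>\<^sup>+y. (c (x, y))\<^sup>2 \<partial>lborel"
  have "(\<integral>\<^sup>+y. \<integral>\<^sup>+z. a (y, z) * b (x, z) * c (x, y) \<partial>lborel \<partial>lborel)\<^sup>2 \<le> ?A * (?b x * ?c x)" for x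
  proof -
    have "(\<integral>\<^sup>+y. \<integral>\<^sup>+z. a (y, z) * b (x, z) * c (x, y) \<partial>lborel \<partial>lborel)
        = (\<integral>\<^sup>+p. a p * (b (x, snd p) * c (x, fst p)) \<partial>(lborel \<Otimes>\<^sub>M lborel))"
      by (subst lborel.nn_integral_fst[symmetric]) (auto simp: mult_ac)
    also have "\<dots>\<^sup>2 \<le> (\<integral>\<^sup>+p. (a p)\<^sup>2 \<partial>(lborel \<Otimes>\<^sub>M lborel)) *
        (\<integral>\<^sup>+p. (b (x, snd p) * c (x, fst p))\<^sup>2 \<partial>(lborel \<Otimes>\<^sub>M lborel))"
      by (rule Cauchy_Schwarz_nn_integral) auto
    also have "(\<integral>\<^sup>+p. (a p)\<^sup>2 \<partial>(lborel \<Otimes>\<^sub>M lborel)) = ?A"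
      by (subst lborel.nn_integral_fst[symmetric]) auto
    also have "(\<integral>\<^sup>+p. (b (x, snd p) * c (x, fst p))\<^sup>2 \<partial>(lborel \<Otimes>\<^sub>M lborel))
        = (\<integral>\<^sup>+y. \<integral>\<^sup>+z. (c (x, y))\<^sup>2 * (b (x, z))\<^sup>2 \<partial>lborel \<partial>lborel)"
      by (subst lborel.nn_integral_fst[symmetric]) (auto simp: power_mult_distrib mult_ac)
    also have "\<dots> = ?b x * ?c x"
      by (simp add: nn_integral_cmult nn_integral_multc mult.commute)
    finally show ?thesis .
  qed
  note I = this
  have "(\<integral>\<^sup>+y. \<integral>\<^sup>+z. a (y, z) * b (x, z) * c (x, y) \<partial>lborel \<partial>lborel)
      \<le> esqrt ?A * (esqrt (?b x) * esqrt (?c x))" for x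
  proof (rule ennreal_power2_le_imp_le)
    show "(\<integral>\<^sup>+y. \<integral>\<^sup>+z. a (y, z) * b (x, z) * c (x, y) \<partial>lborel \<partial>lborel)\<^sup>2
      \<le> (esqrt ?A * (esqrt (?b x) * esqrt (?c x)))\<^sup>2"
      unfolding power_mult_distrib esqrt_power2 by (rule I)
  qed
  then have "?L \<le> (\<integral>\<^sup>+x. esqrt ?A * (esqrt (?b x) * esqrt (?c x)) \<partial>lborel)"
    by (intro nn_integral_mono) auto
  also have "\<dots> = esqrt ?A * (\<integral>\<^sup>+x. esqrt (?b x) * esqrt (?c x) \<partial>lborel)"
    by (rule nn_integral_cmult) measurable
  finally have "?L\<^sup>2 \<le> (esqrt ?A * (\<integral>\<^sup>+x. esqrt (?b x) * esqrt (?c x) \<partial>lborel))\<^sup>2"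
    by (intro power_mono) auto
  also have "\<dots> = ?A * (\<integral>\<^sup>+x. esqrt (?b x) * esqrt (?c x) \<partial>lborel)\<^sup>2"
    by (simp add: power_mult_distrib esqrt_power2)
  also have "\<dots> \<le> ?A * ((\<integral>\<^sup>+x. (esqrt (?b x))\<^sup>2 \<partial>lborel) * (\<integral>\<^sup>+x. (esqrt (?c x))\<^sup>2 \<partial>lborel))"
    by (intro mult_left_mono Cauchy_Schwarz_nn_integral) (auto, measurable)
  also have "\<dots> = ?A * ?B * ?C" by (simp add: esqrt_power2 mult.assoc)
  finally show ?thesis .
qed

text \<open>Fundamental theorem of calculus along the line, started at a point outside the
  support.\<close>

lemma abs_le_line_integral:
  fixes f :: "real^'n \<Rightarrow> real"
  assumes f: "f \<in> Ccinf S" and e: "e \<noteq> 0"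
  shows "ennreal \<bar>f (p + s *\<^sub>R e)\<bar> \<le> (\<integral>\<^sup>+t. ennreal \<bar>grad f (p + t *\<^sub>R e) \<bullet> e\<bar> \<partial>lborel)"
proof -
  obtain R where R: "\<And>x. x \<in> supp f \<Longrightarrow> norm x \<le> R"
    using compact_imp_bounded[OF Ccinf_compact[OF f]] by (auto simp: bounded_iff)
  \<comment> \<open>The first summand takes p - T e beyond the radius of the support, the second
    ensures -T <= s.\<close>
  define T where "T = (\<bar>R\<bar> + norm p + 1) / norm e + \<bar>s\<bar>"
  have "norm (p + (- T) *\<^sub>R e) > R"
  proof -
    have "T * norm e \<ge> \<bar>R\<bar> + norm p + 1" using e by (simp add: T_def field_simps)
    moreover have "T \<ge> 0" using e by (simp add: T_def)
    then have "norm ((- T) *\<^sub>R e) = T * norm e" by simp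
    ultimately show ?thesis
      using norm_triangle_ineq4[of "p + (- T) *\<^sub>R e" p] e \<open>T \<ge> 0\<close> by simp
  qed
  then have z: "f (p + (- T) *\<^sub>R e) = 0" using R not_in_supp[of _ f] by (metis not_le)
  have Ts: "- T \<le> s" using e by (simp add: T_def) (smt (verit) divide_nonneg_nonneg norm_ge_zero)
  have d: "((\<lambda>t. f (p + t *\<^sub>R e)) has_real_derivative grad f (p + t *\<^sub>R e) \<bullet> e) (at t)" for t
  proof -
    have 1: "((\<lambda>t. p + t *\<^sub>R e) has_derivative (\<lambda>t. t *\<^sub>R e)) (at t)"
      by (auto intro!: derivative_eq_intros)
    show ?thesis
      using has_derivative_compose[OF 1 Ccinf_has_derivative[OF f]]
      by (simp add: has_field_derivative_def mult_commute_abs)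
  qed
  have c: "continuous_on UNIV (\<lambda>t. grad f (p + t *\<^sub>R e) \<bullet> e)"
    by (intro continuous_intros continuous_on_compose2[OF Ccinf_continuous_grad[OF f]]) auto
  have hb: "has_bochner_integral lborel (\<lambda>t. indicator {- T..s} t *\<^sub>R (grad f (p + t *\<^sub>R e) \<bullet> e))
      (f (p + s *\<^sub>R e) - f (p + (- T) *\<^sub>R e))"
    by (rule has_bochner_integral_FTC_Icc[OF Ts])
      (use d c in \<open>auto simp: has_real_derivative_iff_has_vector_derivative
         intro: has_vector_derivative_at_within continuous_on_subset\<close>)
  then have "f (p + s *\<^sub>R e) = (LBINT t. indicator {- T..s} t *\<^sub>R (grad f (p + t *\<^sub>R e) \<bullet> e))"
    using z by (simp add: has_bochner_integral_integral_eq)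
  also have "ennreal (norm \<dots>) \<le> (\<integral>\<^sup>+t. ennreal (norm (indicator {- T..s} t *\<^sub>R (grad f (p + t *\<^sub>R e) \<bullet> e))) \<partial>lborel)"
    using hb by (intro integral_norm_bound_ennreal) (simp add: has_bochner_integral_iff)
  also have "\<dots> \<le> (\<integral>\<^sup>+t. ennreal \<bar>grad f (p + t *\<^sub>R e) \<bullet> e\<bar> \<partial>lborel)"
    by (intro nn_integral_mono) (auto simp: indicator_def)
  finally show ?thesis by simp
qed

text \<open>The integral of |d_i f| along the i-th axis bounds |f| and does not depend on the i-th
  coordinate. Multiplying the square roots of the three bounds gives |f|^(3/2) on one side and the
  product structure of \<open>Loomis_Whitney\<close> on the other.\<close>

lemma Gagliardo_Nirenberg:
  fixes f :: "real^3 \<Rightarrow> real"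
  assumes f: "f \<in> Ccinf S"
  shows "(\<integral>\<^sup>+x. ennreal (sqrt \<bar>f x\<bar> ^ 3) \<partial>lborel)\<^sup>2 \<le> (\<integral>\<^sup>+x. ennreal \<bar>grad f x $ 1\<bar> \<partial>lborel)
     * (\<integral>\<^sup>+x. ennreal \<bar>grad f x $ 2\<bar> \<partial>lborel) * (\<integral>\<^sup>+x. ennreal \<bar>grad f x $ 3\<bar> \<partial>lborel)"
proof -
  note [measurable] = Ccinf_measurable[OF f]
  have [measurable]: "(\<lambda>x. grad f x $ i) \<in> borel_measurable borel" for i
    using Ccinf_continuous_grad[OF f] by (intro borel_measurable_continuous_onI continuous_intros)
  have V [measurable]: "vec3 \<in> borel_measurable (borel \<Otimes>\<^sub>M borel \<Otimes>\<^sub>M borel)"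
    by (simp add: borel_prod)
  define a where "a q = (\<integral>\<^sup>+t. ennreal \<bar>grad f (vec3 (t, fst q, snd q)) $ 1\<bar> \<partial>lborel)" for q
  define b where "b q = (\<integral>\<^sup>+t. ennreal \<bar>grad f (vec3 (fst q, t, snd q)) $ 2\<bar> \<partial>lborel)" for q
  define c where "c q = (\<integral>\<^sup>+t. ennreal \<bar>grad f (vec3 (fst q, snd q, t)) $ 3\<bar> \<partial>lborel)" for q
  have "a \<in> borel_measurable (borel \<Otimes>\<^sub>M borel)" "b \<in> borel_measurable (borel \<Otimes>\<^sub>M borel)"
      "c \<in> borel_measurable (borel \<Otimes>\<^sub>M borel)"
    unfolding a_def[abs_def] b_def[abs_def] c_def[abs_def] by measurable
  then have [measurable]: "a \<in> borel_measurable borel" "b \<in> borel_measurable borel" "c \<in> borel_measurable borel"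
    by (simp_all add: borel_prod)
  have dec: "vec3 (x, y, z) = vec3 (0, y, z) + x *\<^sub>R axis 1 1" "vec3 (x, y, z) = vec3 (x, 0, z) + y *\<^sub>R axis 2 1"
     "vec3 (x, y, z) = vec3 (x, y, 0) + z *\<^sub>R axis 3 1" for x y z
    by (simp_all add: vec3_def)
  have ax: "axis i 1 \<noteq> (0::real^3)" for i by (simp add: axis_eq_0_iff)
  have "ennreal (sqrt \<bar>f (vec3 (x, y, z))\<bar>) \<le> esqrt (a (y, z))"
       "ennreal (sqrt \<bar>f (vec3 (x, y, z))\<bar>) \<le> esqrt (b (x, z))"
       "ennreal (sqrt \<bar>f (vec3 (x, y, z))\<bar>) \<le> esqrt (c (x, y))" for x y z
  proof -
    show "ennreal (sqrt \<bar>f (vec3 (x, y, z))\<bar>) \<le> esqrt (a (y, z))"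
      by (rule ennreal_power2_le_imp_le, unfold esqrt_power2, subst dec(1), unfold a_def, subst (2) dec(1))
        (use abs_le_line_integral[OF f ax[of 1], of "vec3 (0, y, z)" x] in \<open>simp add: ennreal_power inner_axis\<close>)
    show "ennreal (sqrt \<bar>f (vec3 (x, y, z))\<bar>) \<le> esqrt (b (x, z))"
      by (rule ennreal_power2_le_imp_le, unfold esqrt_power2, subst dec(2), unfold b_def, subst (2) dec(2))
        (use abs_le_line_integral[OF f ax[of 2], of "vec3 (x, 0, z)" y] in \<open>simp add: ennreal_power inner_axis\<close>)
    show "ennreal (sqrt \<bar>f (vec3 (x, y, z))\<bar>) \<le> esqrt (c (x, y))"
      by (rule ennreal_power2_le_imp_le, unfold esqrt_power2, subst dec(3), unfold c_def, subst (2) dec(3))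
        (use abs_le_line_integral[OF f ax[of 3], of "vec3 (x, y, 0)" z] in \<open>simp add: ennreal_power inner_axis\<close>)
  qed
  note le = this
  have "(\<integral>\<^sup>+x. ennreal (sqrt \<bar>f x\<bar> ^ 3) \<partial>lborel)
      = (\<integral>\<^sup>+x. \<integral>\<^sup>+y. \<integral>\<^sup>+z. ennreal (sqrt \<bar>f (vec3 (x, y, z))\<bar> ^ 3) \<partial>lborel \<partial>lborel \<partial>lborel)"
    by (rule nn_integral_vec3) measurable
  also have "\<dots> \<le> (\<integral>\<^sup>+x. \<integral>\<^sup>+y. \<integral>\<^sup>+z. esqrt (a (y, z)) * esqrt (b (x, z)) * esqrt (c (x, y)) \<partial>lborel \<partial>lborel \<partial>lborel)"
  proof (intro nn_integral_mono)
    fix x y z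
    have "ennreal (sqrt \<bar>f (vec3 (x, y, z))\<bar> ^ 3) =
      ennreal (sqrt \<bar>f (vec3 (x, y, z))\<bar>) * ennreal (sqrt \<bar>f (vec3 (x, y, z))\<bar>) * ennreal (sqrt \<bar>f (vec3 (x, y, z))\<bar>)"
      by (simp add: ennreal_mult[symmetric] power3_eq_cube)
    also have "\<dots> \<le> esqrt (a (y, z)) * esqrt (b (x, z)) * esqrt (c (x, y))"
      by (intro mult_mono le) auto
    finally show "ennreal (sqrt \<bar>f (vec3 (x, y, z))\<bar> ^ 3) \<le> esqrt (a (y, z)) * esqrt (b (x, z)) * esqrt (c (x, y))" .
  qed
  finally have "(\<integral>\<^sup>+x. ennreal (sqrt \<bar>f x\<bar> ^ 3) \<partial>lborel)\<^sup>2 \<le>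
      (\<integral>\<^sup>+x. \<integral>\<^sup>+y. \<integral>\<^sup>+z. esqrt (a (y, z)) * esqrt (b (x, z)) * esqrt (c (x, y)) \<partial>lborel \<partial>lborel \<partial>lborel)\<^sup>2"
    by (rule power_mono) simp
  also have "\<dots> \<le> (\<integral>\<^sup>+y. \<integral>\<^sup>+z. a (y, z) \<partial>lborel \<partial>lborel)
     * (\<integral>\<^sup>+x. \<integral>\<^sup>+z. b (x, z) \<partial>lborel \<partial>lborel) * (\<integral>\<^sup>+x. \<integral>\<^sup>+y. c (x, y) \<partial>lborel \<partial>lborel)"
    using Loomis_Whitney[of "\<lambda>q. esqrt (a q)" "\<lambda>q. esqrt (b q)" "\<lambda>q. esqrt (c q)"]
    by (simp add: esqrt_power2)
  also have "(\<integral>\<^sup>+y. \<integral>\<^sup>+z. a (y, z) \<partial>lborel \<partial>lborel) = (\<integral>\<^sup>+x. ennreal \<bar>grad f x $ 1\<bar> \<partial>lborel)"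
  proof -
    have "(\<integral>\<^sup>+y. \<integral>\<^sup>+z. a (y, z) \<partial>lborel \<partial>lborel)
        = (\<integral>\<^sup>+y. \<integral>\<^sup>+x. \<integral>\<^sup>+z. ennreal \<bar>grad f (vec3 (x, y, z)) $ 1\<bar> \<partial>lborel \<partial>lborel \<partial>lborel)"
      unfolding a_def fst_conv snd_conv by (intro nn_integral_cong lborel_pair.Fubini') measurable
    also have "\<dots> = (\<integral>\<^sup>+x. \<integral>\<^sup>+y. \<integral>\<^sup>+z. ennreal \<bar>grad f (vec3 (x, y, z)) $ 1\<bar> \<partial>lborel \<partial>lborel \<partial>lborel)"
      by (rule lborel_pair.Fubini') measurable
    finally show ?thesis by (subst nn_integral_vec3) auto
  qed
  also have "(\<integral>\<^sup>+x. \<integral>\<^sup>+z. b (x, z) \<partial>lborel \<partial>lborel) = (\<integral>\<^sup>+x. ennreal \<bar>grad f x $ 2\<bar> \<partial>lborel)"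
  proof -
    have "(\<integral>\<^sup>+x. \<integral>\<^sup>+z. b (x, z) \<partial>lborel \<partial>lborel)
        = (\<integral>\<^sup>+x. \<integral>\<^sup>+y. \<integral>\<^sup>+z. ennreal \<bar>grad f (vec3 (x, y, z)) $ 2\<bar> \<partial>lborel \<partial>lborel \<partial>lborel)"
      unfolding b_def fst_conv snd_conv by (intro nn_integral_cong lborel_pair.Fubini') measurable
    then show ?thesis by (subst nn_integral_vec3) auto
  qed
  also have "(\<integral>\<^sup>+x. \<integral>\<^sup>+y. c (x, y) \<partial>lborel \<partial>lborel) = (\<integral>\<^sup>+x. ennreal \<bar>grad f x $ 3\<bar> \<partial>lborel)"
    unfolding c_def fst_conv snd_conv by (rule nn_integral_vec3[symmetric]) measurable
  finally show ?thesis .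
qed

text \<open>For u^4 the inequality \<open>Gagliardo_Nirenberg\<close> has u^6 on the left, and on
  the right gradients bounded by 4 |u|^3 |grad u|, whose integral is at most 4 sqrt(J D) by
  Cauchy-Schwarz. Solving J^2 <= (4 sqrt(J D))^3 for J gives J <= 4^6 D^3, whence the constant
  4096.\<close>

lemma Sobolev_inequality:
  fixes u :: "real^3 \<Rightarrow> real"
  assumes u: "u \<in> Ccinf S"
  shows "(LBINT x. (u x) ^ 6) \<le> 4096 * (LBINT x. (norm (grad u x))\<^sup>2) ^ 3"
proof -
  note [measurable] = Ccinf_measurable[OF u] Ccinf_grad_measurable[OF u]
  define J where "J = (LBINT x. (u x) ^ 6)"
  define D where "D = (LBINT x. (norm (grad u x))\<^sup>2)"
  have Ck: "Ck k u" for k using u by (simp add: Ccinf_iff)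
  have pw: "(\<lambda>x. u x * (u x) ^ n) \<in> Ccinf S" for n
    by (rule Ccinf_mult[OF u Ck_power[OF Ck]])
  have iJ: "integrable lborel (\<lambda>x. (u x) ^ 6)"
    using Ccinf_integrable[OF pw[of 5]] by (simp add: power_Suc[symmetric] del: power_Suc)
  have iD: "integrable lborel (\<lambda>x. (norm (grad u x))\<^sup>2)"
    by (rule continuous_compact_support_integrable[of _ "supp u"])
      (use Ccinf_continuous_grad[OF u] Ccinf_compact[OF u] in \<open>auto intro!: continuous_intros simp: grad_not_in_supp\<close>)
  have f4: "(\<lambda>x. (u x) ^ 4) \<in> Ccinf S"
    using pw[of 3] by (simp add: power_Suc[symmetric] del: power_Suc)
  have g4: "grad (\<lambda>x. (u x) ^ 4) x = (4 * (u x) ^ 3) *\<^sub>R grad u x" for x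
    by (rule grad_eqI) (auto intro!: derivative_eq_intros Ccinf_has_derivative[OF u])
  have bound: "(\<integral>\<^sup>+x. ennreal \<bar>grad (\<lambda>x. (u x) ^ 4) x $ i\<bar> \<partial>lborel) \<le> ennreal (4 * (sqrt J * sqrt D))" for i
  proof -
    have [measurable]: "(\<lambda>x. grad u x $ i) \<in> borel_measurable borel"
      using Ccinf_continuous_grad[OF u] by (intro borel_measurable_continuous_onI continuous_intros)
    have ile: "\<bar>grad u x $ i\<bar>\<^sup>2 \<le> (norm (grad u x))\<^sup>2" for x
      by (intro power_mono component_le_norm_cart) auto
    have i2: "integrable lborel (\<lambda>x. (grad u x $ i)\<^sup>2)"
      by (rule Bochner_Integration.integrable_bound[OF iD]) (use ile in auto)
    have i3: "integrable lborel (\<lambda>x. (\<bar>u x\<bar> ^ 3)\<^sup>2)"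
      using iJ by (simp add: power_mult[symmetric])
    have J3: "(LBINT x. (\<bar>u x\<bar> ^ 3)\<^sup>2) = J" by (simp add: J_def power_mult[symmetric])
    have "(\<integral>\<^sup>+x. ennreal \<bar>grad (\<lambda>x. (u x) ^ 4) x $ i\<bar> \<partial>lborel)
        = (\<integral>\<^sup>+x. ennreal (4 * \<bar>\<bar>u x\<bar> ^ 3 * (grad u x $ i)\<bar>) \<partial>lborel)"
      by (intro nn_integral_cong) (simp add: g4 abs_mult power_abs mult.assoc)
    also have "\<dots> = ennreal (LBINT x. 4 * \<bar>\<bar>u x\<bar> ^ 3 * (grad u x $ i)\<bar>)"
      using integrable_mult_L2[OF _ _ i3 i2] by (intro nn_integral_eq_integral integrable_mult_right integrable_abs) auto
    also have "\<dots> \<le> ennreal (4 * (sqrt J * sqrt D))"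
    proof (rule ennreal_leI)
      have "(LBINT x. \<bar>\<bar>u x\<bar> ^ 3 * (grad u x $ i)\<bar>) \<le> sqrt J * sqrt (LBINT x. (grad u x $ i)\<^sup>2)"
        using Cauchy_Schwarz_integral[OF _ _ i3 i2] unfolding J3 by simp
      also have "\<dots> \<le> sqrt J * sqrt D"
        unfolding D_def by (intro mult_left_mono real_sqrt_le_mono integral_mono i2 iD)
          (use ile in \<open>auto simp: J_def intro!: Bochner_Integration.integral_nonneg\<close>)
      finally show "(LBINT x. 4 * \<bar>\<bar>u x\<bar> ^ 3 * (grad u x $ i)\<bar>) \<le> 4 * (sqrt J * sqrt D)"
        by simp
    qed
    finally show ?thesis .
  qed
  have J0: "0 \<le> J" unfolding J_def by (intro Bochner_Integration.integral_nonneg) auto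
  have D0: "0 \<le> D" unfolding D_def by (intro Bochner_Integration.integral_nonneg) auto
  have s6: "sqrt \<bar>(u x) ^ 4\<bar> ^ 3 = (u x) ^ 6" for x
  proof -
    have "sqrt \<bar>(u x) ^ 4\<bar> = (u x)\<^sup>2"
      by (rule real_sqrt_unique) (simp_all add: power_mult[symmetric])
    then show ?thesis by (simp add: power_mult[symmetric])
  qed
  have "ennreal (J\<^sup>2) = (\<integral>\<^sup>+x. ennreal (sqrt \<bar>(u x) ^ 4\<bar> ^ 3) \<partial>lborel)\<^sup>2"
    unfolding s6 using nn_integral_eq_integral[OF iJ] J0 by (simp add: J_def ennreal_power)
  also have "\<dots> \<le> ennreal (4 * (sqrt J * sqrt D)) * ennreal (4 * (sqrt J * sqrt D)) * ennreal (4 * (sqrt J * sqrt D))"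
    by (rule order_trans[OF Gagliardo_Nirenberg[OF f4]]) (intro mult_mono bound; simp)
  also have "\<dots> = ennreal ((4 * (sqrt J * sqrt D)) ^ 3)"
    using J0 D0 by (simp add: ennreal_mult[symmetric] power3_eq_cube)
  finally have "J\<^sup>2 \<le> (4 * (sqrt J * sqrt D)) ^ 3"
    using J0 D0 by (simp add: ennreal_le_iff)
  note JD = this
  define j d where "j = sqrt J" and "d = sqrt D"
  have "(j\<^sup>2)\<^sup>2 \<le> (4 * (j * d)) ^ 3" using JD J0 unfolding j_def d_def by simp
  then have le: "j ^ 3 * j \<le> j ^ 3 * (64 * d ^ 3)"
    by (simp add: power_mult_distrib power_mult[symmetric] power_Suc2[symmetric] mult_ac del: power_Suc2) (simp add: power_numeral_reduce mult_ac)
  have j0: "0 \<le> j" "0 \<le> d" using J0 D0 by (simp_all add: j_def d_def)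
  have "j \<le> 64 * d ^ 3"
  proof (cases "j = 0")
    case True then show ?thesis using j0 by simp
  next
    case False
    then have "j ^ 3 > 0" using j0 by simp
    with le show ?thesis using mult_le_cancel_left_pos by blast
  qed
  then have "j\<^sup>2 \<le> (64 * d ^ 3)\<^sup>2" using j0 by (intro power_mono) auto
  also have "\<dots> = 4096 * (d\<^sup>2) ^ 3" by (simp add: power_mult_distrib power_mult[symmetric])
  finally show ?thesis using J0 D0 by (simp add: j_def d_def J_def[symmetric] D_def[symmetric])
qed

subsection \<open>Limits along the approximating velocities\<close>

text \<open>Laid out like the Jacobian, with the gradient of component i in row i. Gradients of
  components are what the approximation in \<open>D0\<close> provides, one component at a
  time.\<close>

definition grad_matrix :: "(real^'n \<Rightarrow> real^'m) \<Rightarrow> real^'n \<Rightarrow> real^'n^'m" where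
  "grad_matrix f x = (\<chi> i. grad (\<lambda>y. f y $ i) x)"

lemma norm_outer: "norm (outer a b) = norm a * norm b"
proof -
  have "(outer a b) \<bullet> (outer a b) = (a \<bullet> a) * (b \<bullet> b)"
    by (simp add: outer_def inner_vec_def sum_product mult_ac) (rule sum.swap)
  then show ?thesis by (simp add: norm_eq_sqrt_inner real_sqrt_mult)
qed

lemma outer_measurable [measurable]:
  fixes f :: "'z \<Rightarrow> real^'p" and g :: "'z \<Rightarrow> real^'q"
  assumes "f \<in> borel_measurable N" "g \<in> borel_measurable N"
  shows "(\<lambda>x. outer (f x) (g x)) \<in> borel_measurable N"
proof -
  have "continuous_on UNIV (\<lambda>p::(real^'p) \<times> (real^'q). outer (fst p) (snd p))"
    unfolding outer_def by (intro continuous_intros)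
  from borel_measurable_continuous_Pair[OF assms this] show ?thesis .
qed

section \<open>Elementary inequalities for the exponents 6 and 6/5\<close>

lemma power_le_1_plus_power6:
  fixes a b :: real
  assumes "0 \<le> a" "0 \<le> b" "j + l \<le> 6"
  shows "a ^ j * b ^ l \<le> 1 + a ^ 6 + b ^ 6"
proof -
  define m where "m = max 1 (max a b)"
  have m: "a \<le> m" "b \<le> m" "1 \<le> m" by (auto simp: m_def)
  have "a ^ j * b ^ l \<le> m ^ j * m ^ l"
    using assms m by (intro mult_mono power_mono) auto
  also have "\<dots> = m ^ (j + l)" by (simp add: power_add)
  also have "\<dots> \<le> m ^ 6" using assms m by (intro power_increasing) auto
  also have "\<dots> \<le> 1 + a ^ 6 + b ^ 6"
    using zero_le_power[OF assms(1), of 6] zero_le_power[OF assms(2), of 6] by (auto simp: m_def max_def)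
  finally show ?thesis .
qed

text \<open>A crude substitute for the three-factor Hoelder inequality: each factor is bounded by
  the largest.\<close>

lemma prod3_le_cubes:
  fixes x y z :: real
  assumes "0 \<le> x" "0 \<le> y" "0 \<le> z"
  shows "x * y * z \<le> x ^ 3 + y ^ 3 + z ^ 3"
proof -
  define m where "m = max x (max y z)"
  have m: "x \<le> m" "y \<le> m" "z \<le> m" "0 \<le> m" using assms by (auto simp: m_def)
  have "x * y * z \<le> m * m * m" using assms m by (intro mult_mono) auto
  also have "\<dots> \<le> x ^ 3 + y ^ 3 + z ^ 3"
    using zero_le_power[OF assms(1), of 3] zero_le_power[OF assms(2), of 3] zero_le_power[OF assms(3), of 3]
    by (auto simp: m_def max_def power3_eq_cube)
  finally show ?thesis .
qed

text \<open>Either d <= t, or d = d^6 / d^5 <= d^6 / t^5. Integrated with an integrable and bounded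
  weight, this turns smallness in L^6 into smallness in weighted L^1.\<close>

lemma le_eps_plus_power6:
  fixes d :: real
  assumes "0 \<le> d" "0 < t" shows "d \<le> t + d ^ 6 / t ^ 5"
proof (cases "d \<le> t")
  case True then show ?thesis using assms by (intro add_increasing2) auto
next
  case False
  then have "t ^ 5 \<le> d ^ 5" using assms by (intro power_mono) auto
  then have "d * t ^ 5 \<le> d * d ^ 5" using assms by (intro mult_left_mono) auto
  also have "\<dots> = d ^ 6" by (simp add: power_Suc[symmetric] del: power_Suc)
  finally have "d \<le> d ^ 6 / t ^ 5" using assms by (simp add: pos_le_divide_eq)
  then show ?thesis using assms by linarith
qed

text \<open>Young's inequality for 6 and 6/5 without sharp constants. The cases meet at a = t
  h^(1/5), where a h equals each of the two terms on the right.\<close>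

lemma young_six_fifths:
  fixes a h t :: real
  assumes "0 \<le> a" "0 \<le> h" "0 < t"
  shows "a * h \<le> t * h powr (6/5) + a ^ 6 / t ^ 5"
proof (cases "a \<le> t * h powr (1/5)")
  case True
  have "a * h \<le> t * h powr (1/5) * h" using True assms by (intro mult_right_mono) auto
  also have "\<dots> = t * h powr (6/5)"
  proof (cases "h = 0")
    case False
    then have "h powr (1/5) * h powr 1 = h powr (6/5)" by (subst powr_add[symmetric]) simp
    then show ?thesis using assms False by simp
  qed simp
  also have "\<dots> \<le> t * h powr (6/5) + a ^ 6 / t ^ 5" using assms by simp
  finally show ?thesis .
next
  case False
  then have "(t * h powr (1/5)) ^ 5 \<le> a ^ 5" using assms by (intro power_mono) auto
  moreover have "(h powr (1/5)) ^ 5 = h"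
    using assms by (cases "h = 0") (auto simp: powr_realpow[symmetric] powr_powr)
  ultimately have "t ^ 5 * h \<le> a ^ 5" by (simp add: power_mult_distrib)
  then have "a * (t ^ 5 * h) \<le> a * a ^ 5" using assms by (intro mult_left_mono) auto
  also have "\<dots> = a ^ 6" by (simp add: power_Suc[symmetric] del: power_Suc)
  finally have "a * h \<le> a ^ 6 / t ^ 5" using assms by (simp add: pos_le_divide_eq mult_ac)
  moreover have "0 \<le> t * h powr (6/5)" using assms by simp
  ultimately show ?thesis by linarith
qed

lemma tendsto_norm_bound:
  fixes f :: "nat \<Rightarrow> 'a::real_normed_vector"
  assumes "\<And>n. norm (f n - l) \<le> g n" "g \<longlonglongrightarrow> 0"
  shows "f \<longlonglongrightarrow> l"
  by (rule LIM_zero_cancel, rule Lim_null_comparison[OF _ assms(2)]) (simp add: assms(1))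

text \<open>\<open>K t\<close> may blow up as t tends to 0: t is fixed first, according to the
  desired error, and n follows.\<close>

lemma tendsto_zero_of_tradeoff:
  fixes f X :: "nat \<Rightarrow> real" and K :: "real \<Rightarrow> real"
  assumes X: "X \<longlonglongrightarrow> 0" and C: "0 \<le> C"
    and le: "\<And>t n. 0 < t \<Longrightarrow> t \<le> 1 \<Longrightarrow> \<bar>f n\<bar> \<le> t * C + K t * X n"
  shows "f \<longlonglongrightarrow> 0"
proof (rule LIMSEQ_le_eps)
  fix e :: real assume e: "e > 0"
  define t where "t = min 1 (e / (C + 1))"
  have t: "0 < t" "t \<le> 1" "t * C \<le> e"
  proof -
    show "0 < t" "t \<le> 1" using e C by (auto simp: t_def)
    have "t * C \<le> e / (C + 1) * C" using C by (intro mult_right_mono) (auto simp: t_def)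
    also have "\<dots> \<le> e" using e C by (simp add: divide_simps)
    finally show "t * C \<le> e" .
  qed
  have "\<bar>f n\<bar> \<le> K t * X n + e" for n using le[OF t(1,2), of n] t(3) by linarith
  moreover have "(\<lambda>n. K t * X n) \<longlonglongrightarrow> 0" using tendsto_mult_right_zero[OF X] .
  ultimately show "\<exists>g. g \<longlonglongrightarrow> 0 \<and> (\<forall>n. \<bar>f n\<bar> \<le> g n + e)" by blast
qed

text \<open>64 = 2^6, from |a - b| <= 2 max(|a|, |b|).\<close>

lemma norm_diff_power6: "norm (a - b) ^ 6 \<le> 64 * (norm a ^ 6 + norm b ^ 6)"
  for a b :: "'z::real_normed_vector"
proof -
  define m where "m = max (norm a) (norm b)"
  have "norm (a - b) \<le> 2 * m" using norm_triangle_ineq4[of a b] by (auto simp: m_def)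
  then have "norm (a - b) ^ 6 \<le> (2 * m) ^ 6" by (intro power_mono) auto
  also have "\<dots> \<le> 64 * (norm a ^ 6 + norm b ^ 6)"
    by (auto simp: m_def max_def power_mult_distrib)
  finally show ?thesis .
qed

lemma norm_diff_power2: "(norm (a - b))\<^sup>2 \<le> 2 * ((norm a)\<^sup>2 + (norm b)\<^sup>2)"
  for a b :: "'z::real_normed_vector"
proof -
  have "(norm (a - b))\<^sup>2 \<le> (norm a + norm b)\<^sup>2" by (intro power_mono norm_triangle_ineq4) auto
  also have "\<dots> \<le> 2 * ((norm a)\<^sup>2 + (norm b)\<^sup>2)"
    using sum_squares_bound[of "norm a" "norm b"] by (simp add: power2_sum)
  finally show ?thesis .
qed

lemma integrable_inner_L2:
  fixes F G :: "'z \<Rightarrow> 'e::euclidean_space"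
  assumes [measurable]: "F \<in> borel_measurable N" "G \<in> borel_measurable N"
    and "integrable N (\<lambda>x. (norm (F x))\<^sup>2)" "integrable N (\<lambda>x. (norm (G x))\<^sup>2)"
  shows "integrable N (\<lambda>x. F x \<bullet> G x)"
proof (rule Bochner_Integration.integrable_bound)
  show "integrable N (\<lambda>x. norm (F x) * norm (G x))"
    by (rule integrable_mult_L2) (use assms in auto)
  show "AE x in N. norm (F x \<bullet> G x) \<le> norm (norm (F x) * norm (G x))"
    using Cauchy_Schwarz_ineq2 by auto
qed simp

lemma Ccinf_L2:
  fixes f :: "'a::euclidean_space \<Rightarrow> real"
  assumes "f \<in> Ccinf T" shows "integrable lborel (\<lambda>x. (f x)\<^sup>2)"
  by (rule continuous_compact_support_integrable[OF _ Ccinf_compact[OF assms]])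
    (auto intro!: continuous_intros Ccinf_continuous[OF assms] simp: not_in_supp)

lemma Ccinf_grad_L2:
  assumes "f \<in> Ccinf T" shows "integrable lborel (\<lambda>x. (norm (grad f x))\<^sup>2)"
  by (rule continuous_compact_support_integrable[OF _ Ccinf_compact[OF assms]])
    (auto intro!: continuous_intros Ccinf_continuous_grad[OF assms] simp: grad_not_in_supp)

lemma grad_diff:
  assumes "f \<in> Ccinf T" "g \<in> Ccinf T'"
  shows "grad (\<lambda>x. f x - g x) y = grad f y - grad g y"
  by (rule grad_eqI, rule has_derivative_eq_rhs[OF has_derivative_diff[OF Ccinf_has_derivative[OF assms(1)] Ccinf_has_derivative[OF assms(2)]]])
    (simp add: inner_diff_left)

lemma Ccinf_diff:
  fixes f g :: "'a::euclidean_space \<Rightarrow> real"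
  assumes "f \<in> Ccinf T" "g \<in> Ccinf T" shows "(\<lambda>x. f x - g x) \<in> Ccinf T"
  using Ccinf_add[OF assms(1) Ccinf_cmult[OF assms(2), of "-1"]] by simp

text \<open>w, A and U stand for the velocity extended by zero, its gradient and the approximating
  test fields, as Borel functions on the whole space. A is tied to w only through the common
  approximating sequence.\<close>

locale approximable_field =
  fixes w :: "real^3 \<Rightarrow> real^3" and A :: "real^3 \<Rightarrow> real^3^3" and U :: "nat \<Rightarrow> real^3 \<Rightarrow> real^3"
  assumes w_measurable [measurable]: "w \<in> borel_measurable borel"
    and A_measurable [measurable]: "A \<in> borel_measurable borel"
    and U_Ccinf: "\<And>n i. (\<lambda>x. U n x $ i) \<in> Ccinf UNIV"
    and w_L6: "integrable lborel (\<lambda>x. norm (w x) ^ 6)"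
    and A_L2: "integrable lborel (\<lambda>x. (norm (A x))\<^sup>2)"
    and U_lim: "(\<lambda>n. LBINT x. norm (U n x - w x) ^ 6) \<longlonglongrightarrow> 0"
    and DU_lim: "(\<lambda>n. LBINT x. (norm (grad_matrix (U n) x - A x))\<^sup>2) \<longlonglongrightarrow> 0"
begin

abbreviation "D n \<equiv> grad_matrix (U n)"

definition "S n = (\<Union>i. supp (\<lambda>x. U n x $ i))"

lemma S_compact: "compact (S n)"
  unfolding S_def by (intro compact_UN) (auto intro: Ccinf_compact[OF U_Ccinf])

lemma U_outside: "x \<notin> S n \<Longrightarrow> U n x = 0"
  by (auto simp: S_def vec_eq_iff not_in_supp[of x "\<lambda>x. U n x $ i" for i])

lemma D_outside: "x \<notin> S n \<Longrightarrow> D n x = 0"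
  by (auto simp: S_def grad_matrix_def vec_eq_iff grad_not_in_supp)

lemma U_continuous: "continuous_on UNIV (U n)"
  using Ck_vec[of 0 "U n"] Ccinf_continuous[OF U_Ccinf] by simp

lemma D_continuous: "continuous_on UNIV (D n)"
  unfolding grad_matrix_def[abs_def] by (intro continuous_intros Ccinf_continuous_grad[OF U_Ccinf])

lemma U_measurable [measurable]: "U n \<in> borel_measurable borel"
  by (intro borel_measurable_continuous_onI U_continuous)

lemma D_measurable [measurable]: "D n \<in> borel_measurable borel"
  by (intro borel_measurable_continuous_onI D_continuous)

lemma U_L6: "integrable lborel (\<lambda>x. norm (U n x) ^ 6)"
  by (rule continuous_compact_support_integrable[OF _ S_compact[of n]])
    (auto intro!: continuous_intros U_continuous simp: U_outside)

lemma D_L2: "integrable lborel (\<lambda>x. (norm (D n x))\<^sup>2)"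
  by (rule continuous_compact_support_integrable[OF _ S_compact[of n]])
    (auto intro!: continuous_intros D_continuous simp: D_outside)

lemma Uw_L6: "integrable lborel (\<lambda>x. norm (U n x - w x) ^ 6)"
  by (rule Bochner_Integration.integrable_bound[OF integrable_mult_right[OF
      Bochner_Integration.integrable_add[OF U_L6[of n] w_L6], of 64]])
    (use norm_diff_power6 in \<open>auto simp: abs_of_nonneg\<close>)

lemma DA_L2: "integrable lborel (\<lambda>x. (norm (D n x - A x))\<^sup>2)"
  by (rule Bochner_Integration.integrable_bound[OF integrable_mult_right[OF
      Bochner_Integration.integrable_add[OF D_L2[of n] A_L2], of 2]])
    (use norm_diff_power2 in \<open>auto simp: abs_of_nonneg\<close>)

lemma D_bounded: obtains B where "\<And>n. (LBINT x. (norm (D n x))\<^sup>2) \<le> B"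
proof -
  obtain K where K: "\<And>n. (LBINT x. (norm (D n x - A x))\<^sup>2) \<le> K"
    using convergent_imp_Bseq[OF convergentI[OF DU_lim]]
    unfolding Bseq_def real_norm_def by (meson abs_ge_self order_trans)
  have "(LBINT x. (norm (D n x))\<^sup>2) \<le> 2 * (K + (LBINT x. (norm (A x))\<^sup>2))" for n
  proof -
    have "(LBINT x. (norm (D n x))\<^sup>2) \<le> (LBINT x. 2 * ((norm (D n x - A x))\<^sup>2 + (norm (A x))\<^sup>2))"
    proof (rule integral_mono[OF D_L2])
      show "(norm (D n x))\<^sup>2 \<le> 2 * ((norm (D n x - A x))\<^sup>2 + (norm (A x))\<^sup>2)" for x
        using norm_diff_power2[of "D n x - A x" "- A x"] by simp
    qed (use DA_L2 A_L2 in simp)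
    also have "\<dots> = 2 * ((LBINT x. (norm (D n x - A x))\<^sup>2) + (LBINT x. (norm (A x))\<^sup>2))"
      using DA_L2 A_L2 by simp
    finally show ?thesis using K[of n] by simp
  qed
  then show ?thesis by (rule that)
qed

lemma D_weak_limit:
  assumes [measurable]: "F \<in> borel_measurable borel" and F: "integrable lborel (\<lambda>x. (norm (F x))\<^sup>2)"
  shows "(\<lambda>n. LBINT x. F x \<bullet> D n x) \<longlonglongrightarrow> (LBINT x. F x \<bullet> A x)"
proof -
  have "(\<lambda>n. LBINT x. \<bar>norm (D n x - A x) * norm (F x)\<bar>) \<longlonglongrightarrow> 0"
    by (rule tendsto_Cauchy_Schwarz[OF _ _ _ _ DU_lim order_refl]) (use DA_L2 F in auto)
  moreover have "norm ((LBINT x. F x \<bullet> D n x) - (LBINT x. F x \<bullet> A x))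
      \<le> (LBINT x. \<bar>norm (D n x - A x) * norm (F x)\<bar>)" for n
  proof -
    have "(LBINT x. F x \<bullet> D n x) - (LBINT x. F x \<bullet> A x) = (LBINT x. F x \<bullet> (D n x - A x))"
      using F D_L2[of n] A_L2 by (subst Bochner_Integration.integral_diff[symmetric])
         (auto intro!: integrable_inner_L2 simp: inner_diff_right)
    also have "norm \<dots> \<le> (LBINT x. \<bar>norm (D n x - A x) * norm (F x)\<bar>)"
    proof (rule order_trans[OF integral_norm_bound integral_mono])
      show "integrable lborel (\<lambda>x. \<bar>norm (D n x - A x) * norm (F x)\<bar>)"
        using DA_L2 F by (intro integrable_abs integrable_mult_L2) auto
      show "integrable lborel (\<lambda>x. norm (F x \<bullet> (D n x - A x)))"
        using DA_L2 F by (intro integrable_norm integrable_inner_L2) auto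
      show "norm (F x \<bullet> (D n x - A x)) \<le> \<bar>norm (D n x - A x) * norm (F x)\<bar>" for x
        using Cauchy_Schwarz_ineq2[of "F x" "D n x - A x"] by (simp add: mult.commute)
    qed
    finally show ?thesis .
  qed
  ultimately show ?thesis by (rule tendsto_norm_bound[rotated])
qed

text \<open>L^(6/5) is dual to L^6; Young's inequality with a free parameter t takes the place of
  Hoelder's.\<close>

lemma U_weak_limit:
  assumes F [measurable]: "F \<in> borel_measurable borel" and i: "integrable lborel (\<lambda>x. norm (F x) powr (6/5))"
  shows "(\<lambda>n. LBINT x. F x \<bullet> U n x) \<longlonglongrightarrow> (LBINT x. F x \<bullet> w x)"
    and "integrable lborel (\<lambda>x. F x \<bullet> w x)"
proof -
  have bnd: "norm (F x \<bullet> v) \<le> t * norm (F x) powr (6/5) + norm v ^ 6 / t ^ 5" if "0 < t" for v x t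
    using young_six_fifths[of "norm v" "norm (F x)" t] Cauchy_Schwarz_ineq2[of "F x" v] that
    by (simp add: mult.commute)
  have int: "integrable lborel (\<lambda>x. F x \<bullet> v x)"
    if "v \<in> borel_measurable borel" "integrable lborel (\<lambda>x. norm (v x) ^ 6)" for v
  proof (rule Bochner_Integration.integrable_bound[OF Bochner_Integration.integrable_add[OF i that(2)]])
    show "AE x in lborel. norm (F x \<bullet> v x) \<le> norm (norm (F x) powr (6/5) + norm (v x) ^ 6)"
      using bnd[of 1] by (intro AE_I2) (simp add: abs_of_nonneg add_nonneg_nonneg)
  qed (use that in simp)
  show "integrable lborel (\<lambda>x. F x \<bullet> w x)" by (rule int[OF w_measurable w_L6])
  show "(\<lambda>n. LBINT x. F x \<bullet> U n x) \<longlonglongrightarrow> (LBINT x. F x \<bullet> w x)"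
  proof (rule LIM_zero_cancel, rule tendsto_zero_of_tradeoff[OF U_lim, where K = "\<lambda>t. 1 / t ^ 5"])
    show "0 \<le> (LBINT x. norm (F x) powr (6/5))" by (intro Bochner_Integration.integral_nonneg) auto
    fix t :: real and n assume t: "0 < t"
    have "(LBINT x. F x \<bullet> U n x) - (LBINT x. F x \<bullet> w x) = (LBINT x. F x \<bullet> (U n x - w x))"
      using int[OF U_measurable U_L6] int[OF w_measurable w_L6]
      by (subst Bochner_Integration.integral_diff[symmetric]) (auto simp: inner_diff_right)
    also have "\<bar>\<dots>\<bar> \<le> (LBINT x. t * norm (F x) powr (6/5) + norm (U n x - w x) ^ 6 / t ^ 5)"
    proof (rule order_trans[OF integral_abs_bound integral_mono])
      show "integrable lborel (\<lambda>x. \<bar>F x \<bullet> (U n x - w x)\<bar>)"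
        by (intro integrable_abs int Uw_L6) auto
    qed (use bnd[OF t] i Uw_L6 in auto)
    also have "\<dots> = t * (LBINT x. norm (F x) powr (6/5)) + 1 / t ^ 5 * (LBINT x. norm (U n x - w x) ^ 6)"
      using i Uw_L6 by simp
    finally show "\<bar>(LBINT x. F x \<bullet> U n x) - (LBINT x. F x \<bullet> w x)\<bar> \<le>
       t * (LBINT x. norm (F x) powr (6/5)) + 1 / t ^ 5 * (LBINT x. norm (U n x - w x) ^ 6)" .
  qed
qed

end

text \<open>The bounds on r hold at every point rather than almost everywhere, which a clamped
  representative of the density provides.\<close>

locale solenoidal_flow = approximable_field +
  fixes r :: "real^3 \<Rightarrow> real" and M :: real
  assumes r_measurable [measurable]: "r \<in> borel_measurable borel"
    and r_nonneg: "\<And>x. 0 \<le> r x" and r_le: "\<And>x. r x \<le> M"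
    and r_integrable: "integrable lborel r"
    and div_free: "\<And>\<phi>. \<phi> \<in> Ccinf UNIV \<Longrightarrow> (LBINT x. (r x *\<^sub>R w x) \<bullet> grad \<phi> x) = 0"
begin

lemma M_nonneg: "0 \<le> M" using r_nonneg r_le order_trans by blast

lemma r_power_le: "r x ^ Suc k \<le> M ^ k * r x"
  using mult_right_mono[OF power_mono[OF r_le r_nonneg] r_nonneg, of x k x] by (simp add: mult.commute)

text \<open>Integrability of r pays for the constant, its upper bound M for g. With g = |w|^6, every
  power of |w| up to the sixth becomes integrable against r.\<close>

lemma r_mult_integrable:
  fixes f :: "real^3 \<Rightarrow> real"
  assumes [measurable]: "f \<in> borel_measurable borel" and g: "integrable lborel g"
    and le: "\<And>x. \<bar>f x\<bar> \<le> c * (1 + g x)" "\<And>x. 0 \<le> g x" and c: "0 \<le> c"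
  shows "integrable lborel (\<lambda>x. r x * f x)"
proof (rule Bochner_Integration.integrable_bound)
  show "integrable lborel (\<lambda>x. c * (r x + M * g x))" using g r_integrable by simp
  have "r x * \<bar>f x\<bar> \<le> c * (r x + M * g x)" for x
  proof -
    have "r x * \<bar>f x\<bar> \<le> r x * (c * (1 + g x))" by (intro mult_left_mono le r_nonneg)
    also have "\<dots> = c * (r x + r x * g x)" by (simp add: algebra_simps)
    also have "\<dots> \<le> c * (r x + M * g x)" by (intro mult_left_mono add_left_mono mult_right_mono r_le le c)
    finally show ?thesis .
  qed
  then show "AE x in lborel. norm (r x * f x) \<le> norm (c * (r x + M * g x))"
    using c M_nonneg r_nonneg le(2) by (intro AE_I2) (simp add: abs_mult abs_of_nonneg)
qed simp

lemma rw_integrable: "integrable lborel (\<lambda>x. r x *\<^sub>R w x)"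
proof -
  have "integrable lborel (\<lambda>x. r x * norm (w x))"
    by (rule r_mult_integrable[OF _ w_L6, of _ 1]) (use power_le_1_plus_power6[of "norm (w _)" 0 1 0] in auto)
  then show ?thesis
    by (rule Bochner_Integration.integrable_bound) (auto simp: r_nonneg)
qed

lemma rw_L2: "integrable lborel (\<lambda>x. (norm (r x *\<^sub>R w x))\<^sup>2)"
proof -
  have "integrable lborel (\<lambda>x. r x * (r x * (norm (w x))\<^sup>2))"
  proof (rule r_mult_integrable[OF _ w_L6, of _ M])
    show "\<bar>r x * (norm (w x))\<^sup>2\<bar> \<le> M * (1 + norm (w x) ^ 6)" for x
      using power_le_1_plus_power6[of "norm (w x)" 0 2 0] r_nonneg[of x] r_le[of x]
      by (simp add: abs_mult mult_mono)
  qed (auto simp: M_nonneg)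
  then show ?thesis by (simp add: power_mult_distrib power2_eq_square mult_ac r_nonneg)
qed

text \<open>The square is r (r |w|^4), and 4 <= 6. Square integrability is what pairs this tensor
  with the gradients \<open>D n\<close>.\<close>

lemma rw_outer_L2: "integrable lborel (\<lambda>x. (norm (r x *\<^sub>R outer (w x) (w x)))\<^sup>2)"
proof -
  have "integrable lborel (\<lambda>x. r x * (r x * norm (w x) ^ 4))"
  proof (rule r_mult_integrable[OF _ w_L6, of _ M])
    show "\<bar>r x * norm (w x) ^ 4\<bar> \<le> M * (1 + norm (w x) ^ 6)" for x
      using power_le_1_plus_power6[of "norm (w x)" 0 4 0] r_nonneg[of x] r_le[of x]
      by (simp add: abs_mult mult_mono)
  qed (auto simp: M_nonneg)
  then show ?thesis by (simp add: norm_outer power_mult_distrib power2_eq_square power4_eq_xxxx mult_ac r_nonneg)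
qed

lemma r_dist_limit: "(\<lambda>n. LBINT x. r x * norm (U n x - w x)) \<longlonglongrightarrow> 0"
  and r_dist_integrable: "integrable lborel (\<lambda>x. r x * norm (U n x - w x))"
proof -
  have int: "integrable lborel (\<lambda>x. r x * norm (U n x - w x))" for n
    by (rule r_mult_integrable[OF _ Uw_L6[of n], of _ 1])
      (use power_le_1_plus_power6[of "norm (U n _ - w _)" 0 1 0] in auto)
  then show "integrable lborel (\<lambda>x. r x * norm (U n x - w x))" .
  show "(\<lambda>n. LBINT x. r x * norm (U n x - w x)) \<longlonglongrightarrow> 0"
  proof (rule tendsto_zero_of_tradeoff[OF U_lim, where K = "\<lambda>t. M / t ^ 5"])
    show "0 \<le> (LBINT x. r x)" by (intro Bochner_Integration.integral_nonneg) (auto simp: r_nonneg)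
    fix t :: real and n assume t: "0 < t"
    have "\<bar>LBINT x. r x * norm (U n x - w x)\<bar> = (LBINT x. r x * norm (U n x - w x))"
      by (intro abs_of_nonneg Bochner_Integration.integral_nonneg) (auto simp: r_nonneg)
    also have "\<dots> \<le> (LBINT x. t * r x + M / t ^ 5 * norm (U n x - w x) ^ 6)"
    proof (rule integral_mono[OF int])
      show "integrable lborel (\<lambda>x. t * r x + M / t ^ 5 * norm (U n x - w x) ^ 6)"
        using Uw_L6[of n] r_integrable by simp
      fix x
      have "r x * norm (U n x - w x) \<le> r x * (t + norm (U n x - w x) ^ 6 / t ^ 5)"
        by (intro mult_left_mono le_eps_plus_power6 r_nonneg t) auto
      also have "\<dots> = t * r x + r x * (norm (U n x - w x) ^ 6 / t ^ 5)" by (simp add: algebra_simps)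
      also have "\<dots> \<le> t * r x + M * (norm (U n x - w x) ^ 6 / t ^ 5)"
        using t by (intro add_left_mono mult_right_mono r_le) auto
      finally show "r x * norm (U n x - w x) \<le> t * r x + M / t ^ 5 * norm (U n x - w x) ^ 6" by simp
    qed
    also have "\<dots> = t * (LBINT x. r x) + M / t ^ 5 * (LBINT x. norm (U n x - w x) ^ 6)"
      using Uw_L6[of n] r_integrable by simp
    finally show "\<bar>LBINT x. r x * norm (U n x - w x)\<bar> \<le>
      t * (LBINT x. r x) + M / t ^ 5 * (LBINT x. norm (U n x - w x) ^ 6)" .
  qed
qed

lemma rw_dist_L2_limit: "(\<lambda>n. LBINT x. (r x * norm (w x) * norm (U n x - w x))\<^sup>2) \<longlonglongrightarrow> 0"
  and rw_dist_L2: "integrable lborel (\<lambda>x. (r x * norm (w x) * norm (U n x - w x))\<^sup>2)"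
proof -
  have pt: "(r x * norm (w x) * norm (U n x - w x))\<^sup>2 \<le>
      t * (M ^ 5 * r x + norm (w x) ^ 6) + 1 / t ^ 6 * norm (U n x - w x) ^ 6" if t: "0 < t" "t \<le> 1" for t n x
  proof -
    \<comment> \<open>The powers of t are placed so that the cubes of the first two factors become
      small multiples of integrable functions, while the third may carry any multiple of |U n -
      w|^6, whose integral tends to 0.\<close>
    have "(r x * norm (w x) * norm (U n x - w x))\<^sup>2
      = (t * (r x)\<^sup>2) * (t * (norm (w x))\<^sup>2) * ((norm (U n x - w x))\<^sup>2 / t\<^sup>2)"
      using t by (simp add: power_mult_distrib power2_eq_square)
    also have "\<dots> \<le> (t * (r x)\<^sup>2) ^ 3 + (t * (norm (w x))\<^sup>2) ^ 3 + ((norm (U n x - w x))\<^sup>2 / t\<^sup>2) ^ 3"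
      by (rule prod3_le_cubes) (use t in auto)
    also have "\<dots> = t ^ 3 * (r x ^ Suc 5 + norm (w x) ^ 6) + 1 / t ^ 6 * norm (U n x - w x) ^ 6"
      by (simp add: power_mult_distrib power_divide power_mult[symmetric] distrib_left)
    also have "\<dots> \<le> t * (M ^ 5 * r x + norm (w x) ^ 6) + 1 / t ^ 6 * norm (U n x - w x) ^ 6"
    proof (intro add_right_mono mult_mono add_mono r_power_le order_refl)
      show "t ^ 3 \<le> t" using power_decreasing[of 1 3 t] t by simp
    qed (use t r_nonneg M_nonneg in auto)
    finally show ?thesis .
  qed
  have int: "integrable lborel (\<lambda>x. t * (M ^ 5 * r x + norm (w x) ^ 6) + 1 / t ^ 6 * norm (U n x - w x) ^ 6)" for t n
    using r_integrable w_L6 Uw_L6[of n] by simp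
  show int2: "integrable lborel (\<lambda>x. (r x * norm (w x) * norm (U n x - w x))\<^sup>2)" for n
    by (rule Bochner_Integration.integrable_bound[OF int[of 1 n]])
      (use pt[of 1] in \<open>auto intro!: AE_I2 order_trans[OF _ abs_ge_self]\<close>)
  show "(\<lambda>n. LBINT x. (r x * norm (w x) * norm (U n x - w x))\<^sup>2) \<longlonglongrightarrow> 0"
  proof (rule tendsto_zero_of_tradeoff[OF U_lim, where K = "\<lambda>t. 1 / t ^ 6"])
    show "0 \<le> (LBINT x. M ^ 5 * r x + norm (w x) ^ 6)"
      by (intro Bochner_Integration.integral_nonneg) (auto simp: r_nonneg M_nonneg)
    fix t :: real and n assume t: "0 < t" "t \<le> 1"
    have "\<bar>LBINT x. (r x * norm (w x) * norm (U n x - w x))\<^sup>2\<bar>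
        = (LBINT x. (r x * norm (w x) * norm (U n x - w x))\<^sup>2)"
      by (intro abs_of_nonneg Bochner_Integration.integral_nonneg) auto
    also have "\<dots> \<le> (LBINT x. t * (M ^ 5 * r x + norm (w x) ^ 6) + 1 / t ^ 6 * norm (U n x - w x) ^ 6)"
      by (intro integral_mono int int2 pt t)
    also have "\<dots> = t * (LBINT x. M ^ 5 * r x + norm (w x) ^ 6) + 1 / t ^ 6 * (LBINT x. norm (U n x - w x) ^ 6)"
      using r_integrable w_L6 Uw_L6[of n] by simp
    finally show "\<bar>LBINT x. (r x * norm (w x) * norm (U n x - w x))\<^sup>2\<bar> \<le>
      t * (LBINT x. M ^ 5 * r x + norm (w x) ^ 6) + 1 / t ^ 6 * (LBINT x. norm (U n x - w x) ^ 6)" .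
  qed
qed

text \<open>|U n|^2 as a sum of products, so that it is a test function by the closure
  properties.\<close>

definition "sq n x = (\<Sum>i\<in>UNIV. (U n x $ i) * (U n x $ i))"

lemma sq_Ccinf:
  assumes "\<And>i. (\<lambda>x. U n x $ i) \<in> Ccinf \<Omega>" shows "sq n \<in> Ccinf \<Omega>"
proof -
  have "(\<lambda>x. \<Sum>i\<in>UNIV. (U n x $ i) * (U n x $ i)) \<in> Ccinf \<Omega>"
    by (intro Ccinf_sum Ccinf_mult assms) (use U_Ccinf in \<open>auto simp: Ccinf_iff\<close>)
  then show ?thesis by (simp add: sq_def[abs_def])
qed

lemma sq_eq: "sq n x = (norm (U n x))\<^sup>2"
  by (simp add: sq_def power2_norm_eq_inner inner_vec_def)

lemma has_derivative_sq: "(sq n has_derivative (\<lambda>v. (\<Sum>i\<in>UNIV. (2 * U n x $ i) *\<^sub>R (D n x $ i)) \<bullet> v)) (at x)"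
  unfolding sq_def[abs_def]
  by (rule has_derivative_eq_rhs,
      rule has_derivative_sum[OF has_derivative_mult[OF Ccinf_has_derivative[OF U_Ccinf] Ccinf_has_derivative[OF U_Ccinf]]])
    (auto simp: grad_matrix_def inner_sum_left fun_eq_iff intro!: sum.cong)

lemma grad_sq: "grad (sq n) x = (\<Sum>i\<in>UNIV. (2 * U n x $ i) *\<^sub>R (D n x $ i))"
  by (rule grad_eqI[OF has_derivative_sq])

text \<open>(a . grad) |U|^2 = 2 U . (a . grad) U. The order of the factors of \<open>outer\<close>
  matches the gradients being the rows of \<open>D n\<close>.\<close>

lemma inner_grad_sq: "a \<bullet> grad (sq n) x = 2 * (outer (U n x) a \<bullet> D n x)"
proof -
  have "a \<bullet> grad (sq n) x = (\<Sum>i\<in>UNIV. 2 * U n x $ i * (a \<bullet> (D n x $ i)))"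
    by (simp add: grad_sq inner_sum_right)
  also have "\<dots> = 2 * (\<Sum>i\<in>UNIV. U n x $ i * (\<Sum>j\<in>UNIV. a $ j * D n x $ i $ j))"
    unfolding sum_distrib_left[of 2] by (intro sum.cong refl) (simp add: inner_vec_def)
  also have "\<dots> = 2 * (outer (U n x) a \<bullet> D n x)"
    by (simp add: outer_def inner_vec_def sum_distrib_left mult.assoc)
  finally show ?thesis .
qed

text \<open>The convective term vanishes: since |U n|^2 is an admissible test function for the continuity
  equation, one factor w may be replaced by w - U n.\<close>

lemma convective_term_limit: "(\<lambda>n. LBINT x. (r x *\<^sub>R outer (w x) (w x)) \<bullet> D n x) \<longlonglongrightarrow> 0"
proof -
  obtain B where B: "\<And>n. (LBINT x. (norm (D n x))\<^sup>2) \<le> B" using D_bounded by blast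
  have lim: "(\<lambda>n. LBINT x. \<bar>(r x * norm (w x) * norm (U n x - w x)) * norm (D n x)\<bar>) \<longlonglongrightarrow> 0"
    by (rule tendsto_Cauchy_Schwarz[OF _ _ _ _ rw_dist_L2_limit B]) (use rw_dist_L2 D_L2 in auto)
  have "norm ((LBINT x. (r x *\<^sub>R outer (w x) (w x)) \<bullet> D n x) - 0) \<le>
     (LBINT x. \<bar>(r x * norm (w x) * norm (U n x - w x)) * norm (D n x)\<bar>)" for n
  proof -
    have i1: "integrable lborel (\<lambda>x. (r x *\<^sub>R outer (w x) (w x)) \<bullet> D n x)"
      by (rule integrable_inner_L2[OF _ _ rw_outer_L2 D_L2]) measurable
    have i3: "integrable lborel (\<lambda>x. \<bar>(r x * norm (w x) * norm (U n x - w x)) * norm (D n x)\<bar>)"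
      by (intro integrable_abs integrable_mult_L2 rw_dist_L2) (use D_L2 in auto)
    have le: "\<bar>(r x *\<^sub>R outer (w x - U n x) (w x)) \<bullet> D n x\<bar> \<le> \<bar>(r x * norm (w x) * norm (U n x - w x)) * norm (D n x)\<bar>" for x
      using Cauchy_Schwarz_ineq2[of "r x *\<^sub>R outer (w x - U n x) (w x)" "D n x"]
      by (simp add: norm_outer norm_minus_commute abs_mult mult_ac)
    have i2: "integrable lborel (\<lambda>x. (r x *\<^sub>R outer (w x - U n x) (w x)) \<bullet> D n x)"
      by (rule Bochner_Integration.integrable_bound[OF i3]) (use le in auto)
    have split: "(r x *\<^sub>R outer (w x) (w x)) \<bullet> D n x =
        (r x *\<^sub>R outer (w x - U n x) (w x)) \<bullet> D n x + (1/2) * ((r x *\<^sub>R w x) \<bullet> grad (sq n) x)" for x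
    proof -
      have "outer (w x) (w x) = outer (w x - U n x) (w x) + outer (U n x) (w x)"
        by (simp add: outer_def vec_eq_iff left_diff_distrib)
      then show ?thesis using inner_grad_sq[of "w x" n x] by (simp add: inner_add_left distrib_left)
    qed
    have i4: "integrable lborel (\<lambda>x. (r x *\<^sub>R w x) \<bullet> grad (sq n) x)"
      using integrable_mult_right[OF Bochner_Integration.integrable_diff[OF i1 i2], of 2] unfolding split by simp
    have "(LBINT x. (r x *\<^sub>R outer (w x) (w x)) \<bullet> D n x) = (LBINT x. (r x *\<^sub>R outer (w x - U n x) (w x)) \<bullet> D n x)"
      unfolding split using i2 i4 div_free[OF sq_Ccinf[OF U_Ccinf], of n] by simp
    also have "norm (\<dots> - 0) \<le> (LBINT x. \<bar>(r x * norm (w x) * norm (U n x - w x)) * norm (D n x)\<bar>)"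
      unfolding diff_zero real_norm_def by (rule order_trans[OF integral_abs_bound integral_mono[OF integrable_abs[OF i2] i3 le]])
    finally show ?thesis .
  qed
  then show ?thesis using lim by (rule tendsto_norm_bound)
qed

end

subsection \<open>Mollified densities\<close>

lemma trace_inner: "mat 1 \<bullet> B = trace B" for B :: "real^'n^'n"
  by (simp add: inner_vec_def mat_def trace_def if_distrib[of "\<lambda>x. x * _"] cong: if_cong)

text \<open>Fubini for the double integral of k(z) H(y) q(y + d z), with a kernel k, an integrable
  density or flux q and a bounded weight H. Absolute convergence comes from the translation
  invariance of the L^1 norm of q, so the bounds do not depend on d.\<close>

lemma
  fixes k q H :: "'a::euclidean_space \<Rightarrow> real"
  assumes k: "integrable lborel k" and q: "integrable lborel q"
    and H [measurable]: "H \<in> borel_measurable borel" and C: "\<And>y. \<bar>H y\<bar> \<le> C"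
  shows shifted_product_integrable_inner: "integrable lborel (\<lambda>y. H y * q (y + d *\<^sub>R z))"
    and shifted_product_integrable: "integrable lborel (\<lambda>z. k z * (LBINT y. H y * q (y + d *\<^sub>R z)))"
    and shifted_product_swap: "(LBINT y. LBINT z. k z * (H y * q (y + d *\<^sub>R z)))
      = (LBINT z. k z * (LBINT y. H y * q (y + d *\<^sub>R z)))"
    and shifted_product_bound: "\<bar>LBINT z. k z * (LBINT y. H y * q (y + d *\<^sub>R z))\<bar>
      \<le> C * (LBINT z. \<bar>k z\<bar>) * (LBINT y. \<bar>q y\<bar>)"
    and shifted_product_integrable_outer: "integrable lborel (\<lambda>y. LBINT z. k z * (H y * q (y + d *\<^sub>R z)))"
proof -
  have [measurable]: "k \<in> borel_measurable borel" "q \<in> borel_measurable borel"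
    using k q by (auto dest: borel_measurable_integrable)
  have C0: "0 \<le> C" using C[of 0] by linarith
  show iy: "integrable lborel (\<lambda>y. H y * q (y + d *\<^sub>R z))" for z
    by (rule Bochner_Integration.integrable_bound[OF integrable_mult_right[OF
        lborel_integrable_translate[OF q, of "d *\<^sub>R z"], of C]])
      (use C C0 in \<open>auto simp: abs_mult intro!: mult_right_mono AE_I2\<close>)
  have bnd: "(LBINT y. \<bar>H y * q (y + d *\<^sub>R z)\<bar>) \<le> C * (LBINT y. \<bar>q y\<bar>)" for z
  proof -
    have "(LBINT y. \<bar>H y * q (y + d *\<^sub>R z)\<bar>) \<le> (LBINT y. C * \<bar>q (y + d *\<^sub>R z)\<bar>)"
      using lborel_integrable_translate[OF q, of "d *\<^sub>R z"] C
      by (intro integral_mono[OF integrable_abs[OF iy]]) (auto simp: abs_mult intro: mult_right_mono)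
    also have "\<dots> = C * (LBINT y. \<bar>q y\<bar>)"
      using lborel_integral_translate[of "\<lambda>y. \<bar>q y\<bar>" "d *\<^sub>R z"] by simp
    finally show ?thesis .
  qed
  let ?F = "\<lambda>p. k (fst p) * (H (snd p) * q (snd p + d *\<^sub>R fst p))"
  have int: "integrable (lborel \<Otimes>\<^sub>M lborel) ?F"
  proof (rule lborel_pair.Fubini_integrable)
    show "integrable lborel (\<lambda>z. LBINT y. norm (?F (z, y)))"
    proof (rule Bochner_Integration.integrable_bound[OF integrable_mult_right[OF k, of "C * (LBINT y. \<bar>q y\<bar>)"]])
      show "(\<lambda>z. LBINT y. norm (?F (z, y))) \<in> borel_measurable lborel" by measurable
      have "\<bar>LBINT y. \<bar>k z * (H y * q (y + d *\<^sub>R z))\<bar>\<bar> \<le> C * (LBINT y. \<bar>q y\<bar>) * \<bar>k z\<bar>" for z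
      proof -
        have "\<bar>LBINT y. \<bar>k z * (H y * q (y + d *\<^sub>R z))\<bar>\<bar> = \<bar>k z\<bar> * (LBINT y. \<bar>H y * q (y + d *\<^sub>R z)\<bar>)"
          by (simp add: abs_mult[of "k z"] abs_of_nonneg[OF mult_nonneg_nonneg[OF abs_ge_zero Bochner_Integration.integral_nonneg]])
        also have "\<dots> \<le> \<bar>k z\<bar> * (C * (LBINT y. \<bar>q y\<bar>))" by (intro mult_left_mono bnd) auto
        finally show ?thesis by (simp add: mult_ac)
      qed
      then show "AE z in lborel. norm (LBINT y. norm (?F (z, y))) \<le> norm (C * (LBINT y. \<bar>q y\<bar>) * k z)"
        using C0 by (intro AE_I2) (simp add: abs_mult abs_of_nonneg Bochner_Integration.integral_nonneg)
    qed
    show "AE z in lborel. integrable lborel (\<lambda>y. ?F (z, y))" using iy by simp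
  qed measurable
  show iz: "integrable lborel (\<lambda>z. k z * (LBINT y. H y * q (y + d *\<^sub>R z)))"
    using lborel_pair.integrable_fst[of "\<lambda>z y. ?F (z, y)"] int by (simp add: case_prod_beta')
  show "integrable lborel (\<lambda>y. LBINT z. k z * (H y * q (y + d *\<^sub>R z)))"
    using lborel_pair.integrable_snd[of "\<lambda>z y. ?F (z, y)"] int by (simp add: case_prod_beta')
  show "(LBINT y. LBINT z. k z * (H y * q (y + d *\<^sub>R z)))
      = (LBINT z. k z * (LBINT y. H y * q (y + d *\<^sub>R z)))"
    using lborel_pair.Fubini_integral[of "\<lambda>z y. ?F (z, y)"] int by (simp add: case_prod_beta')
  have "\<bar>LBINT z. k z * (LBINT y. H y * q (y + d *\<^sub>R z))\<bar>
      \<le> (LBINT z. C * (LBINT y. \<bar>q y\<bar>) * \<bar>k z\<bar>)"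
  proof (rule order_trans[OF integral_abs_bound integral_mono])
    fix z
    have "\<bar>k z * (LBINT y. H y * q (y + d *\<^sub>R z))\<bar> \<le> \<bar>k z\<bar> * (C * (LBINT y. \<bar>q y\<bar>))"
      unfolding abs_mult by (intro mult_left_mono order_trans[OF integral_abs_bound bnd]) auto
    then show "\<bar>k z * (LBINT y. H y * q (y + d *\<^sub>R z))\<bar> \<le> C * (LBINT y. \<bar>q y\<bar>) * \<bar>k z\<bar>"
      by (simp add: mult_ac)
  qed (use iz k in auto)
  then show "\<bar>LBINT z. k z * (LBINT y. H y * q (y + d *\<^sub>R z))\<bar>
      \<le> C * (LBINT z. \<bar>k z\<bar>) * (LBINT y. \<bar>q y\<bar>)"
    by (simp add: mult_ac)
qed

text \<open>Factorization of the difference of powers. The exponent m in place of m - 1, harmless as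
  K >= 1, avoids truncated subtraction at m = 0.\<close>

lemma power_diff_bound:
  fixes x y K :: real
  assumes "\<bar>x\<bar> \<le> K" "\<bar>y\<bar> \<le> K" "1 \<le> K"
  shows "\<bar>x ^ m - y ^ m\<bar> \<le> real m * K ^ m * \<bar>x - y\<bar>"
proof -
  have "\<bar>\<Sum>i<m. y ^ (m - Suc i) * x ^ i\<bar> \<le> (\<Sum>i<m. K ^ m)"
  proof (rule order_trans[OF sum_abs sum_mono])
    fix i assume i: "i \<in> {..<m}"
    have "\<bar>y ^ (m - Suc i) * x ^ i\<bar> \<le> K ^ (m - Suc i) * K ^ i"
      unfolding abs_mult power_abs using assms by (intro mult_mono power_mono) auto
    also have "\<dots> \<le> K ^ m" unfolding power_add[symmetric] using assms i by (intro power_increasing) auto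
    finally show "\<bar>y ^ (m - Suc i) * x ^ i\<bar> \<le> K ^ m" .
  qed
  then have "\<bar>x - y\<bar> * \<bar>\<Sum>i<m. y ^ (m - Suc i) * x ^ i\<bar> \<le> \<bar>x - y\<bar> * (real m * K ^ m)"
    by (intro mult_left_mono) auto
  then show ?thesis unfolding power_diff_sumr2[of x m y] abs_mult by (simp add: mult_ac)
qed

lemma Ck_inner_const: "Ck k (\<lambda>z. c \<bullet> z)" for c :: "'a::euclidean_space"
proof (cases k)
  case 0
  then show ?thesis by (auto intro: continuous_intros)
next
  case (Suc j)
  show ?thesis unfolding Suc
    by (rule Ck_SucI[of _ "\<lambda>x v. c \<bullet> v"]) (auto intro!: derivative_eq_intros)
qed

locale mollified_flow = solenoidal_flow +
  fixes \<eta> :: "real^3 \<Rightarrow> real"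
  assumes \<eta>_Ccinf: "\<eta> \<in> Ccinf UNIV" and \<eta>_integral: "(LBINT z. \<eta> z) = 1"
begin

section \<open>The kernel, its first moments and the mollified continuity equation\<close>

lemmas \<eta>_measurable [measurable] = Ccinf_measurable[OF \<eta>_Ccinf]
lemmas grad_\<eta>_measurable [measurable] = Ccinf_grad_measurable[OF \<eta>_Ccinf]
lemmas \<eta>_integrable = Ccinf_integrable[OF \<eta>_Ccinf]

abbreviation "\<kappa> i z \<equiv> grad \<eta> z $ i"

lemma \<kappa>_measurable [measurable]: "\<kappa> i \<in> borel_measurable borel"
  using Ccinf_continuous_grad[OF \<eta>_Ccinf] by (intro borel_measurable_continuous_onI continuous_intros)

lemma \<kappa>_integrable: "integrable lborel (\<kappa> i)"
  by (rule Bochner_Integration.integrable_bound[OF Ccinf_grad_integrable[OF \<eta>_Ccinf]])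
    (auto simp: component_le_norm_cart)

lemma \<kappa>_norm_integrable: "integrable lborel (\<lambda>z. \<bar>\<kappa> i z\<bar> * norm z)"
  by (rule continuous_compact_support_integrable[OF _ Ccinf_compact[OF \<eta>_Ccinf]])
    (auto intro!: continuous_intros Ccinf_continuous_grad[OF \<eta>_Ccinf] simp: grad_not_in_supp)

text \<open>The gradient of \<eta>(z) (c . z) has integral zero. This moment of the kernel is what
  remains of the commutator when the scale d tends to 0.\<close>

lemma \<kappa>_linear_integral: "(LBINT z. \<kappa> i z * (c \<bullet> z)) = - (c $ i)"
proof -
  have m: "(\<lambda>z. \<eta> z * (c \<bullet> z)) \<in> Ccinf UNIV" by (rule Ccinf_mult[OF \<eta>_Ccinf Ck_inner_const])
  have dc: "((\<lambda>z. c \<bullet> z) has_derivative (\<lambda>v. c \<bullet> v)) (at z)" for z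
    by (auto intro!: derivative_eq_intros)
  then have dd: "(\<lambda>z. c \<bullet> z) differentiable at z" for z by (auto simp: differentiable_def)
  have gm: "grad (\<lambda>z. \<eta> z * (c \<bullet> z)) z = \<eta> z *\<^sub>R c + (c \<bullet> z) *\<^sub>R grad \<eta> z" for z
    unfolding grad_mult[OF Ccinf_differentiable[OF \<eta>_Ccinf] dd] grad_eqI[OF dc] ..
  have i1: "integrable lborel (\<lambda>z. \<kappa> i z * (c \<bullet> z))"
    by (rule continuous_compact_support_integrable[OF _ Ccinf_compact[OF \<eta>_Ccinf]])
      (auto intro!: continuous_intros Ccinf_continuous_grad[OF \<eta>_Ccinf] simp: grad_not_in_supp)
  have "0 = (LBINT z. \<eta> z * c $ i + \<kappa> i z * (c \<bullet> z))"
    using integral_grad_zero[OF m, of "axis i 1"] unfolding gm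
    by (simp add: inner_add_left inner_axis mult.commute)
  also have "\<dots> = c $ i + (LBINT z. \<kappa> i z * (c \<bullet> z))"
    using i1 \<eta>_integrable \<eta>_integral by simp
  finally show ?thesis by simp
qed

text \<open>The test function is x |-> \<eta>((x - y)/d); the factors d^3 from the substitution and
  1/d from its gradient cancel against zero.\<close>

lemma continuity_equation_mollified:
  assumes d: "d > 0"
  shows "(LBINT z. (r (y + d *\<^sub>R z) *\<^sub>R w (y + d *\<^sub>R z)) \<bullet> grad \<eta> z) = 0"
proof -
  define \<phi> where "\<phi> x = \<eta> ((- 1/d) *\<^sub>R y + (1/d) *\<^sub>R x)" for x
  have \<phi>: "\<phi> \<in> Ccinf UNIV" unfolding \<phi>_def by (rule Ccinf_affine[OF \<eta>_Ccinf]) (use d in auto)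
  have g: "grad \<phi> x = (1/d) *\<^sub>R grad \<eta> ((- 1/d) *\<^sub>R y + (1/d) *\<^sub>R x)" for x
    unfolding \<phi>_def by (rule grad_affine[OF Ccinf_differentiable[OF \<eta>_Ccinf]])
  have arg: "(- 1/d) *\<^sub>R y + (1/d) *\<^sub>R (y + d *\<^sub>R z) = z" for z
    using d by (simp add: scaleR_right_distrib)
  have "0 = (LBINT x. (r x *\<^sub>R w x) \<bullet> grad \<phi> x)" using div_free[OF \<phi>] by simp
  also have "\<dots> = \<bar>d\<bar> ^ DIM(real^3) *\<^sub>R (LBINT z. (r (y + d *\<^sub>R z) *\<^sub>R w (y + d *\<^sub>R z)) \<bullet> grad \<phi> (y + d *\<^sub>R z))"
    by (rule lborel_integral_affine) (use d Ccinf_grad_measurable[OF \<phi>] in auto)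
  also have "\<dots> = \<bar>d\<bar> ^ DIM(real^3) * (1/d) * (LBINT z. (r (y + d *\<^sub>R z) *\<^sub>R w (y + d *\<^sub>R z)) \<bullet> grad \<eta> z)"
    unfolding g arg by simp
  finally show ?thesis using d by simp
qed

lemma w_component_measurable [measurable]: "(\<lambda>x. w x $ i) \<in> borel_measurable borel"
  using borel_measurable_inner[OF w_measurable, of "\<lambda>_. axis i 1"] by (simp add: inner_axis)

lemma rw_component_integrable: "integrable lborel (\<lambda>y. r y * w y $ i)"
  using integrable_inner_left[of "axis i 1", OF rw_integrable] by (simp add: inner_axis)

text \<open>For each y the sum of the inner integrals is H(y) times the mollified equation, hence
  zero. The statement is split into components so that the exchange of integrals applies to each of
  them.\<close>

lemma continuity_equation_weighted:
  assumes H: "H \<in> borel_measurable borel" and C: "\<And>y. \<bar>H y\<bar> \<le> C" and d: "d > 0"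
  shows "(\<Sum>i\<in>UNIV. LBINT y. LBINT z. \<kappa> i z * (H y * (r (y + d *\<^sub>R z) * w (y + d *\<^sub>R z) $ i))) = 0"
proof -
  let ?q = "\<lambda>i x. r x * w x $ i"
  have d0: "d \<noteq> 0" using d by simp
  have "(\<Sum>i\<in>UNIV. LBINT y. LBINT z. \<kappa> i z * (H y * ?q i (y + d *\<^sub>R z)))
     = (LBINT y. (\<Sum>i\<in>UNIV. LBINT z. \<kappa> i z * (H y * ?q i (y + d *\<^sub>R z))))"
    by (subst Bochner_Integration.integral_sum)
      (auto intro!: shifted_product_integrable_outer[OF \<kappa>_integrable rw_component_integrable H C])
  also have "\<dots> = (\<integral>y. 0 \<partial>(lborel :: (real^3) measure))"
  proof (intro Bochner_Integration.integral_cong refl)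
    fix y
    have i: "integrable lborel (\<lambda>z. \<kappa> i z * ?q i (y + d *\<^sub>R z))" for i
    proof -
      obtain Bg where Bg: "\<And>x. norm (grad \<eta> x) \<le> Bg" using Ccinf_grad_bounded[OF \<eta>_Ccinf] by blast
      have "integrable lborel (\<lambda>z. ?q i (y + d *\<^sub>R z))"
      proof -
        have "integrable (density (distr lborel borel (\<lambda>x. y + d *\<^sub>R x)) (\<lambda>_. \<bar>d\<bar> ^ DIM(real^3))) (?q i)"
          using rw_component_integrable[of i] unfolding lborel_affine[OF d0, symmetric] .
        then show ?thesis using d0 by (simp add: integrable_density integrable_distr_eq)
      qed
      from integrable_mult_right[OF this, of Bg] show ?thesis
      proof (rule Bochner_Integration.integrable_bound)
        have "\<bar>\<kappa> i z\<bar> \<le> \<bar>Bg\<bar>" for z using component_le_norm_cart[of "grad \<eta> z" i] Bg[of z] by linarith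
        then show "AE z in lborel. norm (\<kappa> i z * ?q i (y + d *\<^sub>R z)) \<le> norm (Bg * ?q i (y + d *\<^sub>R z))"
          by (intro AE_I2) (simp add: abs_mult mult_right_mono)
      qed measurable
    qed
    have "(\<Sum>i\<in>UNIV. LBINT z. \<kappa> i z * (H y * ?q i (y + d *\<^sub>R z)))
        = H y * (\<Sum>i\<in>UNIV. LBINT z. \<kappa> i z * ?q i (y + d *\<^sub>R z))"
      unfolding sum_distrib_left integral_mult_right_zero[symmetric] by (simp add: mult_ac)
    also have "(\<Sum>i\<in>UNIV. LBINT z. \<kappa> i z * ?q i (y + d *\<^sub>R z))
        = (LBINT z. (r (y + d *\<^sub>R z) *\<^sub>R w (y + d *\<^sub>R z)) \<bullet> grad \<eta> z)"
      by (subst Bochner_Integration.integral_sum[symmetric])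
        (auto intro!: i Bochner_Integration.integral_cong simp: inner_vec_def sum_distrib_left mult_ac)
    also have "\<dots> = 0" by (rule continuity_equation_mollified[OF d])
    finally show "(\<Sum>i\<in>UNIV. LBINT z. \<kappa> i z * (H y * ?q i (y + d *\<^sub>R z))) = 0" by simp
  qed
  finally show ?thesis by simp
qed

text \<open>The kernel is only required to have integral 1, so its L^1 norm enters the
  bounds.\<close>

definition "N\<eta> = (LBINT z. \<bar>\<eta> z\<bar>)"
text \<open>A common bound for r and all its mollifications, as the L^1 norm of the kernel is at
  least 1; the lower bound 1 is what \<open>power_diff_bound\<close> asks for.\<close>

definition "K = max 1 (M * N\<eta>)"
text \<open>The mollification at scale d: in the variable x = y + d z the kernel is d^(-3) \<eta>((x
  - y)/d).\<close>

definition "R d y = (LBINT z. r (y + d *\<^sub>R z) * \<eta> z)"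

section \<open>The mollified density and its difference quotients\<close>

lemma N\<eta>_ge: "1 \<le> N\<eta>"
  using integral_abs_bound[of lborel \<eta>] \<eta>_integral by (simp add: N\<eta>_def)

lemma K_ge: "1 \<le> K" by (simp add: K_def)

lemma r_le_K: "\<bar>r y\<bar> \<le> K"
  using r_le[of y] r_nonneg[of y] mult_left_mono[OF N\<eta>_ge M_nonneg] by (simp add: K_def)

lemma r_shift_integrable:
  assumes "integrable lborel g" shows "integrable lborel (\<lambda>z. r (y + d *\<^sub>R z) * g z)"
proof (rule Bochner_Integration.integrable_bound[OF integrable_mult_right[OF assms, of M]])
  show "AE z in lborel. norm (r (y + d *\<^sub>R z) * g z) \<le> norm (M * g z)"
    using r_le r_nonneg M_nonneg by (intro AE_I2) (simp add: abs_mult mult_right_mono)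
qed (use assms in \<open>auto dest: borel_measurable_integrable\<close>)

lemma R_measurable [measurable]: "R d \<in> borel_measurable borel"
  unfolding R_def[abs_def] by measurable

lemma R_le_K: "\<bar>R d y\<bar> \<le> K"
proof -
  have "\<bar>R d y\<bar> \<le> (LBINT z. M * \<bar>\<eta> z\<bar>)"
    unfolding R_def
  proof (rule order_trans[OF integral_abs_bound integral_mono])
    show "\<bar>r (y + d *\<^sub>R z) * \<eta> z\<bar> \<le> M * \<bar>\<eta> z\<bar>" for z
      using r_le r_nonneg by (simp add: abs_mult mult_right_mono)
  qed (use r_shift_integrable[OF \<eta>_integrable] \<eta>_integrable in auto)
  then show ?thesis by (simp add: N\<eta>_def[symmetric] K_def)
qed

lemma R_integrable: "integrable lborel (R d)"
  using shifted_product_integrable_outer[OF \<eta>_integrable r_integrable, of "\<lambda>_. 1" 1 d]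
  by (simp add: R_def[abs_def] mult.commute)

text \<open>Translating z turns the increment h e of y into the increment -h e/d of the argument of
  \<eta>, so the difference quotients of \<open>R d\<close> are averages of those of \<eta>. The
  bound L depends on d, which stays fixed in the integration by parts that it serves.\<close>

lemma
  assumes d: "d > 0" and h: "h \<longlonglongrightarrow> 0" "\<And>n. h n \<noteq> 0" "\<And>n. \<bar>h n\<bar> \<le> 1"
  shows R_quotient_tendsto: "(\<lambda>n. (R d (y + h n *\<^sub>R e) - R d y) / h n) \<longlonglongrightarrow>
      - (1/d) * (LBINT z. r (y + d *\<^sub>R z) * (grad \<eta> z \<bullet> e))"
    and R_quotient_bounded: "\<exists>L. \<forall>n y. \<bar>(R d (y + h n *\<^sub>R e) - R d y) / h n\<bar> \<le> L"
proof -
  define k where "k n = - h n / d" for n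
  have k: "k \<longlonglongrightarrow> 0" "\<And>n. k n \<noteq> 0" "\<And>n. \<bar>k n\<bar> \<le> 1/d"
    using tendsto_mult_right_zero[OF h(1), of "- 1/d"] h(2,3) d by (auto simp: k_def[abs_def] divide_simps)
  obtain R0 where R0: "\<And>x. x \<in> supp \<eta> \<Longrightarrow> norm x \<le> R0"
    using compact_imp_bounded[OF Ccinf_compact[OF \<eta>_Ccinf]] by (auto simp: bounded_iff)
  obtain B where B: "\<And>x. norm (grad \<eta> x) \<le> B" using Ccinf_grad_bounded[OF \<eta>_Ccinf] by blast
  have B0: "0 \<le> B" using order_trans[OF norm_ge_zero B] .
  \<comment> \<open>One ball contains the supports of all the quotients \<open>Q n\<close>, because
    |k n| <= 1/d.\<close>
  define W where "W z = (1/d) * (M * (B * norm e)) * indicat_real (cball 0 (R0 + norm e / d)) z" for z :: "real^3"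
  have iW: "integrable lborel W"
    unfolding W_def by (intro integrable_mult_right integrable_real_indicator)
      (use emeasure_lborel_cball_finite[of "0::real^3" "R0 + norm e / d"] in auto)
  define Q where "Q n z = (\<eta> (z + k n *\<^sub>R e) - \<eta> z) / k n" for n z
  have Q0: "Q n z = 0" if "z \<notin> cball 0 (R0 + norm e / d)" for n z
  proof -
    from that have z: "norm z > R0 + norm e / d" by simp
    have "norm (k n *\<^sub>R e) \<le> norm e / d" using mult_right_mono[OF k(3)[of n], of "norm e"] by simp
    moreover have "0 \<le> norm e / d" using d by simp
    ultimately have "norm (z + k n *\<^sub>R e) > R0" "norm z > R0"
      using z norm_triangle_ineq4[of "z + k n *\<^sub>R e" "k n *\<^sub>R e"] by simp_all
    then have "z + k n *\<^sub>R e \<notin> supp \<eta>" "z \<notin> supp \<eta>" using R0 by force+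
    then show ?thesis by (simp add: Q_def not_in_supp)
  qed
  have QW: "\<bar>r (y + d *\<^sub>R z) * ((- 1/d) * Q n z)\<bar> \<le> W z" for y z n
  proof (cases "z \<in> cball 0 (R0 + norm e / d)")
    case True
    have "\<bar>Q n z\<bar> \<le> B * norm e" unfolding Q_def by (rule Ccinf_quotient_bound[OF \<eta>_Ccinf B k(2)])
    then have "r (y + d *\<^sub>R z) * \<bar>Q n z\<bar> \<le> M * (B * norm e)"
      using r_le r_nonneg M_nonneg by (intro mult_mono) auto
    then have "(1/d) * (r (y + d *\<^sub>R z) * \<bar>Q n z\<bar>) \<le> (1/d) * (M * (B * norm e))"
      using d by (intro mult_left_mono) auto
    then show ?thesis using True d r_nonneg by (simp add: W_def abs_mult)
  next
    case False
    then show ?thesis using Q0 by (simp add: W_def)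
  qed
  have eq: "(R d (y + h n *\<^sub>R e) - R d y) / h n = (LBINT z. r (y + d *\<^sub>R z) * ((- 1/d) * Q n z))" for y n
  proof -
    have "R d (y + h n *\<^sub>R e) = (LBINT z. r (y + d *\<^sub>R (z + (- k n) *\<^sub>R e)) * \<eta> ((z + (- k n) *\<^sub>R e) + k n *\<^sub>R e))"
      unfolding R_def by (rule Bochner_Integration.integral_cong) (use d in \<open>auto simp: k_def algebra_simps\<close>)
    also have "\<dots> = (LBINT z. r (y + d *\<^sub>R z) * \<eta> (z + k n *\<^sub>R e))"
      by (rule lborel_integral_translate[of "\<lambda>z. r (y + d *\<^sub>R z) * \<eta> (z + k n *\<^sub>R e)"]) measurable
    finally have "R d (y + h n *\<^sub>R e) - R d y = (LBINT z. r (y + d *\<^sub>R z) * \<eta> (z + k n *\<^sub>R e) - r (y + d *\<^sub>R z) * \<eta> z)"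
      using r_shift_integrable[OF lborel_integrable_translate[OF \<eta>_integrable], of y d "k n *\<^sub>R e"]
        r_shift_integrable[OF \<eta>_integrable, of y d] by (simp add: R_def)
    then have "(R d (y + h n *\<^sub>R e) - R d y) / h n = (LBINT z. (r (y + d *\<^sub>R z) * \<eta> (z + k n *\<^sub>R e) - r (y + d *\<^sub>R z) * \<eta> z) / h n)"
      by simp
    also have "\<dots> = (LBINT z. r (y + d *\<^sub>R z) * ((- 1/d) * Q n z))"
      by (rule Bochner_Integration.integral_cong) (use d h(2)[of n] in \<open>auto simp: Q_def k_def field_simps\<close>)
    finally show ?thesis .
  qed
  have mQ [measurable]: "Q n \<in> borel_measurable borel" for n unfolding Q_def[abs_def] by measurable
  have "(\<lambda>n. LBINT z. r (y + d *\<^sub>R z) * ((- 1/d) * Q n z)) \<longlonglongrightarrow>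
      (LBINT z. r (y + d *\<^sub>R z) * ((- 1/d) * (grad \<eta> z \<bullet> e)))"
  proof (rule integral_dominated_convergence[OF _ _ iW])
    show "AE z in lborel. (\<lambda>n. r (y + d *\<^sub>R z) * (- 1 / d * Q n z)) \<longlonglongrightarrow> r (y + d *\<^sub>R z) * (- 1 / d * (grad \<eta> z \<bullet> e))"
      unfolding Q_def
      by (intro AE_I2 tendsto_mult tendsto_const difference_quotient_tendsto[OF Ccinf_has_derivative[OF \<eta>_Ccinf]] k)
  qed (use QW in auto)
  then show "(\<lambda>n. (R d (y + h n *\<^sub>R e) - R d y) / h n) \<longlonglongrightarrow>
      - (1/d) * (LBINT z. r (y + d *\<^sub>R z) * (grad \<eta> z \<bullet> e))"
    unfolding eq by (simp add: mult.left_commute)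
  have "\<bar>(R d (y + h n *\<^sub>R e) - R d y) / h n\<bar> \<le> (LBINT z. W z)" for n y
    unfolding eq
  proof (rule order_trans[OF integral_abs_bound integral_mono[OF _ iW QW]])
    show "integrable lborel (\<lambda>z. \<bar>r (y + d *\<^sub>R z) * (- 1 / d * Q n z)\<bar>)"
      by (rule Bochner_Integration.integrable_bound[OF iW]) (use QW in \<open>auto intro!: AE_I2 order_trans[OF _ abs_ge_self]\<close>)
  qed
  then show "\<exists>L. \<forall>n y. \<bar>(R d (y + h n *\<^sub>R e) - R d y) / h n\<bar> \<le> L" by blast
qed

text \<open>Chain rule for the power; the minus sign of the integration by parts cancels the one in
  the derivative of \<open>R d\<close>.\<close>

lemma R_power_integration_by_parts:
  assumes d: "d > 0" and f: "f \<in> Ccinf T"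
  shows "(LBINT y. R d y ^ Suc j * (grad f y \<bullet> e)) =
    (real (Suc j) / d) * (LBINT y. R d y ^ j * (LBINT z. r (y + d *\<^sub>R z) * (grad \<eta> z \<bullet> e)) * f y)"
proof -
  obtain h :: "nat \<Rightarrow> real" where h: "h \<longlonglongrightarrow> 0" "\<And>n. h n > 0" "\<And>n. h n \<le> 1"
    using null_sequence_exists by blast
  have h0: "h n \<noteq> 0" "\<bar>h n\<bar> \<le> 1" for n using h(2,3)[of n] by auto
  note lim = R_quotient_tendsto[OF d h(1) h0]
  obtain L where L: "\<And>n y. \<bar>(R d (y + h n *\<^sub>R e) - R d y) / h n\<bar> \<le> L"
    using R_quotient_bounded[OF d h(1) h0] by blast
  let ?DR = "\<lambda>y. - (1/d) * (LBINT z. r (y + d *\<^sub>R z) * (grad \<eta> z \<bullet> e))"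
  have "(LBINT y. R d y ^ Suc j * (grad f y \<bullet> e)) = - (LBINT y. real (Suc j) * R d y ^ j * ?DR y * f y)"
  proof (rule integration_by_parts[OF f _ _ _ h(1) h0])
    show "\<bar>R d y ^ Suc j\<bar> \<le> K ^ Suc j" for y
      unfolding power_abs by (intro power_mono R_le_K) auto
    show "\<bar>(R d (y + h n *\<^sub>R e) ^ Suc j - R d y ^ Suc j) / h n\<bar> \<le> real (Suc j) * K ^ Suc j * L" for n y
    proof -
      have "\<bar>(R d (y + h n *\<^sub>R e) ^ Suc j - R d y ^ Suc j) / h n\<bar>
          \<le> real (Suc j) * K ^ Suc j * \<bar>R d (y + h n *\<^sub>R e) - R d y\<bar> / \<bar>h n\<bar>"
        unfolding abs_divide by (intro divide_right_mono power_diff_bound R_le_K K_ge) auto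
      also have "\<dots> = real (Suc j) * K ^ Suc j * \<bar>(R d (y + h n *\<^sub>R e) - R d y) / h n\<bar>"
        by (simp add: abs_divide)
      also have "\<dots> \<le> real (Suc j) * K ^ Suc j * L"
        by (intro mult_left_mono L) (use K_ge in auto)
      finally show ?thesis .
    qed
    show "(\<lambda>n. (R d (y + h n *\<^sub>R e) ^ Suc j - R d y ^ Suc j) / h n) \<longlonglongrightarrow> real (Suc j) * R d y ^ j * ?DR y" for y
    proof -
      have "(\<lambda>n. R d y + h n * ((R d (y + h n *\<^sub>R e) - R d y) / h n)) \<longlonglongrightarrow> R d y + 0 * ?DR y"
        by (intro tendsto_add tendsto_mult tendsto_const lim h)
      then have X: "(\<lambda>n. R d (y + h n *\<^sub>R e)) \<longlonglongrightarrow> R d y" using h0 by simp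
      have "(\<lambda>n. (R d (y + h n *\<^sub>R e) - R d y) / h n *
          (\<Sum>i<Suc j. R d y ^ (Suc j - Suc i) * R d (y + h n *\<^sub>R e) ^ i))
        \<longlonglongrightarrow> ?DR y * (\<Sum>i<Suc j. R d y ^ (Suc j - Suc i) * R d y ^ i)"
        by (intro tendsto_mult tendsto_sum tendsto_const tendsto_power X lim)
      moreover have "(\<Sum>i<Suc j. R d y ^ (Suc j - Suc i) * R d y ^ i) = (\<Sum>i<Suc j. R d y ^ j)"
        by (intro sum.cong refl) (simp add: power_add[symmetric])
      ultimately show ?thesis unfolding power_diff_sumr2 by (simp add: mult_ac del: sum.lessThan_Suc)
    qed
  qed measurable
  also have "\<dots> = (real (Suc j) / d) * (LBINT y. R d y ^ j * (LBINT z. r (y + d *\<^sub>R z) * (grad \<eta> z \<bullet> e)) * f y)"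
    unfolding integral_mult_right_zero[symmetric] Bochner_Integration.integral_minus[symmetric]
    by (rule Bochner_Integration.integral_cong) auto
  finally show ?thesis .
qed

text \<open>The commutator of mollification and transport before integration against the kernel: the
  difference quotient of f at distance d in direction z, with a bounded weight.\<close>

definition "J j d f z = (LBINT y. R d y ^ j * (r (y + d *\<^sub>R z) * ((f y - f (y + d *\<^sub>R z)) / d)))"

section \<open>Bounds for the commutator\<close>

lemma Rpow_le: "\<bar>R d y ^ j\<bar> \<le> K ^ j"
  unfolding power_abs by (intro power_mono R_le_K) auto

lemma J_integrable_inner:
  assumes f: "f \<in> Ccinf T"
  shows "integrable lborel (\<lambda>y. R d y ^ j * (r (y + d *\<^sub>R z) * ((f y - f (y + d *\<^sub>R z)) / d)))"
proof -
  note [measurable] = Ccinf_measurable[OF f]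
  have i: "integrable lborel (\<lambda>y. (f y - f (y + d *\<^sub>R z)) / d)"
    using Ccinf_integrable[OF f] lborel_integrable_translate[OF Ccinf_integrable[OF f]] by simp
  show ?thesis
  proof (rule Bochner_Integration.integrable_bound[OF integrable_mult_right[OF i, of "K ^ j * K"]])
    have le: "\<bar>R d y ^ j * (r (y + d *\<^sub>R z) * x)\<bar> \<le> \<bar>K ^ j * K * x\<bar>" for y x
      unfolding abs_mult mult.assoc[symmetric] using K_ge by (intro mult_mono abs_ge_self order_trans[OF Rpow_le] order_trans[OF r_le_K]) auto
    show "AE y in lborel. norm (R d y ^ j * (r (y + d *\<^sub>R z) * ((f y - f (y + d *\<^sub>R z)) / d)))
      \<le> norm (K ^ j * K * ((f y - f (y + d *\<^sub>R z)) / d))"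
      unfolding real_norm_def by (intro AE_I2 le)
  qed measurable
qed

lemma J_diff:
  assumes f: "f \<in> Ccinf T" and g: "g \<in> Ccinf T'"
  shows "J j d (\<lambda>x. f x - g x) z = J j d f z - J j d g z"
  unfolding J_def Bochner_Integration.integral_diff[OF J_integrable_inner[OF f] J_integrable_inner[OF g], symmetric]
  by (intro Bochner_Integration.integral_cong refl) (simp add: diff_divide_distrib right_diff_distrib)

definition "r2 = sqrt (LBINT y. (r y)\<^sup>2)"

lemma r_L2: "integrable lborel (\<lambda>y. (r y)\<^sup>2)"
  using r_mult_integrable[of r "\<lambda>_. 0" M] r_le r_nonneg M_nonneg by (simp add: power2_eq_square abs_of_nonneg)

text \<open>By \<open>L2_difference_bound\<close> only the L^2 norm of grad v enters, and d drops
  out. This uniformity is what allows commutators of different test fields to be compared at every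
  scale.\<close>

lemma J_bound:
  assumes v: "v \<in> Ccinf T" and d: "d > 0"
  shows "\<bar>J j d v z\<bar> \<le> K ^ j * r2 * (norm z * sqrt (LBINT y. (norm (grad v y))\<^sup>2))"
proof -
  note [measurable] = Ccinf_measurable[OF v] Ccinf_grad_measurable[OF v]
  let ?q = "\<lambda>y. (v y - v (y + d *\<^sub>R z)) / d"
  have vs: "(\<lambda>x. - 1 * v (d *\<^sub>R z + 1 *\<^sub>R x)) \<in> Ccinf UNIV"
    by (intro Ccinf_cmult Ccinf_affine Ccinf_mono[OF v]) auto
  have "(\<lambda>y. (1/d) * (v y + (- 1 * v (d *\<^sub>R z + 1 *\<^sub>R y)))) \<in> Ccinf UNIV"
    by (intro Ccinf_cmult Ccinf_add vs Ccinf_mono[OF v]) auto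
  then have "?q \<in> Ccinf UNIV" by (simp add: add.commute)
  then have q2: "integrable lborel (\<lambda>y. (?q y)\<^sup>2)" by (rule Ccinf_L2)
  have r2i: "integrable lborel (\<lambda>y. (R d y ^ j * r (y + d *\<^sub>R z))\<^sup>2)"
    and r2le: "(LBINT y. (R d y ^ j * r (y + d *\<^sub>R z))\<^sup>2) \<le> (K ^ j)\<^sup>2 * (LBINT y. (r y)\<^sup>2)"
  proof -
    note tr = lborel_integrable_translate[OF r_L2, of "d *\<^sub>R z"]
    have le: "(R d y ^ j * r (y + d *\<^sub>R z))\<^sup>2 \<le> (K ^ j)\<^sup>2 * (r (y + d *\<^sub>R z))\<^sup>2" for y
      unfolding power_mult_distrib using Rpow_le[of d y j]
      by (intro mult_right_mono) (auto simp: abs_le_square_iff[symmetric] K_ge intro: order_trans[OF _ abs_ge_self])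
    show i: "integrable lborel (\<lambda>y. (R d y ^ j * r (y + d *\<^sub>R z))\<^sup>2)"
      by (rule Bochner_Integration.integrable_bound[OF integrable_mult_right[OF tr, of "(K ^ j)\<^sup>2"]])
        (use le in \<open>auto intro!: AE_I2 order_trans[OF _ abs_ge_self]\<close>)
    have "(LBINT y. (R d y ^ j * r (y + d *\<^sub>R z))\<^sup>2) \<le> (LBINT y. (K ^ j)\<^sup>2 * (r (y + d *\<^sub>R z))\<^sup>2)"
      by (intro integral_mono i le integrable_mult_right tr)
    also have "\<dots> = (K ^ j)\<^sup>2 * (LBINT y. (r y)\<^sup>2)"
      using lborel_integral_translate[of "\<lambda>y. (r y)\<^sup>2" "d *\<^sub>R z"] by simp
    finally show "(LBINT y. (R d y ^ j * r (y + d *\<^sub>R z))\<^sup>2) \<le> (K ^ j)\<^sup>2 * (LBINT y. (r y)\<^sup>2)" .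
  qed
  have q_le: "(LBINT y. (?q y)\<^sup>2) \<le> (norm z)\<^sup>2 * (LBINT y. (norm (grad v y))\<^sup>2)"
  proof -
    have "(LBINT y. (?q y)\<^sup>2) = (1/d)\<^sup>2 * (LBINT y. (v (y + d *\<^sub>R z) - v y)\<^sup>2)"
      unfolding integral_mult_right_zero[symmetric]
      by (intro Bochner_Integration.integral_cong refl) (simp add: power2_eq_square field_simps)
    also have "\<dots> \<le> (1/d)\<^sup>2 * (LBINT y. (grad v y \<bullet> (d *\<^sub>R z))\<^sup>2)"
      by (intro mult_left_mono L2_difference_bound[OF v]) auto
    also have "\<dots> = (LBINT y. (grad v y \<bullet> z)\<^sup>2)"
      unfolding integral_mult_right_zero[symmetric]
      by (intro Bochner_Integration.integral_cong refl) (use d in \<open>simp add: power2_eq_square field_simps\<close>)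
    also have "\<dots> \<le> (LBINT y. (norm z)\<^sup>2 * (norm (grad v y))\<^sup>2)"
    proof (rule integral_mono)
      have le: "(grad v y \<bullet> z)\<^sup>2 \<le> (norm z)\<^sup>2 * (norm (grad v y))\<^sup>2" for y
        using power_mono[OF Cauchy_Schwarz_ineq2[of "grad v y" z] abs_ge_zero, of 2]
        by (simp add: power_mult_distrib mult.commute)
      then show "(grad v y \<bullet> z)\<^sup>2 \<le> (norm z)\<^sup>2 * (norm (grad v y))\<^sup>2" for y .
      show i: "integrable lborel (\<lambda>y. (norm z)\<^sup>2 * (norm (grad v y))\<^sup>2)"
        using Ccinf_grad_L2[OF v] by simp
      show "integrable lborel (\<lambda>y. (grad v y \<bullet> z)\<^sup>2)"
        by (rule Bochner_Integration.integrable_bound[OF i]) (use le in auto)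
    qed
    finally show ?thesis by simp
  qed
  have "\<bar>J j d v z\<bar> \<le> (LBINT y. \<bar>(R d y ^ j * r (y + d *\<^sub>R z)) * ?q y\<bar>)"
    unfolding J_def mult.assoc[symmetric] by (rule integral_abs_bound)
  also have "\<dots> \<le> sqrt (LBINT y. (R d y ^ j * r (y + d *\<^sub>R z))\<^sup>2) * sqrt (LBINT y. (?q y)\<^sup>2)"
    by (rule Cauchy_Schwarz_integral[OF _ _ r2i q2]) measurable
  also have "\<dots> \<le> sqrt ((K ^ j)\<^sup>2 * (LBINT y. (r y)\<^sup>2)) * sqrt ((norm z)\<^sup>2 * (LBINT y. (norm (grad v y))\<^sup>2))"
    by (intro mult_mono real_sqrt_le_mono r2le q_le) (auto intro!: Bochner_Integration.integral_nonneg)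
  also have "\<dots> = K ^ j * r2 * (norm z * sqrt (LBINT y. (norm (grad v y))\<^sup>2))"
    using K_ge by (simp add: real_sqrt_mult r2_def)
  finally show ?thesis .
qed

text \<open>Separates the commutator into the term with f outside the mollification and the term
  with f under it.\<close>

lemma
  assumes f: "f \<in> Ccinf T" and d: "d \<noteq> 0"
  shows \<kappa>_J_integrable: "integrable lborel (\<lambda>z. \<kappa> i z * J j d f z)"
    and \<kappa>_J_integral: "d * (LBINT z. \<kappa> i z * J j d f z) =
      (LBINT z. \<kappa> i z * (LBINT y. R d y ^ j * f y * r (y + d *\<^sub>R z)))
      - (LBINT z. \<kappa> i z * (LBINT y. R d y ^ j * (r (y + d *\<^sub>R z) * f (y + d *\<^sub>R z))))"
proof -
  note [measurable] = Ccinf_measurable[OF f]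
  obtain B where B: "\<And>x. \<bar>f x\<bar> \<le> B" using Ccinf_bounded[OF f] by (metis real_norm_def)
  have rf: "integrable lborel (\<lambda>y. r y * f y)"
    using r_shift_integrable[OF Ccinf_integrable[OF f], of 0 1] by simp
  have b: "\<bar>R d y ^ j * f y\<bar> \<le> K ^ j * B" for y
    unfolding abs_mult using K_ge by (intro mult_mono Rpow_le B) auto
  note s1 = shifted_product_integrable[OF \<kappa>_integrable[of i] r_integrable _ b, where d = d]
  note s2 = shifted_product_integrable[OF \<kappa>_integrable[of i] rf _ Rpow_le[of d _ j], where d = d]
  have "J j d f z = ((LBINT y. R d y ^ j * f y * r (y + d *\<^sub>R z))
      - (LBINT y. R d y ^ j * (r (y + d *\<^sub>R z) * f (y + d *\<^sub>R z)))) / d" for z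
    unfolding J_def
    using shifted_product_integrable_inner[OF \<kappa>_integrable[of i] r_integrable _ b, where d = d and z = z]
      shifted_product_integrable_inner[OF \<kappa>_integrable[of i] rf _ Rpow_le[of d _ j], where d = d and z = z]
    by (subst Bochner_Integration.integral_diff[symmetric], measurable, simp add: mult_ac)
      (auto simp: field_simps intro!: Bochner_Integration.integral_cong)
  then have eq: "\<kappa> i z * J j d f z = (\<kappa> i z * (LBINT y. R d y ^ j * f y * r (y + d *\<^sub>R z))
      - \<kappa> i z * (LBINT y. R d y ^ j * (r (y + d *\<^sub>R z) * f (y + d *\<^sub>R z)))) / d" for z
    by (auto simp: field_simps)
  show "integrable lborel (\<lambda>z. \<kappa> i z * J j d f z)" unfolding eq using s1 s2 by simp
  show "d * (LBINT z. \<kappa> i z * J j d f z) =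
      (LBINT z. \<kappa> i z * (LBINT y. R d y ^ j * f y * r (y + d *\<^sub>R z)))
      - (LBINT z. \<kappa> i z * (LBINT y. R d y ^ j * (r (y + d *\<^sub>R z) * f (y + d *\<^sub>R z))))"
    unfolding eq using s1 s2 d by simp
qed

lemma trace_D: "trace (D n y) = (\<Sum>i\<in>UNIV. grad (\<lambda>x. U n x $ i) y $ i)"
  by (simp add: trace_def grad_matrix_def)

lemma integral_power_trace_D:
  assumes "integrable lborel g" and [measurable]: "g \<in> borel_measurable borel" and le: "\<And>y. \<bar>g y\<bar> \<le> K"
  shows "(LBINT y. g y ^ Suc j * trace (D n y)) = (\<Sum>i\<in>UNIV. LBINT y. g y ^ Suc j * grad (\<lambda>x. U n x $ i) y $ i)"
proof -
  have i: "integrable lborel (\<lambda>y. g y ^ Suc j * grad (\<lambda>x. U n x $ i) y $ i)" for i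
  proof (rule Bochner_Integration.integrable_bound[OF integrable_scaleR_right[OF Ccinf_grad_integrable[OF U_Ccinf[of n i]], of "K ^ Suc j"]])
    show "(\<lambda>y. g y ^ Suc j * grad (\<lambda>x. U n x $ i) y $ i) \<in> borel_measurable lborel"
      using borel_measurable_inner[OF Ccinf_grad_measurable[OF U_Ccinf], of "\<lambda>_. axis i 1" n i]
      by (simp add: inner_axis)
    have "\<bar>g y ^ Suc j * grad (\<lambda>x. U n x $ i) y $ i\<bar> \<le> K ^ Suc j * norm (grad (\<lambda>x. U n x $ i) y)" for y
      unfolding abs_mult power_abs using K_ge by (intro mult_mono power_mono le component_le_norm_cart) auto
    then show "AE y in lborel. norm (g y ^ Suc j * grad (\<lambda>x. U n x $ i) y $ i) \<le> norm (K ^ Suc j *\<^sub>R grad (\<lambda>x. U n x $ i) y)"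
      using K_ge by (intro AE_I2) simp
  qed
  show ?thesis
    by (subst Bochner_Integration.integral_sum[symmetric])
      (auto intro!: i simp: trace_D sum_distrib_left simp del: power_Suc)
qed

text \<open>Integration by parts turns the first integral into (j+1)/d times the sum of the P_i. The
  continuity equation with weight R^j says that the Q_i sum to zero, so they may be subtracted. The
  commutator is the same expression with V_i in place of Q_i, and the discrepancy between U n and w
  is charged with the factor 1/d.\<close>

lemma renormalized_mollified:
  assumes d: "d > 0"
  shows "\<bar>(LBINT y. R d y ^ Suc j * trace (D n y))
      - real (Suc j) * (\<Sum>i\<in>UNIV. LBINT z. \<kappa> i z * J j d (\<lambda>x. U n x $ i) z)\<bar>
    \<le> (real (Suc j) / d) * (\<Sum>i\<in>UNIV. K ^ j * (LBINT z. \<bar>\<kappa> i z\<bar>)) * (LBINT y. r y * norm (U n y - w y))"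
proof -
  have d0: "d \<noteq> 0" using d by simp
  let ?u = "\<lambda>i y. U n y $ i" and ?w = "\<lambda>i y. w y $ i"
  have [measurable]: "?u i \<in> borel_measurable borel" "?w i \<in> borel_measurable borel" for i
    using Ccinf_measurable[OF U_Ccinf] by simp_all
  have "\<exists>B. \<forall>x. \<bar>?u i x\<bar> \<le> B" for i
    using Ccinf_bounded[OF U_Ccinf[of n i]] by (metis real_norm_def)
  then obtain B where B: "\<And>i x. \<bar>?u i x\<bar> \<le> B i" by metis
  have b: "\<bar>R d y ^ j * ?u i y\<bar> \<le> K ^ j * B i" for y i
    unfolding abs_mult using K_ge by (intro mult_mono Rpow_le B) auto
  note rw = rw_component_integrable
  have ru: "integrable lborel (\<lambda>y. r y * ?u i y)" for i
    using r_shift_integrable[OF Ccinf_integrable[OF U_Ccinf], of 0 1 n i] by simp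
  \<comment> \<open>In \<open>P\<close> the test field stands outside the mollified density, in
    \<open>V\<close> it is part of the mollified flux, and in \<open>Q\<close> it is replaced there
    by w, for which the continuity equation holds.\<close>
  define P where "P i = (LBINT z. \<kappa> i z * (LBINT y. R d y ^ j * ?u i y * r (y + d *\<^sub>R z)))" for i
  define V where "V i = (LBINT z. \<kappa> i z * (LBINT y. R d y ^ j * (r (y + d *\<^sub>R z) * ?u i (y + d *\<^sub>R z))))" for i
  define Q where "Q i = (LBINT z. \<kappa> i z * (LBINT y. R d y ^ j * (r (y + d *\<^sub>R z) * ?w i (y + d *\<^sub>R z))))" for i
  have a: "(LBINT y. R d y ^ Suc j * grad (?u i) y $ i) = real (Suc j) / d * P i" for i
  proof -
    have "(LBINT y. R d y ^ Suc j * grad (?u i) y $ i) = (real (Suc j) / d) *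
      (LBINT y. R d y ^ j * (LBINT z. r (y + d *\<^sub>R z) * \<kappa> i z) * ?u i y)"
      using R_power_integration_by_parts[OF d U_Ccinf, where j = j and e = "axis i 1" and n1 = n and i1 = i]
      by (simp add: inner_axis)
    also have "(LBINT y. R d y ^ j * (LBINT z. r (y + d *\<^sub>R z) * \<kappa> i z) * ?u i y)
        = (LBINT y. LBINT z. \<kappa> i z * (R d y ^ j * ?u i y * r (y + d *\<^sub>R z)))"
      unfolding integral_mult_right_zero[symmetric] integral_mult_left_zero[symmetric] by (simp add: mult_ac)
    also have "\<dots> = P i"
      unfolding P_def by (rule shifted_product_swap[OF \<kappa>_integrable r_integrable _ b]) measurable
    finally show ?thesis .
  qed
  have Q0: "(\<Sum>i\<in>UNIV. Q i) = 0"
  proof -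
    have "Q i = (LBINT y. LBINT z. \<kappa> i z * (R d y ^ j * (r (y + d *\<^sub>R z) * ?w i (y + d *\<^sub>R z))))" for i
      unfolding Q_def by (rule shifted_product_swap[OF \<kappa>_integrable rw _ Rpow_le, symmetric]) measurable
    then show ?thesis using continuity_equation_weighted[OF _ Rpow_le d] by simp
  qed
  have VQ: "\<bar>V i - Q i\<bar> \<le> K ^ j * (LBINT z. \<bar>\<kappa> i z\<bar>) * (LBINT y. r y * norm (U n y - w y))" for i
  proof -
    have rd: "integrable lborel (\<lambda>y. r y * (?u i y - ?w i y))"
      using Bochner_Integration.integrable_diff[OF ru[of i] rw[of i]] by (simp add: right_diff_distrib)
    have e: "V i - Q i = (LBINT z. \<kappa> i z * (LBINT y. R d y ^ j * (r (y + d *\<^sub>R z) * (?u i (y + d *\<^sub>R z) - ?w i (y + d *\<^sub>R z)))))"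
      unfolding V_def Q_def
      using shifted_product_integrable[OF \<kappa>_integrable[of i] ru[of i] _ Rpow_le[of d _ j], where d = d]
        shifted_product_integrable[OF \<kappa>_integrable[of i] rw[of i] _ Rpow_le[of d _ j], where d = d]
        shifted_product_integrable_inner[OF \<kappa>_integrable[of i] ru[of i] _ Rpow_le[of d _ j], where d = d]
        shifted_product_integrable_inner[OF \<kappa>_integrable[of i] rw[of i] _ Rpow_le[of d _ j], where d = d]
      by (subst Bochner_Integration.integral_diff[symmetric]) (auto simp: right_diff_distrib)
    have "\<bar>V i - Q i\<bar> \<le> K ^ j * (LBINT z. \<bar>\<kappa> i z\<bar>) * (LBINT y. \<bar>r y * (?u i y - ?w i y)\<bar>)"
      unfolding e by (rule shifted_product_bound[OF \<kappa>_integrable rd _ Rpow_le]) measurable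
    also have "\<dots> \<le> K ^ j * (LBINT z. \<bar>\<kappa> i z\<bar>) * (LBINT y. r y * norm (U n y - w y))"
    proof (intro mult_left_mono integral_mono integrable_abs rd r_dist_integrable)
      show "\<bar>r y * (?u i y - ?w i y)\<bar> \<le> r y * norm (U n y - w y)" for y
        using component_le_norm_cart[of "U n y - w y" i] r_nonneg[of y] by (simp add: abs_mult mult_left_mono)
    qed (use K_ge in \<open>auto intro!: mult_nonneg_nonneg Bochner_Integration.integral_nonneg\<close>)
    finally show ?thesis .
  qed
  note tr = integral_power_trace_D[OF R_integrable R_measurable R_le_K, of d j n]
  have "(LBINT y. R d y ^ Suc j * trace (D n y)) = (\<Sum>i\<in>UNIV. real (Suc j) / d * (P i - Q i))"
    unfolding tr a sum_distrib_left[symmetric] sum_subtractf Q0 by simp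
  moreover have "real (Suc j) * (\<Sum>i\<in>UNIV. LBINT z. \<kappa> i z * J j d (?u i) z) = (\<Sum>i\<in>UNIV. real (Suc j) / d * (P i - V i))"
    unfolding sum_distrib_left
  proof (intro sum.cong refl)
    fix i
    show "real (Suc j) * (LBINT z. \<kappa> i z * J j d (?u i) z) = real (Suc j) / d * (P i - V i)"
    proof -
      have e: "d * (LBINT z. \<kappa> i z * J j d (?u i) z) = P i - V i"
        unfolding P_def V_def by (rule \<kappa>_J_integral[OF U_Ccinf d0])
      show ?thesis unfolding e[symmetric] using d by simp
    qed
  qed
  ultimately have "\<bar>(LBINT y. R d y ^ Suc j * trace (D n y))
      - real (Suc j) * (\<Sum>i\<in>UNIV. LBINT z. \<kappa> i z * J j d (?u i) z)\<bar> = \<bar>\<Sum>i\<in>UNIV. real (Suc j) / d * (V i - Q i)\<bar>"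
    by (simp add: sum_subtractf[symmetric] right_diff_distrib del: of_nat_Suc)
  also have "\<dots> \<le> (\<Sum>i\<in>UNIV. real (Suc j) / d * (K ^ j * (LBINT z. \<bar>\<kappa> i z\<bar>) * (LBINT y. r y * norm (U n y - w y))))"
  proof (rule order_trans[OF sum_abs sum_mono])
    fix i
    show "\<bar>real (Suc j) / d * (V i - Q i)\<bar> \<le> real (Suc j) / d * (K ^ j * (LBINT z. \<bar>\<kappa> i z\<bar>) * (LBINT y. r y * norm (U n y - w y)))"
      unfolding abs_mult[of "real (Suc j) / d"] using d by (intro mult_mono VQ) auto
  qed
  finally show ?thesis by (simp add: sum_distrib_left sum_distrib_right mult_ac del: of_nat_Suc)
qed

end

section \<open>Removal of the mollification\<close>

context mollified_flow
begin

lemma r_pow_integrable: "integrable lborel (\<lambda>y. r y ^ Suc j)"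
proof (rule Bochner_Integration.integrable_bound[OF integrable_mult_right[OF r_integrable, of "M ^ j"]])
  show "AE y in lborel. norm (r y ^ Suc j) \<le> norm (M ^ j * r y)"
  proof (rule AE_I2)
    fix y
    have "0 \<le> r y ^ Suc j" using zero_le_power[OF r_nonneg] .
    then show "norm (r y ^ Suc j) \<le> norm (M ^ j * r y)" using r_power_le[of y j]
      by (simp add: order_trans[OF _ abs_ge_self] del: power_Suc)
  qed
qed measurable

lemma r_translation_le: "(LBINT y. \<bar>r (y + h) - r y\<bar>) \<le> 2 * (LBINT y. r y)"
proof -
  note tr = lborel_integrable_translate[OF r_integrable, of h]
  have "(LBINT y. \<bar>r (y + h) - r y\<bar>) \<le> (LBINT y. r (y + h) + r y)"
  proof (rule integral_mono)
    show "\<bar>r (y + h) - r y\<bar> \<le> r (y + h) + r y" for y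
      using r_nonneg[of y] r_nonneg[of "y + h"] by linarith
  qed (use tr r_integrable in auto)
  also have "\<dots> = 2 * (LBINT y. r y)"
    using tr r_integrable lborel_integral_translate[OF r_measurable, of h] by simp
  finally show ?thesis .
qed

text \<open>Minkowski's integral inequality, through Tonelli for the nonnegative double integral.
  The integral of \<eta> being 1 lets r(y) be drawn under the integral.\<close>

lemma R_r_L1_le:
  assumes d: "d > 0"
  shows "(LBINT y. \<bar>R d y - r y\<bar>) \<le> (LBINT z. \<bar>\<eta> z\<bar> * (LBINT y. \<bar>r (y + d *\<^sub>R z) - r y\<bar>))"
proof -
  let ?om = "\<lambda>z. (LBINT y. \<bar>r (y + d *\<^sub>R z) - r y\<bar>)"
  have tr: "integrable lborel (\<lambda>y. \<bar>r (y + d *\<^sub>R z) - r y\<bar>)" for z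
    using lborel_integrable_translate[OF r_integrable] r_integrable by auto
  have om: "0 \<le> ?om z" "?om z \<le> 2 * (LBINT y. r y)" for z
    using r_translation_le by auto
  have i: "integrable lborel (\<lambda>z. \<bar>\<eta> z\<bar> * ?om z)"
  proof (rule Bochner_Integration.integrable_bound[OF integrable_mult_right[OF \<eta>_integrable, of "2 * (LBINT y. r y)"]])
    show "AE z in lborel. norm (\<bar>\<eta> z\<bar> * ?om z) \<le> norm (2 * (LBINT y. r y) * \<eta> z)"
    proof (rule AE_I2)
      fix z
      have "\<bar>\<eta> z\<bar> * ?om z \<le> \<bar>\<eta> z\<bar> * (2 * (LBINT y. r y))" by (intro mult_left_mono om) auto
      moreover have "0 \<le> (LBINT y. r y)" using om[of z] by linarith
      ultimately show "norm (\<bar>\<eta> z\<bar> * ?om z) \<le> norm (2 * (LBINT y. r y) * \<eta> z)"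
        using om(1)[of z] by (simp add: abs_mult mult_ac)
    qed
  qed measurable
  have pt: "ennreal \<bar>R d y - r y\<bar> \<le> (\<integral>\<^sup>+z. ennreal (\<bar>\<eta> z\<bar> * \<bar>r (y + d *\<^sub>R z) - r y\<bar>) \<partial>lborel)" for y
  proof -
    have eq: "R d y - r y = (LBINT z. (r (y + d *\<^sub>R z) - r y) * \<eta> z)"
      using r_shift_integrable[OF \<eta>_integrable, of y d] \<eta>_integrable \<eta>_integral by (simp add: R_def left_diff_distrib)
    have "ennreal (norm (R d y - r y)) \<le> (\<integral>\<^sup>+z. ennreal (norm ((r (y + d *\<^sub>R z) - r y) * \<eta> z)) \<partial>lborel)"
      unfolding eq
      by (rule integral_norm_bound_ennreal)
        (use r_shift_integrable[OF \<eta>_integrable, of y d] \<eta>_integrable in \<open>simp add: left_diff_distrib\<close>)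
    then show ?thesis by (simp add: abs_mult mult.commute)
  qed
  have "ennreal (LBINT y. \<bar>R d y - r y\<bar>) = (\<integral>\<^sup>+y. ennreal \<bar>R d y - r y\<bar> \<partial>lborel)"
    using R_integrable r_integrable by (intro nn_integral_eq_integral[symmetric]) auto
  also have "\<dots> \<le> (\<integral>\<^sup>+y. \<integral>\<^sup>+z. ennreal (\<bar>\<eta> z\<bar> * \<bar>r (y + d *\<^sub>R z) - r y\<bar>) \<partial>lborel \<partial>lborel)"
    by (intro nn_integral_mono pt)
  also have "\<dots> = (\<integral>\<^sup>+z. \<integral>\<^sup>+y. ennreal (\<bar>\<eta> z\<bar> * \<bar>r (y + d *\<^sub>R z) - r y\<bar>) \<partial>lborel \<partial>lborel)"
    by (rule lborel_pair.Fubini') measurable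
  also have "\<dots> = (\<integral>\<^sup>+z. ennreal (\<bar>\<eta> z\<bar> * ?om z) \<partial>lborel)"
  proof (intro nn_integral_cong)
    fix z
    show "(\<integral>\<^sup>+y. ennreal (\<bar>\<eta> z\<bar> * \<bar>r (y + d *\<^sub>R z) - r y\<bar>) \<partial>lborel) = ennreal (\<bar>\<eta> z\<bar> * ?om z)"
      using nn_integral_eq_integral[OF integrable_mult_right[OF tr[of z], of "\<bar>\<eta> z\<bar>"]] by simp
  qed
  also have "\<dots> = ennreal (LBINT z. \<bar>\<eta> z\<bar> * ?om z)"
    using om by (intro nn_integral_eq_integral i) auto
  finally show "(LBINT y. \<bar>R d y - r y\<bar>) \<le> (LBINT z. \<bar>\<eta> z\<bar> * ?om z)"
    by (subst (asm) ennreal_le_iff) (auto intro!: Bochner_Integration.integral_nonneg mult_nonneg_nonneg om)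
qed

lemma scaled_null: "d \<longlonglongrightarrow> 0 \<Longrightarrow> (\<lambda>n. d n *\<^sub>R z) \<longlonglongrightarrow> 0" for d :: "nat \<Rightarrow> real" and z :: "real^3"
  using tendsto_scaleR[of d 0 sequentially "\<lambda>_. z" z] by simp

lemma R_tendsto_L1:
  assumes d: "d \<longlonglongrightarrow> 0" "\<And>n. d n > 0"
  shows "(\<lambda>n. LBINT y. \<bar>R (d n) y - r y\<bar>) \<longlonglongrightarrow> 0"
proof (rule tendsto_sandwich[OF _ _ tendsto_const])
  let ?om = "\<lambda>n z. (LBINT y. \<bar>r (y + d n *\<^sub>R z) - r y\<bar>)"
  have "(\<lambda>n. LBINT z. \<bar>\<eta> z\<bar> * ?om n z) \<longlonglongrightarrow> (\<integral>z. 0 \<partial>(lborel :: (real^3) measure))"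
  proof (rule integral_dominated_convergence)
    show "integrable lborel (\<lambda>z. 2 * (LBINT y. r y) * \<bar>\<eta> z\<bar>)" using \<eta>_integrable by simp
    show "AE z in lborel. (\<lambda>n. \<bar>\<eta> z\<bar> * ?om n z) \<longlonglongrightarrow> 0"
      using L1_translation_continuous[OF r_integrable scaled_null[OF d(1)]]
      by (intro AE_I2 tendsto_mult_right_zero) simp
    show "AE z in lborel. norm (\<bar>\<eta> z\<bar> * ?om n z) \<le> 2 * (LBINT y. r y) * \<bar>\<eta> z\<bar>" for n
    proof (rule AE_I2)
      fix z
      have "?om n z \<le> 2 * (LBINT y. r y)" by (rule r_translation_le)
      then have "\<bar>\<eta> z\<bar> * ?om n z \<le> \<bar>\<eta> z\<bar> * (2 * (LBINT y. r y))" by (intro mult_left_mono) auto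
      moreover have "0 \<le> \<bar>\<eta> z\<bar> * ?om n z" by simp
      ultimately show "norm (\<bar>\<eta> z\<bar> * ?om n z) \<le> 2 * (LBINT y. r y) * \<bar>\<eta> z\<bar>"
        by (simp add: mult_ac)
    qed
  qed measurable
  then show "(\<lambda>n. LBINT z. \<bar>\<eta> z\<bar> * ?om n z) \<longlonglongrightarrow> 0" by simp
  show "\<forall>\<^sub>F n in sequentially. (LBINT y. \<bar>R (d n) y - r y\<bar>) \<le> (LBINT z. \<bar>\<eta> z\<bar> * ?om n z)"
    using R_r_L1_le[OF d(2)] by simp
qed simp

text \<open>The difference is R^j (r(. + d z) - r) + r (R^j - r^j). The first part tends to 0 by
  continuity of translations, the second by convergence of the mollification, all weights being
  bounded in terms of K.\<close>

lemma R_power_tendsto_L1: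
  assumes d: "d \<longlonglongrightarrow> 0" "\<And>n. d n > 0"
  shows "(\<lambda>n. LBINT y. \<bar>R (d n) y ^ j * r (y + d n *\<^sub>R z) - r y ^ Suc j\<bar>) \<longlonglongrightarrow> 0"
    and "integrable lborel (\<lambda>y. R (d n) y ^ j * r (y + d n *\<^sub>R z) - r y ^ Suc j)"
proof -
  note tr = lborel_integrable_translate[OF r_integrable]
  have i1: "integrable lborel (\<lambda>y. R (d n) y ^ j * r (y + d n *\<^sub>R z))" for n
    by (rule shifted_product_integrable_inner[OF \<eta>_integrable r_integrable _ Rpow_le]) measurable
  note i2 = r_pow_integrable[of j]
  show i: "integrable lborel (\<lambda>y. R (d n) y ^ j * r (y + d n *\<^sub>R z) - r y ^ Suc j)" for n
    using i1 i2 by auto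
  show "(\<lambda>n. LBINT y. \<bar>R (d n) y ^ j * r (y + d n *\<^sub>R z) - r y ^ Suc j\<bar>) \<longlonglongrightarrow> 0"
  proof (rule tendsto_sandwich[OF _ _ tendsto_const])
    show "(\<lambda>n. K ^ j * (LBINT y. \<bar>r (y + d n *\<^sub>R z) - r y\<bar>) + K * (real j * K ^ j) * (LBINT y. \<bar>R (d n) y - r y\<bar>)) \<longlonglongrightarrow> 0"
      using tendsto_add[OF tendsto_mult_right_zero[OF L1_translation_continuous[OF r_integrable scaled_null[OF d(1)]]]
          tendsto_mult_right_zero[OF R_tendsto_L1[OF d]]] by simp
    have "(LBINT y. \<bar>R (d n) y ^ j * r (y + d n *\<^sub>R z) - r y ^ Suc j\<bar>) \<le>
      (LBINT y. K ^ j * \<bar>r (y + d n *\<^sub>R z) - r y\<bar> + K * (real j * K ^ j) * \<bar>R (d n) y - r y\<bar>)" for n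
    proof (rule integral_mono[OF integrable_abs[OF i]])
      show "integrable lborel (\<lambda>y. K ^ j * \<bar>r (y + d n *\<^sub>R z) - r y\<bar> + K * (real j * K ^ j) * \<bar>R (d n) y - r y\<bar>)"
        using tr r_integrable R_integrable by auto
      fix y
      have "R (d n) y ^ j * r (y + d n *\<^sub>R z) - r y ^ Suc j =
        R (d n) y ^ j * (r (y + d n *\<^sub>R z) - r y) + r y * (R (d n) y ^ j - r y ^ j)"
        by (simp add: algebra_simps)
      moreover have "\<bar>R (d n) y ^ j * (r (y + d n *\<^sub>R z) - r y)\<bar> \<le> K ^ j * \<bar>r (y + d n *\<^sub>R z) - r y\<bar>"
        unfolding abs_mult by (intro mult_right_mono Rpow_le) auto
      moreover have "\<bar>r y * (R (d n) y ^ j - r y ^ j)\<bar> \<le> K * (real j * K ^ j * \<bar>R (d n) y - r y\<bar>)"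
        unfolding abs_mult using K_ge by (intro mult_mono r_le_K power_diff_bound R_le_K) auto
      ultimately show "\<bar>R (d n) y ^ j * r (y + d n *\<^sub>R z) - r y ^ Suc j\<bar> \<le>
          K ^ j * \<bar>r (y + d n *\<^sub>R z) - r y\<bar> + K * (real j * K ^ j) * \<bar>R (d n) y - r y\<bar>"
        using abs_triangle_ineq[of "R (d n) y ^ j * (r (y + d n *\<^sub>R z) - r y)" "r y * (R (d n) y ^ j - r y ^ j)"]
        by (simp add: mult.assoc)
    qed
    also have "\<dots> n = K ^ j * (LBINT y. \<bar>r (y + d n *\<^sub>R z) - r y\<bar>) + K * (real j * K ^ j) * (LBINT y. \<bar>R (d n) y - r y\<bar>)" for n
      using tr r_integrable R_integrable by (subst Bochner_Integration.integral_add) auto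
    finally show "\<forall>\<^sub>F n in sequentially. (LBINT y. \<bar>R (d n) y ^ j * r (y + d n *\<^sub>R z) - r y ^ Suc j\<bar>)
      \<le> K ^ j * (LBINT y. \<bar>r (y + d n *\<^sub>R z) - r y\<bar>) + K * (real j * K ^ j) * (LBINT y. \<bar>R (d n) y - r y\<bar>)"
      by simp
  qed simp
qed

text \<open>The difference quotient of f is bounded and converges pointwise, so its coefficient may
  be replaced by the L^1 limit r^(j+1). The minus sign is due to f(y) - f(y + d z).\<close>

lemma J_tendsto:
  assumes f: "f \<in> Ccinf T" and d: "d \<longlonglongrightarrow> 0" "\<And>n. d n > 0"
  shows "(\<lambda>n. J j (d n) f z) \<longlonglongrightarrow> - (LBINT y. r y ^ Suc j * (grad f y \<bullet> z))"
proof -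
  note [measurable] = Ccinf_measurable[OF f] Ccinf_grad_measurable[OF f]
  obtain B where B: "\<And>x. norm (grad f x) \<le> B" using Ccinf_grad_bounded[OF f] by blast
  have d0: "d n \<noteq> 0" for n using d(2)[of n] by simp
  define q where "q n y = (f y - f (y + d n *\<^sub>R z)) / d n" for n y
  have qB: "\<bar>q n y\<bar> \<le> B * norm z" for n y
    using Ccinf_quotient_bound[OF f B d0, of y n z] by (simp add: q_def abs_minus_commute abs_divide)
  have BB: "0 \<le> B" using order_trans[OF norm_ge_zero B] .
  have [measurable]: "q n \<in> borel_measurable borel" for n unfolding q_def[abs_def] by measurable
  have qlim: "(\<lambda>n. q n y) \<longlonglongrightarrow> - (grad f y \<bullet> z)" for y
    using tendsto_minus[OF difference_quotient_tendsto[OF Ccinf_has_derivative[OF f] d(1) d0, of y z]]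
    by (simp add: q_def minus_divide_left)
  have i1: "integrable lborel (\<lambda>y. r y ^ Suc j * q n y)" for n
  proof (rule Bochner_Integration.integrable_bound[OF integrable_mult_right[OF r_pow_integrable, of "B * norm z"]])
    show "AE y in lborel. norm (r y ^ Suc j * q n y) \<le> norm (B * norm z * r y ^ Suc j)"
      using qB BB by (intro AE_I2) (simp add: abs_mult mult.commute mult_right_mono del: power_Suc)
  qed measurable
  have "(\<lambda>n. LBINT y. r y ^ Suc j * q n y) \<longlonglongrightarrow> (LBINT y. r y ^ Suc j * - (grad f y \<bullet> z))"
  proof (rule integral_dominated_convergence)
    show "integrable lborel (\<lambda>y. B * norm z * r y ^ Suc j)" using r_pow_integrable by (rule integrable_mult_right)
    show "AE y in lborel. norm (r y ^ Suc j * q n y) \<le> B * norm z * r y ^ Suc j" for n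
      using qB BB zero_le_power[OF r_nonneg] by (intro AE_I2) (simp add: abs_mult mult.commute mult_right_mono del: power_Suc)
    show "AE y in lborel. (\<lambda>n. r y ^ Suc j * q n y) \<longlonglongrightarrow> r y ^ Suc j * - (grad f y \<bullet> z)"
      by (intro AE_I2 tendsto_intros qlim)
  qed measurable
  moreover have "(\<lambda>n. J j (d n) f z - (LBINT y. r y ^ Suc j * q n y)) \<longlonglongrightarrow> 0"
  proof (rule tendsto_norm_bound)
    show "(\<lambda>n. B * norm z * (LBINT y. \<bar>R (d n) y ^ j * r (y + d n *\<^sub>R z) - r y ^ Suc j\<bar>)) \<longlonglongrightarrow> 0"
      by (intro tendsto_mult_right_zero R_power_tendsto_L1 d)
    fix n
    note iR = R_power_tendsto_L1(2)[OF d, of n j z]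
    have iJ: "integrable lborel (\<lambda>y. R (d n) y ^ j * r (y + d n *\<^sub>R z) * q n y)"
      using J_integrable_inner[OF f, of "d n" j z] by (simp add: q_def mult.assoc)
    have "J j (d n) f z - (LBINT y. r y ^ Suc j * q n y) = (LBINT y. (R (d n) y ^ j * r (y + d n *\<^sub>R z) - r y ^ Suc j) * q n y)"
      unfolding left_diff_distrib Bochner_Integration.integral_diff[OF iJ i1]
      by (simp add: J_def q_def mult.assoc)
    then have "norm (J j (d n) f z - (LBINT y. r y ^ Suc j * q n y) - 0) \<le> (LBINT y. \<bar>(R (d n) y ^ j * r (y + d n *\<^sub>R z) - r y ^ Suc j) * q n y\<bar>)"
      by (simp only: diff_zero real_norm_def integral_abs_bound)
    also have "\<dots> \<le> (LBINT y. B * norm z * \<bar>R (d n) y ^ j * r (y + d n *\<^sub>R z) - r y ^ Suc j\<bar>)"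
    proof (rule integral_mono)
      show "integrable lborel (\<lambda>y. \<bar>(R (d n) y ^ j * r (y + d n *\<^sub>R z) - r y ^ Suc j) * q n y\<bar>)"
        using Bochner_Integration.integrable_diff[OF iJ i1[of n]] by (intro integrable_abs) (simp add: left_diff_distrib)
      show "integrable lborel (\<lambda>y. B * norm z * \<bar>R (d n) y ^ j * r (y + d n *\<^sub>R z) - r y ^ Suc j\<bar>)"
        by (intro integrable_mult_right integrable_abs iR)
      show "\<bar>(R (d n) y ^ j * r (y + d n *\<^sub>R z) - r y ^ Suc j) * q n y\<bar> \<le> B * norm z * \<bar>R (d n) y ^ j * r (y + d n *\<^sub>R z) - r y ^ Suc j\<bar>" for y
        unfolding abs_mult mult.commute[of "B * norm z"] by (intro mult_left_mono qB) auto
    qed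
    also have "\<dots> = B * norm z * (LBINT y. \<bar>R (d n) y ^ j * r (y + d n *\<^sub>R z) - r y ^ Suc j\<bar>)" by simp
    finally show "norm (J j (d n) f z - (LBINT y. r y ^ Suc j * q n y) - 0) \<le> B * norm z * (LBINT y. \<bar>R (d n) y ^ j * r (y + d n *\<^sub>R z) - r y ^ Suc j\<bar>)" .
  qed
  ultimately have "(\<lambda>n. (LBINT y. r y ^ Suc j * q n y) + (J j (d n) f z - (LBINT y. r y ^ Suc j * q n y)))
     \<longlonglongrightarrow> (LBINT y. r y ^ Suc j * - (grad f y \<bullet> z)) + 0" by (rule tendsto_add)
  then show ?thesis by (simp del: power_Suc)
qed

text \<open>The limit of J is linear in z, and the first moments of the kernel pick out one
  coefficient; their minus sign cancels that of the limit. \<open>J_bound\<close> supplies the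
  domination, whose factor |z| is absorbed by the compact support of the kernel.\<close>

lemma \<kappa>_J_tendsto:
  assumes f: "f \<in> Ccinf T" and d: "d \<longlonglongrightarrow> 0" "\<And>n. d n > 0"
  shows "(\<lambda>n. LBINT z. \<kappa> i z * J j (d n) f z) \<longlonglongrightarrow> (LBINT y. r y ^ Suc j * grad f y $ i)"
proof -
  have d0: "d n \<noteq> 0" for n using d(2)[of n] by simp
  define G where "G = sqrt (LBINT y. (norm (grad f y))\<^sup>2)"
  note [measurable] = Ccinf_grad_measurable[OF f] Ccinf_measurable[OF f]
  have ig: "integrable lborel (\<lambda>y. r y ^ Suc j *\<^sub>R grad f y)"
  proof (rule Bochner_Integration.integrable_bound[OF integrable_scaleR_right[OF Ccinf_grad_integrable[OF f], of "K ^ Suc j"]])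
    have "\<bar>r y ^ Suc j\<bar> \<le> K ^ Suc j" for y unfolding power_abs by (intro power_mono r_le_K) auto
    then show "AE y in lborel. norm (r y ^ Suc j *\<^sub>R grad f y) \<le> norm (K ^ Suc j *\<^sub>R grad f y)"
      using K_ge by (intro AE_I2) (simp add: mult_right_mono del: power_Suc)
  qed measurable
  \<comment> \<open>One vector represents the limit for all directions z.\<close>
  let ?c = "LBINT y. r y ^ Suc j *\<^sub>R grad f y"
  have c: "(LBINT y. r y ^ Suc j * (grad f y \<bullet> z)) = ?c \<bullet> z" for z
    using integral_inner_left[of z, OF ig] by simp
  have "(\<lambda>n. LBINT z. \<kappa> i z * J j (d n) f z) \<longlonglongrightarrow> (LBINT z. \<kappa> i z * - (?c \<bullet> z))"
  proof (rule integral_dominated_convergence)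
    show "integrable lborel (\<lambda>z. K ^ j * r2 * G * (\<bar>\<kappa> i z\<bar> * norm z))"
      using \<kappa>_norm_integrable by simp
    show "AE z in lborel. (\<lambda>n. \<kappa> i z * J j (d n) f z) \<longlonglongrightarrow> \<kappa> i z * - (?c \<bullet> z)"
      unfolding c[symmetric] by (intro AE_I2 tendsto_mult tendsto_const J_tendsto[OF f d])
    show "AE z in lborel. norm (\<kappa> i z * J j (d n) f z) \<le> K ^ j * r2 * G * (\<bar>\<kappa> i z\<bar> * norm z)" for n
    proof (rule AE_I2)
      fix z
      have "\<bar>\<kappa> i z\<bar> * \<bar>J j (d n) f z\<bar> \<le> \<bar>\<kappa> i z\<bar> * (K ^ j * r2 * (norm z * G))"
        unfolding G_def by (intro mult_left_mono J_bound[OF f d(2)]) auto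
      then show "norm (\<kappa> i z * J j (d n) f z) \<le> K ^ j * r2 * G * (\<bar>\<kappa> i z\<bar> * norm z)"
        by (simp add: abs_mult mult_ac)
    qed
    show "(\<lambda>z. \<kappa> i z * J j (d n) f z) \<in> borel_measurable lborel" for n
      using \<kappa>_J_integrable[OF f d0] by (rule borel_measurable_integrable)
  qed measurable
  also have "(LBINT z. \<kappa> i z * - (?c \<bullet> z)) = ?c $ i"
    using \<kappa>_linear_integral[of i ?c] by simp
  also have "?c $ i = (LBINT y. r y ^ Suc j * grad f y $ i)"
    using c[of "axis i 1"] by (simp add: inner_axis)
  finally show ?thesis .
qed

section \<open>The renormalized identity in the limit\<close>

lemma trace_A_L2: "integrable lborel (\<lambda>y. (trace (A y))\<^sup>2)"
  and trace_A_measurable [measurable]: "(\<lambda>y. trace (A y)) \<in> borel_measurable borel"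
proof -
  show m: "(\<lambda>y. trace (A y)) \<in> borel_measurable borel"
    unfolding trace_inner[symmetric] by measurable
  show "integrable lborel (\<lambda>y. (trace (A y))\<^sup>2)"
  proof (rule Bochner_Integration.integrable_bound[OF integrable_mult_right[OF A_L2, of "(norm (mat 1 :: real^3^3))\<^sup>2"]])
    have "(trace (A y))\<^sup>2 \<le> (norm (mat 1 :: real^3^3))\<^sup>2 * (norm (A y))\<^sup>2" for y
      using power_mono[OF Cauchy_Schwarz_ineq2[of "mat 1" "A y"] abs_ge_zero, of 2]
      by (simp add: power_mult_distrib trace_inner)
    then show "AE y in lborel. norm ((trace (A y))\<^sup>2) \<le> norm ((norm (mat 1 :: real^3^3))\<^sup>2 * (norm (A y))\<^sup>2)"
      by simp
  qed (use m in simp)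
qed

lemma trace_D_weak_limit:
  assumes [measurable]: "f \<in> borel_measurable borel" and f: "integrable lborel (\<lambda>y. (f y)\<^sup>2)"
  shows "(\<lambda>n. LBINT y. f y * trace (D n y)) \<longlonglongrightarrow> (LBINT y. f y * trace (A y))"
  using D_weak_limit[of "\<lambda>y. f y *\<^sub>R mat 1"] f by (simp add: trace_inner power_mult_distrib)

lemma bounded_power_L2:
  assumes [measurable]: "g \<in> borel_measurable borel" and "integrable lborel g" "\<And>y. \<bar>g y\<bar> \<le> K"
  shows "integrable lborel (\<lambda>y. (g y ^ Suc j)\<^sup>2)"
proof (rule Bochner_Integration.integrable_bound[OF integrable_mult_right[OF assms(2), of "K ^ Suc j * K ^ j"]])
  have "(g y ^ Suc j)\<^sup>2 \<le> K ^ Suc j * K ^ j * \<bar>g y\<bar>" for y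
  proof -
    have "(g y ^ Suc j)\<^sup>2 = \<bar>g y\<bar> ^ Suc j * \<bar>g y\<bar> ^ Suc j"
      unfolding power_abs[symmetric] by (metis abs_mult_self_eq power2_eq_square)
    also have "\<dots> = \<bar>g y\<bar> ^ Suc j * \<bar>g y\<bar> ^ j * \<bar>g y\<bar>" by simp
    also have "\<dots> \<le> K ^ Suc j * K ^ j * \<bar>g y\<bar>"
      using K_ge assms(3) by (intro mult_right_mono mult_mono power_mono) auto
    finally show ?thesis .
  qed
  then show "AE y in lborel. norm ((g y ^ Suc j)\<^sup>2) \<le> norm (K ^ Suc j * K ^ j * g y)"
    using K_ge by (intro AE_I2) (simp add: abs_mult)
qed measurable

text \<open>J is linear in f, so the left side is the commutator of U l - U n, whose bound does not
  involve d. Comparing both gradients with A makes it small for large l and n.\<close>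

lemma \<kappa>_J_stability:
  assumes d: "d > 0"
  shows "\<bar>(LBINT z. \<kappa> i z * J j d (\<lambda>x. U l x $ i) z) - (LBINT z. \<kappa> i z * J j d (\<lambda>x. U n x $ i) z)\<bar>
    \<le> K ^ j * r2 * (LBINT z. \<bar>\<kappa> i z\<bar> * norm z) *
      sqrt (2 * ((LBINT x. (norm (D l x - A x))\<^sup>2) + (LBINT x. (norm (D n x - A x))\<^sup>2)))"
proof -
  let ?E = "2 * ((LBINT x. (norm (D l x - A x))\<^sup>2) + (LBINT x. (norm (D n x - A x))\<^sup>2))"
  have d0: "d \<noteq> 0" using d by simp
  define v where "v x = U l x $ i - U n x $ i" for x
  have v: "v \<in> Ccinf UNIV" unfolding v_def[abs_def] by (intro Ccinf_diff U_Ccinf)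
  have gv: "grad v y = (D l y - D n y) $ i" for y
    unfolding v_def[abs_def] grad_diff[OF U_Ccinf U_Ccinf] by (simp add: grad_matrix_def)
  have G: "(LBINT y. (norm (grad v y))\<^sup>2) \<le> ?E"
  proof -
    have "(LBINT y. (norm (grad v y))\<^sup>2) \<le> (LBINT y. 2 * ((norm (D l y - A y))\<^sup>2 + (norm (D n y - A y))\<^sup>2))"
    proof (rule integral_mono[OF Ccinf_grad_L2[OF v]])
      show "integrable lborel (\<lambda>y. 2 * ((norm (D l y - A y))\<^sup>2 + (norm (D n y - A y))\<^sup>2))"
        using DA_L2 by simp
      show "(norm (grad v y))\<^sup>2 \<le> 2 * ((norm (D l y - A y))\<^sup>2 + (norm (D n y - A y))\<^sup>2)" for y
        unfolding gv
        by (rule order_trans[OF power_mono[OF Finite_Cartesian_Product.norm_nth_le norm_ge_zero]])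
          (use norm_diff_power2[of "D l y - A y" "D n y - A y"] in simp)
    qed
    then show ?thesis using DA_L2 by simp
  qed
  have e: "(LBINT z. \<kappa> i z * J j d (\<lambda>x. U l x $ i) z) - (LBINT z. \<kappa> i z * J j d (\<lambda>x. U n x $ i) z)
      = (LBINT z. \<kappa> i z * J j d v z)"
    unfolding v_def[abs_def] J_diff[OF U_Ccinf U_Ccinf] right_diff_distrib
    by (rule Bochner_Integration.integral_diff[symmetric]) (rule \<kappa>_J_integrable[OF U_Ccinf d0])+
  have b: "\<bar>(LBINT z. \<kappa> i z * J j d v z)\<bar> \<le> (LBINT z. K ^ j * r2 * sqrt ?E * (\<bar>\<kappa> i z\<bar> * norm z))"
  proof (rule order_trans[OF integral_abs_bound integral_mono])
    show "integrable lborel (\<lambda>z. \<bar>\<kappa> i z * J j d v z\<bar>)" using \<kappa>_J_integrable[OF v d0] by (rule integrable_abs)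
    show "integrable lborel (\<lambda>z. K ^ j * r2 * sqrt ?E * (\<bar>\<kappa> i z\<bar> * norm z))"
      using \<kappa>_norm_integrable by (rule integrable_mult_right)
    fix z
    have "\<bar>J j d v z\<bar> \<le> K ^ j * r2 * (norm z * sqrt (LBINT y. (norm (grad v y))\<^sup>2))" by (rule J_bound[OF v d])
    also have "\<dots> \<le> K ^ j * r2 * (norm z * sqrt ?E)"
      using K_ge by (intro mult_left_mono real_sqrt_le_mono G) (auto simp: r2_def intro!: mult_nonneg_nonneg Bochner_Integration.integral_nonneg)
    finally have "\<bar>\<kappa> i z\<bar> * \<bar>J j d v z\<bar> \<le> \<bar>\<kappa> i z\<bar> * (K ^ j * r2 * (norm z * sqrt ?E))"
      by (intro mult_left_mono) auto
    then show "\<bar>\<kappa> i z * J j d v z\<bar> \<le> K ^ j * r2 * sqrt ?E * (\<bar>\<kappa> i z\<bar> * norm z)"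
      by (simp only: abs_mult mult_ac)
  qed
  have c: "(LBINT z. K ^ j * r2 * sqrt ?E * (\<bar>\<kappa> i z\<bar> * norm z))
      = K ^ j * r2 * (LBINT z. \<bar>\<kappa> i z\<bar> * norm z) * sqrt ?E"
    unfolding integral_mult_right_zero by (simp only: mult_ac)
  show ?thesis using b unfolding e c .
qed

text \<open>For functions bounded by K, convergence in L^1 implies convergence in L^2, and the trace
  of A is in L^2.\<close>

lemma R_power_trace_tendsto:
  assumes d: "d \<longlonglongrightarrow> 0" "\<And>n. d n > 0"
  shows "(\<lambda>n. LBINT y. R (d n) y ^ Suc j * trace (A y)) \<longlonglongrightarrow> (LBINT y. r y ^ Suc j * trace (A y))"
proof -
  let ?C = "real (Suc j) * K ^ Suc j"
  have le: "(R (d n) y ^ Suc j - r y ^ Suc j)\<^sup>2 \<le> ?C\<^sup>2 * (2 * K) * \<bar>R (d n) y - r y\<bar>" for n y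
  proof -
    have "(R (d n) y ^ Suc j - r y ^ Suc j)\<^sup>2 \<le> (?C * \<bar>R (d n) y - r y\<bar>)\<^sup>2"
      by (rule power2_le_iff_abs_le[THEN iffD2])
        (use K_ge in \<open>auto intro!: power_diff_bound R_le_K r_le_K mult_nonneg_nonneg simp del: power_Suc of_nat_Suc\<close>)
    also have "\<dots> = ?C\<^sup>2 * (\<bar>R (d n) y - r y\<bar> * \<bar>R (d n) y - r y\<bar>)" by (simp add: power_mult_distrib power2_eq_square)
    also have "\<dots> \<le> ?C\<^sup>2 * (2 * K * \<bar>R (d n) y - r y\<bar>)"
      using R_le_K[of "d n" y] r_le_K[of y] by (intro mult_left_mono mult_right_mono) auto
    finally show ?thesis by (simp only: mult.assoc)
  qed
  have iR: "integrable lborel (\<lambda>y. \<bar>R (d n) y - r y\<bar>)" for n using R_integrable r_integrable by auto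
  have i: "integrable lborel (\<lambda>y. (R (d n) y ^ Suc j - r y ^ Suc j)\<^sup>2)" for n
    by (rule Bochner_Integration.integrable_bound[OF integrable_mult_right[OF iR, of "?C\<^sup>2 * (2 * K)"]])
      (use le in \<open>auto intro!: AE_I2 order_trans[OF _ abs_ge_self] simp del: power_Suc of_nat_Suc\<close>)
  have "(\<lambda>n. LBINT y. (R (d n) y ^ Suc j - r y ^ Suc j)\<^sup>2) \<longlonglongrightarrow> 0"
  proof (rule tendsto_sandwich[OF _ _ tendsto_const])
    show "(\<lambda>n. ?C\<^sup>2 * (2 * K) * (LBINT y. \<bar>R (d n) y - r y\<bar>)) \<longlonglongrightarrow> 0"
      by (intro tendsto_mult_right_zero R_tendsto_L1 d)
    have "(LBINT y. (R (d n) y ^ Suc j - r y ^ Suc j)\<^sup>2) \<le> (LBINT y. ?C\<^sup>2 * (2 * K) * \<bar>R (d n) y - r y\<bar>)" for n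
      by (intro integral_mono i integrable_mult_right iR le)
    then show "\<forall>\<^sub>F n in sequentially. (LBINT y. (R (d n) y ^ Suc j - r y ^ Suc j)\<^sup>2) \<le> ?C\<^sup>2 * (2 * K) * (LBINT y. \<bar>R (d n) y - r y\<bar>)"
      by simp
  qed simp
  then have lim: "(\<lambda>n. LBINT y. \<bar>(R (d n) y ^ Suc j - r y ^ Suc j) * trace (A y)\<bar>) \<longlonglongrightarrow> 0"
    by (intro tendsto_Cauchy_Schwarz[OF _ _ i trace_A_L2 _ order_refl]) measurable
  show ?thesis
  proof (rule tendsto_norm_bound[OF _ lim])
    fix n
    have i1: "integrable lborel (\<lambda>y. R (d n) y ^ Suc j * trace (A y))"
      by (intro integrable_mult_L2 bounded_power_L2 R_integrable R_le_K trace_A_L2) measurable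
    have i2: "integrable lborel (\<lambda>y. r y ^ Suc j * trace (A y))"
      by (intro integrable_mult_L2 bounded_power_L2 r_integrable r_le_K trace_A_L2) measurable
    have "(LBINT y. R (d n) y ^ Suc j * trace (A y)) - (LBINT y. r y ^ Suc j * trace (A y))
      = (LBINT y. (R (d n) y ^ Suc j - r y ^ Suc j) * trace (A y))"
      unfolding left_diff_distrib by (rule Bochner_Integration.integral_diff[OF i1 i2, symmetric])
    then show "norm ((LBINT y. R (d n) y ^ Suc j * trace (A y)) - (LBINT y. r y ^ Suc j * trace (A y)))
      \<le> (LBINT y. \<bar>(R (d n) y ^ Suc j - r y ^ Suc j) * trace (A y)\<bar>)"
      by (simp only: real_norm_def integral_abs_bound)
  qed
qed

text \<open>The factor m comes from the chain rule for the m-th power of the mollified density, the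
  integral on the right from the commutator of mollification and transport.\<close>

lemma power_trace_integral_multiple:
  "(LBINT y. r y ^ Suc j * trace (A y)) = real (Suc j) * (LBINT y. r y ^ Suc j * trace (A y))"
proof -
  define d where "d k = inverse (real (Suc k))" for k
  have d: "d \<longlonglongrightarrow> 0" "\<And>k. d k > 0"
    using LIMSEQ_inverse_real_of_nat by (auto simp: d_def[abs_def])
  define E where "E n = (LBINT x. (norm (D n x - A x))\<^sup>2)" for n
  \<comment> \<open>\<open>X k\<close> is the mollified integral with the true gradient,
    \<open>Y k n\<close> the commutator of the n-th test field at scale \<open>d k\<close>, and
    \<open>Z n\<close> the limit of the latter as the scale vanishes.\<close>
  define X where "X k = (LBINT y. R (d k) y ^ Suc j * trace (A y))" for k
  define Y where "Y k n = real (Suc j) * (\<Sum>i\<in>UNIV. LBINT z. \<kappa> i z * J j (d k) (\<lambda>x. U n x $ i) z)" for k n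
  define Z where "Z n = real (Suc j) * (LBINT y. r y ^ Suc j * trace (D n y))" for n
  define c where "c = real (Suc j) * (\<Sum>i\<in>UNIV. K ^ j * r2 * (LBINT z. \<bar>\<kappa> i z\<bar> * norm z))"
  let ?X = "LBINT y. r y ^ Suc j * trace (A y)"
  have E: "E \<longlonglongrightarrow> 0" unfolding E_def using DU_lim .
  have YY: "\<bar>Y k l - Y k n\<bar> \<le> c * sqrt (2 * (E l + E n))" for k l n
  proof -
    have "\<bar>Y k l - Y k n\<bar> = real (Suc j) * \<bar>\<Sum>i\<in>UNIV. (LBINT z. \<kappa> i z * J j (d k) (\<lambda>x. U l x $ i) z)
        - (LBINT z. \<kappa> i z * J j (d k) (\<lambda>x. U n x $ i) z)\<bar>"
      unfolding Y_def right_diff_distrib[symmetric] abs_mult sum_subtractf by simp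
    also have "\<dots> \<le> real (Suc j) * (\<Sum>i\<in>UNIV. K ^ j * r2 * (LBINT z. \<bar>\<kappa> i z\<bar> * norm z) * sqrt (2 * (E l + E n)))"
      unfolding E_def by (intro mult_left_mono order_trans[OF sum_abs sum_mono] \<kappa>_J_stability d) auto
    finally show ?thesis unfolding c_def by (simp only: sum_distrib_right mult.assoc)
  qed
  \<comment> \<open>A third index l takes the test field in the equation to its limit at the fixed
    scale \<open>d k\<close>; this removes the error with its factor 1/\<open>d k\<close>, while n
    stays where it is.\<close>
  have XY: "\<bar>X k - Y k n\<bar> \<le> c * sqrt (2 * E n)" for k n
  proof (rule LIMSEQ_le)
    let ?b = "(real (Suc j) / d k) * (\<Sum>i\<in>UNIV. K ^ j * (LBINT z. \<bar>\<kappa> i z\<bar>))"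
    have "(\<lambda>l. LBINT y. R (d k) y ^ Suc j * trace (D l y)) \<longlonglongrightarrow> X k"
      unfolding X_def by (intro trace_D_weak_limit bounded_power_L2 R_integrable R_le_K) measurable
    then show "(\<lambda>l. \<bar>(LBINT y. R (d k) y ^ Suc j * trace (D l y)) - Y k n\<bar>) \<longlonglongrightarrow> \<bar>X k - Y k n\<bar>"
      by (intro tendsto_intros)
    have "(\<lambda>l. ?b * (LBINT y. r y * norm (U l y - w y)) + c * sqrt (2 * (E l + E n))) \<longlonglongrightarrow> ?b * 0 + c * sqrt (2 * (0 + E n))"
      by (intro tendsto_intros E r_dist_limit)
    then show "(\<lambda>l. ?b * (LBINT y. r y * norm (U l y - w y)) + c * sqrt (2 * (E l + E n))) \<longlonglongrightarrow> c * sqrt (2 * E n)"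
      by simp
    show "\<exists>N. \<forall>l\<ge>N. \<bar>(LBINT y. R (d k) y ^ Suc j * trace (D l y)) - Y k n\<bar>
        \<le> ?b * (LBINT y. r y * norm (U l y - w y)) + c * sqrt (2 * (E l + E n))"
    proof (intro exI allI impI)
      fix l
      show "\<bar>(LBINT y. R (d k) y ^ Suc j * trace (D l y)) - Y k n\<bar>
        \<le> ?b * (LBINT y. r y * norm (U l y - w y)) + c * sqrt (2 * (E l + E n))"
        using renormalized_mollified[OF d(2), of k j l, folded Y_def] YY[of k l n] by linarith
    qed
  qed
  \<comment> \<open>Only now does the scale tend to 0, with n fixed; the bound does not depend on
    k.\<close>
  have XZ: "\<bar>?X - Z n\<bar> \<le> c * sqrt (2 * E n)" for n
  proof (rule LIMSEQ_le_const2)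
    have "(\<lambda>k. Y k n) \<longlonglongrightarrow> real (Suc j) * (\<Sum>i\<in>UNIV. LBINT y. r y ^ Suc j * grad (\<lambda>x. U n x $ i) y $ i)"
      unfolding Y_def by (intro tendsto_mult tendsto_const tendsto_sum \<kappa>_J_tendsto[OF U_Ccinf d])
    then have "(\<lambda>k. Y k n) \<longlonglongrightarrow> Z n"
      unfolding Z_def integral_power_trace_D[OF r_integrable r_measurable r_le_K] .
    moreover have "X \<longlonglongrightarrow> ?X" unfolding X_def by (rule R_power_trace_tendsto[OF d])
    ultimately show "(\<lambda>k. \<bar>X k - Y k n\<bar>) \<longlonglongrightarrow> \<bar>?X - Z n\<bar>" by (intro tendsto_intros)
  qed (use XY in auto)
  \<comment> \<open>Finally n tends to infinity, where \<open>Z n\<close> reaches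
    \<open>Suc j\<close> times the integral with A.\<close>
  have "\<bar>?X - real (Suc j) * ?X\<bar> \<le> 0"
  proof (rule LIMSEQ_le)
    show "(\<lambda>n. \<bar>?X - Z n\<bar>) \<longlonglongrightarrow> \<bar>?X - real (Suc j) * ?X\<bar>"
      unfolding Z_def
      by (intro tendsto_intros trace_D_weak_limit bounded_power_L2 r_integrable r_le_K) measurable
    have "(\<lambda>n. c * sqrt (2 * E n)) \<longlonglongrightarrow> c * sqrt (2 * 0)" by (intro tendsto_intros E)
    then show "(\<lambda>n. c * sqrt (2 * E n)) \<longlonglongrightarrow> 0" by simp
    show "\<exists>N. \<forall>n\<ge>N. \<bar>?X - Z n\<bar> \<le> c * sqrt (2 * E n)" using XZ by blast
  qed
  then show ?thesis by linarith
qed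

text \<open>X = m X with m = j + 2 gives (j + 1) X = 0, and j + 1 is positive; hence the exponents
  start at 2.\<close>

lemma power_trace_integral_zero: "(LBINT y. r y ^ Suc (Suc j) * trace (A y)) = 0"
proof -
  have "real (Suc j) * (LBINT y. r y ^ Suc (Suc j) * trace (A y)) = 0"
    using power_trace_integral_multiple[of "Suc j"] by (simp add: algebra_simps del: power_Suc)
  then show ?thesis by (simp del: power_Suc of_nat_Suc)
qed

end

subsection \<open>The stress and the potential force\<close>

text \<open>The substitution y -> y + d z carries the shift from the bounded function to the
  integrable one: convolution is moved to its adjoint.\<close>

lemma shifted_product_swap':
  fixes k q H :: "'a::euclidean_space \<Rightarrow> real"
  assumes k: "integrable lborel k" and q: "integrable lborel q"
    and H [measurable]: "H \<in> borel_measurable borel" and C: "\<And>y. \<bar>H y\<bar> \<le> C"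
  shows "(LBINT y. q y * (LBINT z. k z * H (y - d *\<^sub>R z)))
      = (LBINT z. k z * (LBINT y. H y * q (y + d *\<^sub>R z)))"
proof -
  have [measurable]: "k \<in> borel_measurable borel" "q \<in> borel_measurable borel"
    using k q by (auto dest: borel_measurable_integrable)
  have C0: "0 \<le> C" using C[of 0] by linarith
  let ?F = "\<lambda>p. k (fst p) * (q (snd p) * H (snd p - d *\<^sub>R fst p))"
  have int: "integrable (lborel \<Otimes>\<^sub>M lborel) ?F"
  proof (rule Bochner_Integration.integrable_bound)
    have "integrable (lborel \<Otimes>\<^sub>M lborel) (\<lambda>p. k (fst p) * q (snd p))"
      by (rule lborel_pair.Fubini_integrable) (use k q in \<open>auto simp: abs_mult\<close>)
    then show "integrable (lborel \<Otimes>\<^sub>M lborel) (\<lambda>p. C * (k (fst p) * q (snd p)))" by (rule integrable_mult_right)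
    have "\<bar>?F p\<bar> \<le> C * \<bar>k (fst p) * q (snd p)\<bar>" for p
      using mult_left_mono[OF C, of "\<bar>k (fst p)\<bar> * \<bar>q (snd p)\<bar>" "snd p - d *\<^sub>R fst p"] by (simp add: abs_mult mult_ac)
    then show "AE p in lborel \<Otimes>\<^sub>M lborel. norm (?F p) \<le> norm (C * (k (fst p) * q (snd p)))"
      using C0 by (intro AE_I2) (simp add: abs_mult)
  qed measurable
  have e: "(LBINT z. k z * (q y * H (y - d *\<^sub>R z))) = q y * (LBINT z. k z * H (y - d *\<^sub>R z))" for y
    unfolding integral_mult_right_zero[symmetric] by (simp only: mult_ac)
  have "(LBINT y. LBINT z. k z * (q y * H (y - d *\<^sub>R z))) = (LBINT z. LBINT y. k z * (q y * H (y - d *\<^sub>R z)))"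
    using lborel_pair.Fubini_integral[of "\<lambda>z y. ?F (z, y)"] int by (simp add: case_prod_beta')
  also have "\<dots> = (LBINT z. k z * (LBINT y. H y * q (y + d *\<^sub>R z)))"
  proof (intro Bochner_Integration.integral_cong refl)
    fix z
    have "(LBINT y. q y * H (y - d *\<^sub>R z)) = (LBINT y. q (y + d *\<^sub>R z) * H (y + d *\<^sub>R z - d *\<^sub>R z))"
      by (rule lborel_integral_translate[symmetric]) measurable
    then show "(LBINT y. k z * (q y * H (y - d *\<^sub>R z))) = k z * (LBINT y. H y * q (y + d *\<^sub>R z))"
      by (simp add: mult.commute)
  qed
  finally show "(LBINT y. q y * (LBINT z. k z * H (y - d *\<^sub>R z)))
      = (LBINT z. k z * (LBINT y. H y * q (y + d *\<^sub>R z)))"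
    unfolding e .
qed

text \<open>729 = 3^6, as the norm is at most three times the largest component.\<close>

lemma norm_power6_le_sum: "norm v ^ 6 \<le> 729 * (\<Sum>i\<in>UNIV. (v $ i) ^ 6)" for v :: "real^3"
proof -
  have "norm v \<le> (\<Sum>i\<in>UNIV. \<bar>v $ i\<bar>)" by (rule norm_le_l1_cart)
  also have "\<dots> = \<bar>v $ 1\<bar> + \<bar>v $ 2\<bar> + \<bar>v $ 3\<bar>" by (simp add: sum_3)
  also have "\<dots> \<le> 3 * max \<bar>v $ 1\<bar> (max \<bar>v $ 2\<bar> \<bar>v $ 3\<bar>)" by (simp add: max_def)
  finally have "norm v ^ 6 \<le> (3 * max \<bar>v $ 1\<bar> (max \<bar>v $ 2\<bar> \<bar>v $ 3\<bar>)) ^ 6" by (intro power_mono) auto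
  also have "\<dots> \<le> 729 * ((v $ 1) ^ 6 + (v $ 2) ^ 6 + (v $ 3) ^ 6)"
    by (auto simp: max_def power_mult_distrib)
  finally show ?thesis by (simp add: sum_3)
qed

context approximable_field
begin

text \<open>For gradients, \<open>L B \<bullet> B\<close> is the null Lagrangian d_i u_j d_j u_i -
  (div u)^2. Splitting it off from S(B) : B leaves only squares.\<close>

definition "L B = transpose B - trace B *\<^sub>R (mat 1 :: real^3^3)" for B :: "real^3^3"

lemma L_inner: "L B \<bullet> C = (\<Sum>i\<in>UNIV. \<Sum>j\<in>UNIV. B $ j $ i * C $ i $ j) - trace B * trace C"
  by (simp add: L_def inner_diff_left trace_inner) (simp add: inner_vec_def transpose_def)

lemma L_symmetric: "L B \<bullet> C = L C \<bullet> B"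
  unfolding L_inner by (subst sum.swap) (simp add: mult.commute)

lemma L_bounded_linear: "bounded_linear L"
  unfolding L_def[abs_def]
  by (intro linear_conv_bounded_linear[THEN iffD1] linearI)
    (auto simp: transpose_def vec_eq_iff trace_def sum.distrib sum_distrib_left algebra_simps mat_def)

lemma L_measurable [measurable]: "f \<in> borel_measurable N \<Longrightarrow> (\<lambda>x. L (f x)) \<in> borel_measurable N"
  by (rule measurable_compose[OF _ borel_measurable_continuous_onI[OF linear_continuous_on[OF L_bounded_linear]]])

lemma L_L2:
  assumes [measurable]: "f \<in> borel_measurable lborel" and i: "integrable lborel (\<lambda>x. (norm (f x))\<^sup>2)"
  shows "integrable lborel (\<lambda>x. (norm (L (f x)))\<^sup>2)"
proof -
  obtain C where C: "\<And>x. norm (L x) \<le> norm x * C"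
    using bounded_linear.bounded[OF L_bounded_linear] by blast
  show ?thesis
  proof (rule Bochner_Integration.integrable_bound[OF integrable_mult_right[OF i, of "C\<^sup>2"]])
    show "AE x in lborel. norm ((norm (L (f x)))\<^sup>2) \<le> norm (C\<^sup>2 * (norm (f x))\<^sup>2)"
      using power_mono[OF C norm_ge_zero, of _ 2] by (intro AE_I2) (simp add: power_mult_distrib mult.commute)
  qed measurable
qed

text \<open>Exchanging derivatives makes the bilinear form vanish on pairs of test fields. With two
  independent indices, each passage to the limit concerns a single argument and is a weak
  one.\<close>

lemma L_form_zero: "(LBINT x. L (A x) \<bullet> A x) = 0"
proof -
  have z: "(LBINT x. L (D n x) \<bullet> D l x) = 0" for n l
  proof -
    have Dc: "D n x $ i $ j = grad (\<lambda>y. U n y $ i) x \<bullet> axis j 1" for n x i j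
      by (simp add: grad_matrix_def inner_axis)
    have i: "integrable lborel (\<lambda>x. D n x $ i $ j * D l x $ i' $ j')" for i j i' j'
      by (rule continuous_compact_support_integrable[OF _ S_compact[of n]])
        (auto intro!: continuous_intros D_continuous simp: D_outside)
    have "(LBINT x. L (D n x) \<bullet> D l x) =
      (\<Sum>i\<in>UNIV. \<Sum>j\<in>UNIV. (LBINT x. D n x $ j $ i * D l x $ i $ j) - (LBINT x. D n x $ j $ j * D l x $ i $ i))"
    proof -
      have "L (D n x) \<bullet> D l x = (\<Sum>i\<in>UNIV. \<Sum>j\<in>UNIV. D n x $ j $ i * D l x $ i $ j - D n x $ j $ j * D l x $ i $ i)" for x
        unfolding L_inner trace_def sum_product sum_subtractf
        by (subst (4) sum.swap) (rule refl)
      then show ?thesis using i by (simp add: Bochner_Integration.integral_sum)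
    qed
    also have "\<dots> = 0"
    proof (intro sum.neutral ballI)
      fix i j :: 3
      show "(LBINT x. D n x $ j $ i * D l x $ i $ j) - (LBINT x. D n x $ j $ j * D l x $ i $ i) = 0"
        unfolding Dc using integral_grad_grad_swap[OF U_Ccinf U_Ccinf, of n j "axis i 1" l i "axis j 1"] by simp
    qed
    finally show ?thesis .
  qed
  have zA: "(LBINT x. L (A x) \<bullet> D n x) = 0" for n
  proof -
    have "(\<lambda>l. LBINT x. L (D n x) \<bullet> D l x) \<longlonglongrightarrow> (LBINT x. L (D n x) \<bullet> A x)"
      by (intro D_weak_limit L_L2 D_L2) measurable
    then show ?thesis unfolding z by (simp add: LIMSEQ_const_iff L_symmetric[of "D n _"])
  qed
  have "(\<lambda>l. LBINT x. L (A x) \<bullet> D l x) \<longlonglongrightarrow> (LBINT x. L (A x) \<bullet> A x)"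
    by (intro D_weak_limit L_L2 A_L2) measurable
  then show ?thesis unfolding zA by (simp add: LIMSEQ_const_iff)
qed

section \<open>Coercivity of the dissipation\<close>

lemma stress_inner: "stress \<mu> \<eta> B \<bullet> B = \<mu> * (B \<bullet> B) + \<mu> * (L B \<bullet> B) + (\<mu> / 3 + \<eta>) * (trace B)\<^sup>2"
  by (simp add: stress_def L_def inner_add_left inner_diff_left trace_inner power2_eq_square algebra_simps)

lemma stress_L2: "integrable lborel (\<lambda>x. (norm (stress \<mu> \<eta> (A x)))\<^sup>2)"
  and stress_measurable [measurable]: "(\<lambda>x. stress \<mu> \<eta> (A x)) \<in> borel_measurable borel"
proof -
  have bl: "bounded_linear (stress \<mu> \<eta>)"
    unfolding stress_def[abs_def]
    by (intro linear_conv_bounded_linear[THEN iffD1] linearI)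
      (auto simp: transpose_def vec_eq_iff trace_def sum.distrib sum_distrib_left algebra_simps mat_def)
  show m: "(\<lambda>x. stress \<mu> \<eta> (A x)) \<in> borel_measurable borel"
    by (rule measurable_compose[OF A_measurable borel_measurable_continuous_onI[OF linear_continuous_on[OF bl]]])
  obtain C where C: "\<And>x. norm (stress \<mu> \<eta> x) \<le> norm x * C"
    using bounded_linear.bounded[OF bl] by blast
  show "integrable lborel (\<lambda>x. (norm (stress \<mu> \<eta> (A x)))\<^sup>2)"
  proof (rule Bochner_Integration.integrable_bound[OF integrable_mult_right[OF A_L2, of "C\<^sup>2"]])
    show "AE x in lborel. norm ((norm (stress \<mu> \<eta> (A x)))\<^sup>2) \<le> norm (C\<^sup>2 * (norm (A x))\<^sup>2)"
      using power_mono[OF C norm_ge_zero, of _ 2] by (intro AE_I2) (simp add: power_mult_distrib mult.commute)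
  qed (use m in simp)
qed

text \<open>The gradients of U n tend to 0 in L^2, so the Sobolev inequality sends U n, and with it
  w, to 0 in L^6. This rules out nonzero constants.\<close>

lemma zero_if_gradient_zero:
  assumes A0: "(LBINT x. (norm (A x))\<^sup>2) = 0"
  shows "AE x in lborel. w x = 0"
proof -
  have AE0: "AE x in lborel. A x = 0"
    using integral_nonneg_eq_0_iff_AE[OF A_L2] A0 by simp
  have E: "(LBINT x. (norm (D n x - A x))\<^sup>2) = (LBINT x. (norm (D n x))\<^sup>2)" for n
    by (rule integral_cong_AE) (use AE0 in auto)
  have lim: "(\<lambda>n. (LBINT x. (norm (D n x))\<^sup>2)) \<longlonglongrightarrow> 0" using DU_lim unfolding E .
  have U6: "(LBINT x. norm (U n x) ^ 6) \<le> 729 * (3 * (4096 * (LBINT x. (norm (D n x))\<^sup>2) ^ 3))" for n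
  proof -
    have i6: "integrable lborel (\<lambda>x. (U n x $ i) ^ 6)" for i
      by (rule continuous_compact_support_integrable[OF _ S_compact[of n]])
        (auto intro!: continuous_intros U_continuous simp: U_outside)
    have "(LBINT x. norm (U n x) ^ 6) \<le> (LBINT x. 729 * (\<Sum>i\<in>UNIV. (U n x $ i) ^ 6))"
      by (intro integral_mono U_L6 norm_power6_le_sum integrable_mult_right Bochner_Integration.integrable_sum i6)
    also have "\<dots> = 729 * (\<Sum>i\<in>UNIV. LBINT x. (U n x $ i) ^ 6)"
      using i6 by (simp add: Bochner_Integration.integral_sum)
    also have "\<dots> \<le> 729 * (\<Sum>i\<in>(UNIV::3 set). 4096 * (LBINT x. (norm (D n x))\<^sup>2) ^ 3)"
    proof (intro mult_left_mono sum_mono)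
      fix i :: 3
      have gi: "integrable lborel (\<lambda>x. (norm (grad (\<lambda>y. U n y $ i) x))\<^sup>2)"
        by (rule continuous_compact_support_integrable[OF _ Ccinf_compact[OF U_Ccinf[of n i]]])
          (auto intro!: continuous_intros Ccinf_continuous_grad[OF U_Ccinf] simp: grad_not_in_supp)
      have "norm (grad (\<lambda>y. U n y $ i) x) \<le> norm (D n x)" for x
        using Finite_Cartesian_Product.norm_nth_le[of "D n x" i] by (simp add: grad_matrix_def)
      then have "(LBINT x. (norm (grad (\<lambda>y. U n y $ i) x))\<^sup>2) \<le> (LBINT x. (norm (D n x))\<^sup>2)"
        by (intro integral_mono D_L2 gi power_mono) auto
      then have "(LBINT x. (norm (grad (\<lambda>y. U n y $ i) x))\<^sup>2) ^ 3 \<le> (LBINT x. (norm (D n x))\<^sup>2) ^ 3"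
        by (intro power_mono Bochner_Integration.integral_nonneg) auto
      then show "(LBINT x. (U n x $ i) ^ 6) \<le> 4096 * (LBINT x. (norm (D n x))\<^sup>2) ^ 3"
        using Sobolev_inequality[OF U_Ccinf[of n i]] by linarith
    qed auto
    finally show ?thesis by (simp add: sum_3)
  qed
  have le: "(LBINT x. norm (w x) ^ 6) \<le> 64 * ((LBINT x. norm (U n x - w x) ^ 6)
      + 729 * (3 * (4096 * (LBINT x. (norm (D n x))\<^sup>2) ^ 3)))" for n
  proof -
    have "(LBINT x. norm (w x) ^ 6) \<le> (LBINT x. 64 * (norm (U n x - w x) ^ 6 + norm (U n x) ^ 6))"
    proof (rule integral_mono[OF w_L6])
      show "integrable lborel (\<lambda>x. 64 * (norm (U n x - w x) ^ 6 + norm (U n x) ^ 6))"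
        using Uw_L6 U_L6 by simp
      show "norm (w x) ^ 6 \<le> 64 * (norm (U n x - w x) ^ 6 + norm (U n x) ^ 6)" for x
        using norm_diff_power6[of "U n x - w x" "U n x"] by simp
    qed
    also have "\<dots> = 64 * ((LBINT x. norm (U n x - w x) ^ 6) + (LBINT x. norm (U n x) ^ 6))"
      using Uw_L6 U_L6 by simp
    also have "\<dots> \<le> 64 * ((LBINT x. norm (U n x - w x) ^ 6)
      + 729 * (3 * (4096 * (LBINT x. (norm (D n x))\<^sup>2) ^ 3)))"
      by (intro mult_left_mono add_left_mono U6) auto
    finally show ?thesis .
  qed
  have "(\<lambda>n. 64 * ((LBINT x. norm (U n x - w x) ^ 6)
      + 729 * (3 * (4096 * (LBINT x. (norm (D n x))\<^sup>2) ^ 3)))) \<longlonglongrightarrow> 64 * (0 + 729 * (3 * (4096 * 0 ^ 3)))"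
    by (intro tendsto_intros U_lim lim)
  then have "(LBINT x. norm (w x) ^ 6) \<le> 64 * (0 + 729 * (3 * (4096 * 0 ^ 3)))"
    by (rule LIMSEQ_le_const) (use le in auto)
  moreover have "0 \<le> (LBINT x. norm (w x) ^ 6)" by (intro Bochner_Integration.integral_nonneg) auto
  ultimately have "(LBINT x. norm (w x) ^ 6) = 0" by simp
  then show ?thesis using integral_nonneg_eq_0_iff_AE[OF w_L6] by simp
qed

end

section \<open>Forces whose potential is a limit of test functions\<close>

context solenoidal_flow
begin

text \<open>For h <= t the small factor is h itself. For h > t, Young's inequality with parameter
  1/t applies, and h^(6/5) is raised to h^q at the price of t^(6/5 - q), because 6/5 - q <=
  0.\<close>

lemma force_pointwise:
  assumes "0 \<le> h" "0 < t" "t \<le> 1" "6/5 \<le> q"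
  shows "r x * norm (w x) * h \<le> t * (r x * norm (w x) + M * norm (w x) ^ 6) + (M * t powr (6/5 - q) / t) * h powr q"
proof (cases "h \<le> t")
  case True
  have "r x * norm (w x) * h \<le> t * (r x * norm (w x))"
    using True r_nonneg[of x] by (simp add: mult_left_mono mult.commute[of t])
  moreover have "0 \<le> t * (M * norm (w x) ^ 6)" using assms M_nonneg by simp
  moreover have "0 \<le> (M * t powr (6/5 - q) / t) * h powr q" using assms M_nonneg by simp
  ultimately show ?thesis by (simp add: distrib_left)
next
  case False
  have t5: "t ^ 5 \<le> t" using power_decreasing[of 1 5 t] assms by simp
  have "norm (w x) * h \<le> (1/t) * h powr (6/5) + norm (w x) ^ 6 / (1/t) ^ 5"
    by (rule young_six_fifths) (use assms in auto)
  also have "norm (w x) ^ 6 / (1/t) ^ 5 = t ^ 5 * norm (w x) ^ 6" using assms by (simp add: power_divide)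
  also have "\<dots> \<le> t * norm (w x) ^ 6" by (intro mult_right_mono t5) auto
  also have "h powr (6/5) = h powr (6/5 - q) * h powr q" by (simp add: powr_add[symmetric])
  also have "\<dots> \<le> t powr (6/5 - q) * h powr q"
    using False assms by (intro mult_right_mono powr_mono2') auto
  finally have "norm (w x) * h \<le> (1/t) * (t powr (6/5 - q) * h powr q) + t * norm (w x) ^ 6"
    using assms by (simp add: divide_right_mono)
  then have "r x * (norm (w x) * h) \<le> M * ((1/t) * (t powr (6/5 - q) * h powr q) + t * norm (w x) ^ 6)"
    using assms r_le r_nonneg M_nonneg by (intro mult_mono) auto
  moreover have "0 \<le> t * (r x * norm (w x))" using assms r_nonneg by simp
  ultimately show ?thesis by (simp add: algebra_simps)
qed

lemma rw_norm_integrable: "integrable lborel (\<lambda>x. r x * norm (w x))"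
  using integrable_norm[OF rw_integrable] by (simp add: r_nonneg)

text \<open>The continuity equation annihilates each gradient of \<phi>_n, and the error r |w| |grad
  \<phi>_n - g| tends to 0 in L^1 by the trade-off in t.\<close>

lemma potential_force_zero_limit:
  assumes q: "6/5 \<le> q" and g [measurable]: "g \<in> borel_measurable borel"
    and gq: "\<And>n. integrable lborel (\<lambda>x. norm (grad (\<phi> n) x - g x) powr q)"
    and \<phi>: "\<And>n. \<phi> n \<in> Ccinf UNIV"
    and lim: "(\<lambda>n. LBINT x. norm (grad (\<phi> n) x - g x) powr q) \<longlonglongrightarrow> 0"
  shows "(LBINT x. (r x *\<^sub>R w x) \<bullet> g x) = 0"
proof -
  have [measurable]: "grad (\<phi> n) \<in> borel_measurable borel" for n by (rule Ccinf_grad_measurable[OF \<phi>])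
  let ?h = "\<lambda>n x. norm (grad (\<phi> n) x - g x)"
  let ?a = "\<lambda>x. r x * norm (w x) + M * norm (w x) ^ 6"
  have ia: "integrable lborel ?a" using rw_norm_integrable w_L6 by simp
  have i0: "integrable lborel (\<lambda>x. r x * norm (w x) * ?h n x)" for n
  proof (rule Bochner_Integration.integrable_bound)
    show "integrable lborel (\<lambda>x. 1 * ?a x + (M * 1 powr (6/5 - q) / 1) * ?h n x powr q)"
      using ia gq[of n] by simp
    show "AE x in lborel. norm (r x * norm (w x) * ?h n x) \<le> norm (1 * ?a x + (M * 1 powr (6/5 - q) / 1) * ?h n x powr q)"
      by (intro AE_I2 order_trans[OF _ abs_ge_self[THEN order_trans[OF _ order_refl]]])
        (use force_pointwise[of _ 1 q] q r_nonneg in \<open>auto simp: abs_mult intro: order_trans[OF _ abs_ge_self]\<close>)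
  qed measurable
  have z: "(\<lambda>n. LBINT x. r x * norm (w x) * ?h n x) \<longlonglongrightarrow> 0"
  proof (rule tendsto_zero_of_tradeoff[OF lim])
    show "0 \<le> (LBINT x. ?a x)" using r_nonneg M_nonneg by (intro Bochner_Integration.integral_nonneg) auto
    fix t :: real and n assume t: "0 < t" "t \<le> 1"
    have "\<bar>LBINT x. r x * norm (w x) * ?h n x\<bar> = (LBINT x. r x * norm (w x) * ?h n x)"
      using r_nonneg by (intro abs_of_nonneg Bochner_Integration.integral_nonneg) auto
    also have "\<dots> \<le> (LBINT x. t * ?a x + (M * t powr (6/5 - q) / t) * ?h n x powr q)"
      by (intro integral_mono i0 force_pointwise t q Bochner_Integration.integrable_add integrable_mult_right ia gq) auto
    also have "\<dots> = t * (LBINT x. ?a x) + (M * t powr (6/5 - q) / t) * (LBINT x. ?h n x powr q)"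
      using ia gq[of n] by simp
    finally show "\<bar>LBINT x. r x * norm (w x) * ?h n x\<bar> \<le> t * (LBINT x. ?a x) + (M * t powr (6/5 - q) / t) * (LBINT x. ?h n x powr q)" .
  qed
  have "(\<lambda>n. 0) \<longlonglongrightarrow> (LBINT x. (r x *\<^sub>R w x) \<bullet> g x)"
  proof (rule tendsto_norm_bound[OF _ z])
    fix n
    have i1: "integrable lborel (\<lambda>x. (r x *\<^sub>R w x) \<bullet> (grad (\<phi> n) x - g x))"
      by (rule Bochner_Integration.integrable_bound[OF i0[of n]])
        (use Cauchy_Schwarz_ineq2 r_nonneg in \<open>auto intro!: AE_I2 mult_left_mono simp: abs_mult mult.assoc\<close>)
    obtain B where B: "\<And>x. norm (grad (\<phi> n) x) \<le> B" using Ccinf_grad_bounded[OF \<phi>] by blast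
    have i2: "integrable lborel (\<lambda>x. (r x *\<^sub>R w x) \<bullet> grad (\<phi> n) x)"
    proof (rule Bochner_Integration.integrable_bound[OF integrable_mult_right[OF rw_norm_integrable, of B]])
      have "\<bar>(r x *\<^sub>R w x) \<bullet> grad (\<phi> n) x\<bar> \<le> \<bar>B * (r x * norm (w x))\<bar>" for x
      proof -
        have "\<bar>(r x *\<^sub>R w x) \<bullet> grad (\<phi> n) x\<bar> \<le> r x * norm (w x) * norm (grad (\<phi> n) x)"
          using Cauchy_Schwarz_ineq2[of "r x *\<^sub>R w x" "grad (\<phi> n) x"] r_nonneg[of x] by simp
        also have "\<dots> \<le> r x * norm (w x) * B" using r_nonneg[of x] by (intro mult_left_mono B) auto
        finally show ?thesis by (simp add: mult_ac)
      qed
      then show "AE x in lborel. norm ((r x *\<^sub>R w x) \<bullet> grad (\<phi> n) x) \<le> norm (B * (r x * norm (w x)))" by simp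
    qed measurable
    have i3: "integrable lborel (\<lambda>x. (r x *\<^sub>R w x) \<bullet> g x)"
      using Bochner_Integration.integrable_diff[OF i2 i1] by (simp add: inner_diff_right algebra_simps)
    have "0 - (LBINT x. (r x *\<^sub>R w x) \<bullet> g x) = (LBINT x. (r x *\<^sub>R w x) \<bullet> grad (\<phi> n) x) - (LBINT x. (r x *\<^sub>R w x) \<bullet> g x)"
      using div_free[OF \<phi>[of n]] by simp
    also have "\<dots> = (LBINT x. (r x *\<^sub>R w x) \<bullet> (grad (\<phi> n) x - g x))"
      unfolding inner_diff_right by (rule Bochner_Integration.integral_diff[OF i2 i3, symmetric])
    finally have e: "0 - (LBINT x. (r x *\<^sub>R w x) \<bullet> g x) = (LBINT x. (r x *\<^sub>R w x) \<bullet> (grad (\<phi> n) x - g x))" .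
    show "norm (0 - (LBINT x. (r x *\<^sub>R w x) \<bullet> g x)) \<le> (LBINT x. r x * norm (w x) * ?h n x)"
      unfolding e real_norm_def
    proof (rule order_trans[OF integral_abs_bound integral_mono[OF integrable_abs[OF i1] i0]])
      show "\<bar>(r x *\<^sub>R w x) \<bullet> (grad (\<phi> n) x - g x)\<bar> \<le> r x * norm (w x) * ?h n x" for x
        using Cauchy_Schwarz_ineq2[of "r x *\<^sub>R w x" "grad (\<phi> n) x - g x"] r_nonneg[of x] by simp
    qed
  qed
  then show ?thesis by (simp add: LIMSEQ_const_iff)
qed

end

subsection \<open>The pressure term\<close>

context mollified_flow
begin

text \<open>The bound is proportional to B, so uniform approximation of f on the range of r carries
  over to the integral.\<close>

lemma r2_trace_integrable:
  assumes [measurable]: "f \<in> borel_measurable borel" and b: "\<And>x. \<bar>f (r x)\<bar> \<le> B"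
  shows "integrable lborel (\<lambda>x. (r x)\<^sup>2 * f (r x) * trace (A x))"
    and "(LBINT x. \<bar>(r x)\<^sup>2 * f (r x) * trace (A x)\<bar>) \<le> B * (LBINT x. \<bar>(r x)\<^sup>2 * trace (A x)\<bar>)"
proof -
  have i: "integrable lborel (\<lambda>x. (r x)\<^sup>2 * trace (A x))"
    using integrable_mult_L2[OF _ _ bounded_power_L2[OF r_measurable r_integrable r_le_K, of 1] trace_A_L2]
    by (simp add: power2_eq_square)
  have B: "0 \<le> B" using order_trans[OF abs_ge_zero b] .
  have le: "\<bar>(r x)\<^sup>2 * f (r x) * trace (A x)\<bar> \<le> B * \<bar>(r x)\<^sup>2 * trace (A x)\<bar>" for x
    using mult_right_mono[OF b[of x], of "\<bar>(r x)\<^sup>2 * trace (A x)\<bar>"] by (simp add: abs_mult mult_ac)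
  show i2: "integrable lborel (\<lambda>x. (r x)\<^sup>2 * f (r x) * trace (A x))"
    by (rule Bochner_Integration.integrable_bound[OF integrable_mult_right[OF integrable_abs[OF i], of B]])
      (use le B in \<open>auto simp: abs_mult\<close>)
  have "(LBINT x. \<bar>(r x)\<^sup>2 * f (r x) * trace (A x)\<bar>) \<le> (LBINT x. B * \<bar>(r x)\<^sup>2 * trace (A x)\<bar>)"
    by (intro integral_mono integrable_abs i2 integrable_mult_right i le)
  then show "(LBINT x. \<bar>(r x)\<^sup>2 * f (r x) * trace (A x)\<bar>) \<le> B * (LBINT x. \<bar>(r x)\<^sup>2 * trace (A x)\<bar>)"
    by simp
qed

text \<open>On [0, M], where r takes its values, f is a uniform limit of polynomials, and s^2 times
  a polynomial contains only powers from 2 on.\<close>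

lemma r2_trace_integral_zero:
  assumes f: "continuous_on UNIV f"
  shows "(LBINT x. (r x)\<^sup>2 * f (r x) * trace (A x)) = 0"
proof -
  have [measurable]: "f \<in> borel_measurable borel" by (rule borel_measurable_continuous_onI[OF f])
  have rM: "r x \<in> {0..M}" for x using r_nonneg r_le by simp
  have fb: "\<exists>B. \<forall>x. \<bar>g (r x)\<bar> \<le> B" if "continuous_on UNIV g" for g :: "real \<Rightarrow> real"
  proof -
    have "bounded (g ` {0..M})"
      using that by (intro compact_imp_bounded compact_continuous_image) (auto intro: continuous_on_subset)
    then obtain B where "\<forall>s\<in>{0..M}. \<bar>g s\<bar> \<le> B" by (auto simp: bounded_iff)
    then show ?thesis using rM by blast
  qed
  let ?I = "LBINT x. \<bar>(r x)\<^sup>2 * trace (A x)\<bar>"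
  have bnd: "\<bar>LBINT x. (r x)\<^sup>2 * f (r x) * trace (A x)\<bar> \<le> e * ?I" if e: "0 < e" for e
  proof -
    obtain g where g: "real_polynomial_function g" and ap: "\<And>s. s \<in> {0..M} \<Longrightarrow> \<bar>f s - g s\<bar> < e"
      using Stone_Weierstrass_real_polynomial_function[of "{0..M}" f e] f e
      by (metis compact_Icc continuous_on_subset subset_UNIV)
    obtain a n where gs: "g = (\<lambda>s. \<Sum>i\<le>n. a i * s ^ i)"
      using g unfolding real_polynomial_function_iff_sum by blast
    have cg: "continuous_on UNIV g" unfolding gs by (intro continuous_intros)
    have [measurable]: "g \<in> borel_measurable borel" by (rule borel_measurable_continuous_onI[OF cg])
    obtain Bf where Bf: "\<And>x. \<bar>f (r x)\<bar> \<le> Bf" using fb[OF f] by blast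
    obtain Bg where Bg: "\<And>x. \<bar>g (r x)\<bar> \<le> Bg" using fb[OF cg] by blast
    have pw: "integrable lborel (\<lambda>x. r x ^ Suc (Suc i) * trace (A x))" for i
      by (intro integrable_mult_L2 bounded_power_L2 r_integrable r_le_K trace_A_L2) measurable
    have "(LBINT x. (r x)\<^sup>2 * g (r x) * trace (A x)) = (LBINT x. (\<Sum>i\<le>n. a i * (r x ^ Suc (Suc i) * trace (A x))))"
      by (intro Bochner_Integration.integral_cong refl)
        (simp add: gs sum_distrib_left sum_distrib_right power2_eq_square mult_ac)
    also have "\<dots> = (\<Sum>i\<le>n. a i * (LBINT x. r x ^ Suc (Suc i) * trace (A x)))"
      using pw by (subst Bochner_Integration.integral_sum) (auto simp del: power_Suc)
    also have "\<dots> = 0" unfolding power_trace_integral_zero by simp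
    finally have g0: "(LBINT x. (r x)\<^sup>2 * g (r x) * trace (A x)) = 0" .
    have "(LBINT x. (r x)\<^sup>2 * f (r x) * trace (A x)) =
        (LBINT x. (r x)\<^sup>2 * f (r x) * trace (A x)) - (LBINT x. (r x)\<^sup>2 * g (r x) * trace (A x))"
      using g0 by simp
    also have "\<dots> = (LBINT x. (r x)\<^sup>2 * f (r x) * trace (A x) - (r x)\<^sup>2 * g (r x) * trace (A x))"
      by (intro Bochner_Integration.integral_diff[symmetric] r2_trace_integrable(1)[where f = f and B = Bf]
          r2_trace_integrable(1)[where f = g and B = Bg] Bf Bg) measurable
    also have "\<dots> = (LBINT x. (r x)\<^sup>2 * (f (r x) - g (r x)) * trace (A x))"
      by (simp add: algebra_simps)
    finally have eq: "(LBINT x. (r x)\<^sup>2 * f (r x) * trace (A x)) = (LBINT x. (r x)\<^sup>2 * (f (r x) - g (r x)) * trace (A x))" .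
    show ?thesis
      unfolding eq
      by (rule order_trans[OF integral_abs_bound r2_trace_integrable(2)[of "\<lambda>s. f s - g s"]])
        (use ap rM in \<open>auto intro: less_imp_le\<close>)
  qed
  have "(\<lambda>n. inverse (real (Suc n)) * ?I) \<longlonglongrightarrow> 0" using tendsto_mult_left_zero[OF LIMSEQ_inverse_real_of_nat] by simp
  then have "\<bar>LBINT x. (r x)\<^sup>2 * f (r x) * trace (A x)\<bar> \<le> 0"
    by (rule LIMSEQ_le_const) (use bnd in auto)
  then show ?thesis by simp
qed

lemma pressure_integral_zero:
  assumes P: "continuous_on {0..} P" "P 0 = 0" and i: "integrable lborel (\<lambda>x. (P (r x))\<^sup>2)"
  shows "(LBINT x. P (r x) * trace (A x)) = 0"
proof -
  \<comment> \<open>Constant extension to negative densities, to have continuity on the whole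
    line.\<close>
  define P' where "P' s = P (max 0 s)" for s
  have cP: "continuous_on UNIV P'"
    unfolding P'_def by (rule continuous_on_compose2[OF P(1)]) (auto intro!: continuous_intros)
  have [measurable]: "P' \<in> borel_measurable borel" by (rule borel_measurable_continuous_onI[OF cP])
  have PP: "P (r x) = P' (r x)" for x using r_nonneg by (simp add: P'_def max_absorb2)
  \<comment> \<open>The offset keeps the quotient continuous at density 0, and s^2 f(s) stays below
    |P'(s)|, which dominates the limit.\<close>
  define f where "f n s = P' s / (s\<^sup>2 + inverse (real (Suc n)))" for n s
  have pos: "s\<^sup>2 + inverse (real (Suc n)) > 0" for s :: real and n by (intro add_nonneg_pos) auto
  have cf: "continuous_on UNIV (f n)" for n
    unfolding f_def by (intro continuous_intros cP) (use pos in \<open>auto simp: less_imp_neq[symmetric]\<close>)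
  have [measurable]: "f n \<in> borel_measurable borel" for n by (rule borel_measurable_continuous_onI[OF cf])
  have lim: "(\<lambda>n. (r x)\<^sup>2 * f n (r x)) \<longlonglongrightarrow> P' (r x)" for x
  proof (cases "r x = 0")
    \<comment> \<open>In the vacuum all approximants are 0, so the limit is right because P 0 =
      0.\<close>
    case True
    then show ?thesis using P(2) by (simp add: P'_def)
  next
    case False
    have "(\<lambda>n. (r x)\<^sup>2 * f n (r x)) \<longlonglongrightarrow> (r x)\<^sup>2 * (P' (r x) / ((r x)\<^sup>2 + 0))"
      unfolding f_def by (intro tendsto_intros LIMSEQ_inverse_real_of_nat) (use False in auto)
    then show ?thesis using False by simp
  qed
  have le: "\<bar>(r x)\<^sup>2 * f n (r x)\<bar> \<le> \<bar>P' (r x)\<bar>" for n x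
  proof -
    have "(r x)\<^sup>2 * \<bar>P' (r x)\<bar> \<le> \<bar>P' (r x)\<bar> * ((r x)\<^sup>2 + inverse (real (Suc n)))"
      by (simp add: distrib_left mult.commute)
    then show ?thesis using pos[of "r x" n] by (simp add: f_def abs_mult abs_divide pos_divide_le_eq)
  qed
  have "(\<lambda>n. LBINT x. (r x)\<^sup>2 * f n (r x) * trace (A x)) \<longlonglongrightarrow> (LBINT x. P' (r x) * trace (A x))"
  proof (rule integral_dominated_convergence)
    show "integrable lborel (\<lambda>x. \<bar>P' (r x) * trace (A x)\<bar>)"
      using i unfolding PP by (intro integrable_abs integrable_mult_L2 trace_A_L2) auto
    show "AE x in lborel. (\<lambda>n. (r x)\<^sup>2 * f n (r x) * trace (A x)) \<longlonglongrightarrow> P' (r x) * trace (A x)"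
      by (intro AE_I2 tendsto_mult lim tendsto_const)
    show "AE x in lborel. norm ((r x)\<^sup>2 * f n (r x) * trace (A x)) \<le> \<bar>P' (r x) * trace (A x)\<bar>" for n
      unfolding real_norm_def abs_mult[of _ "trace _"] by (intro AE_I2 mult_right_mono le) auto
  qed measurable
  then show ?thesis
    unfolding r2_trace_integral_zero[OF cf] PP by (simp add: LIMSEQ_const_iff)
qed

text \<open>Weak differentiability of F with bounded gradient Dv suffices to test the continuity equation
  with F: the mollifying kernel is moved from F to the flux by Fubini.\<close>

lemma test_with_bounded_gradient:
  assumes F [measurable]: "F \<in> borel_measurable borel" and BF: "\<And>x. \<bar>F x\<bar> \<le> B"
    and Dv [measurable]: "Dv \<in> borel_measurable borel" and BD: "\<And>x. norm (Dv x) \<le> B"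
    and weak: "\<And>\<phi>. \<phi> \<in> Ccinf UNIV \<Longrightarrow> (LBINT x. F x *\<^sub>R grad \<phi> x) = - (LBINT x. \<phi> x *\<^sub>R Dv x)"
  shows "(LBINT x. (r x *\<^sub>R w x) \<bullet> Dv x) = 0"
proof -
  let ?q = "\<lambda>i x. r x * w x $ i"
  have q: "integrable lborel (?q i)" for i
    by (rule rw_component_integrable)
  have [measurable]: "(\<lambda>x. Dv x $ i) \<in> borel_measurable borel" for i
    using borel_measurable_inner[OF Dv, of "\<lambda>_. axis i 1"] by (simp add: inner_axis)
  have BDi: "\<bar>Dv x $ i\<bar> \<le> B" for x i using component_le_norm_cart[of "Dv x" i] BD[of x] by linarith
  \<comment> \<open>The weak gradient is tested with y |-> \<eta>((x - y)/d); this trades the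
    derivative of the kernel for Dv, at the price of a factor d.\<close>
  have conv: "(LBINT z. \<kappa> i z * F (x - d *\<^sub>R z)) = d * (LBINT z. \<eta> z * Dv (x - d *\<^sub>R z) $ i)" if d: "d > 0" for d x i
  proof -
    define \<phi> where "\<phi> y = \<eta> ((1/d) *\<^sub>R x + (- 1/d) *\<^sub>R y)" for y
    have \<phi>: "\<phi> \<in> Ccinf UNIV" unfolding \<phi>_def by (rule Ccinf_affine[OF \<eta>_Ccinf]) (use d in auto)
    have g: "grad \<phi> y = (- 1/d) *\<^sub>R grad \<eta> ((1/d) *\<^sub>R x + (- 1/d) *\<^sub>R y)" for y
      unfolding \<phi>_def by (rule grad_affine[OF Ccinf_differentiable[OF \<eta>_Ccinf]])
    have arg: "(1/d) *\<^sub>R x + (- 1/d) *\<^sub>R (x + (- d) *\<^sub>R z) = z" for z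
      using d by (simp add: scaleR_right_diff_distrib)
    have c: "- d \<noteq> 0" using d by simp
    note [measurable] = Ccinf_measurable[OF \<phi>] Ccinf_grad_measurable[OF \<phi>]
    have 1: "(LBINT y. F y *\<^sub>R grad \<phi> y) = \<bar>- d\<bar> ^ DIM(real^3) *\<^sub>R ((- 1/d) *\<^sub>R (LBINT z. F (x - d *\<^sub>R z) *\<^sub>R grad \<eta> z))"
      using lborel_integral_affine[OF _ c, of "\<lambda>y. F y *\<^sub>R grad \<phi> y" x]
      unfolding g arg by (simp add: integral_scaleR_right[symmetric] scaleR_left_commute del: integral_scaleR_right)
    have 2: "(LBINT y. \<phi> y *\<^sub>R Dv y) = \<bar>- d\<bar> ^ DIM(real^3) *\<^sub>R (LBINT z. \<eta> z *\<^sub>R Dv (x - d *\<^sub>R z))"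
      using lborel_integral_affine[OF _ c, of "\<lambda>y. \<phi> y *\<^sub>R Dv y" x] by (simp add: \<phi>_def[of "x - _"] \<phi>_def[of "x + _"] arg[simplified])
    have "\<bar>- d\<bar> ^ DIM(real^3) *\<^sub>R ((- 1/d) *\<^sub>R (LBINT z. F (x - d *\<^sub>R z) *\<^sub>R grad \<eta> z))
        = \<bar>- d\<bar> ^ DIM(real^3) *\<^sub>R (- (LBINT z. \<eta> z *\<^sub>R Dv (x - d *\<^sub>R z)))"
      using weak[OF \<phi>] unfolding 1 2 by (simp only: scaleR_minus_right)
    then have "(- 1/d) *\<^sub>R (LBINT z. F (x - d *\<^sub>R z) *\<^sub>R grad \<eta> z) = - (LBINT z. \<eta> z *\<^sub>R Dv (x - d *\<^sub>R z))"
      using d by (subst (asm) scaleR_cancel_left) auto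
    then have e: "(LBINT z. F (x - d *\<^sub>R z) *\<^sub>R grad \<eta> z) = d *\<^sub>R (LBINT z. \<eta> z *\<^sub>R Dv (x - d *\<^sub>R z))"
      using d by (simp add: vec_eq_iff field_simps)
    have i1: "integrable lborel (\<lambda>z. F (x - d *\<^sub>R z) *\<^sub>R grad \<eta> z)"
    proof (rule Bochner_Integration.integrable_bound[OF integrable_scaleR_right[OF Ccinf_grad_integrable[OF \<eta>_Ccinf], of B]])
      show "AE z in lborel. norm (F (x - d *\<^sub>R z) *\<^sub>R grad \<eta> z) \<le> norm (B *\<^sub>R grad \<eta> z)"
        using order_trans[OF BF abs_ge_self] by (intro AE_I2) (simp add: mult_right_mono)
    qed measurable
    have i2: "integrable lborel (\<lambda>z. \<eta> z *\<^sub>R Dv (x - d *\<^sub>R z))"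
    proof (rule Bochner_Integration.integrable_bound[OF integrable_mult_right[OF \<eta>_integrable, of B]])
      show "AE z in lborel. norm (\<eta> z *\<^sub>R Dv (x - d *\<^sub>R z)) \<le> norm (B * \<eta> z)"
        using order_trans[OF BD abs_ge_self] by (intro AE_I2) (simp add: abs_mult mult.commute[of "\<bar>B\<bar>"] mult_left_mono)
    qed measurable
    have "(LBINT z. F (x - d *\<^sub>R z) *\<^sub>R grad \<eta> z) \<bullet> axis i 1 = d * ((LBINT z. \<eta> z *\<^sub>R Dv (x - d *\<^sub>R z)) \<bullet> axis i 1)"
      unfolding e by simp
    then show ?thesis
      unfolding integral_inner_left[symmetric, of "axis i 1", OF i1] integral_inner_left[symmetric, of "axis i 1", OF i2]
      by (simp add: inner_axis mult.commute)
  qed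
  \<comment> \<open>\<open>\<Theta> h\<close> pairs Dv with the flux shifted by h, and its value at
    0 is the integral in question.\<close>
  define \<Theta> where "\<Theta> h = (\<Sum>i\<in>UNIV. LBINT y. Dv y $ i * ?q i (y + h))" for h
  have i_inner: "integrable lborel (\<lambda>y. Dv y $ i * ?q i (y + h))" for i h
    using shifted_product_integrable_inner[OF \<eta>_integrable q[of i] _ BDi[of _ i], where d = 1 and z = h] by simp
  \<comment> \<open>In the continuity equation weighted with F, the kernel is moved onto F, its
    derivative replaced by Dv, and the kernel moved back to the flux.\<close>
  have zero: "(LBINT z. \<eta> z * \<Theta> (d *\<^sub>R z)) = 0" if d: "d > 0" for d
  proof -
    note E = continuity_equation_weighted[OF F BF d]
    have "(LBINT y. LBINT z. \<kappa> i z * (F y * ?q i (y + d *\<^sub>R z)))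
        = d * (LBINT z. \<eta> z * (LBINT y. Dv y $ i * ?q i (y + d *\<^sub>R z)))" for i
    proof -
      have "(LBINT y. LBINT z. \<kappa> i z * (F y * ?q i (y + d *\<^sub>R z)))
          = (LBINT y. ?q i y * (LBINT z. \<kappa> i z * F (y - d *\<^sub>R z)))"
        unfolding shifted_product_swap[OF \<kappa>_integrable[of i] q[of i] F BF]
          shifted_product_swap'[OF \<kappa>_integrable[of i] q[of i] F BF] ..
      also have "\<dots> = d * (LBINT y. ?q i y * (LBINT z. \<eta> z * Dv (y - d *\<^sub>R z) $ i))"
        unfolding conv[OF d] integral_mult_right_zero[symmetric] by (simp only: mult.left_commute)
      also have "(LBINT y. ?q i y * (LBINT z. \<eta> z * Dv (y - d *\<^sub>R z) $ i))
          = (LBINT z. \<eta> z * (LBINT y. Dv y $ i * ?q i (y + d *\<^sub>R z)))"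
        by (rule shifted_product_swap'[OF \<eta>_integrable q[of i] _ BDi[of _ i]]) measurable
      finally show ?thesis .
    qed
    then have "d * (\<Sum>i\<in>UNIV. LBINT z. \<eta> z * (LBINT y. Dv y $ i * ?q i (y + d *\<^sub>R z))) = 0"
      using E by (simp add: sum_distrib_left)
    moreover have "(LBINT z. \<eta> z * \<Theta> (d *\<^sub>R z)) = (\<Sum>i\<in>UNIV. LBINT z. \<eta> z * (LBINT y. Dv y $ i * ?q i (y + d *\<^sub>R z)))"
      unfolding \<Theta>_def sum_distrib_left
      by (rule Bochner_Integration.integral_sum)
        (rule shifted_product_integrable[OF \<eta>_integrable q _ BDi], measurable)
    ultimately show ?thesis using d by simp
  qed
  have \<Theta>0: "\<Theta> 0 = (LBINT x. (r x *\<^sub>R w x) \<bullet> Dv x)"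
    unfolding \<Theta>_def using i_inner[of _ 0]
    by (subst Bochner_Integration.integral_sum[symmetric])
      (auto intro!: Bochner_Integration.integral_cong simp: inner_vec_def mult_ac)
  have \<Theta>_lim: "(\<lambda>n. \<Theta> (h n)) \<longlonglongrightarrow> \<Theta> 0" if h: "h \<longlonglongrightarrow> 0" for h
    unfolding \<Theta>_def
  proof (intro tendsto_sum)
    fix i :: 3
    show "(\<lambda>n. LBINT y. Dv y $ i * ?q i (y + h n)) \<longlonglongrightarrow> (LBINT y. Dv y $ i * ?q i (y + 0))"
    proof (rule tendsto_norm_bound)
      show "(\<lambda>n. B * (LBINT y. norm (?q i (y + h n) - ?q i y))) \<longlonglongrightarrow> 0"
        by (intro tendsto_mult_right_zero L1_translation_continuous q h)
      fix n
      note tr = lborel_integrable_translate[OF q[of i], of "h n"]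
      have "(LBINT y. Dv y $ i * ?q i (y + h n)) - (LBINT y. Dv y $ i * ?q i (y + 0))
          = (LBINT y. Dv y $ i * (?q i (y + h n) - ?q i y))"
        using i_inner[of i "h n"] i_inner[of i 0] by (subst Bochner_Integration.integral_diff[symmetric]) (auto simp: right_diff_distrib)
      then have "norm ((LBINT y. Dv y $ i * ?q i (y + h n)) - (LBINT y. Dv y $ i * ?q i (y + 0)))
          \<le> (LBINT y. \<bar>Dv y $ i * (?q i (y + h n) - ?q i y)\<bar>)"
        by (simp only: real_norm_def integral_abs_bound)
      also have "\<dots> \<le> (LBINT y. B * norm (?q i (y + h n) - ?q i y))"
      proof (rule integral_mono)
        show "integrable lborel (\<lambda>y. \<bar>Dv y $ i * (?q i (y + h n) - ?q i y)\<bar>)"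
          using Bochner_Integration.integrable_diff[OF i_inner[of i "h n"] i_inner[of i 0]]
          by (intro integrable_abs) (simp add: right_diff_distrib)
        show "integrable lborel (\<lambda>y. B * norm (?q i (y + h n) - ?q i y))"
          by (intro integrable_mult_right integrable_norm Bochner_Integration.integrable_diff tr q)
        show "\<bar>Dv y $ i * (?q i (y + h n) - ?q i y)\<bar> \<le> B * norm (?q i (y + h n) - ?q i y)" for y
          unfolding abs_mult real_norm_def by (intro mult_right_mono BDi) auto
      qed
      finally show "norm ((LBINT y. Dv y $ i * ?q i (y + h n)) - (LBINT y. Dv y $ i * ?q i (y + 0)))
        \<le> B * (LBINT y. norm (?q i (y + h n) - ?q i y))" by simp
    qed
  qed
  define C where "C = (\<Sum>i\<in>(UNIV::3 set). B * (LBINT y. \<bar>?q i y\<bar>))"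
  have \<Theta>_bound: "\<bar>\<Theta> h\<bar> \<le> C" for h
    unfolding \<Theta>_def C_def
  proof (rule order_trans[OF sum_abs sum_mono])
    fix i :: 3
    have "\<bar>LBINT y. Dv y $ i * ?q i (y + h)\<bar> \<le> (LBINT y. B * \<bar>?q i (y + h)\<bar>)"
    proof (rule order_trans[OF integral_abs_bound integral_mono[OF integrable_abs[OF i_inner]]])
      show "integrable lborel (\<lambda>y. B * \<bar>?q i (y + h)\<bar>)"
        by (intro integrable_mult_right integrable_abs lborel_integrable_translate[OF q[of i]])
      show "\<bar>Dv y $ i * ?q i (y + h)\<bar> \<le> B * \<bar>?q i (y + h)\<bar>" for y
        unfolding abs_mult[of "Dv y $ i"] by (intro mult_right_mono BDi) auto
    qed
    also have "\<dots> = B * (LBINT y. \<bar>?q i y\<bar>)"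
      using lborel_integral_translate[of "\<lambda>y. \<bar>?q i y\<bar>" h] by simp
    finally show "\<bar>LBINT y. Dv y $ i * ?q i (y + h)\<bar> \<le> B * (LBINT y. \<bar>?q i y\<bar>)" .
  qed
  have C0: "0 \<le> C" using \<Theta>_bound[of 0] by linarith
  let ?d = "\<lambda>n. inverse (real (Suc n))"
  have [measurable]: "\<Theta> \<in> borel_measurable borel"
    unfolding \<Theta>_def[abs_def] by measurable
  \<comment> \<open>\<open>\<Theta>\<close> is bounded and continuous at 0, so its vanishing
    averages tend to its value there.\<close>
  have "(\<lambda>n. LBINT z. \<eta> z * \<Theta> (?d n *\<^sub>R z)) \<longlonglongrightarrow> (LBINT z. \<eta> z * \<Theta> 0)"
  proof (rule integral_dominated_convergence)
    show "integrable lborel (\<lambda>z. C * \<bar>\<eta> z\<bar>)" using \<eta>_integrable by simp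
    show "AE z in lborel. (\<lambda>n. \<eta> z * \<Theta> (?d n *\<^sub>R z)) \<longlonglongrightarrow> \<eta> z * \<Theta> 0"
      by (intro AE_I2 tendsto_mult tendsto_const \<Theta>_lim scaled_null LIMSEQ_inverse_real_of_nat)
    show "AE z in lborel. norm (\<eta> z * \<Theta> (?d n *\<^sub>R z)) \<le> C * \<bar>\<eta> z\<bar>" for n
      by (intro AE_I2) (simp add: abs_mult mult.commute[of C] mult_left_mono \<Theta>_bound)
  qed measurable
  moreover have "(LBINT z. \<eta> z * \<Theta> (?d n *\<^sub>R z)) = 0" for n by (rule zero) simp
  moreover have "(LBINT z. \<eta> z * \<Theta> 0) = \<Theta> 0" using \<eta>_integral by simp
  ultimately have "0 = \<Theta> 0" by (simp only: LIMSEQ_const_iff)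
  then show ?thesis using \<Theta>0 by simp
qed

end

subsection \<open>Bounded potentials\<close>

text \<open>Both rest on 2 a e <= a^2 + e^2. The quotient is the coefficient in the gradient of
  a^2/(a^2 + e^2), where a is the length of a vector field; the first bound is used at fixed e, the
  second is uniform in e.\<close>

lemma saturation_bounds:
  fixes a e :: real
  assumes "0 \<le> a" "0 < e"
  shows "2 * e\<^sup>2 / (a\<^sup>2 + e\<^sup>2)\<^sup>2 * a \<le> 1 / e" "2 * e\<^sup>2 / (a\<^sup>2 + e\<^sup>2)\<^sup>2 * a\<^sup>2 \<le> 1"
proof -
  have pos: "0 < (a\<^sup>2 + e\<^sup>2)\<^sup>2" using assms by (simp add: add_nonneg_pos)
  have amgm: "2 * a * e \<le> a\<^sup>2 + e\<^sup>2" using sum_squares_bound[of a e] .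
  have "e\<^sup>2 * (2 * a * e) \<le> (a\<^sup>2 + e\<^sup>2) * (a\<^sup>2 + e\<^sup>2)" using assms by (intro mult_mono amgm) auto
  then have "2 * e\<^sup>2 * a * e \<le> (a\<^sup>2 + e\<^sup>2)\<^sup>2" by (simp add: power2_eq_square mult_ac)
  then show "2 * e\<^sup>2 / (a\<^sup>2 + e\<^sup>2)\<^sup>2 * a \<le> 1 / e"
    using pos assms by (simp add: pos_divide_le_eq pos_le_divide_eq)
  have "(2 * a * e) * (2 * a * e) \<le> (a\<^sup>2 + e\<^sup>2) * (a\<^sup>2 + e\<^sup>2)" using assms by (intro mult_mono amgm) auto
  moreover have "0 \<le> a\<^sup>2 * e\<^sup>2" by simp
  ultimately have "2 * e\<^sup>2 * a\<^sup>2 \<le> (a\<^sup>2 + e\<^sup>2)\<^sup>2" by (simp add: power2_eq_square mult_ac)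
  then show "2 * e\<^sup>2 / (a\<^sup>2 + e\<^sup>2)\<^sup>2 * a\<^sup>2 \<le> 1" using pos by (simp add: pos_divide_le_eq)
qed

lemma tendsto_outer:
  fixes f :: "'z \<Rightarrow> real^'p" and g :: "'z \<Rightarrow> real^'q"
  shows "(f \<longlongrightarrow> a) F \<Longrightarrow> (g \<longlongrightarrow> b) F \<Longrightarrow> ((\<lambda>x. outer (f x) (g x)) \<longlongrightarrow> outer a b) F"
  unfolding outer_def by (intro tendsto_intros)

context mollified_flow
begin

lemma AE_subsequence: "\<exists>s::nat \<Rightarrow> nat. strict_mono s \<and> (AE x in lborel. (\<lambda>n. U (s n) x) \<longlonglongrightarrow> w x)"
proof -
  obtain s :: "nat \<Rightarrow> nat" where s: "strict_mono s" "AE x in lborel. (\<lambda>n. norm (U (s n) x - w x)) \<longlonglongrightarrow> 0"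
    using tendsto_L1_AE_subseq[where u = "\<lambda>n x. norm (U n x - w x) ^ 6", OF Uw_L6] U_lim by auto
  from s(2) have "AE x in lborel. (\<lambda>n. U (s n) x) \<longlonglongrightarrow> w x"
    by eventually_elim (rule LIM_zero_cancel[OF tendsto_norm_zero_cancel])
  with s(1) show ?thesis by blast
qed

text \<open>A smooth cutoff with values in [0, 1] that vanishes where U n does and tends to 1
  elsewhere as e tends to 0.\<close>

definition "sat e n x = sq n x * inverse (sq n x + e\<^sup>2)"

lemma sq_nonneg: "0 \<le> sq n x" by (simp add: sq_eq)

lemma
  assumes \<Omega>: "\<And>n i. (\<lambda>x. U n x $ i) \<in> Ccinf \<Omega>" and e: "0 < e"
  shows sat_Ccinf: "sat e n \<in> Ccinf \<Omega>"
    and grad_sat: "grad (sat e n) x = (e\<^sup>2 / (sq n x + e\<^sup>2)\<^sup>2) *\<^sub>R grad (sq n) x"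
    and sat_le: "\<bar>sat e n x\<bar> \<le> 1"
proof -
  have pos: "0 < sq n x + e\<^sup>2" for x using sq_nonneg e by (simp add: add_nonneg_pos)
  note sqC = sq_Ccinf[OF \<Omega>]
  have "Ck k (\<lambda>x. inverse (sq n x + e\<^sup>2))" for k
    by (intro Ck_inverse Ck_add Ck_const) (use pos sqC in \<open>auto simp: Ccinf_iff less_imp_neq[symmetric]\<close>)
  then show "sat e n \<in> Ccinf \<Omega>"
    unfolding sat_def[abs_def] by (intro Ccinf_mult sqC) auto
  have "((\<lambda>s. s * inverse (s + e\<^sup>2)) has_real_derivative e\<^sup>2 / (sq n x + e\<^sup>2)\<^sup>2) (at (sq n x))"
  proof -
    have ne: "sq n x + e\<^sup>2 \<noteq> 0" using pos[of x] by simp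
    then show ?thesis
      by (auto intro!: derivative_eq_intros simp: divide_simps power2_eq_square)
  qed
  from DERIV_compose_FDERIV[OF this Ccinf_has_derivative[OF sqC]]
  show "grad (sat e n) x = (e\<^sup>2 / (sq n x + e\<^sup>2)\<^sup>2) *\<^sub>R grad (sq n) x"
    unfolding sat_def[abs_def] by (intro grad_eqI) (simp add: mult.commute)
  show "\<bar>sat e n x\<bar> \<le> 1"
    using pos[of x] sq_nonneg[of n x] by (simp add: sat_def abs_mult divide_inverse[symmetric] pos_divide_le_eq)
qed

text \<open>For any test function \<phi> on the whole space, the product of \<phi> with the cutoff
  is a test function in \<Omega>, so the weak gradient of G applies to it. Hence G times the cutoff
  has a bounded weak gradient on the whole space and can be used in the continuity equation.\<close>

lemma saturated_force_identity:
  assumes \<Omega>: "\<And>n i. (\<lambda>x. U n x $ i) \<in> Ccinf \<Omega>" and e: "0 < e"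
    and G [measurable]: "G \<in> borel_measurable borel" and BG: "\<And>x. \<bar>G x\<bar> \<le> B"
    and g [measurable]: "g \<in> borel_measurable borel" and Bg: "\<And>x. norm (g x) \<le> B"
    and weak: "\<And>\<phi>. \<phi> \<in> Ccinf \<Omega> \<Longrightarrow> (LBINT x. G x *\<^sub>R grad \<phi> x) = - (LBINT x. \<phi> x *\<^sub>R g x)"
  shows "(LBINT x. (r x *\<^sub>R w x) \<bullet> (sat e n x *\<^sub>R g x + G x *\<^sub>R grad (sat e n) x)) = 0"
proof -
  note \<psi> = sat_Ccinf[OF \<Omega> e, of n]
  note [measurable] = Ccinf_measurable[OF \<psi>] Ccinf_grad_measurable[OF \<psi>]
  have B0: "0 \<le> B" using order_trans[OF norm_ge_zero Bg] .
  obtain C where C: "C > 0" "\<And>x. norm (grad (sat e n) x) \<le> C" using Ccinf_grad_bounded[OF \<psi>] by blast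
  show ?thesis
  proof (rule test_with_bounded_gradient[where F = "\<lambda>x. G x * sat e n x" and B = "B + B * C"])
    show "\<bar>G x * sat e n x\<bar> \<le> B + B * C" for x
    proof -
      have "\<bar>G x * sat e n x\<bar> \<le> B * 1" unfolding abs_mult by (intro mult_mono BG sat_le[OF \<Omega> e] B0) auto
      then show ?thesis using B0 C(1) by (simp add: add_increasing2)
    qed
    show "norm (sat e n x *\<^sub>R g x + G x *\<^sub>R grad (sat e n) x) \<le> B + B * C" for x
    proof (rule norm_triangle_le[OF add_mono])
      show "norm (sat e n x *\<^sub>R g x) \<le> B" using mult_mono[OF sat_le[OF \<Omega> e, of n x] Bg[of x]] by simp
      show "norm (G x *\<^sub>R grad (sat e n) x) \<le> B * C" unfolding norm_scaleR by (intro mult_mono BG C B0) auto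
    qed
    fix \<phi> :: "real^3 \<Rightarrow> real" assume \<phi>: "\<phi> \<in> Ccinf UNIV"
    note [measurable] = Ccinf_measurable[OF \<phi>] Ccinf_grad_measurable[OF \<phi>]
    have \<psi>\<phi>: "(\<lambda>x. sat e n x * \<phi> x) \<in> Ccinf \<Omega>"
      by (rule Ccinf_mult[OF \<psi>]) (use \<phi> in \<open>simp add: Ccinf_iff\<close>)
    have gr: "grad (\<lambda>x. sat e n x * \<phi> x) x = sat e n x *\<^sub>R grad \<phi> x + \<phi> x *\<^sub>R grad (sat e n) x" for x
      by (rule grad_mult[OF Ccinf_differentiable[OF \<psi>] Ccinf_differentiable[OF \<phi>]])
    have i1: "integrable lborel (\<lambda>x. (G x * sat e n x) *\<^sub>R grad \<phi> x)"
    proof (rule Bochner_Integration.integrable_bound[OF integrable_scaleR_right[OF Ccinf_grad_integrable[OF \<phi>], of B]])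
      have "\<bar>G x * sat e n x\<bar> \<le> \<bar>B\<bar>" for x
        using mult_mono[OF BG[of x] sat_le[OF \<Omega> e, of n x]] B0 by (simp add: abs_mult)
      then show "AE x in lborel. norm ((G x * sat e n x) *\<^sub>R grad \<phi> x) \<le> norm (B *\<^sub>R grad \<phi> x)"
        by (intro AE_I2) (simp add: mult_right_mono)
    qed measurable
    have i2: "integrable lborel (\<lambda>x. \<phi> x *\<^sub>R (G x *\<^sub>R grad (sat e n) x))"
    proof (rule Bochner_Integration.integrable_bound[OF integrable_mult_right[OF Ccinf_integrable[OF \<phi>], of "B * C"]])
      have "norm (G x *\<^sub>R grad (sat e n) x) \<le> \<bar>B * C\<bar>" for x
        using mult_mono[OF BG[of x] C(2)[of x]] B0 C(1) by simp
      then show "AE x in lborel. norm (\<phi> x *\<^sub>R (G x *\<^sub>R grad (sat e n) x)) \<le> norm (B * C * \<phi> x)"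
        unfolding norm_scaleR real_norm_def abs_mult[of "B * C"] mult.commute[of "\<bar>B * C\<bar>"]
        by (intro AE_I2 mult_left_mono) auto
    qed measurable
    have i3: "integrable lborel (\<lambda>x. \<phi> x *\<^sub>R (sat e n x *\<^sub>R g x))"
    proof (rule Bochner_Integration.integrable_bound[OF integrable_mult_right[OF Ccinf_integrable[OF \<phi>], of B]])
      have "norm (sat e n x *\<^sub>R g x) \<le> \<bar>B\<bar>" for x using mult_mono[OF sat_le[OF \<Omega> e, of n x] Bg[of x]] by simp
      then show "AE x in lborel. norm (\<phi> x *\<^sub>R (sat e n x *\<^sub>R g x)) \<le> norm (B * \<phi> x)"
        unfolding norm_scaleR[of "\<phi> _"] real_norm_def abs_mult[of B] mult.commute[of "\<bar>B\<bar>"]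
        by (intro AE_I2 mult_left_mono) auto
    qed measurable
    have "(LBINT x. G x *\<^sub>R grad (\<lambda>x. sat e n x * \<phi> x) x) =
      (LBINT x. (G x * sat e n x) *\<^sub>R grad \<phi> x) + (LBINT x. \<phi> x *\<^sub>R (G x *\<^sub>R grad (sat e n) x))"
      unfolding gr Bochner_Integration.integral_add[OF i1 i2, symmetric]
      by (intro Bochner_Integration.integral_cong refl) (simp add: scaleR_right_distrib mult.commute)
    moreover have "(LBINT x. (sat e n x * \<phi> x) *\<^sub>R g x) = (LBINT x. \<phi> x *\<^sub>R (sat e n x *\<^sub>R g x))"
      by (simp add: mult.commute)
    moreover have "(LBINT x. \<phi> x *\<^sub>R (sat e n x *\<^sub>R g x + G x *\<^sub>R grad (sat e n) x)) =
      (LBINT x. \<phi> x *\<^sub>R (sat e n x *\<^sub>R g x)) + (LBINT x. \<phi> x *\<^sub>R (G x *\<^sub>R grad (sat e n) x))"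
      unfolding Bochner_Integration.integral_add[OF i3 i2, symmetric]
      by (simp only: scaleR_right_distrib)
    ultimately show "(LBINT x. (G x * sat e n x) *\<^sub>R grad \<phi> x) =
        - (LBINT x. \<phi> x *\<^sub>R (sat e n x *\<^sub>R g x + G x *\<^sub>R grad (sat e n) x))"
      using weak[OF \<psi>\<phi>] by (simp add: algebra_simps)
  qed measurable
qed

text \<open>A potential of class W^{1,inf} need not extend across the boundary.  It is cut off by
  |u|^2 / (|u|^2 + e^2), which is approximated by test functions because u vanishes on the boundary;
  the gradient of the cutoff disappears as e tends to 0 since |u| times it is bounded by |grad u|.\<close>

lemma potential_force_zero_bounded:
  assumes \<Omega>: "\<And>n i. (\<lambda>x. U n x $ i) \<in> Ccinf \<Omega>"
    and G [measurable]: "G \<in> borel_measurable borel" and BG: "\<And>x. \<bar>G x\<bar> \<le> B"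
    and g [measurable]: "g \<in> borel_measurable borel" and Bg: "\<And>x. norm (g x) \<le> B"
    and weak: "\<And>\<phi>. \<phi> \<in> Ccinf \<Omega> \<Longrightarrow> (LBINT x. G x *\<^sub>R grad \<phi> x) = - (LBINT x. \<phi> x *\<^sub>R g x)"
  shows "(LBINT x. (r x *\<^sub>R w x) \<bullet> g x) = 0"
proof -
  have B0: "0 \<le> B" using order_trans[OF norm_ge_zero Bg] .
  obtain s :: "nat \<Rightarrow> nat" where s: "strict_mono s" and ae: "AE x in lborel. (\<lambda>n. U (s n) x) \<longlonglongrightarrow> w x"
    using AE_subsequence by blast
  \<comment> \<open>At v = U n, the product of \<open>c e v x\<close> with \<open>D n x\<close> is G
    r w . grad of the cutoff. Both \<open>c\<close> and \<open>H\<close> are functions of the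
    velocity v, so that U n can be replaced by w.\<close>
  define c where "c e v x = (G x * r x * (2 * e\<^sup>2 / ((norm v)\<^sup>2 + e\<^sup>2)\<^sup>2)) *\<^sub>R outer v (w x)" for e and v :: "real^3" and x
  define H where "H e v = (norm v)\<^sup>2 * inverse ((norm v)\<^sup>2 + e\<^sup>2)" for e and v :: "real^3"
  have pos: "0 < (norm v)\<^sup>2 + e\<^sup>2" if "0 < e" for e and v :: "real^3" using that by (simp add: add_nonneg_pos)
  have c_meas [measurable]: "(\<lambda>x. c e (v x) x) \<in> borel_measurable borel" if [measurable]: "v \<in> borel_measurable borel" for e v
    unfolding c_def by measurable
  have H_meas [measurable]: "(\<lambda>x. H e (v x)) \<in> borel_measurable borel" if [measurable]: "v \<in> borel_measurable borel" for e v
    unfolding H_def by measurable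
  have H_le: "0 \<le> H e v" "H e v \<le> 1" if "0 < e" for e v
    using pos[OF that, of v] by (simp_all add: H_def divide_inverse[symmetric] pos_divide_le_eq)
  have nc: "norm (c e v x) = \<bar>G x\<bar> * (r x * norm (w x)) * (2 * e\<^sup>2 / ((norm v)\<^sup>2 + e\<^sup>2)\<^sup>2 * norm v)" for e v x
    using r_nonneg by (simp add: c_def norm_outer abs_mult)
  have c_le: "norm (c e v x) \<le> B * (r x * norm (w x)) * (1 / e)" if e: "0 < e" for e v x
    unfolding nc using e r_nonneg B0 by (intro mult_mono BG saturation_bounds(1)) auto
  have crw: "norm (c e v x) \<le> B / e * norm (r x *\<^sub>R w x)" if e: "0 < e" for e v x
    using c_le[OF e, of v x] r_nonneg by simp
  have rwg_le: "\<bar>(r x *\<^sub>R w x) \<bullet> g x\<bar> \<le> B * norm (r x *\<^sub>R w x)" for x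
    using order_trans[OF Cauchy_Schwarz_ineq2[of "r x *\<^sub>R w x" "g x"] mult_left_mono[OF Bg norm_ge_zero]]
    by (simp add: mult.commute)
  have i_rwg: "integrable lborel (\<lambda>x. (r x *\<^sub>R w x) \<bullet> g x)"
    by (rule Bochner_Integration.integrable_bound[OF integrable_mult_right[OF integrable_norm[OF rw_integrable], of B]])
      (use rwg_le B0 in \<open>auto simp: abs_mult\<close>)
  have c_L2: "integrable lborel (\<lambda>x. (norm (c e (v x) x))\<^sup>2)" if e: "0 < e" and [measurable]: "v \<in> borel_measurable borel" for e v
  proof (rule Bochner_Integration.integrable_bound[OF integrable_mult_right[OF rw_L2, of "(B / e)\<^sup>2"]])
    show "AE x in lborel. norm ((norm (c e (v x) x))\<^sup>2) \<le> norm ((B / e)\<^sup>2 * (norm (r x *\<^sub>R w x))\<^sup>2)"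
      using power_mono[OF crw[OF e] norm_ge_zero, of _ _ 2] unfolding power_mult_distrib by (intro AE_I2) simp
  qed measurable
  \<comment> \<open>The limit in n at fixed e: coefficients converge almost everywhere along a
    subsequence, dominated by a multiple of r |w| that may grow like 1/e.\<close>
  have id: "(LBINT x. H e (w x) * ((r x *\<^sub>R w x) \<bullet> g x)) + (LBINT x. c e (w x) x \<bullet> A x) = 0" if e: "0 < e" for e
  proof -
    have i1: "integrable lborel (\<lambda>x. H e (v x) * ((r x *\<^sub>R w x) \<bullet> g x))" if [measurable]: "v \<in> borel_measurable borel" for v
      by (rule Bochner_Integration.integrable_bound[OF i_rwg])
        (use H_le[OF e] in \<open>auto simp: abs_mult intro!: mult_left_le_one_le\<close>)
    have i2: "integrable lborel (\<lambda>x. c e (U n x) x \<bullet> D n x)" for n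
      by (intro integrable_inner_L2 c_L2 e D_L2) measurable
    have id_n: "(LBINT x. H e (U n x) * ((r x *\<^sub>R w x) \<bullet> g x)) + (LBINT x. c e (U n x) x \<bullet> D n x) = 0" for n
    proof -
      have "H e (U n x) * ((r x *\<^sub>R w x) \<bullet> g x) + c e (U n x) x \<bullet> D n x =
          (r x *\<^sub>R w x) \<bullet> (sat e n x *\<^sub>R g x + G x *\<^sub>R grad (sat e n) x)" for x
        unfolding grad_sat[OF \<Omega> e] inner_add_right
        using inner_grad_sq[of "w x" n x] by (simp add: H_def c_def sat_def sq_eq)
      then show ?thesis
        unfolding Bochner_Integration.integral_add[OF i1[OF U_measurable] i2, symmetric]
        using saturated_force_identity[OF \<Omega> e G BG g Bg weak, of n] by simp
    qed
    have lim1: "(\<lambda>n. LBINT x. H e (U (s n) x) * ((r x *\<^sub>R w x) \<bullet> g x)) \<longlonglongrightarrow> (LBINT x. H e (w x) * ((r x *\<^sub>R w x) \<bullet> g x))"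
    proof (rule integral_dominated_convergence)
      show "integrable lborel (\<lambda>x. \<bar>(r x *\<^sub>R w x) \<bullet> g x\<bar>)" using i_rwg by (rule integrable_abs)
      show "AE x in lborel. (\<lambda>n. H e (U (s n) x) * ((r x *\<^sub>R w x) \<bullet> g x)) \<longlonglongrightarrow> H e (w x) * ((r x *\<^sub>R w x) \<bullet> g x)"
        using ae
      proof eventually_elim
        case (elim x)
        show ?case unfolding H_def
          by (intro tendsto_intros elim) (use e in simp)
      qed
      show "AE x in lborel. norm (H e (U (s n) x) * ((r x *\<^sub>R w x) \<bullet> g x)) \<le> \<bar>(r x *\<^sub>R w x) \<bullet> g x\<bar>" for n
        using H_le[OF e] by (intro AE_I2) (simp add: abs_mult mult_left_le_one_le)
    qed measurable
    have limc: "(\<lambda>n. LBINT x. (norm (c e (U (s n) x) x - c e (w x) x))\<^sup>2) \<longlonglongrightarrow> (\<integral>x. 0 \<partial>(lborel :: (real^3) measure))"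
    proof (rule integral_dominated_convergence)
      show "integrable lborel (\<lambda>x. (2 * (B / e))\<^sup>2 * (norm (r x *\<^sub>R w x))\<^sup>2)" using rw_L2 by (rule integrable_mult_right)
      show "AE x in lborel. (\<lambda>n. (norm (c e (U (s n) x) x - c e (w x) x))\<^sup>2) \<longlonglongrightarrow> 0"
        using ae
      proof eventually_elim
        case (elim x)
        have "(\<lambda>n. c e (U (s n) x) x) \<longlonglongrightarrow> c e (w x) x"
          unfolding c_def by (intro tendsto_intros tendsto_outer elim) (use e in simp)
        then have "(\<lambda>n. (norm (c e (U (s n) x) x - c e (w x) x))\<^sup>2) \<longlonglongrightarrow> (norm (c e (w x) x - c e (w x) x))\<^sup>2"
          by (intro tendsto_intros)
        then show ?case by simp
      qed
      show "AE x in lborel. norm ((norm (c e (U (s n) x) x - c e (w x) x))\<^sup>2) \<le> (2 * (B / e))\<^sup>2 * (norm (r x *\<^sub>R w x))\<^sup>2" for n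
      proof (rule AE_I2)
        fix x
        have "norm (c e (U (s n) x) x - c e (w x) x) \<le> 2 * (B / e) * norm (r x *\<^sub>R w x)"
          using norm_triangle_ineq4[of "c e (U (s n) x) x" "c e (w x) x"] crw[OF e, of "U (s n) x" x] crw[OF e, of "w x" x]
          by linarith
        from power_mono[OF this norm_ge_zero, of 2]
        show "norm ((norm (c e (U (s n) x) x - c e (w x) x))\<^sup>2) \<le> (2 * (B / e))\<^sup>2 * (norm (r x *\<^sub>R w x))\<^sup>2"
          unfolding power_mult_distrib by simp
      qed
    qed measurable
    have lim2: "(\<lambda>n. LBINT x. c e (U (s n) x) x \<bullet> D (s n) x) \<longlonglongrightarrow> (LBINT x. c e (w x) x \<bullet> A x)"
    proof -
      obtain K' where K': "\<And>n. (LBINT x. (norm (D n x))\<^sup>2) \<le> K'" using D_bounded by blast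
      have dL2: "integrable lborel (\<lambda>x. (norm (c e (U (s n) x) x - c e (w x) x))\<^sup>2)" for n
      proof (rule Bochner_Integration.integrable_bound)
        show "integrable lborel (\<lambda>x. 2 * ((norm (c e (U (s n) x) x))\<^sup>2 + (norm (c e (w x) x))\<^sup>2))"
          using c_L2[OF e U_measurable] c_L2[OF e w_measurable] by simp
        show "AE x in lborel. norm ((norm (c e (U (s n) x) x - c e (w x) x))\<^sup>2) \<le> norm (2 * ((norm (c e (U (s n) x) x))\<^sup>2 + (norm (c e (w x) x))\<^sup>2))"
          using norm_diff_power2 by (intro AE_I2) simp
      qed measurable
      have z: "(\<lambda>n. LBINT x. \<bar>norm (c e (U (s n) x) x - c e (w x) x) * norm (D (s n) x)\<bar>) \<longlonglongrightarrow> 0"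
        by (rule tendsto_Cauchy_Schwarz[OF _ _ dL2 D_L2 _ K']) (use limc in auto)
      \<comment> \<open>The coefficients converge strongly in L^2 and the gradients are bounded
        there, so the coefficient may be frozen at w before the gradient goes to its limit.\<close>
      have "(\<lambda>n. (LBINT x. c e (U (s n) x) x \<bullet> D (s n) x) - (LBINT x. c e (w x) x \<bullet> D (s n) x)) \<longlonglongrightarrow> 0"
      proof (rule tendsto_norm_bound[OF _ z])
        fix n
        have j1: "integrable lborel (\<lambda>x. c e (w x) x \<bullet> D (s n) x)"
          by (intro integrable_inner_L2 c_L2 e D_L2) measurable
        have j3: "integrable lborel (\<lambda>x. (c e (U (s n) x) x - c e (w x) x) \<bullet> D (s n) x)"
          by (intro integrable_inner_L2 dL2 D_L2) measurable
        have "(LBINT x. c e (U (s n) x) x \<bullet> D (s n) x) - (LBINT x. c e (w x) x \<bullet> D (s n) x)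
          = (LBINT x. (c e (U (s n) x) x - c e (w x) x) \<bullet> D (s n) x)"
          unfolding inner_diff_left by (rule Bochner_Integration.integral_diff[OF i2 j1, symmetric])
        then have "norm ((LBINT x. c e (U (s n) x) x \<bullet> D (s n) x) - (LBINT x. c e (w x) x \<bullet> D (s n) x) - 0)
          \<le> (LBINT x. \<bar>(c e (U (s n) x) x - c e (w x) x) \<bullet> D (s n) x\<bar>)"
          by (simp only: real_norm_def diff_zero integral_abs_bound)
        also have "\<dots> \<le> (LBINT x. \<bar>norm (c e (U (s n) x) x - c e (w x) x) * norm (D (s n) x)\<bar>)"
        proof (rule integral_mono[OF integrable_abs[OF j3]])
          show "integrable lborel (\<lambda>x. \<bar>norm (c e (U (s n) x) x - c e (w x) x) * norm (D (s n) x)\<bar>)"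
            by (intro integrable_abs integrable_mult_L2 dL2 D_L2) measurable
          show "\<bar>(c e (U (s n) x) x - c e (w x) x) \<bullet> D (s n) x\<bar> \<le> \<bar>norm (c e (U (s n) x) x - c e (w x) x) * norm (D (s n) x)\<bar>" for x
            using Cauchy_Schwarz_ineq2 by (simp add: abs_mult)
        qed
        finally show "norm ((LBINT x. c e (U (s n) x) x \<bullet> D (s n) x) - (LBINT x. c e (w x) x \<bullet> D (s n) x) - 0)
          \<le> (LBINT x. \<bar>norm (c e (U (s n) x) x - c e (w x) x) * norm (D (s n) x)\<bar>)" .
      qed
      moreover have "(\<lambda>n. LBINT x. c e (w x) x \<bullet> D (s n) x) \<longlonglongrightarrow> (LBINT x. c e (w x) x \<bullet> A x)"
        using LIMSEQ_subseq_LIMSEQ[OF D_weak_limit[OF _ c_L2[OF e w_measurable]] s] by (simp add: o_def)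
      ultimately show ?thesis using tendsto_add by fastforce
    qed
    from tendsto_add[OF lim1 lim2] show ?thesis unfolding id_n by (simp add: LIMSEQ_const_iff)
  qed
  \<comment> \<open>The limit in e: where w = 0 the flux vanishes as well, and elsewhere the cutoff
    tends to 1, so the first integral tends to the full one.\<close>
  let ?e = "\<lambda>n. inverse (real (Suc n))"
  have e: "0 < ?e n" for n by simp
  have e2: "(\<lambda>n. (?e n)\<^sup>2) \<longlonglongrightarrow> 0" using tendsto_power[OF LIMSEQ_inverse_real_of_nat, of 2] by simp
  have "(\<lambda>n. LBINT x. H (?e n) (w x) * ((r x *\<^sub>R w x) \<bullet> g x)) \<longlonglongrightarrow> (LBINT x. (r x *\<^sub>R w x) \<bullet> g x)"
  proof (rule integral_dominated_convergence)
    show "integrable lborel (\<lambda>x. \<bar>(r x *\<^sub>R w x) \<bullet> g x\<bar>)" using i_rwg by (rule integrable_abs)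
    show "AE x in lborel. (\<lambda>n. H (?e n) (w x) * ((r x *\<^sub>R w x) \<bullet> g x)) \<longlonglongrightarrow> (r x *\<^sub>R w x) \<bullet> g x"
    proof (rule AE_I2)
      fix x
      show "(\<lambda>n. H (?e n) (w x) * ((r x *\<^sub>R w x) \<bullet> g x)) \<longlonglongrightarrow> (r x *\<^sub>R w x) \<bullet> g x"
      proof (cases "w x = 0")
        case False
        have "(\<lambda>n. H (?e n) (w x) * ((r x *\<^sub>R w x) \<bullet> g x)) \<longlonglongrightarrow> (norm (w x))\<^sup>2 * inverse ((norm (w x))\<^sup>2 + 0) * ((r x *\<^sub>R w x) \<bullet> g x)"
          unfolding H_def by (intro tendsto_intros e2) (use False in simp)
        then show ?thesis using False by simp
      qed simp
    qed
    show "AE x in lborel. norm (H (?e n) (w x) * ((r x *\<^sub>R w x) \<bullet> g x)) \<le> \<bar>(r x *\<^sub>R w x) \<bullet> g x\<bar>" for n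
      using H_le[OF e[of n]] by (intro AE_I2) (simp only: real_norm_def abs_mult[of "H _ _"], simp add: mult_left_le_one_le)
  qed measurable
  \<comment> \<open>The uniform bound of \<open>saturation_bounds\<close> absorbs both factors |w|
    of the tensor and leaves B r |A|, an integrable product of two L^2 functions.\<close>
  moreover have "(\<lambda>n. LBINT x. c (?e n) (w x) x \<bullet> A x) \<longlonglongrightarrow> (\<integral>x. 0 \<partial>(lborel :: (real^3) measure))"
  proof (rule integral_dominated_convergence)
    show "integrable lborel (\<lambda>x. B * (r x * norm (A x)))"
      by (intro integrable_mult_right integrable_mult_L2 r_L2) (use A_L2 in auto)
    show "AE x in lborel. (\<lambda>n. c (?e n) (w x) x \<bullet> A x) \<longlonglongrightarrow> 0"
    proof (rule AE_I2)
      fix x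
      show "(\<lambda>n. c (?e n) (w x) x \<bullet> A x) \<longlonglongrightarrow> 0"
      proof (cases "w x = 0")
        case True
        then have "norm (c e (w x) x) = 0" for e by (simp add: nc)
        then show ?thesis by simp
      next
        case False
        have "(\<lambda>n. c (?e n) (w x) x \<bullet> A x) \<longlonglongrightarrow> (G x * r x * (2 * 0 / ((norm (w x))\<^sup>2 + 0)\<^sup>2)) *\<^sub>R outer (w x) (w x) \<bullet> A x"
          unfolding c_def by (intro tendsto_intros e2) (use False in simp)
        then show ?thesis by simp
      qed
    qed
    show "AE x in lborel. norm (c (?e n) (w x) x \<bullet> A x) \<le> B * (r x * norm (A x))" for n
    proof (rule AE_I2)
      fix x
      let ?k = "2 * (?e n)\<^sup>2 / ((norm (w x))\<^sup>2 + (?e n)\<^sup>2)\<^sup>2"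
      have "norm (c (?e n) (w x) x) = \<bar>G x\<bar> * (r x * (?k * (norm (w x))\<^sup>2))"
        unfolding nc by (simp add: power2_eq_square mult_ac)
      also have "\<dots> \<le> B * (r x * 1)"
        using r_nonneg B0 e by (intro mult_mono BG mult_left_mono saturation_bounds(2)) auto
      finally have "norm (c (?e n) (w x) x) \<le> B * r x" by simp
      from order_trans[OF Cauchy_Schwarz_ineq2 mult_right_mono[OF this norm_ge_zero]]
      show "norm (c (?e n) (w x) x \<bullet> A x) \<le> B * (r x * norm (A x))" by (simp add: mult.assoc)
    qed
  qed measurable
  ultimately have "(\<lambda>n. (LBINT x. H (?e n) (w x) * ((r x *\<^sub>R w x) \<bullet> g x)) + (LBINT x. c (?e n) (w x) x \<bullet> A x))
      \<longlonglongrightarrow> (LBINT x. (r x *\<^sub>R w x) \<bullet> g x) + (\<integral>x. 0 \<partial>(lborel :: (real^3) measure))" by (rule tendsto_add)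
  then have "0 = (LBINT x. (r x *\<^sub>R w x) \<bullet> g x) + (\<integral>x. 0 \<partial>(lborel :: (real^3) measure))"
    unfolding id[OF e] by (simp only: LIMSEQ_const_iff)
  then show ?thesis by simp
qed

end

subsection \<open>From Lebesgue measure on the domain to the whole space\<close>

lemma lebesgue_measurable_AE:
  fixes f g :: "'a::euclidean_space \<Rightarrow> 'b::topological_space"
  assumes f: "f \<in> borel_measurable lebesgue" and ae: "AE x in lebesgue. g x = f x"
  shows "g \<in> borel_measurable lebesgue"
proof (rule measurableI)
  fix S :: "'b set" assume S: "S \<in> sets borel"
  have "AE x in lebesgue. x \<in> f -` S \<inter> space lebesgue \<longleftrightarrow> x \<in> g -` S \<inter> space lebesgue"
    using ae by eventually_elim simp
  then show "g -` S \<inter> space lebesgue \<in> sets lebesgue"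
    by (rule completion.in_sets_AE[OF _ measurable_sets[OF f S]]) auto
qed simp

text \<open>Measurability of F is inherited from F' by completeness of Lebesgue measure. This is the
  bridge from integrals over \<Omega> to integrals of Borel functions on the whole space.\<close>

lemma
  fixes F F' :: "'a::euclidean_space \<Rightarrow> 'b::{banach, second_countable_topology}"
  assumes \<Omega>: "open \<Omega>" and F': "F' \<in> borel_measurable borel" and zero: "\<And>x. x \<notin> \<Omega> \<Longrightarrow> F' x = 0"
    and ae: "AE x in lebesgue_on \<Omega>. F x = F' x"
  shows integral_lebesgue_on_eq_lborel: "integral\<^sup>L (lebesgue_on \<Omega>) F = integral\<^sup>L lborel F'"
    and integrable_lebesgue_on_iff_lborel: "integrable (lebesgue_on \<Omega>) F \<longleftrightarrow> integrable lborel F'"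
proof -
  have \<Omega>l: "\<Omega> \<inter> space lebesgue \<in> sets lebesgue" using \<Omega> by auto
  let ?H = "\<lambda>x. indicat_real \<Omega> x *\<^sub>R F x"
  have aeH: "AE x in lebesgue. ?H x = F' x"
    using ae unfolding AE_restrict_space_iff[OF \<Omega>l] by eventually_elim (use zero in \<open>auto simp: indicator_def\<close>)
  have F'l: "F' \<in> borel_measurable lebesgue" using F' by (simp add: measurable_completion)
  have H: "?H \<in> borel_measurable lebesgue" by (rule lebesgue_measurable_AE[OF F'l aeH])
  have "integral\<^sup>L (lebesgue_on \<Omega>) F = integral\<^sup>L lebesgue ?H" by (rule integral_restrict_space[OF \<Omega>l])
  also have "\<dots> = integral\<^sup>L lebesgue F'" by (rule integral_cong_AE[OF H F'l aeH])
  also have "\<dots> = integral\<^sup>L lborel F'" by (rule integral_completion) (use F' in simp)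
  finally show "integral\<^sup>L (lebesgue_on \<Omega>) F = integral\<^sup>L lborel F'" .
  have "integrable (lebesgue_on \<Omega>) F \<longleftrightarrow> integrable lebesgue ?H" by (rule integrable_restrict_space[OF \<Omega>l])
  also have "\<dots> \<longleftrightarrow> integrable lebesgue F'" by (rule integrable_cong_AE[OF H F'l aeH])
  also have "\<dots> \<longleftrightarrow> integrable lborel F'" by (rule integrable_completion) (use F' in simp)
  finally show "integrable (lebesgue_on \<Omega>) F \<longleftrightarrow> integrable lborel F'" .
qed

text \<open>Each coordinate, multiplied by the indicator of \<Omega>, has a Borel representative; a
  second factor of the indicator makes it vanish off \<Omega> at every point.\<close>

lemma borel_representative:
  fixes f :: "'a::euclidean_space \<Rightarrow> 'b::euclidean_space"
  assumes \<Omega>: "open \<Omega>" and f: "f \<in> borel_measurable (lebesgue_on \<Omega>)"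
  obtains f' where "f' \<in> borel_measurable borel" "\<And>x. x \<notin> \<Omega> \<Longrightarrow> f' x = 0" "AE x in lebesgue_on \<Omega>. f x = f' x"
proof -
  have \<Omega>l: "\<Omega> \<inter> space lebesgue \<in> sets lebesgue" using \<Omega> by auto
  have "\<exists>g\<in>borel_measurable lborel. AE x in lborel. indicat_real \<Omega> x *\<^sub>R (f x \<bullet> b) = g x" for b
  proof (rule completion_ex_borel_measurable_real)
    have "(\<lambda>x. f x \<bullet> b) \<in> borel_measurable (lebesgue_on \<Omega>)" using f by simp
    then show "(\<lambda>x. indicat_real \<Omega> x *\<^sub>R (f x \<bullet> b)) \<in> borel_measurable lebesgue"
      by (rule borel_measurable_restrict_space_iff[THEN iffD1, OF \<Omega>l])
  qed
  then obtain g where g: "\<And>b. g b \<in> borel_measurable lborel"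
    and ae: "\<And>b. AE x in lborel. indicat_real \<Omega> x *\<^sub>R (f x \<bullet> b) = g b x" by metis
  have [measurable]: "\<Omega> \<in> sets borel" "\<And>b. g b \<in> borel_measurable borel" using \<Omega> g by auto
  define f' where "f' x = (\<Sum>b\<in>Basis. (indicat_real \<Omega> x * g b x) *\<^sub>R b)" for x
  have "AE x in lborel. \<forall>b\<in>Basis. indicat_real \<Omega> x *\<^sub>R (f x \<bullet> b) = g b x"
    using ae by (simp add: AE_finite_allI)
  then have "AE x in lebesgue. \<forall>b\<in>Basis. indicat_real \<Omega> x *\<^sub>R (f x \<bullet> b) = g b x"
    by (rule AE_completion)
  then have "AE x in lebesgue_on \<Omega>. f x = f' x"
    unfolding AE_restrict_space_iff[OF \<Omega>l]
  proof eventually_elim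
    case (elim x)
    show ?case
    proof
      assume "x \<in> \<Omega>"
      then have "f' x = (\<Sum>b\<in>Basis. (f x \<bullet> b) *\<^sub>R b)" using elim by (auto simp: f'_def intro!: sum.cong)
      then show "f x = f' x" by (simp add: euclidean_representation)
    qed
  qed
  moreover have "f' \<in> borel_measurable borel" unfolding f'_def by measurable
  moreover have "f' x = 0" if "x \<notin> \<Omega>" for x using that by (simp add: f'_def)
  ultimately show ?thesis using that by blast
qed

text \<open>Reconciles the Jacobian in the momentum equation with the gradients of the
  components.\<close>

lemma jacobian_eq_grad_matrix:
  fixes f :: "real^'n \<Rightarrow> real^'m"
  assumes "f differentiable at x" shows "jacobian f (at x) = grad_matrix f x"
proof -
  have d: "(f has_derivative frechet_derivative f (at x)) (at x)"
    using assms frechet_derivative_works by blast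
  have "frechet_derivative (\<lambda>y. f y $ i) (at x) = (\<lambda>v. frechet_derivative f (at x) v $ i)" for i
    using frechet_derivative_at[OF bounded_linear.has_derivative[OF bounded_linear_vec_nth d]] by simp
  then show ?thesis
    by (simp add: jacobian_def matrix_def grad_matrix_def grad_def vec_eq_iff)
qed

text \<open>The test functions are known to converge only locally in L^1, their gradients in L^2.
  The Sobolev inequality makes them Cauchy in L^6, and Fatou's lemma along an almost everywhere
  convergent subsequence bounds the L^6 distance to v by that of the gradients.\<close>

lemma Sobolev_completion_component:
  fixes v :: "real^3 \<Rightarrow> real"
  assumes \<Omega>: "open \<Omega>" and v: "v \<in> D0 2 \<Omega>" and vm: "v \<in> borel_measurable (lebesgue_on \<Omega>)"
  obtains v' a f where "v' \<in> borel_measurable borel" "\<And>x. x \<notin> \<Omega> \<Longrightarrow> v' x = 0" "AE x in lebesgue_on \<Omega>. v x = v' x"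
    "a \<in> borel_measurable borel" "\<And>x. x \<notin> \<Omega> \<Longrightarrow> a x = 0" "AE x in lebesgue_on \<Omega>. weak_grad \<Omega> v x = a x"
    "\<And>n::nat. f n \<in> Ccinf \<Omega>" "integrable lborel (\<lambda>x. (norm (a x))\<^sup>2)"
    "\<And>n. integrable lborel (\<lambda>x. (norm (grad (f n) x - a x))\<^sup>2)"
    "(\<lambda>n. LBINT x. (norm (grad (f n) x - a x))\<^sup>2) \<longlonglongrightarrow> 0"
    "\<And>n. integrable lborel (\<lambda>x. (f n x - v' x) ^ 6)"
    "(\<lambda>n. LBINT x. (f n x - v' x) ^ 6) \<longlonglongrightarrow> 0"
proof -
  from v have hw: "\<exists>g. has_weak_grad \<Omega> v g" and aq: "weak_grad \<Omega> v \<in> Lq 2 \<Omega>" by (auto simp: D0_def)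
  from v obtain f where f: "\<And>n. f n \<in> Ccinf \<Omega>"
    and lim: "(\<lambda>n. LINT x|lebesgue_on \<Omega>. norm (grad (f n) x - weak_grad \<Omega> v x) powr 2) \<longlonglongrightarrow> 0"
    and loc: "\<And>K. compact K \<Longrightarrow> K \<subseteq> \<Omega> \<Longrightarrow> (\<lambda>n. LINT x|lebesgue_on K. \<bar>f n x - v x\<bar>) \<longlonglongrightarrow> 0"
    by (auto simp: D0_def)
  from hw have vloc: "v \<in> L1loc \<Omega>" by (auto simp: has_weak_grad_def)
  obtain v' where v': "v' \<in> borel_measurable borel" "\<And>x. x \<notin> \<Omega> \<Longrightarrow> v' x = 0" "AE x in lebesgue_on \<Omega>. v x = v' x"
    using borel_representative[OF \<Omega> vm] by blast
  have wm: "weak_grad \<Omega> v \<in> borel_measurable (lebesgue_on \<Omega>)" using aq by (simp add: Lq_def)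
  obtain a where a: "a \<in> borel_measurable borel" "\<And>x. x \<notin> \<Omega> \<Longrightarrow> a x = 0" "AE x in lebesgue_on \<Omega>. weak_grad \<Omega> v x = a x"
    using borel_representative[OF \<Omega> wm] by blast
  note [measurable] = v'(1) a(1)
  have fm [measurable]: "f n \<in> borel_measurable borel" "grad (f n) \<in> borel_measurable borel" for n
    using Ccinf_measurable[OF f] Ccinf_grad_measurable[OF f] by auto
  have fsupp: "x \<notin> supp (f n)" if "x \<notin> \<Omega>" for x n using f[of n] that by (auto simp: Ccinf_iff)
  have a2: "integrable lborel (\<lambda>x. (norm (a x))\<^sup>2)"
  proof -
    have "integrable (lebesgue_on \<Omega>) (\<lambda>x. norm (weak_grad \<Omega> v x) powr 2)" using aq by (auto simp: Lq_def)
    then show ?thesis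
    proof (rule integrable_lebesgue_on_iff_lborel[OF \<Omega>, THEN iffD1, rotated -1])
      show "AE x in lebesgue_on \<Omega>. norm (weak_grad \<Omega> v x) powr 2 = (norm (a x))\<^sup>2"
        using a(3) by eventually_elim simp
    qed (use a(2) in auto)
  qed
  have d2: "integrable lborel (\<lambda>x. (norm (grad (f n) x - a x))\<^sup>2)" for n
  proof (rule Bochner_Integration.integrable_bound[OF integrable_mult_right[OF Bochner_Integration.integrable_add[OF Ccinf_grad_L2[OF f[of n]] a2], of 2]])
    show "AE x in lborel. norm ((norm (grad (f n) x - a x))\<^sup>2) \<le> norm (2 * ((norm (grad (f n) x))\<^sup>2 + (norm (a x))\<^sup>2))"
      using norm_diff_power2 by (intro AE_I2) simp
  qed measurable
  define E where "E n = (LBINT x. (norm (grad (f n) x - a x))\<^sup>2)" for n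
  have E0: "0 \<le> E n" for n unfolding E_def by (intro Bochner_Integration.integral_nonneg) auto
  have "(LINT x|lebesgue_on \<Omega>. norm (grad (f n) x - weak_grad \<Omega> v x) powr 2) = E n" for n
    unfolding E_def
  proof (rule integral_lebesgue_on_eq_lborel[OF \<Omega>])
    show "AE x in lebesgue_on \<Omega>. norm (grad (f n) x - weak_grad \<Omega> v x) powr 2 = (norm (grad (f n) x - a x))\<^sup>2"
      using a(3) by eventually_elim simp
  qed (use a(2) grad_not_in_supp[OF fsupp] in auto)
  with lim have E: "E \<longlonglongrightarrow> 0" by simp
  \<comment> \<open>The convergent subsequence depends on K but the bound does not; monotone
    convergence over an exhaustion by compact sets thus replaces a diagonal argument.\<close>
  have K_bound: "(\<integral>\<^sup>+x. ennreal (indicator K x * (f n x - v' x) ^ 6) \<partial>lborel) \<le> ennreal (4096 * (2 * E n) ^ 3)"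
    if K: "compact K" "K \<subseteq> \<Omega>" for K n
  proof -
    have Kl: "K \<inter> space lebesgue \<in> sets lebesgue" using fmeasurableD[OF lmeasurable_compact[OF K(1)]] by simp
    have \<Omega>l: "\<Omega> \<inter> space lebesgue \<in> sets lebesgue" using \<Omega> by auto
    have int: "integrable (lebesgue_on K) (\<lambda>x. f n x - v x)" for n
    proof (rule Bochner_Integration.integrable_diff)
      show "integrable (lebesgue_on K) v" using vloc K by (auto simp: L1loc_def)
      have "integrable lebesgue (f n)" using Ccinf_integrable[OF f[of n]] fm by (subst integrable_completion) auto
      then show "integrable (lebesgue_on K) (f n)"
        unfolding integrable_restrict_space[OF Kl] using Kl by (intro integrable_mult_indicator) simp_all
    qed
    obtain s :: "nat \<Rightarrow> nat" where s: "strict_mono s" "AE x in lebesgue_on K. (\<lambda>k. f (s k) x - v x) \<longlonglongrightarrow> 0"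
      using tendsto_L1_AE_subseq[where u = "\<lambda>n x. f n x - v x", OF int] loc[OF K] by auto
    have "AE x in lebesgue. x \<in> K \<longrightarrow> (\<lambda>k. f (s k) x - v x) \<longlonglongrightarrow> 0"
      using s(2) unfolding AE_restrict_space_iff[OF Kl] .
    moreover have "AE x in lebesgue. x \<in> \<Omega> \<longrightarrow> v x = v' x"
      using v'(3) unfolding AE_restrict_space_iff[OF \<Omega>l] .
    ultimately have "AE x in lebesgue. x \<in> K \<longrightarrow> (\<lambda>k. f (s k) x) \<longlonglongrightarrow> v' x"
      by eventually_elim (use K(2) LIM_zero_cancel in fastforce)
    then have ae: "AE x in lborel. x \<in> K \<longrightarrow> (\<lambda>k. f (s k) x) \<longlonglongrightarrow> v' x"
      unfolding AE_completion_iff .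
    have "(\<integral>\<^sup>+x. ennreal (indicator K x * (f n x - v' x) ^ 6) \<partial>lborel)
        \<le> (\<integral>\<^sup>+x. liminf (\<lambda>k. ennreal ((f n x - f (s k) x) ^ 6)) \<partial>lborel)"
      using ae
    proof (intro nn_integral_mono_AE, eventually_elim)
      case (elim x)
      show ?case
      proof (cases "x \<in> K")
        case True
        with elim have "(\<lambda>k. f (s k) x) \<longlonglongrightarrow> v' x" by simp
        then have "(\<lambda>k. ennreal ((f n x - f (s k) x) ^ 6)) \<longlonglongrightarrow> ennreal ((f n x - v' x) ^ 6)"
          by (intro tendsto_ennrealI tendsto_intros)
        from lim_imp_Liminf[OF sequentially_bot this] show ?thesis using True by simp
      qed simp
    qed
    also have "\<dots> \<le> liminf (\<lambda>k. \<integral>\<^sup>+x. ennreal ((f n x - f (s k) x) ^ 6) \<partial>lborel)"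
      by (rule nn_integral_liminf) measurable
    also have "\<dots> \<le> liminf (\<lambda>k. ennreal (4096 * (2 * (E n + E (s k))) ^ 3))"
    proof (rule Liminf_mono, rule always_eventually, rule allI)
      fix k
      have df: "(\<lambda>x. f n x - f (s k) x) \<in> Ccinf \<Omega>" by (intro Ccinf_diff f)
      have i6: "integrable lborel (\<lambda>x. (f n x - f (s k) x) ^ 6)"
        by (rule continuous_compact_support_integrable[OF _ Ccinf_compact[OF df]])
          (use not_in_supp[of _ "\<lambda>x. f n x - f (s k) x"] in \<open>auto intro!: continuous_intros Ccinf_continuous[OF f]\<close>)
      have "(\<integral>\<^sup>+x. ennreal ((f n x - f (s k) x) ^ 6) \<partial>lborel) = ennreal (LBINT x. (f n x - f (s k) x) ^ 6)"
        by (rule nn_integral_eq_integral[OF i6]) simp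
      also have "\<dots> \<le> ennreal (4096 * (LBINT x. (norm (grad (\<lambda>x. f n x - f (s k) x) x))\<^sup>2) ^ 3)"
        by (intro ennreal_leI Sobolev_inequality[OF df])
      also have "\<dots> \<le> ennreal (4096 * (2 * (E n + E (s k))) ^ 3)"
      proof (intro ennreal_leI mult_left_mono power_mono)
        have "(LBINT x. (norm (grad (\<lambda>x. f n x - f (s k) x) x))\<^sup>2)
          \<le> (LBINT x. 2 * ((norm (grad (f n) x - a x))\<^sup>2 + (norm (grad (f (s k)) x - a x))\<^sup>2))"
        proof (rule integral_mono[OF Ccinf_grad_L2[OF df]])
          show "integrable lborel (\<lambda>x. 2 * ((norm (grad (f n) x - a x))\<^sup>2 + (norm (grad (f (s k)) x - a x))\<^sup>2))"
            using d2 by simp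
          show "(norm (grad (\<lambda>x. f n x - f (s k) x) x))\<^sup>2 \<le> 2 * ((norm (grad (f n) x - a x))\<^sup>2 + (norm (grad (f (s k)) x - a x))\<^sup>2)" for x
            using norm_diff_power2[of "grad (f n) x - a x" "grad (f (s k)) x - a x"] by (simp add: grad_diff[OF f f])
        qed
        also have "\<dots> = 2 * (E n + E (s k))" using d2 by (simp add: E_def)
        finally show "(LBINT x. (norm (grad (\<lambda>x. f n x - f (s k) x) x))\<^sup>2) \<le> 2 * (E n + E (s k))" .
      qed (auto intro!: Bochner_Integration.integral_nonneg)
      finally show "(\<integral>\<^sup>+x. ennreal ((f n x - f (s k) x) ^ 6) \<partial>lborel) \<le> ennreal (4096 * (2 * (E n + E (s k))) ^ 3)" .
    qed
    also have "\<dots> = ennreal (4096 * (2 * (E n + 0)) ^ 3)"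
    proof (rule lim_imp_Liminf[OF sequentially_bot])
      have "(\<lambda>k. E (s k)) \<longlonglongrightarrow> 0" using LIMSEQ_subseq_LIMSEQ[OF E s(1)] by (simp add: o_def)
      then show "(\<lambda>k. ennreal (4096 * (2 * (E n + E (s k))) ^ 3)) \<longlonglongrightarrow> ennreal (4096 * (2 * (E n + 0)) ^ 3)"
        by (intro tendsto_ennrealI tendsto_intros)
    qed
    finally show ?thesis by simp
  qed
  have nn6: "(\<integral>\<^sup>+x. ennreal ((f n x - v' x) ^ 6) \<partial>lborel) \<le> ennreal (4096 * (2 * E n) ^ 3)" for n
  proof -
    obtain C where C: "\<And>m::nat. compact (C m)" "\<And>m. C m \<subseteq> \<Omega>" "\<And>m. C m \<subseteq> interior (C (Suc m))" "\<Union> (range C) = \<Omega>"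
      using open_Union_compact_subsets[OF \<Omega>] by metis
    have inc: "incseq C" by (rule incseq_SucI) (use C(3) interior_subset in blast)
    have [measurable]: "C m \<in> sets borel" for m using C(1) by (simp add: borel_compact)
    have eq: "ennreal ((f n x - v' x) ^ 6) = (SUP m. ennreal (indicator (C m) x * (f n x - v' x) ^ 6))" for x
    proof (cases "x \<in> \<Omega>")
      case True
      then obtain m where m: "x \<in> C m" using C(4) by blast
      show ?thesis
      proof (rule antisym)
        show "ennreal ((f n x - v' x) ^ 6) \<le> (SUP m. ennreal (indicator (C m) x * (f n x - v' x) ^ 6))"
          by (rule SUP_upper2[of m]) (use m in auto)
        show "(SUP m. ennreal (indicator (C m) x * (f n x - v' x) ^ 6)) \<le> ennreal ((f n x - v' x) ^ 6)"
          by (rule SUP_least) (auto simp: indicator_def)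
      qed
    next
      case False
      then have "f n x - v' x = 0" using not_in_supp[OF fsupp] v'(2) by simp
      then show ?thesis by simp
    qed
    have "(\<integral>\<^sup>+x. ennreal ((f n x - v' x) ^ 6) \<partial>lborel) = (SUP m. \<integral>\<^sup>+x. ennreal (indicator (C m) x * (f n x - v' x) ^ 6) \<partial>lborel)"
      unfolding eq
    proof (rule nn_integral_monotone_convergence_SUP)
      show "incseq (\<lambda>m x. ennreal (indicator (C m) x * (f n x - v' x) ^ 6))"
      proof (rule incseq_SucI, rule le_funI, rule ennreal_leI)
        fix m x
        have "C m \<subseteq> C (Suc m)" using inc by (simp add: incseq_SucD)
        then show "indicator (C m) x * (f n x - v' x) ^ 6 \<le> indicator (C (Suc m)) x * (f n x - v' x) ^ 6"
          by (auto simp: indicator_def)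
      qed
    qed measurable
    also have "\<dots> \<le> ennreal (4096 * (2 * E n) ^ 3)" by (intro SUP_least K_bound C)
    finally show ?thesis .
  qed
  have i6: "integrable lborel (\<lambda>x. (f n x - v' x) ^ 6)" for n
  proof (rule integrableI_bounded)
    have "(\<integral>\<^sup>+x. ennreal (norm ((f n x - v' x) ^ 6)) \<partial>lborel) \<le> ennreal (4096 * (2 * E n) ^ 3)"
      using nn6[of n] by simp
    then show "(\<integral>\<^sup>+x. ennreal (norm ((f n x - v' x) ^ 6)) \<partial>lborel) < \<infinity>"
      by (rule order_le_less_trans) simp
  qed measurable
  have lim6: "(\<lambda>n. LBINT x. (f n x - v' x) ^ 6) \<longlonglongrightarrow> 0"
  proof (rule tendsto_sandwich[OF _ _ tendsto_const])
    have "(LBINT x. (f n x - v' x) ^ 6) \<le> 4096 * (2 * E n) ^ 3" for n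
    proof -
      have "ennreal (LBINT x. (f n x - v' x) ^ 6) \<le> ennreal (4096 * (2 * E n) ^ 3)"
        using nn6[of n] nn_integral_eq_integral[OF i6[of n]] by simp
      then show ?thesis using E0[of n] by (subst (asm) ennreal_le_iff) auto
    qed
    then show "\<forall>\<^sub>F n in sequentially. (LBINT x. (f n x - v' x) ^ 6) \<le> 4096 * (2 * E n) ^ 3" by simp
    have "(\<lambda>n. 4096 * (2 * E n) ^ 3) \<longlonglongrightarrow> 4096 * (2 * 0) ^ 3" by (intro tendsto_intros E)
    then show "(\<lambda>n. 4096 * (2 * E n) ^ 3) \<longlonglongrightarrow> 0" by simp
  qed simp
  have E': "(\<lambda>n. LBINT x. (norm (grad (f n) x - a x))\<^sup>2) \<longlonglongrightarrow> 0" using E unfolding E_def .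
  show ?thesis by (rule that[OF v' a f a2 d2 E' i6 lim6])
qed

lemma D0_vec_approximation:
  fixes u :: "real^3 \<Rightarrow> real^3"
  assumes \<Omega>: "open \<Omega>" and u: "u \<in> D0_vec 2 \<Omega>" and um: "u \<in> borel_measurable (lebesgue_on \<Omega>)"
  obtains w A U where "approximable_field w A U" "\<And>n i. (\<lambda>x. U n x $ i) \<in> Ccinf \<Omega>"
    "\<And>x. x \<notin> \<Omega> \<Longrightarrow> A x = 0"
    "AE x in lebesgue_on \<Omega>. u x = w x" "AE x in lebesgue_on \<Omega>. weak_jacobian \<Omega> u x = A x"
proof -
  have umi: "(\<lambda>x. u x $ i) \<in> borel_measurable (lebesgue_on \<Omega>)" for i
    using borel_measurable_inner[OF um, of "\<lambda>_. axis i 1"] by (simp add: inner_axis)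
  \<comment> \<open>All properties of one component in a single predicate, so that the witnesses for
    the three components can be chosen together.\<close>
  define P where "P i v' a f \<longleftrightarrow> v' \<in> borel_measurable borel \<and> (\<forall>x. x \<notin> \<Omega> \<longrightarrow> v' x = 0) \<and> (AE x in lebesgue_on \<Omega>. u x $ i = v' x) \<and>
    a \<in> borel_measurable borel \<and> (\<forall>x. x \<notin> \<Omega> \<longrightarrow> a x = 0) \<and> (AE x in lebesgue_on \<Omega>. weak_grad \<Omega> (\<lambda>x. u x $ i) x = a x) \<and>
    (\<forall>n::nat. f n \<in> Ccinf \<Omega>) \<and> integrable lborel (\<lambda>x. (norm (a x))\<^sup>2) \<and>
    (\<forall>n. integrable lborel (\<lambda>x. (norm (grad (f n) x - a x))\<^sup>2)) \<and>
    (\<lambda>n. LBINT x. (norm (grad (f n) x - a x))\<^sup>2) \<longlonglongrightarrow> 0 \<and>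
    (\<forall>n. integrable lborel (\<lambda>x. (f n x - v' x) ^ 6)) \<and>
    (\<lambda>n. LBINT x. (f n x - v' x) ^ 6) \<longlonglongrightarrow> 0"
    for i :: 3 and v' and a :: "real^3 \<Rightarrow> real^3" and f
  have "\<exists>v' a f. P i v' a f" for i
  proof -
    have "(\<lambda>x. u x $ i) \<in> D0 2 \<Omega>" using u by (simp add: D0_vec_def)
    then show ?thesis
    proof (rule Sobolev_completion_component[OF \<Omega> _ umi], goal_cases)
      case (1 v' a f)
      show ?case by (intro exI[of _ v'] exI[of _ a] exI[of _ f] conjI allI impI 1 P_def[THEN iffD2])
    qed
  qed
  then obtain v' a f where P: "\<And>i. P i (v' i) (a i) (f i)" by metis
  then have v': "\<And>i. v' i \<in> borel_measurable borel" "\<And>i x. x \<notin> \<Omega> \<Longrightarrow> v' i x = 0" "\<And>i. AE x in lebesgue_on \<Omega>. u x $ i = v' i x"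
    and a: "\<And>i. a i \<in> borel_measurable borel" "\<And>i x. x \<notin> \<Omega> \<Longrightarrow> a i x = 0"
      "\<And>i. AE x in lebesgue_on \<Omega>. weak_grad \<Omega> (\<lambda>x. u x $ i) x = a i x"
    and f: "\<And>i (n::nat). f i n \<in> Ccinf \<Omega>" and a2: "\<And>i. integrable lborel (\<lambda>x. (norm (a i x))\<^sup>2)"
    and d2: "\<And>i n. integrable lborel (\<lambda>x. (norm (grad (f i n) x - a i x))\<^sup>2)"
    and dlim: "\<And>i. (\<lambda>n. LBINT x. (norm (grad (f i n) x - a i x))\<^sup>2) \<longlonglongrightarrow> 0"
    and i6: "\<And>i n. integrable lborel (\<lambda>x. (f i n x - v' i x) ^ 6)"
    and lim6: "\<And>i. (\<lambda>n. LBINT x. (f i n x - v' i x) ^ 6) \<longlonglongrightarrow> 0"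
    unfolding P_def by blast+
  note [measurable] = v'(1) a(1)
  have fm [measurable]: "f i n \<in> borel_measurable borel" "grad (f i n) \<in> borel_measurable borel" for i n
    using Ccinf_measurable[OF f] Ccinf_grad_measurable[OF f] by auto
  define w where "w x = (\<chi> i. v' i x)" for x
  define A where "A x = (\<chi> i. a i x)" for x
  define U where "U n x = (\<chi> i. f i n x)" for n x
  have vecm: "(\<lambda>x. \<chi> i. g i x) \<in> borel_measurable borel" if "\<And>i. g i \<in> borel_measurable borel"
    for g :: "3 \<Rightarrow> real^3 \<Rightarrow> 'z::euclidean_space"
  proof -
    have "(\<lambda>x. (\<chi> i. g i x) \<bullet> c) \<in> borel_measurable borel" if "c \<in> Basis" for c
    proof -
      from that obtain k b where "c = axis k b" by (auto simp: Basis_vec_def)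
      then have "(\<lambda>x. (\<chi> i. g i x) \<bullet> c) = (\<lambda>x. g k x \<bullet> b)" by (simp add: inner_axis)
      then show ?thesis using \<open>\<And>i. g i \<in> borel_measurable borel\<close>[of k] by simp
    qed
    then show ?thesis using borel_measurable_euclidean_space by blast
  qed
  have norm2: "(norm B)\<^sup>2 = (\<Sum>i\<in>UNIV. (norm (B $ i))\<^sup>2)" for B :: "real^3^3"
    by (simp add: norm_vec_def L2_set_def sum_nonneg)
  have gm: "grad_matrix (U n) x $ i = grad (f i n) x" for n x i by (simp add: grad_matrix_def U_def)
  have m6: "norm (U n x - w x) ^ 6 \<le> 729 * (\<Sum>i\<in>UNIV. (f i n x - v' i x) ^ 6)" for n x
    using norm_power6_le_sum[of "U n x - w x"] by (simp add: U_def w_def)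
  have i729: "integrable lborel (\<lambda>x. 729 * (\<Sum>i\<in>UNIV. (f i n x - v' i x) ^ 6))" for n
    using i6 by simp
  have Uw_m [measurable]: "U n \<in> borel_measurable borel" "w \<in> borel_measurable borel" for n
    unfolding U_def[abs_def] w_def[abs_def] by (intro vecm; measurable)+
  have U6: "integrable lborel (\<lambda>x. norm (U n x - w x) ^ 6)" for n
    by (rule Bochner_Integration.integrable_bound[OF i729[of n]])
      (use m6 in \<open>auto intro!: AE_I2 order_trans[OF _ abs_ge_self]\<close>)
  have Uc: "continuous_on UNIV (U n)" for n
    unfolding U_def[abs_def] by (intro continuous_intros Ccinf_continuous[OF f])
  have ap: "approximable_field w A U"
  proof
    show "w \<in> borel_measurable borel" by measurable
    show Am: "A \<in> borel_measurable borel" unfolding A_def[abs_def] by (intro vecm) measurable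
    show "(\<lambda>x. U n x $ i) \<in> Ccinf UNIV" for n i
      using Ccinf_mono[OF f] by (simp add: U_def)
    \<comment> \<open>w differs from the test field \<open>U 0\<close> by a function in L^6.\<close>
    show "integrable lborel (\<lambda>x. norm (w x) ^ 6)"
    proof (rule Bochner_Integration.integrable_bound)
      have "integrable lborel (\<lambda>x. norm (U 0 x) ^ 6)"
      proof (rule continuous_compact_support_integrable)
        show "compact (\<Union>i. supp (f i 0))" by (intro compact_UN) (auto intro: Ccinf_compact[OF f])
        show "norm (U 0 x) ^ 6 = 0" if "x \<notin> (\<Union>i. supp (f i 0))" for x
        proof -
          have "f i 0 x = 0" for i using that by (intro not_in_supp) auto
          then show ?thesis by (simp add: U_def vec_eq_iff)
        qed
      qed (intro continuous_intros Uc)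
      then show "integrable lborel (\<lambda>x. 64 * (norm (U 0 x - w x) ^ 6 + norm (U 0 x) ^ 6))" using U6[of 0] by simp
      have "norm (w x) ^ 6 \<le> 64 * (norm (U 0 x - w x) ^ 6 + norm (U 0 x) ^ 6)" for x
        using norm_diff_power6[of "U 0 x - w x" "U 0 x"] by simp
      then show "AE x in lborel. norm (norm (w x) ^ 6) \<le> norm (64 * (norm (U 0 x - w x) ^ 6 + norm (U 0 x) ^ 6))"
        by (intro AE_I2) simp
    qed measurable
    show "integrable lborel (\<lambda>x. (norm (A x))\<^sup>2)"
      unfolding norm2 by (simp add: A_def a2)
    show "(\<lambda>n. LBINT x. norm (U n x - w x) ^ 6) \<longlonglongrightarrow> 0"
    proof (rule tendsto_sandwich[OF _ _ tendsto_const])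
      have "(\<lambda>n. 729 * (\<Sum>i\<in>UNIV. LBINT x. (f i n x - v' i x) ^ 6)) \<longlonglongrightarrow> 729 * (\<Sum>i\<in>(UNIV::3 set). 0)"
        by (intro tendsto_intros lim6)
      then show "(\<lambda>n. 729 * (\<Sum>i\<in>UNIV. LBINT x. (f i n x - v' i x) ^ 6)) \<longlonglongrightarrow> 0" by simp
      have "(LBINT x. norm (U n x - w x) ^ 6) \<le> 729 * (\<Sum>i\<in>UNIV. LBINT x. (f i n x - v' i x) ^ 6)" for n
        using integral_mono[OF U6 i729 m6, of n] i6 by (simp add: Bochner_Integration.integral_sum)
      then show "\<forall>\<^sub>F n in sequentially. (LBINT x. norm (U n x - w x) ^ 6) \<le> 729 * (\<Sum>i\<in>UNIV. LBINT x. (f i n x - v' i x) ^ 6)"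
        by simp
    qed simp
    have "(LBINT x. (norm (grad_matrix (U n) x - A x))\<^sup>2) = (\<Sum>i\<in>UNIV. LBINT x. (norm (grad (f i n) x - a i x))\<^sup>2)" for n
      unfolding norm2 using d2 by (simp add: gm A_def Bochner_Integration.integral_sum)
    moreover have "(\<lambda>n. \<Sum>i\<in>UNIV. LBINT x. (norm (grad (f i n) x - a i x))\<^sup>2) \<longlonglongrightarrow> (\<Sum>i\<in>(UNIV::3 set). 0)"
      by (intro tendsto_sum dlim)
    ultimately show "(\<lambda>n. LBINT x. (norm (grad_matrix (U n) x - A x))\<^sup>2) \<longlonglongrightarrow> 0" by simp
  qed
  show ?thesis
  proof (rule that[OF ap])
    show "(\<lambda>x. U n x $ i) \<in> Ccinf \<Omega>" for n i using f by (simp add: U_def)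
    show "A x = 0" if "x \<notin> \<Omega>" for x using that a(2) by (simp add: A_def vec_eq_iff)
    have "AE x in lebesgue_on \<Omega>. \<forall>i\<in>UNIV. u x $ i = v' i x" by (intro AE_finite_allI v') simp
    then show "AE x in lebesgue_on \<Omega>. u x = w x" by eventually_elim (simp add: w_def vec_eq_iff)
    have "AE x in lebesgue_on \<Omega>. \<forall>i\<in>UNIV. weak_grad \<Omega> (\<lambda>x. u x $ i) x = a i x" by (intro AE_finite_allI a) simp
    then show "AE x in lebesgue_on \<Omega>. weak_jacobian \<Omega> u x = A x"
      by eventually_elim (simp add: weak_jacobian_def A_def vec_eq_iff)
  qed
qed

subsection \<open>The Liouville theorem\<close>

lemma powr_six_fifths_le: "t powr (6/5) \<le> 1 + t powr q" if "0 \<le> t" "6/5 \<le> q" for t q :: real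
proof (cases "t \<le> 1")
  case True
  then have "t powr (6/5) \<le> 1 powr (6/5)" using that by (intro powr_mono2) auto
  then show ?thesis by (simp add: add_increasing2)
next
  case False
  then have "t powr (6/5) \<le> t powr q" using that by (intro powr_mono) auto
  then show ?thesis by simp
qed

lemma norm_diff_powr: "norm (a - b) powr q \<le> 2 powr q * (norm a powr q + norm b powr q)"
  if "0 \<le> q" for a b :: "'z::real_normed_vector" and q :: real
proof -
  define m where "m = max (norm a) (norm b)"
  have "norm (a - b) \<le> 2 * m" using norm_triangle_ineq4[of a b] by (auto simp: m_def)
  then have "norm (a - b) powr q \<le> (2 * m) powr q" using that by (intro powr_mono2) auto
  also have "\<dots> = 2 powr q * m powr q" by (simp add: powr_mult m_def)
  also have "\<dots> \<le> 2 powr q * (norm a powr q + norm b powr q)"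
    by (intro mult_left_mono) (auto simp: m_def max_def)
  finally show ?thesis .
qed

lemma Ccinf_grad_powr_integrable:
  assumes f: "f \<in> Ccinf S" and q: "0 < q"
  shows "integrable lborel (\<lambda>x. norm (grad f x) powr q)"
proof (rule continuous_compact_support_integrable[OF _ Ccinf_compact[OF f]])
  show "continuous_on UNIV (\<lambda>x. norm (grad f x) powr q)"
    by (rule continuous_on_powr') (use q in \<open>auto intro!: continuous_on_norm Ccinf_continuous_grad[OF f]\<close>)
qed (use q in \<open>simp add: grad_not_in_supp\<close>)

context solenoidal_flow
begin

text \<open>In r^(6/5) = r r^(1/5) one power of r is kept for integration and the rest is bounded.
  Thus potential gradients that are bounded or in L^q with q >= 6/5 give forces in L^(6/5).\<close>

lemma force_L_six_fifths:
  assumes [measurable]: "g \<in> borel_measurable borel" and h: "integrable lborel h" "\<And>x. 0 \<le> h x"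
    and le: "\<And>x. norm (g x) powr (6/5) \<le> C * (1 + h x)" and C: "0 \<le> C"
  shows "integrable lborel (\<lambda>x. norm (r x *\<^sub>R g x) powr (6/5))"
proof -
  have eq: "norm (r x *\<^sub>R g x) powr (6/5) = r x * (r x powr (1/5) * norm (g x) powr (6/5))" for x
  proof -
    have "r x powr (6/5) = r x * r x powr (1/5)"
    proof (cases "r x = 0")
      case False
      then have "0 < r x" using r_nonneg[of x] by simp
      then have "r x powr (1 + 1/5) = r x powr 1 * r x powr (1/5)" by (subst powr_add) simp
      then show ?thesis using \<open>0 < r x\<close> by simp
    qed simp
    then show ?thesis using r_nonneg[of x] by (simp add: powr_mult)
  qed
  show ?thesis
    unfolding eq
  proof (rule r_mult_integrable[OF _ h(1), where c = "M powr (1/5) * C"])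
    show "\<bar>r x powr (1/5) * norm (g x) powr (6/5)\<bar> \<le> M powr (1/5) * C * (1 + h x)" for x
    proof -
      have "r x powr (1/5) * norm (g x) powr (6/5) \<le> M powr (1/5) * (C * (1 + h x))"
        by (intro mult_mono powr_mono2 le r_le r_nonneg) auto
      then show ?thesis by (simp add: abs_mult mult.assoc)
    qed
  qed (use h C in auto)
qed

lemma pressure_measurable:
  assumes P: "continuous_on {0..} P" shows "(\<lambda>x. P (r x)) \<in> borel_measurable borel"
proof -
  have "continuous_on UNIV (\<lambda>s. P (max 0 s))"
    by (rule continuous_on_compose2[OF P]) (auto intro!: continuous_intros)
  then have "(\<lambda>x. P (max 0 (r x))) \<in> borel_measurable borel"
    by (intro measurable_compose[OF r_measurable] borel_measurable_continuous_onI)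
  then show ?thesis using r_nonneg by (simp add: max_absorb2)
qed

text \<open>Below density 1 the square-root bound gives p(r)^2 <= C^2 r; from 1 to M the pressure is
  bounded and 1 <= r. In both ranges a multiple of r dominates.\<close>

lemma pressure_L2:
  assumes P: "continuous_on {0..} P" and nonneg: "\<And>s. 0 \<le> s \<Longrightarrow> 0 \<le> P s"
    and C: "0 \<le> C" "\<And>s. 0 \<le> s \<Longrightarrow> s < 1 \<Longrightarrow> P s \<le> C * sqrt s"
  shows "integrable lborel (\<lambda>x. (P (r x))\<^sup>2)"
proof -
  note [measurable] = pressure_measurable[OF P]
  have "bounded (P ` {0..M})"
    by (intro compact_imp_bounded compact_continuous_image continuous_on_subset[OF P]) auto
  then obtain B where "\<forall>s\<in>{0..M}. \<bar>P s\<bar> \<le> B" by (auto simp: bounded_iff)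
  then have B: "\<And>s. s \<in> {0..M} \<Longrightarrow> \<bar>P s\<bar> \<le> B" by blast
  show ?thesis
  proof (rule Bochner_Integration.integrable_bound[OF integrable_mult_right[OF r_integrable, of "C\<^sup>2 + B\<^sup>2"]])
    have le: "(P (r x))\<^sup>2 \<le> (C\<^sup>2 + B\<^sup>2) * r x" for x
    proof (cases "r x < 1")
      case True
      then have "(P (r x))\<^sup>2 \<le> (C * sqrt (r x))\<^sup>2"
        by (intro power_mono C nonneg r_nonneg) auto
      also have "\<dots> = C\<^sup>2 * r x" using r_nonneg[of x] by (simp add: power_mult_distrib)
      also have "\<dots> \<le> (C\<^sup>2 + B\<^sup>2) * r x" using r_nonneg[of x] by (intro mult_right_mono) auto
      finally show ?thesis .
    next
      case False
      have "(P (r x))\<^sup>2 \<le> B\<^sup>2"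
        using power_mono[OF B[of "r x"] abs_ge_zero, of 2] r_nonneg[of x] r_le[of x] by simp
      also have "\<dots> \<le> (C\<^sup>2 + B\<^sup>2) * 1" by simp
      also have "\<dots> \<le> (C\<^sup>2 + B\<^sup>2) * r x" using False by (intro mult_left_mono) auto
      finally show ?thesis .
    qed
    show "AE x in lborel. norm ((P (r x))\<^sup>2) \<le> norm ((C\<^sup>2 + B\<^sup>2) * r x)"
      unfolding real_norm_def abs_power2 by (intro AE_I2 order_trans[OF le abs_ge_self])
  qed measurable
qed

end

section \<open>Vanishing of the velocity\<close>

context mollified_flow
begin

text \<open>The two assumptions on the force serve different ends: the L^(6/5) bound makes its work
  along U n converge, and the vanishing integral identifies the limit.\<close>

lemma velocity_zero:
  assumes \<mu>: "0 < \<mu>" and \<nu>: "0 \<le> \<nu>"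
    and P: "continuous_on {0..} P" "P 0 = 0" and P2: "integrable lborel (\<lambda>x. (P (r x))\<^sup>2)"
    and g [measurable]: "g \<in> borel_measurable borel"
    and rg: "integrable lborel (\<lambda>x. norm (r x *\<^sub>R g x) powr (6/5))"
    and force: "(LBINT x. (r x *\<^sub>R w x) \<bullet> g x) = 0"
    and momentum: "\<And>n. (LBINT x. (r x *\<^sub>R outer (w x) (w x)) \<bullet> D n x + P (r x) * trace (D n x))
      = (LBINT x. stress \<mu> \<nu> (A x) \<bullet> D n x) - (LBINT x. (r x *\<^sub>R g x) \<bullet> U n x)"
  shows "AE x in lborel. w x = 0"
proof -
  note [measurable] = pressure_measurable[OF P(1)]
  have i1: "integrable lborel (\<lambda>x. (r x *\<^sub>R outer (w x) (w x)) \<bullet> D n x)" for n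
    by (rule integrable_inner_L2[OF _ _ rw_outer_L2 D_L2]) measurable
  have i2: "integrable lborel (\<lambda>x. P (r x) * trace (D n x))" for n
    using integrable_inner_L2[of "\<lambda>x. P (r x) *\<^sub>R mat 1" lborel "D n"] P2 D_L2[of n]
    by (simp add: trace_inner power_mult_distrib)
  have "(\<lambda>n. (LBINT x. (r x *\<^sub>R outer (w x) (w x)) \<bullet> D n x) + (LBINT x. P (r x) * trace (D n x)))
      \<longlonglongrightarrow> 0 + (LBINT x. P (r x) * trace (A x))"
    by (intro tendsto_add convective_term_limit trace_D_weak_limit P2) measurable
  then have l1: "(\<lambda>n. (LBINT x. (r x *\<^sub>R outer (w x) (w x)) \<bullet> D n x + P (r x) * trace (D n x))) \<longlonglongrightarrow> 0"
    unfolding pressure_integral_zero[OF P P2] Bochner_Integration.integral_add[OF i1 i2] by simp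
  have "(\<lambda>n. (LBINT x. stress \<mu> \<nu> (A x) \<bullet> D n x) - (LBINT x. (r x *\<^sub>R g x) \<bullet> U n x))
      \<longlonglongrightarrow> (LBINT x. stress \<mu> \<nu> (A x) \<bullet> A x) - (LBINT x. (r x *\<^sub>R g x) \<bullet> w x)"
    by (intro tendsto_diff D_weak_limit stress_L2 U_weak_limit(1) rg) measurable
  moreover have "(LBINT x. (r x *\<^sub>R g x) \<bullet> w x) = 0"
    using force by (simp add: inner_commute)
  ultimately have "(LBINT x. stress \<mu> \<nu> (A x) \<bullet> A x) = 0"
    using LIMSEQ_unique[OF l1[unfolded momentum]] by simp
  moreover have "(LBINT x. stress \<mu> \<nu> (A x) \<bullet> A x) =
      \<mu> * (LBINT x. (norm (A x))\<^sup>2) + (\<mu> / 3 + \<nu>) * (LBINT x. (trace (A x))\<^sup>2)"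
  proof -
    have iL: "integrable lborel (\<lambda>x. L (A x) \<bullet> A x)" by (intro integrable_inner_L2 L_L2 A_L2) measurable
    show ?thesis
      unfolding stress_inner power2_norm_eq_inner[symmetric] using iL A_L2 trace_A_L2 L_form_zero by simp
  qed
  moreover have "0 \<le> (\<mu> / 3 + \<nu>) * (LBINT x. (trace (A x))\<^sup>2)"
    using \<mu> \<nu> by (intro mult_nonneg_nonneg Bochner_Integration.integral_nonneg) auto
  moreover have "0 \<le> \<mu> * (LBINT x. (norm (A x))\<^sup>2)"
    using \<mu> by (intro mult_nonneg_nonneg Bochner_Integration.integral_nonneg) auto
  ultimately have "\<mu> * (LBINT x. (norm (A x))\<^sup>2) = 0" by linarith
  then have "(LBINT x. (norm (A x))\<^sup>2) = 0" using \<mu> by simp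
  then show ?thesis by (rule zero_if_gradient_zero)
qed

lemma potential_force_D0:
  assumes \<Omega>: "open \<Omega>" and q: "6/5 \<le> q" and G: "G \<in> D0 q \<Omega>"
  obtains g where "g \<in> borel_measurable borel" "\<And>x. x \<notin> \<Omega> \<Longrightarrow> g x = 0"
    "AE x in lebesgue_on \<Omega>. weak_grad \<Omega> G x = g x"
    "integrable lborel (\<lambda>x. norm (r x *\<^sub>R g x) powr (6/5))"
    "(LBINT x. (r x *\<^sub>R w x) \<bullet> g x) = 0"
proof -
  have q0: "0 \<le> q" using q by simp
  have Gm: "weak_grad \<Omega> G \<in> borel_measurable (lebesgue_on \<Omega>)"
    and Gq: "integrable (lebesgue_on \<Omega>) (\<lambda>x. norm (weak_grad \<Omega> G x) powr q)"
    using G by (auto simp: D0_def Lq_def)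
  obtain f where f: "\<And>n. f n \<in> Ccinf \<Omega>"
    and lim: "(\<lambda>n. LINT x|lebesgue_on \<Omega>. norm (grad (f n) x - weak_grad \<Omega> G x) powr q) \<longlonglongrightarrow> 0"
    using G by (auto simp: D0_def)
  obtain g where g: "g \<in> borel_measurable borel" "\<And>x. x \<notin> \<Omega> \<Longrightarrow> g x = 0" "AE x in lebesgue_on \<Omega>. weak_grad \<Omega> G x = g x"
    using borel_representative[OF \<Omega> Gm] by blast
  note [measurable] = g(1)
  have fm [measurable]: "grad (f n) \<in> borel_measurable borel" for n by (rule Ccinf_grad_measurable[OF f])
  have f0: "grad (f n) x = 0" if "x \<notin> \<Omega>" for n x
    using f[of n] that by (intro grad_not_in_supp) (auto simp: Ccinf_iff)
  have gq: "integrable lborel (\<lambda>x. norm (g x) powr q)"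
    by (rule integrable_lebesgue_on_iff_lborel[OF \<Omega>, THEN iffD1, rotated -1, OF Gq]) (use g in auto)
  have dq: "integrable lborel (\<lambda>x. norm (grad (f n) x - g x) powr q)" for n
  proof (rule Bochner_Integration.integrable_bound)
    show "integrable lborel (\<lambda>x. 2 powr q * (norm (grad (f n) x) powr q + norm (g x) powr q))"
      using Ccinf_grad_powr_integrable[OF f, of q n] gq q by simp
    show "AE x in lborel. norm (norm (grad (f n) x - g x) powr q) \<le> norm (2 powr q * (norm (grad (f n) x) powr q + norm (g x) powr q))"
      using norm_diff_powr[OF q0] by (intro AE_I2) simp
  qed measurable
  have "(LINT x|lebesgue_on \<Omega>. norm (grad (f n) x - weak_grad \<Omega> G x) powr q) = (LBINT x. norm (grad (f n) x - g x) powr q)" for n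
  proof (rule integral_lebesgue_on_eq_lborel[OF \<Omega>])
    show "AE x in lebesgue_on \<Omega>. norm (grad (f n) x - weak_grad \<Omega> G x) powr q = norm (grad (f n) x - g x) powr q"
      using g(3) by eventually_elim simp
  qed (use g(2) f0 in auto)
  with lim have "(\<lambda>n. LBINT x. norm (grad (f n) x - g x) powr q) \<longlonglongrightarrow> 0" by simp
  then have z: "(LBINT x. (r x *\<^sub>R w x) \<bullet> g x) = 0"
    by (rule potential_force_zero_limit[OF q g(1) dq Ccinf_mono[OF f subset_UNIV]])
  have "integrable lborel (\<lambda>x. norm (r x *\<^sub>R g x) powr (6/5))"
    by (rule force_L_six_fifths[OF g(1) gq, of 1]) (use powr_six_fifths_le[OF norm_ge_zero q] in auto)
  from that[OF g this z] show ?thesis .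
qed

lemma potential_force_W1inf:
  assumes \<Omega>: "open \<Omega>" and U\<Omega>: "\<And>n i. (\<lambda>x. U n x $ i) \<in> Ccinf \<Omega>" and G: "G \<in> W1inf \<Omega>"
  obtains g where "g \<in> borel_measurable borel" "\<And>x. x \<notin> \<Omega> \<Longrightarrow> g x = 0"
    "AE x in lebesgue_on \<Omega>. weak_grad \<Omega> G x = g x"
    "integrable lborel (\<lambda>x. norm (r x *\<^sub>R g x) powr (6/5))"
    "(LBINT x. (r x *\<^sub>R w x) \<bullet> g x) = 0"
proof -
  from G obtain M1 M2 where Gm: "G \<in> borel_measurable (lebesgue_on \<Omega>)" "AE x in lebesgue_on \<Omega>. norm (G x) \<le> M1"
    and gm: "weak_grad \<Omega> G \<in> borel_measurable (lebesgue_on \<Omega>)" "AE x in lebesgue_on \<Omega>. norm (weak_grad \<Omega> G x) \<le> M2"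
    by (auto simp: W1inf_def Linf_def)
  from G obtain h where "has_weak_grad \<Omega> G h" by (auto simp: W1inf_def)
  then have hw: "has_weak_grad \<Omega> G (weak_grad \<Omega> G)" 
    unfolding weak_grad_def by (rule someI[of "has_weak_grad \<Omega> G"])
  define B where "B = max 0 (max M1 M2)"
  have B: "M1 \<le> B" "M2 \<le> B" "0 \<le> B" by (auto simp: B_def)
  obtain G0 where G0: "G0 \<in> borel_measurable borel" "\<And>x. x \<notin> \<Omega> \<Longrightarrow> G0 x = 0" "AE x in lebesgue_on \<Omega>. G x = G0 x"
    using borel_representative[OF \<Omega> Gm(1)] by blast
  obtain g0 where g0: "g0 \<in> borel_measurable borel" "\<And>x. x \<notin> \<Omega> \<Longrightarrow> g0 x = 0" "AE x in lebesgue_on \<Omega>. weak_grad \<Omega> G x = g0 x"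
    using borel_representative[OF \<Omega> gm(1)] by blast
  \<comment> \<open>The representatives are changed on a null set so that the bound B holds at every
    point.\<close>
  define G' where "G' x = (if \<bar>G0 x\<bar> \<le> B then G0 x else 0)" for x
  define g where "g x = (if norm (g0 x) \<le> B then g0 x else 0)" for x
  note [measurable] = G0(1) g0(1)
  have [measurable]: "G' \<in> borel_measurable borel" unfolding G'_def[abs_def] by measurable
  have g1 [measurable]: "g \<in> borel_measurable borel" unfolding g_def[abs_def] by measurable
  have aeG: "AE x in lebesgue_on \<Omega>. G x = G' x"
    using G0(3) Gm(2) by eventually_elim (use B in \<open>auto simp: G'_def\<close>)
  have g3: "AE x in lebesgue_on \<Omega>. weak_grad \<Omega> G x = g x"
    using g0(3) gm(2) by eventually_elim (use B in \<open>auto simp: g_def\<close>)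
  have g2: "g x = 0" if "x \<notin> \<Omega>" for x using g0(2)[OF that] by (simp add: g_def)
  have bG: "\<bar>G' x\<bar> \<le> B" and bg: "norm (g x) \<le> B" for x using B by (auto simp: G'_def g_def)
  have z: "(LBINT x. (r x *\<^sub>R w x) \<bullet> g x) = 0"
  proof (rule potential_force_zero_bounded[OF U\<Omega> _ bG g1 bg])
    show "G' \<in> borel_measurable borel" by measurable
    fix \<phi> :: "real^3 \<Rightarrow> real" assume \<phi>: "\<phi> \<in> Ccinf \<Omega>"
    note [measurable] = Ccinf_measurable[OF \<phi>] Ccinf_grad_measurable[OF \<phi>]
    have out: "x \<notin> supp \<phi>" if "x \<notin> \<Omega>" for x using \<phi> that by (auto simp: Ccinf_iff)
    have "(LINT x|lebesgue_on \<Omega>. G x *\<^sub>R grad \<phi> x) = (LBINT x. G' x *\<^sub>R grad \<phi> x)"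
    proof (rule integral_lebesgue_on_eq_lborel[OF \<Omega>])
      show "AE x in lebesgue_on \<Omega>. G x *\<^sub>R grad \<phi> x = G' x *\<^sub>R grad \<phi> x" using aeG by eventually_elim simp
    qed (use grad_not_in_supp[OF out] in auto)
    moreover have "(LINT x|lebesgue_on \<Omega>. \<phi> x *\<^sub>R weak_grad \<Omega> G x) = (LBINT x. \<phi> x *\<^sub>R g x)"
    proof (rule integral_lebesgue_on_eq_lborel[OF \<Omega>])
      show "AE x in lebesgue_on \<Omega>. \<phi> x *\<^sub>R weak_grad \<Omega> G x = \<phi> x *\<^sub>R g x" using g3 by eventually_elim simp
    qed (use g2 in auto)
    ultimately show "(LBINT x. G' x *\<^sub>R grad \<phi> x) = - (LBINT x. \<phi> x *\<^sub>R g x)"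
      using hw \<phi> by (simp add: has_weak_grad_def)
  qed
  have "integrable lborel (\<lambda>x. norm (r x *\<^sub>R g x) powr (6/5))"
    by (rule force_L_six_fifths[OF g1, of "\<lambda>_. 0" "B powr (6/5)"]) (use bg in \<open>auto intro: powr_mono2\<close>)
  from that[OF g1 g2 g3 this z] show ?thesis .
qed

end

text \<open>The normalized square of a test function takes the place of the usual exponential
  bump.\<close>

lemma mollifier_exists:
  fixes f :: "'a::euclidean_space \<Rightarrow> real"
  assumes f: "f \<in> Ccinf S" and nz: "(LBINT x. (f x)\<^sup>2) \<noteq> 0"
  obtains \<eta> :: "'a \<Rightarrow> real" where "\<eta> \<in> Ccinf S" "(LBINT x. \<eta> x) = 1"
proof -
  let ?\<eta> = "\<lambda>x. inverse (LBINT x. (f x)\<^sup>2) * (f x * f x)"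
  have 1: "?\<eta> \<in> Ccinf S" by (intro Ccinf_cmult Ccinf_mult f) (use f in \<open>simp add: Ccinf_iff\<close>)
  have 2: "(LBINT x. ?\<eta> x) = 1" using nz by (simp add: power2_eq_square)
  show ?thesis by (rule that[OF 1 2])
qed

theorem theorem1:
  fixes \<Omega> :: "(real^3) set" and \<mu> \<eta> :: real and p :: "real \<Rightarrow> real"
    and G \<rho> :: "real^3 \<Rightarrow> real" and u :: "real^3 \<Rightarrow> real^3"
  assumes "open \<Omega>" and "connected \<Omega>" and "\<Omega> \<noteq> {}"
    and "\<mu> > 0" and "\<eta> \<ge> 0"
    and "continuous_on {0..} p" and "p 0 = 0" and "\<And>r. r \<ge> 0 \<Longrightarrow> p r \<ge> 0"
    and "\<exists>C>0. \<forall>r. 0 \<le> r \<and> r < 1 \<longrightarrow> p r \<le> C * sqrt r"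
    and "(\<exists>q. 6/5 \<le> q \<and> G \<in> D0 q \<Omega>) \<or> G \<in> W1inf \<Omega>"
    and "weak_solution \<Omega> \<mu> \<eta> p G \<rho> u"
    and "\<rho> \<in> Lq 1 \<Omega>" and "\<rho> \<in> Linf \<Omega>"
  shows "AE x in lebesgue_on \<Omega>. u x = 0"
proof -
  note \<Omega> = \<open>open \<Omega>\<close>
  have \<Omega>l: "\<Omega> \<inter> space lebesgue \<in> sets lebesgue" using \<Omega> by auto
  have ws: "\<rho> \<in> borel_measurable (lebesgue_on \<Omega>)" "u \<in> borel_measurable (lebesgue_on \<Omega>)"
    "AE x in lebesgue_on \<Omega>. 0 \<le> \<rho> x" "u \<in> D0_vec 2 \<Omega>"
    and cont: "\<And>\<phi>. \<phi> \<in> Ccinf UNIV \<Longrightarrow> (LINT x|lebesgue_on \<Omega>. (\<rho> x *\<^sub>R u x) \<bullet> grad \<phi> x) = 0"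
    and mom: "\<And>\<phi>. \<phi> \<in> Cck 1 \<Omega> \<Longrightarrow>
        (LINT x|lebesgue_on \<Omega>. (\<rho> x *\<^sub>R outer (u x) (u x)) \<bullet> jacobian \<phi> (at x) + p (\<rho> x) * trace (jacobian \<phi> (at x)))
        = (LINT x|lebesgue_on \<Omega>. stress \<mu> \<eta> (weak_jacobian \<Omega> u x) \<bullet> jacobian \<phi> (at x))
          - (LINT x|lebesgue_on \<Omega>. (\<rho> x *\<^sub>R weak_grad \<Omega> G x) \<bullet> \<phi> x)"
    using assms(11) unfolding weak_solution_def by blast+
  obtain w A U where ap: "approximable_field w A U" and U: "\<And>n i. (\<lambda>x. U n x $ i) \<in> Ccinf \<Omega>"
    and A0: "\<And>x. x \<notin> \<Omega> \<Longrightarrow> A x = 0"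
    and uw: "AE x in lebesgue_on \<Omega>. u x = w x" and JA: "AE x in lebesgue_on \<Omega>. weak_jacobian \<Omega> u x = A x"
    using D0_vec_approximation[OF \<Omega> ws(4,2)] by blast
  note [measurable] = approximable_field.U_measurable[OF ap] approximable_field.w_measurable[OF ap]
  \<comment> \<open>A component of some U n that is not almost everywhere zero provides the
    mollifier. If there is none, w is the L^6 limit of fields vanishing almost everywhere.\<close>
  have "AE x in lborel. w x = 0"
  proof (cases "\<exists>n i. (LBINT x. (U n x $ i)\<^sup>2) \<noteq> 0")
    case False
    have "AE x in lborel. U n x $ i = 0" for n i
      using False integral_nonneg_eq_0_iff_AE[OF Ccinf_L2[OF U[of n i]]] by simp
    then have "AE x in lborel. \<forall>i\<in>UNIV. U n x $ i = 0" for n by (intro AE_finite_allI) auto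
    then have U0: "AE x in lborel. U n x = 0" for n by (simp add: vec_eq_iff)
    have "AE x in lborel. norm (U n x - w x) ^ 6 = norm (w x) ^ 6" for n
      using U0[of n] by eventually_elim simp
    then have "(LBINT x. norm (U n x - w x) ^ 6) = (LBINT x. norm (w x) ^ 6)" for n
      by (intro integral_cong_AE) measurable
    then have "(LBINT x. norm (w x) ^ 6) = 0" using approximable_field.U_lim[OF ap] by (simp add: LIMSEQ_const_iff)
    then show ?thesis using integral_nonneg_eq_0_iff_AE[OF approximable_field.w_L6[OF ap]] by simp
  next
    case True
    then obtain n i where "(LBINT x. (U n x $ i)\<^sup>2) \<noteq> 0" by blast
    then obtain \<kappa> :: "real^3 \<Rightarrow> real" where \<kappa>: "\<kappa> \<in> Ccinf UNIV" "(LBINT x. \<kappa> x) = 1"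
      using mollifier_exists[OF approximable_field.U_Ccinf[OF ap]] by blast
    obtain r0 where r0: "r0 \<in> borel_measurable borel" "\<And>x. x \<notin> \<Omega> \<Longrightarrow> r0 x = 0" "AE x in lebesgue_on \<Omega>. \<rho> x = r0 x"
      using borel_representative[OF \<Omega> ws(1)] by blast
    obtain M where M: "AE x in lebesgue_on \<Omega>. norm (\<rho> x) \<le> M" using assms(13) by (auto simp: Linf_def)
    \<comment> \<open>Clamping alters r0 only on a null set and makes 0 <= r <=
      \<open>max 0 M\<close> hold everywhere; the inner maximum covers a negative M.\<close>
    define r where "r x = max 0 (min (max 0 M) (r0 x))" for x
    note [measurable] = r0(1)
    have rm [measurable]: "r \<in> borel_measurable borel" unfolding r_def[abs_def] by measurable
    have rz: "r x = 0" if "x \<notin> \<Omega>" for x using r0(2)[OF that] by (simp add: r_def)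
    have \<rho>r: "AE x in lebesgue_on \<Omega>. \<rho> x = r x"
      using r0(3) M ws(3) by eventually_elim (auto simp: r_def)
    have ri: "integrable lborel r"
    proof -
      have "integrable (lebesgue_on \<Omega>) (\<lambda>x. norm (\<rho> x) powr 1)" using assms(12) by (simp add: Lq_def)
      then show ?thesis
      proof (rule integrable_lebesgue_on_iff_lborel[OF \<Omega> rm rz, THEN iffD1, rotated -1])
        show "AE x in lebesgue_on \<Omega>. norm (\<rho> x) powr 1 = r x" using \<rho>r ws(3) by eventually_elim simp
      qed
    qed
    interpret mollified_flow w A U r "max 0 M" \<kappa>
    proof (intro mollified_flow.intro solenoidal_flow.intro ap solenoidal_flow_axioms.intro mollified_flow_axioms.intro)
      show "0 \<le> r x" "r x \<le> max 0 M" for x by (auto simp: r_def)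
      show "integrable lborel r" by (rule ri)
      show "\<kappa> \<in> Ccinf UNIV" "(LBINT z. \<kappa> z) = 1" by (rule \<kappa>)+
      fix \<phi> :: "real^3 \<Rightarrow> real" assume \<phi>: "\<phi> \<in> Ccinf UNIV"
      note [measurable] = Ccinf_grad_measurable[OF \<phi>]
      have "(LINT x|lebesgue_on \<Omega>. (\<rho> x *\<^sub>R u x) \<bullet> grad \<phi> x) = (LBINT x. (r x *\<^sub>R w x) \<bullet> grad \<phi> x)"
      proof (rule integral_lebesgue_on_eq_lborel[OF \<Omega>])
        show "AE x in lebesgue_on \<Omega>. (\<rho> x *\<^sub>R u x) \<bullet> grad \<phi> x = (r x *\<^sub>R w x) \<bullet> grad \<phi> x"
          using \<rho>r uw by eventually_elim simp
      qed (use rz in auto)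
      then show "(LBINT x. (r x *\<^sub>R w x) \<bullet> grad \<phi> x) = 0" using cont[OF \<phi>] by simp
    qed measurable
    obtain g where g: "g \<in> borel_measurable borel" "\<And>x. x \<notin> \<Omega> \<Longrightarrow> g x = 0"
      "AE x in lebesgue_on \<Omega>. weak_grad \<Omega> G x = g x"
      "integrable lborel (\<lambda>x. norm (r x *\<^sub>R g x) powr (6/5))"
      "(LBINT x. (r x *\<^sub>R w x) \<bullet> g x) = 0"
      using assms(10)
    proof (elim disjE exE conjE)
      fix q assume q: "6/5 \<le> q" "G \<in> D0 q \<Omega>"
      show thesis
      proof (rule potential_force_D0[OF \<Omega> q], goal_cases)
        case (1 g) show ?case by (rule that[OF 1])
      qed
    next
      assume W: "G \<in> W1inf \<Omega>"
      show thesis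
      proof (rule potential_force_W1inf[OF \<Omega> U W], goal_cases)
        case (1 g) show ?case by (rule that[OF 1])
      qed
    qed
    note [measurable] = g(1) pressure_measurable[OF assms(6)]
    obtain C where C: "C > 0" "\<And>s. 0 \<le> s \<Longrightarrow> s < 1 \<Longrightarrow> p s \<le> C * sqrt s" using assms(9) by blast
    show ?thesis
    proof (rule velocity_zero[OF assms(4,5,6,7) _ g(1,4,5)])
      show "integrable lborel (\<lambda>x. (p (r x))\<^sup>2)" by (rule pressure_L2[OF assms(6,8) less_imp_le[OF C(1)] C(2)])
      fix n :: nat
      have S\<Omega>: "S n \<subseteq> \<Omega>" using U[of n] by (auto simp: S_def Ccinf_iff)
      have Ck: "Ck k (U n)" for k by (rule Ck_vec) (use U in \<open>simp add: Ccinf_iff\<close>)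
      have "supp (U n) \<subseteq> S n"
        by (rule supp_subset[OF compact_imp_closed[OF S_compact]]) (rule U_outside)
      moreover have "compact (supp (U n))"
        by (rule compact_suppI[OF S_compact]) (rule U_outside)
      ultimately have Un: "U n \<in> Cck 1 \<Omega>" using Ck[of 1] S\<Omega> by (auto simp: Cck_def simp del: One_nat_def)
      have jac: "jacobian (U n) (at x) = D n x" for x
        by (rule jacobian_eq_grad_matrix) (use Ck[of "Suc 0"] in simp)
      have D0: "D n x = 0" if "x \<notin> \<Omega>" for x using S\<Omega> that by (intro D_outside) blast
      have 1: "(LINT x|lebesgue_on \<Omega>. (\<rho> x *\<^sub>R outer (u x) (u x)) \<bullet> D n x + p (\<rho> x) * trace (D n x))
        = (LBINT x. (r x *\<^sub>R outer (w x) (w x)) \<bullet> D n x + p (r x) * trace (D n x))"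
      proof (rule integral_lebesgue_on_eq_lborel[OF \<Omega>])
        show "(\<lambda>x. (r x *\<^sub>R outer (w x) (w x)) \<bullet> D n x + p (r x) * trace (D n x)) \<in> borel_measurable borel"
          unfolding trace_inner[symmetric] by measurable
        show "AE x in lebesgue_on \<Omega>. (\<rho> x *\<^sub>R outer (u x) (u x)) \<bullet> D n x + p (\<rho> x) * trace (D n x)
          = (r x *\<^sub>R outer (w x) (w x)) \<bullet> D n x + p (r x) * trace (D n x)"
          using \<rho>r uw by eventually_elim simp
      qed (use D0 in \<open>simp add: trace_inner[symmetric]\<close>)
      have 2: "(LINT x|lebesgue_on \<Omega>. stress \<mu> \<eta> (weak_jacobian \<Omega> u x) \<bullet> D n x) = (LBINT x. stress \<mu> \<eta> (A x) \<bullet> D n x)"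
      proof (rule integral_lebesgue_on_eq_lborel[OF \<Omega>])
        show "AE x in lebesgue_on \<Omega>. stress \<mu> \<eta> (weak_jacobian \<Omega> u x) \<bullet> D n x = stress \<mu> \<eta> (A x) \<bullet> D n x"
          using JA by eventually_elim simp
      qed (use D0 in auto)
      have 3: "(LINT x|lebesgue_on \<Omega>. (\<rho> x *\<^sub>R weak_grad \<Omega> G x) \<bullet> U n x) = (LBINT x. (r x *\<^sub>R g x) \<bullet> U n x)"
      proof (rule integral_lebesgue_on_eq_lborel[OF \<Omega>])
        show "AE x in lebesgue_on \<Omega>. (\<rho> x *\<^sub>R weak_grad \<Omega> G x) \<bullet> U n x = (r x *\<^sub>R g x) \<bullet> U n x"
          using \<rho>r g(3) by eventually_elim simp
      qed (use rz in auto)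
      show "(LBINT x. (r x *\<^sub>R outer (w x) (w x)) \<bullet> D n x + p (r x) * trace (D n x))
        = (LBINT x. stress \<mu> \<eta> (A x) \<bullet> D n x) - (LBINT x. (r x *\<^sub>R g x) \<bullet> U n x)"
        using mom[OF Un] unfolding jac 1 2 3 .
    qed
  qed
  then have "AE x in lebesgue_on \<Omega>. w x = 0"
    unfolding AE_restrict_space_iff[OF \<Omega>l] using AE_completion by fastforce
  with uw show ?thesis by eventually_elim simp
qed

end
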